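(* Let $\mathcal{G}$ be the set of all (topologically sorted) directed acyclic graphs $G$ on $\{1,\dots,K\}$ for which $\mathrm{pa}(k)$ is fully connected for every $k$. For every $n\ge1$ there exists an estimator $\hat\mu^{b\mathcal{A},ad}$, depending only on the data $X^1,\dots,X^n$ and on $(d_k)_{k=1}^K$, such that for every $G\in\mathcal{G}$, every $L$, and every $\mu\in\mathcal{P}_G$ satisfying the TV-Lipschitz condition (for the graph $G$, see context) with constant $L$, one has, for $X^1,\dots,X^n$ i.i.d. with law $\mu$, $$\mathbb{E}\left[\mathcal{W}(\mu,\hat\mu^{b\mathcal{A},ad})\right]\le C\cdot\max\{1,\log(n)\}\cdot\left(n^{-2/(2+d_{\rm loc}(G))}+n^{-1/d_{\rm max}}\right),$$ where $C$ is a constant depending only on $L$, $K$ and $(d_k)_{k=1}^K$.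
   Context: Setting: directed acyclic graphs $G$ on nodes $\{1,\dots,K\}$ are topologically sorted (every edge $i\to j$ has $i<j$); $\mathrm{pa}(k)$ is the set of parents of $k$ in $G$ and $\mathrm{pre}(k)=\{1,\dots,k-1\}\setminus\mathrm{pa}(k)$. A set $J$ of nodes is fully connected if there is an edge $k\to\ell$ for all $k,\ell\in J$ with $k<\ell$. $\mathcal{X}=[0,1]^d=\mathcal{X}_1\times\dots\times\mathcal{X}_K$ with $\mathcal{X}_k=[0,1]^{d_k}$, $\mathcal{X}_I=\prod_{i\in I}\mathcal{X}_i$, $x_I=(x_i)_{i\in I}$. $\|\cdot\|$ is the sup-norm. $\mathcal{P}_G$ is the set of Borel probability measures $\mu$ on $\mathcal{X}$ with $\mu(dx)=\prod_{k=1}^K\mu(dx_k\mid x_{\mathrm{pa}(k)})$ (regular conditional distributions; marginal if $\mathrm{pa}(k)=\emptyset$). $\mathcal{W}$ is the first-order Wasserstein distance w.r.t. $\|\cdot\|$; $\mathrm{TV}(\nu,\tilde\nu)=\sup_f(\int f\,d\nu-\int f\,d\tilde\nu)$ over measurable $|f|\le1/2$. TV-Lipschitz condition with constant $L$ for $\mu\in\mathcal{P}_G$: for all $2\le k\le K$, all $x_{\mathrm{pa}(k)},\tilde x_{\mathrm{pa}(k)}\in\mathcal{X}_{\mathrm{pa}(k)}$ and all $x_k,\tilde x_k\in\mathcal{X}_k$: $\mathrm{TV}(\mu(dx_k\mid x_{\mathrm{pa}(k)}),\mu(dx_k\mid\tilde x_{\mathrm{pa}(k)}))\le L\|x_{\mathrm{pa}(k)}-\tilde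 x_{\mathrm{pa}(k)}\|$; $\mathrm{TV}(\mu(dx_{\mathrm{pre}(k)}\mid x_{\mathrm{pa}(k)}),\mu(dx_{\mathrm{pre}(k)}\mid\tilde x_{\mathrm{pa}(k)}))\le L\|x_{\mathrm{pa}(k)}-\tilde x_{\mathrm{pa}(k)}\|$; $\mathrm{TV}(\mu(dx_{\mathrm{pa}(k)}\mid x_k),\mu(dx_{\mathrm{pa}(k)}\mid\tilde x_k))\le L\|x_k-\tilde x_k\|$. (I.e. the conditional distributions admit versions with these properties; conditions involving empty index sets are void.) $d_{\rm loc}(G)=\max_k(\max\{2,d_k\}+\sum_{\ell\in\mathrm{pa}(k)}d_\ell)$, $d_{\rm max}=\max_k\max\{2,d_k\}$. An estimator is a measurable map $\mathcal{X}^n\to\mathcal{P}(\mathcal{X})$. *)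

theory Defs
  imports "HOL-Probability.Probability"
begin

section \<open>The state space\<close>

text \<open>
  The cube \<open>[0,1]\<^sup>m\<close> consists of the functions in \<open>{..<m} \<rightarrow>\<^sub>E {0..1}\<close>, so that a point of
  \<open>\<X>\<^sub>I = (\<Prod>i\<in>I. [0,1]\<^bsup>d i\<^esup>)\<close> is an extensional function on \<open>I\<close>, and \<open>x\<^sub>I\<close> is \<open>restrict x I\<close>.
  Both are used only as measurable spaces; the product sigma-algebra of finitely many intervals is
  the Borel sigma-algebra.  Single nodes are treated as the index set \<open>{k}\<close>.
\<close>

type_synonym point = "nat \<Rightarrow> nat \<Rightarrow> real"

definition cube :: "nat \<Rightarrow> (nat \<Rightarrow> real) measure" where
  "cube m = (\<Pi>\<^sub>M j\<in>{..<m}. restrict_space borel {0..1})"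

definition Xs :: "(nat \<Rightarrow> nat) \<Rightarrow> nat set \<Rightarrow> point measure" where
  "Xs d I = (\<Pi>\<^sub>M i\<in>I. cube (d i))"

text \<open>The element \<open>0\<close> is inserted only to make the maximum meaningful for empty index sets.\<close>

definition sup_dist :: "(nat \<Rightarrow> nat) \<Rightarrow> nat set \<Rightarrow> point \<Rightarrow> point \<Rightarrow> real" where
  "sup_dist d I x y = Max (insert 0 ((\<lambda>(i, j). \<bar>x i j - y i j\<bar>) ` (SIGMA i:I. {..<d i})))"


section \<open>Distances between probability measures\<close>

definition couplings :: "'a measure \<Rightarrow> 'a measure \<Rightarrow> ('a \<times> 'a) measure set" where
  "couplings \<mu> \<nu> = {\<pi> \<in> space (prob_algebra (\<mu> \<Otimes>\<^sub>M \<nu>)). distr \<pi> \<mu> fst = \<mu> \<and> distr \<pi> \<nu> snd = \<nu>}"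

definition wasserstein :: "('a \<Rightarrow> 'a \<Rightarrow> real) \<Rightarrow> 'a measure \<Rightarrow> 'a measure \<Rightarrow> ennreal" where
  "wasserstein dst \<mu> \<nu> = (INF \<pi>\<in>couplings \<mu> \<nu>. \<integral>\<^sup>+ z. ennreal (dst (fst z) (snd z)) \<partial>\<pi>)"

definition TV :: "'a measure \<Rightarrow> 'a measure \<Rightarrow> real" where
  "TV \<mu> \<nu> = (SUP f\<in>{f \<in> borel_measurable \<mu>. \<forall>x\<in>space \<mu>. \<bar>f x\<bar> \<le> 1 / 2}.
               (\<integral>x. f x \<partial>\<mu>) - (\<integral>x. f x \<partial>\<nu>))"


section \<open>Topologically sorted directed acyclic graphs\<close>

definition sorted_dag :: "nat \<Rightarrow> (nat \<times> nat) set \<Rightarrow> bool" where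
  "sorted_dag K G \<longleftrightarrow> G \<subseteq> {1..K} \<times> {1..K} \<and> acyclic G \<and> (\<forall>(i, j)\<in>G. i < j)"

definition pa :: "(nat \<times> nat) set \<Rightarrow> nat \<Rightarrow> nat set" where
  "pa G k = {i. (i, k) \<in> G}"

definition pre :: "(nat \<times> nat) set \<Rightarrow> nat \<Rightarrow> nat set" where
  "pre G k = {1..k - 1} - pa G k"

definition fully_connected :: "(nat \<times> nat) set \<Rightarrow> nat set \<Rightarrow> bool" where
  "fully_connected G J \<longleftrightarrow> (\<forall>k\<in>J. \<forall>l\<in>J. k < l \<longrightarrow> (k, l) \<in> G)"

definition d_loc :: "nat \<Rightarrow> (nat \<Rightarrow> nat) \<Rightarrow> (nat \<times> nat) set \<Rightarrow> nat" where
  "d_loc K d G = Max ((\<lambda>k. max 2 (d k) + (\<Sum>l\<in>pa G k. d l)) ` {1..K})"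

definition d_max :: "nat \<Rightarrow> (nat \<Rightarrow> nat) \<Rightarrow> nat" where
  "d_max K d = Max ((\<lambda>k. max 2 (d k)) ` {1..K})"


section \<open>Conditional distributions and graphical models\<close>

text \<open>
  \<open>cond_dist d \<mu> I J \<kappa>\<close>: the kernel \<open>\<kappa>\<close> from \<open>\<X>\<^sub>I\<close> to \<open>\<X>\<^sub>J\<close> is a version of the regular conditional
  distribution \<open>\<mu>(dx\<^sub>J | x\<^sub>I)\<close>.  For \<open>I = {}\<close> the space \<open>\<X>\<^sub>I\<close> is a singleton and the value of \<open>\<kappa>\<close> is
  the marginal of \<open>\<mu>\<close> on \<open>\<X>\<^sub>J\<close>.
\<close>

definition cond_dist ::
  "(nat \<Rightarrow> nat) \<Rightarrow> point measure \<Rightarrow> nat set \<Rightarrow> nat set \<Rightarrow> (point \<Rightarrow> point measure) \<Rightarrow> bool" where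
  "cond_dist d \<mu> I J \<kappa> \<longleftrightarrow>
     \<kappa> \<in> Xs d I \<rightarrow>\<^sub>M prob_algebra (Xs d J) \<and>
     (\<forall>A\<in>sets (Xs d I). \<forall>B\<in>sets (Xs d J).
        emeasure \<mu> {x \<in> space \<mu>. restrict x I \<in> A \<and> restrict x J \<in> B} =
        (\<integral>\<^sup>+ y\<in>A. emeasure (\<kappa> y) B \<partial>distr \<mu> (Xs d I) (\<lambda>x. restrict x I)))"

text \<open>
  The measure \<open>\<Prod>k\<le>m. \<kappa>\<^sub>k(dx\<^sub>k | x\<^bsub>pa(k)\<^esub>)\<close> on \<open>\<X>\<^bsub>{1..m}\<^esub>\<close>, built one node at a time.
\<close>

primrec kernel_prod ::
  "(nat \<Rightarrow> nat) \<Rightarrow> (nat \<times> nat) set \<Rightarrow> (nat \<Rightarrow> point \<Rightarrow> point measure) \<Rightarrow> nat \<Rightarrow> point measure" where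
  "kernel_prod d G \<kappa> 0 = return (Xs d {}) (\<lambda>_. undefined)"
| "kernel_prod d G \<kappa> (Suc m) =
     kernel_prod d G \<kappa> m \<bind>
       (\<lambda>x. distr (\<kappa> (Suc m) (restrict x (pa G (Suc m)))) (Xs d {1..Suc m})
              (\<lambda>y. merge {1..m} {Suc m} (x, y)))"

text \<open>
  The choice of the versions is immaterial, as two versions agree almost surely with respect to
  the marginal on \<open>\<X>\<^bsub>pa(k)\<^esub>\<close>.
\<close>

definition graph_measures ::
  "nat \<Rightarrow> (nat \<Rightarrow> nat) \<Rightarrow> (nat \<times> nat) set \<Rightarrow> point measure set" where
  "graph_measures K d G =
     {\<mu> \<in> space (prob_algebra (Xs d {1..K})).
        \<exists>\<kappa>. (\<forall>k\<in>{1..K}. cond_dist d \<mu> (pa G k) {k} (\<kappa> k)) \<and> \<mu> = kernel_prod d G \<kappa> K}"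

text \<open>The condition on \<open>\<mu>(dx\<^sub>J | x\<^sub>I)\<close> is void if one of the index sets is empty.\<close>

definition TV_lipschitz_cond ::
  "(nat \<Rightarrow> nat) \<Rightarrow> point measure \<Rightarrow> real \<Rightarrow> nat set \<Rightarrow> nat set \<Rightarrow> bool" where
  "TV_lipschitz_cond d \<mu> L I J \<longleftrightarrow>
     (I \<noteq> {} \<and> J \<noteq> {} \<longrightarrow>
       (\<exists>\<kappa>. cond_dist d \<mu> I J \<kappa> \<and>
            (\<forall>x\<in>space (Xs d I). \<forall>y\<in>space (Xs d I). TV (\<kappa> x) (\<kappa> y) \<le> L * sup_dist d I x y)))"

definition TV_lipschitz ::
  "nat \<Rightarrow> (nat \<Rightarrow> nat) \<Rightarrow> (nat \<times> nat) set \<Rightarrow> real \<Rightarrow> point measure \<Rightarrow> bool" where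
  "TV_lipschitz K d G L \<mu> \<longleftrightarrow>
     (\<forall>k\<in>{2..K}.
        TV_lipschitz_cond d \<mu> L (pa G k) {k} \<and>
        TV_lipschitz_cond d \<mu> L (pa G k) (pre G k) \<and>
        TV_lipschitz_cond d \<mu> L {k} (pa G k))"


section \<open>Estimators\<close>

text \<open>
  \<open>prob_algebra\<close> carries the sigma-algebra generated by the evaluations \<open>\<mu> \<mapsto> \<mu>(A)\<close>, which is the
  Borel sigma-algebra of the weak topology.
\<close>

definition estimators ::
  "nat \<Rightarrow> (nat \<Rightarrow> nat) \<Rightarrow> nat \<Rightarrow> ((nat \<Rightarrow> point) \<Rightarrow> point measure) set" where
  "estimators K d n =
     (\<Pi>\<^sub>M i\<in>{1..n}. Xs d {1..K}) \<rightarrow>\<^sub>M prob_algebra (Xs d {1..K})"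

text \<open>
  The expected error for an i.i.d. sample of size \<open>n\<close>, whose joint law is the product measure.
\<close>

definition expected_error ::
  "nat \<Rightarrow> (nat \<Rightarrow> nat) \<Rightarrow> nat \<Rightarrow> point measure \<Rightarrow> ((nat \<Rightarrow> point) \<Rightarrow> point measure) \<Rightarrow> ennreal" where
  "expected_error K d n \<mu> est =
     (\<integral>\<^sup>+ X. wasserstein (sup_dist d {1..K}) \<mu> (est X) \<partial>(\<Pi>\<^sub>M i\<in>{1..n}. \<mu>))"

end

theory Submission
  imports Defs
begin

text \<open>
  Each node is quantised to the dyadic cells of side \<open>2\<^sup>-\<^sup>n\<close>, so that laws on \<open>\<X>\<close> become laws on a
  finite product of alphabets that carry a tree of cells.  For a graph \<open>G\<close> and a level \<open>J\<close>, any law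
  \<open>q\<close> is replaced by the product over the nodes \<open>k\<close> of the transition probability of \<open>q\<close> from the
  level-\<open>J\<close> cell of \<open>x\<^bsub>pa(k)\<^esub>\<close> to the level-\<open>J\<close> cell of \<open>x\<^sub>k\<close> and of the law of \<open>x\<^sub>k\<close> under \<open>q\<close> inside its
  cell.  For the true law this costs only \<open>O(4\<^bsup>-J\<^esup>)\<close> instead of \<open>O(2\<^bsup>-J\<^esup>)\<close>: inside a cell the
  conditional laws vary by \<open>O(2\<^bsup>-J\<^esup>)\<close> in total variation (in both directions between \<open>x\<^sub>k\<close> and \<open>x\<^bsub>pa(k)\<^esub>\<close>),
  and a signed mass that is confined to a cell is tested against functions that vary by \<open>2\<^bsup>-J\<^esup>\<close> on it.
  For the empirical law the stochastic error is governed by the number \<open>2\<^bsup>J d_loc(G)\<^esup>\<close> of coarse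
  cells of \<open>(x\<^bsub>pa(k)\<^esub>, x\<^sub>k)\<close> and by the cells of single nodes, which give the rate \<open>n\<^bsup>-1/d_max\<^esup>\<close>; the two
  errors balance at \<open>2\<^sup>J = n\<^bsup>1/(2+d_loc(G))\<^esup>\<close>.

  Errors of the single nodes add up along the graph, as the Lipschitz property of the kernels
  preserves Lipschitz test functions; full connectedness of the parent sets makes the coarse
  marginals on \<open>pa(k) \<union> {k}\<close> of the product agree with those of \<open>q\<close>.  The graph is chosen on a second
  half of the sample by minimising the distance over the finitely many test functions that realise
  the distances between the estimators for the various graphs.
\<close>

section \<open>Chains on trees of cells\<close>

text \<open>A bias of order \<open>2^-J\<close> would be too large for the stated rate, so no
  first-order error may survive: each transition error, of total variation \<open>O(2^-J)\<close>,
  has to be centred before it meets a test function. The delicate part is the dependence of the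
  kernel on the position of the parents inside their cells. Its average vanishes under the true law,
  but the coarse chain makes the coordinates independent inside cells. These two laws differ again
  by \<open>O(2^-J)\<close>, by the Lipschitz condition in the reverse direction, and this supplies
  the second factor. The finest level is \<open>n\<close>, so quantisation costs only
  \<open>O(2^-n)\<close>, and every function of the quantised sample factors through a finite set,
  which settles measurability and integrability of the data-driven choice. Splitting the sample
  makes the test functions independent of the validation data; their number depends on
  \<open>K\<close> alone, so the selection costs \<open>O(n^(-1/2))\<close>, absorbed by
  \<open>n^(-1/d_max)\<close> because \<open>d_max\<close> is at least \<open>2\<close>. The
  logarithm counts the levels, each of which is bounded by the same quantity.\<close>

lemma sum_mult_fibres:
  fixes a :: "'a \<Rightarrow> real"
  assumes "finite S" "finite Z" "h ` S \<subseteq> Z"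
  shows "(\<Sum>x\<in>S. a x * \<phi> (h x)) = (\<Sum>l\<in>Z. (\<Sum>x | x \<in> S \<and> h x = l. a x) * \<phi> l)"
proof -
  have "(\<Sum>x\<in>S. a x * \<phi> (h x)) = (\<Sum>l\<in>Z. \<Sum>x | x \<in> S \<and> h x = l. a x * \<phi> (h x))"
    using assms by (intro sum.group[symmetric]) auto
  also have "\<dots> = (\<Sum>l\<in>Z. (\<Sum>x | x \<in> S \<and> h x = l. a x) * \<phi> l)"
    by (intro sum.cong refl) (auto simp: sum_distrib_right)
  finally show ?thesis .
qed

lemma sum_fibres:
  fixes a :: "'a \<Rightarrow> real"
  assumes "finite S" "finite Z" "h ` S \<subseteq> Z"
  shows "(\<Sum>l\<in>Z. \<Sum>x | x \<in> S \<and> h x = l. a x) = (\<Sum>x\<in>S. a x)"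
  using assms by (intro sum.group) auto

lemma abs_sum_mult_le:
  fixes a f :: "'a \<Rightarrow> real"
  assumes "\<And>x. x \<in> S \<Longrightarrow> \<bar>f x\<bar> \<le> b"
  shows "\<bar>\<Sum>x\<in>S. a x * f x\<bar> \<le> (\<Sum>x\<in>S. \<bar>a x\<bar>) * b"
proof -
  have "\<bar>\<Sum>x\<in>S. a x * f x\<bar> \<le> (\<Sum>x\<in>S. \<bar>a x * f x\<bar>)" by (rule sum_abs)
  also have "\<dots> \<le> (\<Sum>x\<in>S. \<bar>a x\<bar> * b)"
    by (intro sum_mono) (auto simp: abs_mult intro!: mult_left_mono assms)
  finally show ?thesis by (simp add: sum_distrib_right)
qed

text \<open>
  \<open>F k\<close> is the alphabet of node \<open>k\<close>, and \<open>c k j u\<close> is the name of the cell of level \<open>j\<close> that contains \<open>u\<close>.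
  The predicate \<open>lip\<close> below is the Lipschitz property for the ultrametric in which points with the
  same cells of level \<open>j\<close> are at distance at most \<open>2\<^bsup>-j\<^esup>\<close>.
\<close>

locale tree =
  fixes F :: "nat \<Rightarrow> 'b set" and c :: "nat \<Rightarrow> nat \<Rightarrow> 'b \<Rightarrow> 'c"
  assumes finF [simp, intro]: "finite (F k)" and neF: "F k \<noteq> {}"
    and c_refine: "c k (Suc j) u = c k (Suc j) v \<Longrightarrow> c k j u = c k j v"
    and c_root: "u \<in> F k \<Longrightarrow> v \<in> F k \<Longrightarrow> c k 0 u = c k 0 v"
begin

definition Om :: "nat set \<Rightarrow> (nat \<Rightarrow> 'b) set" where
  "Om I = PiE I F"

text \<open>All coordinates are read at the same level \<open>j\<close>, which matches the sup-norm:
  a label names a product cell of side \<open>2^-j\<close>. The restriction turns agreement on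
  \<open>I\<close> into equality of functions.\<close>

definition lab :: "nat set \<Rightarrow> nat \<Rightarrow> (nat \<Rightarrow> 'b) \<Rightarrow> nat \<Rightarrow> 'c" where
  "lab I j x = restrict (\<lambda>i. c i j (x i)) I"

definition lip :: "nat \<Rightarrow> real \<Rightarrow> ((nat \<Rightarrow> 'b) \<Rightarrow> real) \<Rightarrow> bool" where
  "lip m \<theta> f \<longleftrightarrow> (\<forall>x\<in>Om {1..m}. \<forall>y\<in>Om {1..m}. \<forall>j. lab {1..m} j x = lab {1..m} j y \<longrightarrow>
      \<bar>f x - f y\<bar> \<le> \<theta> / 2 ^ j)"

lemma c_coarse: "c k j u = c k j v \<Longrightarrow> i \<le> j \<Longrightarrow> c k i u = c k i v"
proof (induction j)
  case (Suc j)
  then show ?case using c_refine[of k j u v] by (cases "i = Suc j") auto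
qed simp

lemma lab_eq_iff: "lab I j x = lab I j y \<longleftrightarrow> (\<forall>i\<in>I. c i j (x i) = c i j (y i))"
  unfolding lab_def restrict_def fun_eq_iff by metis

lemma lab_coarse: "lab I j x = lab I j y \<Longrightarrow> i \<le> j \<Longrightarrow> lab I i x = lab I i y"
  unfolding lab_eq_iff using c_coarse by blast

lemma lab_mono: "lab I j x = lab I j y \<Longrightarrow> I' \<subseteq> I \<Longrightarrow> lab I' j x = lab I' j y"
  unfolding lab_eq_iff by blast

lemma finite_Om [simp, intro]: "finite I \<Longrightarrow> finite (Om I)"
  unfolding Om_def by (intro finite_PiE) auto

lemma Om_nonempty: "Om I \<noteq> {}"
  unfolding Om_def using neF by (auto simp: PiE_eq_empty_iff)

lemma Om_empty [simp]: "Om {} = {\<lambda>_. undefined}"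
  unfolding Om_def by simp

lemma restrict_Om: "x \<in> Om I \<Longrightarrow> I' \<subseteq> I \<Longrightarrow> restrict x I' \<in> Om I'"
  unfolding Om_def by auto

lemma Om_app: "x \<in> Om I \<Longrightarrow> i \<in> I \<Longrightarrow> x i \<in> F i"
  unfolding Om_def by auto

lemma Om_upd: "x \<in> Om I \<Longrightarrow> u \<in> F i \<Longrightarrow> x(i := u) \<in> Om (insert i I)"
  unfolding Om_def by (auto simp: PiE_def extensional_def)

lemma lab_restrict [simp]: "I' \<subseteq> I \<Longrightarrow> lab I' j (restrict x I) = lab I' j x"
  unfolding lab_def by (auto simp: restrict_def fun_eq_iff)

lemma lab_upd_notin [simp]: "i \<notin> I \<Longrightarrow> lab I j (x(i := u)) = lab I j x"
  unfolding lab_def by (auto simp: restrict_def fun_eq_iff)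

lemma lab_empty [simp]: "lab {} j x = (\<lambda>_. undefined)"
  unfolding lab_def by (simp add: restrict_def)

lemma lab_root: "x \<in> Om I \<Longrightarrow> y \<in> Om I \<Longrightarrow> lab I 0 x = lab I 0 y"
  unfolding lab_eq_iff using c_root Om_app by metis

lemma sum_Om_insert:
  assumes "i \<notin> I"
  shows "sum g (Om (insert i I)) = (\<Sum>x\<in>Om I. \<Sum>u\<in>F i. g (x(i := u)))"
proof -
  have "sum g (Om (insert i I)) = sum g ((\<lambda>(y, g). g(i := y)) ` (F i \<times> Om I))"
    unfolding Om_def PiE_insert_eq ..
  also have "\<dots> = sum (g \<circ> (\<lambda>(y, g). g(i := y))) (F i \<times> Om I)"
    unfolding Om_def using assms by (intro sum.reindex inj_combinator)
  also have "\<dots> = (\<Sum>u\<in>F i. \<Sum>x\<in>Om I. g (x(i := u)))"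
    by (simp add: sum.cartesian_product split_def)
  finally show ?thesis by (simp add: sum.swap[of _ "F i"])
qed

lemma restrict_insert_eq:
  assumes "z \<in> Om I" "i \<notin> I"
  shows "restrict x (insert i I) = z(i := u) \<longleftrightarrow> restrict x I = z \<and> x i = u"
proof
  assume *: "restrict x (insert i I) = z(i := u)"
  have "restrict x I = z"
  proof
    fix j show "restrict x I j = z j"
      using fun_cong[OF *, of j] assms unfolding Om_def
      by (cases "j \<in> I") (auto simp: PiE_def extensional_def restrict_def split: if_splits)
  qed
  then show "restrict x I = z \<and> x i = u" using fun_cong[OF *, of i] by simp
qed (auto simp: restrict_def fun_eq_iff)

lemma interval_Suc: "{1..Suc m} = insert (Suc m) {1..m}"
  by auto

lemma sum_Om_Suc: "sum g (Om {1..Suc m}) = (\<Sum>x\<in>Om {1..m}. \<Sum>u\<in>F (Suc m). g (x(Suc m := u)))"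
  unfolding interval_Suc by (rule sum_Om_insert) simp

lemma Om_upd_Suc: "x \<in> Om {1..m} \<Longrightarrow> u \<in> F (Suc m) \<Longrightarrow> x(Suc m := u) \<in> Om {1..Suc m}"
  unfolding interval_Suc by (rule Om_upd)

lemma lab_upd_Suc:
  "lab {1..m} j x = lab {1..m} j y \<Longrightarrow> c (Suc m) j u = c (Suc m) j v \<Longrightarrow>
   lab {1..Suc m} j (x(Suc m := u)) = lab {1..Suc m} j (y(Suc m := v))"
  unfolding lab_eq_iff by (auto simp: le_Suc_eq)

lemma lipD: "lip m \<theta> f \<Longrightarrow> x \<in> Om {1..m} \<Longrightarrow> y \<in> Om {1..m} \<Longrightarrow> lab {1..m} j x = lab {1..m} j y \<Longrightarrow>
    \<bar>f x - f y\<bar> \<le> \<theta> / 2 ^ j"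
  unfolding lip_def by blast

lemma lip_osc: "lip m \<theta> f \<Longrightarrow> x \<in> Om {1..m} \<Longrightarrow> y \<in> Om {1..m} \<Longrightarrow> \<bar>f x - f y\<bar> \<le> \<theta>"
  using lipD[of m \<theta> f x y 0] lab_root[of x "{1..m}" y] by simp

lemma lip_nonneg: "lip m \<theta> f \<Longrightarrow> 0 \<le> \<theta>"
  using Om_nonempty[of "{1..m}"] lip_osc[of m \<theta> f] by fastforce

text \<open>The difference at \<open>x\<close> and \<open>y\<close> splits into the change of
  \<open>f\<close> under one kernel, at most \<open>\<theta> / 2 ^ j\<close>, and the change of the
  kernel. The latter has total mass zero, so \<open>f\<close> may be recentred at \<open>u0\<close>
  and only its oscillation \<open>\<theta>\<close> enters; together this gives the factor
  \<open>1 + \<Lambda>\<close>.\<close>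

lemma lip_integral:
  assumes f: "lip (Suc m) \<theta> f"
    and nonneg: "\<And>x u. x \<in> Om {1..m} \<Longrightarrow> u \<in> F (Suc m) \<Longrightarrow> 0 \<le> \<kappa> x u"
    and total: "\<And>x. x \<in> Om {1..m} \<Longrightarrow> (\<Sum>u\<in>F (Suc m). \<kappa> x u) = 1"
    and TV: "\<And>x y j. x \<in> Om {1..m} \<Longrightarrow> y \<in> Om {1..m} \<Longrightarrow> lab {1..m} j x = lab {1..m} j y \<Longrightarrow>
      (\<Sum>u\<in>F (Suc m). \<bar>\<kappa> x u - \<kappa> y u\<bar>) \<le> \<Lambda> / 2 ^ j"
  shows "lip m ((1 + \<Lambda>) * \<theta>) (\<lambda>x. \<Sum>u\<in>F (Suc m). \<kappa> x u * f (x(Suc m := u)))"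
  unfolding lip_def
proof (intro ballI allI impI)
  fix x y j assume x: "x \<in> Om {1..m}" and y: "y \<in> Om {1..m}" and xy: "lab {1..m} j x = lab {1..m} j y"
  let ?F = "F (Suc m)"
  define X where "X u = x(Suc m := u)" for u
  define Y where "Y u = y(Suc m := u)" for u
  obtain u0 where u0: "u0 \<in> ?F" using neF by blast
  have l0: "0 \<le> \<theta>" using f by (rule lip_nonneg)
  have "(\<Sum>u\<in>?F. \<kappa> x u * f (X u)) - (\<Sum>u\<in>?F. \<kappa> y u * f (Y u))
    = (\<Sum>u\<in>?F. \<kappa> x u * (f (X u) - f (Y u))) + (\<Sum>u\<in>?F. (\<kappa> x u - \<kappa> y u) * (f (Y u) - f (Y u0)))
      + ((\<Sum>u\<in>?F. \<kappa> x u) - (\<Sum>u\<in>?F. \<kappa> y u)) * f (Y u0)"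
    by (simp add: algebra_simps sum.distrib sum_subtractf sum_distrib_left sum_distrib_right)
  also have "\<dots> = (\<Sum>u\<in>?F. \<kappa> x u * (f (X u) - f (Y u))) + (\<Sum>u\<in>?F. (\<kappa> x u - \<kappa> y u) * (f (Y u) - f (Y u0)))"
    using total[OF x] total[OF y] by simp
  finally have eq: "(\<Sum>u\<in>?F. \<kappa> x u * f (X u)) - (\<Sum>u\<in>?F. \<kappa> y u * f (Y u)) = \<dots>" .
  have "\<bar>\<Sum>u\<in>?F. \<kappa> x u * (f (X u) - f (Y u))\<bar> \<le> (\<Sum>u\<in>?F. \<bar>\<kappa> x u\<bar>) * (\<theta> / 2 ^ j)"
    unfolding X_def Y_def
    by (intro abs_sum_mult_le lipD[OF f] Om_upd_Suc x y lab_upd_Suc xy refl) auto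
  also have "(\<Sum>u\<in>?F. \<bar>\<kappa> x u\<bar>) = 1"
    using nonneg[OF x] total[OF x] by (simp add: abs_of_nonneg cong: sum.cong)
  finally have 1: "\<bar>\<Sum>u\<in>?F. \<kappa> x u * (f (X u) - f (Y u))\<bar> \<le> \<theta> / 2 ^ j" by simp
  have "\<bar>\<Sum>u\<in>?F. (\<kappa> x u - \<kappa> y u) * (f (Y u) - f (Y u0))\<bar> \<le> (\<Sum>u\<in>?F. \<bar>\<kappa> x u - \<kappa> y u\<bar>) * \<theta>"
    unfolding X_def Y_def
    by (intro abs_sum_mult_le lip_osc[OF f] Om_upd_Suc y u0) auto
  also have "\<dots> \<le> \<Lambda> / 2 ^ j * \<theta>"
    by (intro mult_right_mono TV x y xy l0)
  finally have 2: "\<bar>\<Sum>u\<in>?F. (\<kappa> x u - \<kappa> y u) * (f (Y u) - f (Y u0))\<bar> \<le> \<Lambda> / 2 ^ j * \<theta>" .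
  show "\<bar>(\<Sum>u\<in>?F. \<kappa> x u * f (x(Suc m := u))) - (\<Sum>u\<in>?F. \<kappa> y u * f (y(Suc m := u)))\<bar> \<le> (1 + \<Lambda>) * \<theta> / 2 ^ j"
    using eq 1 2 unfolding X_def Y_def by (simp add: field_simps abs_le_iff)
qed

text \<open>Telescoping over the nodes: averaging the test function over the last node by
  \<open>\<kappa> m\<close> costs one error \<open>\<theta> * e\<close> and multiplies the Lipschitz
  constant by \<open>1 + \<Lambda>\<close>. The kernel is kept separate from \<open>A\<close> and
  \<open>B\<close>, so that the bias can use the true kernels and the variance those of the coarse
  chain.\<close>

lemma chain_error:
  fixes A B :: "nat \<Rightarrow> (nat \<Rightarrow> 'b) \<Rightarrow> real"
  assumes nonneg: "\<And>m x u. m < K \<Longrightarrow> x \<in> Om {1..m} \<Longrightarrow> u \<in> F (Suc m) \<Longrightarrow> 0 \<le> \<kappa> m x u"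
    and total: "\<And>m x. m < K \<Longrightarrow> x \<in> Om {1..m} \<Longrightarrow> (\<Sum>u\<in>F (Suc m). \<kappa> m x u) = 1"
    and TV: "\<And>m x y j. m < K \<Longrightarrow> x \<in> Om {1..m} \<Longrightarrow> y \<in> Om {1..m} \<Longrightarrow> lab {1..m} j x = lab {1..m} j y \<Longrightarrow>
      (\<Sum>u\<in>F (Suc m). \<bar>\<kappa> m x u - \<kappa> m y u\<bar>) \<le> \<Lambda> / 2 ^ j"
    and base: "\<And>x. x \<in> Om {} \<Longrightarrow> A 0 x = B 0 x"
    and step: "\<And>m f \<theta>. m < K \<Longrightarrow> lip (Suc m) \<theta> f \<Longrightarrow>
      \<bar>(\<Sum>x\<in>Om {1..Suc m}. (A (Suc m) x - B (Suc m) x) * f x) -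
       (\<Sum>x\<in>Om {1..m}. (A m x - B m x) * (\<Sum>u\<in>F (Suc m). \<kappa> m x u * f (x(Suc m := u))))\<bar> \<le> \<theta> * e"
    and "0 \<le> \<Lambda>" "0 \<le> e"
  shows "m \<le> K \<Longrightarrow> lip m \<theta> f \<Longrightarrow>
    \<bar>\<Sum>x\<in>Om {1..m}. (A m x - B m x) * f x\<bar> \<le> \<theta> * (real m * (1 + \<Lambda>) ^ m * e)"
proof (induction m arbitrary: f \<theta>)
  case 0
  then show ?case using base by simp
next
  case (Suc m)
  let ?g = "\<lambda>x. \<Sum>u\<in>F (Suc m). \<kappa> m x u * f (x(Suc m := u))"
  have m: "m < K" using Suc.prems by simp
  have l0: "0 \<le> \<theta>" using Suc.prems lip_nonneg by blast
  have g: "lip m ((1 + \<Lambda>) * \<theta>) ?g"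
    using Suc.prems(2) nonneg[OF m] total[OF m] TV[OF m] by (intro lip_integral) auto
  have 1: "\<bar>\<Sum>x\<in>Om {1..m}. (A m x - B m x) * ?g x\<bar> \<le> (1 + \<Lambda>) * \<theta> * (real m * (1 + \<Lambda>) ^ m * e)"
    using m by (intro Suc.IH[OF _ g]) simp
  have "\<bar>\<Sum>x\<in>Om {1..Suc m}. (A (Suc m) x - B (Suc m) x) * f x\<bar>
      \<le> (1 + \<Lambda>) * \<theta> * (real m * (1 + \<Lambda>) ^ m * e) + \<theta> * e"
    using 1 step[OF m Suc.prems(2)] by linarith
  \<comment> \<open>The new error is enlarged by the power of \<open>1 + \<Lambda>\<close> so that
    it merges with the \<open>m\<close> old ones.\<close>
  also have "\<dots> \<le> (1 + \<Lambda>) * \<theta> * (real m * (1 + \<Lambda>) ^ m * e) + \<theta> * ((1 + \<Lambda>) ^ Suc m * e)"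
  proof -
    have "1 \<le> (1 + \<Lambda>) ^ Suc m" using \<open>0 \<le> \<Lambda>\<close> by (intro one_le_power) simp
    then have "1 * e \<le> (1 + \<Lambda>) ^ Suc m * e" using \<open>0 \<le> e\<close> by (intro mult_right_mono) auto
    then show ?thesis using l0 by (intro add_left_mono mult_left_mono) auto
  qed
  also have "\<dots> = \<theta> * (real (Suc m) * (1 + \<Lambda>) ^ Suc m * e)"
    by (simp add: algebra_simps)
  finally show ?case .
qed

end

section \<open>Chains of coarse cells along a graph with fully connected parent sets\<close>

locale graph_tree = tree F c
  for F :: "nat \<Rightarrow> 'b set" and c :: "nat \<Rightarrow> nat \<Rightarrow> 'b \<Rightarrow> 'c" +
  fixes K :: nat and P :: "nat \<Rightarrow> nat set" and J :: nat
  assumes P_sub: "k \<in> {1..K} \<Longrightarrow> P k \<subseteq> {1..<k}"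
    and P_conn: "k \<in> {1..K} \<Longrightarrow> i \<in> P k \<Longrightarrow> l \<in> P k \<Longrightarrow> i < l \<Longrightarrow> i \<in> P l"
begin

definition mass :: "((nat \<Rightarrow> 'b) \<Rightarrow> real) \<Rightarrow> ((nat \<Rightarrow> 'b) \<Rightarrow> bool) \<Rightarrow> real" where
  "mass q E = sum q {x \<in> Om {1..K}. E x}"

definition Lab :: "nat \<Rightarrow> (nat \<Rightarrow> 'c) set" where
  "Lab k = lab (P k) J ` Om (P k)"

definition cells :: "nat \<Rightarrow> nat \<Rightarrow> 'c set" where
  "cells k j = c k j ` F k"

text \<open>The factors are left open: taken from the true law or from the empirical law, they give
  the coarse product measure of that law. Parents enter only through their level-\<open>J\<close>
  label.\<close>

definition chainw :: "(nat \<Rightarrow> (nat \<Rightarrow> 'c) \<Rightarrow> 'c \<Rightarrow> real) \<Rightarrow> (nat \<Rightarrow> 'b \<Rightarrow> real) \<Rightarrow> nat \<Rightarrow> (nat \<Rightarrow> 'b) \<Rightarrow> real" where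
  "chainw T w m x = (\<Prod>k\<in>{1..m}. T k (lab (P k) J x) (c k J (x k)) * w k (x k))"

lemma finite_P: "k \<in> {1..K} \<Longrightarrow> finite (P k)"
  using P_sub finite_subset by blast

lemma P_sub_nodes: "k \<in> {1..K} \<Longrightarrow> P k \<subseteq> {1..K}"
  using P_sub by fastforce

lemma P_sub_Suc: "m < K \<Longrightarrow> P (Suc m) \<subseteq> {1..m}"
  using P_sub[of "Suc m"] by (auto simp: less_Suc_eq_le)

lemma P_notin: "k \<in> {1..K} \<Longrightarrow> k \<notin> P k"
  using P_sub by fastforce

text \<open>A parent of \<open>k\<close> below the largest one is a parent of the largest one, by
  \<open>P_conn\<close>. Statements about the parents of \<open>k\<close> thus reduce to a smaller
  node together with its own parents; all uses of full connectedness go through this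
  induction.\<close>

lemma P_Max:
  assumes "k \<in> {1..K}" "P k \<noteq> {}"
  shows "Max (P k) \<in> {1..<k}" "Max (P k) \<in> P k" "P k \<subseteq> insert (Max (P k)) (P (Max (P k)))"
proof -
  have fin: "finite (P k)" using assms finite_P by blast
  show 1: "Max (P k) \<in> P k" using fin assms by (intro Max_in)
  then show "Max (P k) \<in> {1..<k}" using P_sub assms by blast
  show "P k \<subseteq> insert (Max (P k)) (P (Max (P k)))"
  proof
    fix i assume i: "i \<in> P k"
    then have "i \<le> Max (P k)" using fin by simp
    then show "i \<in> insert (Max (P k)) (P (Max (P k)))"
      using P_conn[OF assms(1) i 1] by (cases "i = Max (P k)") auto
  qed
qed

lemma finite_Lab [simp]: "k \<in> {1..K} \<Longrightarrow> finite (Lab k)"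
  unfolding Lab_def using finite_P by blast

lemma finite_cells [simp]: "finite (cells k j)"
  unfolding cells_def by simp

lemma lab_in_Lab:
  assumes "x \<in> Om I" "P k \<subseteq> I"
  shows "lab (P k) J x \<in> Lab k"
proof -
  have "lab (P k) J x = lab (P k) J (restrict x (P k))" by simp
  then show ?thesis unfolding Lab_def using restrict_Om[OF assms] by blast
qed

lemma c_in_cells: "u \<in> F k \<Longrightarrow> c k j u \<in> cells k j"
  unfolding cells_def by blast

lemma mass_fibres:
  assumes "finite Z" "\<And>x. x \<in> Om {1..K} \<Longrightarrow> E x \<Longrightarrow> h x \<in> Z"
  shows "(\<Sum>l\<in>Z. mass q (\<lambda>x. E x \<and> h x = l)) = mass q E"
proof -
  have "(\<Sum>l\<in>Z. mass q (\<lambda>x. E x \<and> h x = l)) = (\<Sum>l\<in>Z. \<Sum>x | x \<in> {x \<in> Om {1..K}. E x} \<and> h x = l. q x)"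
    unfolding mass_def by (intro sum.cong refl arg_cong2[where f=sum]) auto
  also have "\<dots> = mass q E"
    unfolding mass_def using assms by (intro sum_fibres) auto
  finally show ?thesis .
qed

lemma sum_mass:
  assumes "finite Z" "\<And>x. x \<in> Om {1..K} \<Longrightarrow> h x \<in> Z"
  shows "(\<Sum>x\<in>Om {1..K}. q x * \<phi> (h x)) = (\<Sum>l\<in>Z. mass q (\<lambda>x. h x = l) * \<phi> l)"
  unfolding mass_def using assms by (subst sum_mult_fibres[of _ Z]) auto

lemma mass_nonneg: "(\<And>x. x \<in> Om {1..K} \<Longrightarrow> 0 \<le> q x) \<Longrightarrow> 0 \<le> mass q E"
  unfolding mass_def by (intro sum_nonneg) auto

lemma mass_mono: "(\<And>x. x \<in> Om {1..K} \<Longrightarrow> 0 \<le> q x) \<Longrightarrow> (\<And>x. x \<in> Om {1..K} \<Longrightarrow> E x \<Longrightarrow> E' x) \<Longrightarrow> mass q E \<le> mass q E'"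
  unfolding mass_def by (intro sum_mono2) auto

lemma mass_cong: "(\<And>x. x \<in> Om {1..K} \<Longrightarrow> E x = E' x) \<Longrightarrow> mass q E = mass q E'"
  unfolding mass_def by (intro sum.cong) auto

lemma chainw_Suc:
  assumes "m < K"
  shows "chainw T w (Suc m) (x(Suc m := u)) =
    chainw T w m x * (T (Suc m) (lab (P (Suc m)) J x) (c (Suc m) J u) * w (Suc m) u)"
proof -
  have "(\<Prod>k\<in>{1..m}. T k (lab (P k) J (x(Suc m := u))) (c k J ((x(Suc m := u)) k)) * w k ((x(Suc m := u)) k))
     = (\<Prod>k\<in>{1..m}. T k (lab (P k) J x) (c k J (x k)) * w k (x k))"
  proof (intro prod.cong refl)
    fix k assume k: "k \<in> {1..m}"
    then have "Suc m \<notin> P k" using P_sub[of k] assms by fastforce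
    then show "T k (lab (P k) J (x(Suc m := u))) (c k J ((x(Suc m := u)) k)) * w k ((x(Suc m := u)) k)
       = T k (lab (P k) J x) (c k J (x k)) * w k (x k)" using k by simp
  qed
  moreover have "Suc m \<notin> P (Suc m)" using P_sub[of "Suc m"] assms by fastforce
  ultimately show ?thesis unfolding chainw_def interval_Suc by simp
qed

end

text \<open>\<open>T\<close> is the transition between coarse cells, \<open>w\<close> the law inside a coarse cell.\<close>

locale coarse_chain = graph_tree F c K P J
  for F :: "nat \<Rightarrow> 'b set" and c :: "nat \<Rightarrow> nat \<Rightarrow> 'b \<Rightarrow> 'c" and K P J +
  fixes q :: "(nat \<Rightarrow> 'b) \<Rightarrow> real" and T :: "nat \<Rightarrow> (nat \<Rightarrow> 'c) \<Rightarrow> 'c \<Rightarrow> real" and w :: "nat \<Rightarrow> 'b \<Rightarrow> real"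
  assumes q_nonneg: "x \<in> Om {1..K} \<Longrightarrow> 0 \<le> q x"
    and q_total: "(\<Sum>x\<in>Om {1..K}. q x) = 1"
    and T_nonneg: "k \<in> {1..K} \<Longrightarrow> l \<in> Lab k \<Longrightarrow> B \<in> cells k J \<Longrightarrow> 0 \<le> T k l B"
    and T_total: "k \<in> {1..K} \<Longrightarrow> l \<in> Lab k \<Longrightarrow> (\<Sum>B\<in>cells k J. T k l B) = 1"
    and w_nonneg: "k \<in> {1..K} \<Longrightarrow> u \<in> F k \<Longrightarrow> 0 \<le> w k u"
    and w_total: "k \<in> {1..K} \<Longrightarrow> B \<in> cells k J \<Longrightarrow> (\<Sum>u | u \<in> F k \<and> c k J u = B. w k u) = 1"
    and T_mass: "k \<in> {1..K} \<Longrightarrow> l \<in> Lab k \<Longrightarrow> B \<in> cells k J \<Longrightarrow>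
      mass q (\<lambda>x. lab (P k) J x = l) * T k l B = mass q (\<lambda>x. lab (P k) J x = l \<and> c k J (x k) = B)"
begin

abbreviation R :: "nat \<Rightarrow> (nat \<Rightarrow> 'b) \<Rightarrow> real" where
  "R \<equiv> chainw T w"

definition ker :: "nat \<Rightarrow> (nat \<Rightarrow> 'c) \<Rightarrow> 'b \<Rightarrow> real" where
  "ker k l u = T k l (c k J u) * w k u"

lemma R_Suc: "m < K \<Longrightarrow> R (Suc m) (x(Suc m := u)) = R m x * ker (Suc m) (lab (P (Suc m)) J x) u"
  unfolding ker_def by (rule chainw_Suc)

text \<open>A function of the coarse cell does not see the position inside it, and \<open>w\<close>
  has mass one in each cell, so only the transition remains.\<close>

lemma sum_ker:
  assumes k: "k \<in> {1..K}"
  shows "(\<Sum>u\<in>F k. ker k l u * \<phi> (c k J u)) = (\<Sum>B\<in>cells k J. T k l B * \<phi> B)"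
proof -
  have "(\<Sum>u\<in>F k. ker k l u * \<phi> (c k J u)) = (\<Sum>u\<in>F k. w k u * (T k l (c k J u) * \<phi> (c k J u)))"
    unfolding ker_def by (simp add: ac_simps)
  also have "\<dots> = (\<Sum>B\<in>cells k J. (\<Sum>u | u \<in> F k \<and> c k J u = B. w k u) * (T k l B * \<phi> B))"
    by (rule sum_mult_fibres[where h = "c k J" and \<phi> = "\<lambda>B. T k l B * \<phi> B"]) (auto simp: cells_def)
  also have "\<dots> = (\<Sum>B\<in>cells k J. T k l B * \<phi> B)"
    using w_total[OF k] by (intro sum.cong) auto
  finally show ?thesis .
qed

lemma ker_total: "k \<in> {1..K} \<Longrightarrow> l \<in> Lab k \<Longrightarrow> (\<Sum>u\<in>F k. ker k l u) = 1"
  using sum_ker[of k l "\<lambda>_. 1"] T_total by simp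

lemma ker_nonneg: "k \<in> {1..K} \<Longrightarrow> l \<in> Lab k \<Longrightarrow> u \<in> F k \<Longrightarrow> 0 \<le> ker k l u"
  unfolding ker_def by (intro mult_nonneg_nonneg T_nonneg w_nonneg c_in_cells)

lemma lab_Lab: "m < K \<Longrightarrow> x \<in> Om {1..m} \<Longrightarrow> lab (P (Suc m)) J x \<in> Lab (Suc m)"
  using lab_in_Lab P_sub_Suc by blast

lemma lab_Lab_nodes: "k \<in> {1..K} \<Longrightarrow> x \<in> Om {1..K} \<Longrightarrow> lab (P k) J x \<in> Lab k"
  using lab_in_Lab P_sub_nodes by blast

lemma R_nonneg: "m \<le> K \<Longrightarrow> x \<in> Om {1..m} \<Longrightarrow> 0 \<le> R m x"
  unfolding chainw_def
proof (intro prod_nonneg mult_nonneg_nonneg)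
  fix k assume "m \<le> K" "x \<in> Om {1..m}" "k \<in> {1..m}"
  moreover from this have "P k \<subseteq> {1..m}" using P_sub[of k] by fastforce
  ultimately show "0 \<le> T k (lab (P k) J x) (c k J (x k))" "0 \<le> w k (x k)"
    using T_nonneg[of k] w_nonneg[of k] lab_in_Lab[of x "{1..m}" k] c_in_cells Om_app[of x "{1..m}" k] by auto
qed

lemma sum_R_Suc:
  assumes "m < K"
  shows "(\<Sum>x\<in>Om {1..Suc m}. R (Suc m) x * h x) =
    (\<Sum>x\<in>Om {1..m}. R m x * (\<Sum>u\<in>F (Suc m). ker (Suc m) (lab (P (Suc m)) J x) u * h (x(Suc m := u))))"
  unfolding sum_Om_Suc R_Suc[OF assms] by (simp add: sum_distrib_left mult.assoc)

text \<open>Nodes after \<open>k\<close> integrate out one at a time, since their kernels have mass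
  one and \<open>h\<close> ignores their coordinates.\<close>

lemma sum_R_extend:
  assumes "k \<le> m" "m \<le> K" and h: "\<And>x i u. k < i \<Longrightarrow> h (x(i := u)) = h x"
  shows "(\<Sum>x\<in>Om {1..m}. R m x * h x) = (\<Sum>x\<in>Om {1..k}. R k x * h x)"
  using assms(1,2)
proof (induction m rule: dec_induct)
  case (step m)
  then have "(\<Sum>x\<in>Om {1..Suc m}. R (Suc m) x * h x) =
    (\<Sum>x\<in>Om {1..m}. R m x * (\<Sum>u\<in>F (Suc m). ker (Suc m) (lab (P (Suc m)) J x) u * h x))"
    using h[of "Suc m"] by (subst sum_R_Suc) auto
  also have "\<dots> = (\<Sum>x\<in>Om {1..m}. R m x * h x)"
    using step ker_total[of "Suc m"] lab_Lab
    by (intro sum.cong refl) (auto simp flip: sum_distrib_right)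
  finally show ?case using step by simp
qed simp

lemma R_total: "m \<le> K \<Longrightarrow> (\<Sum>x\<in>Om {1..m}. R m x) = 1"
  using sum_R_extend[of 0 m "\<lambda>_. 1"] by (simp add: chainw_def)

text \<open>Averaged over the label under \<open>q\<close>, the transition becomes the joint law of
  label and cell under \<open>q\<close>; this is \<open>T_mass\<close>, and labels without mass
  carry no weight.\<close>

lemma sum_T_mass:
  assumes k: "k \<in> {1..K}"
  shows "(\<Sum>x\<in>Om {1..K}. q x * (\<Sum>B\<in>cells k J. T k (lab (P k) J x) B * g (lab (P k) J x) B)) =
    (\<Sum>x\<in>Om {1..K}. q x * g (lab (P k) J x) (c k J (x k)))"
proof -
  let ?h = "\<lambda>x. (lab (P k) J x, c k J (x k))"
  have "(\<Sum>x\<in>Om {1..K}. q x * g (lab (P k) J x) (c k J (x k))) =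
     (\<Sum>z\<in>Lab k \<times> cells k J. mass q (\<lambda>x. ?h x = z) * case_prod g z)"
    using sum_mass[of "Lab k \<times> cells k J" ?h q "case_prod g"] k lab_Lab_nodes c_in_cells Om_app by auto
  also have "\<dots> = (\<Sum>l\<in>Lab k. \<Sum>B\<in>cells k J. mass q (\<lambda>x. ?h x = (l, B)) * g l B)"
    by (simp add: sum.cartesian_product split_def prod_eq_iff)
  also have "\<dots> = (\<Sum>l\<in>Lab k. mass q (\<lambda>x. lab (P k) J x = l) * (\<Sum>B\<in>cells k J. T k l B * g l B))"
    using T_mass[OF k] by (auto simp: sum_distrib_left mult.assoc[symmetric] intro!: sum.cong)
  also have "\<dots> = (\<Sum>x\<in>Om {1..K}. q x * (\<Sum>B\<in>cells k J. T k (lab (P k) J x) B * g (lab (P k) J x) B))"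
    using k lab_Lab_nodes
    by (intro sum_mass[of "Lab k" "lab (P k) J", symmetric]) auto
  finally show ?thesis ..
qed

text \<open>
  The parents of \<open>k\<close> other than the last one, \<open>m\<close>, are parents of \<open>m\<close>; so the marginal on the parents
  of \<open>k\<close> is part of the one on \<open>m\<close> and its parents.
\<close>

lemma marginal:
  assumes "k \<in> {1..K}" "k \<le> m" "m \<le> K"
  shows "(\<Sum>x\<in>Om {1..m}. R m x * g (lab (P k) J x) (c k J (x k))) =
    (\<Sum>x\<in>Om {1..K}. q x * g (lab (P k) J x) (c k J (x k)))"
  using assms
proof (induction k arbitrary: m g rule: less_induct)
  case (less k)
  then obtain k' where k': "k = Suc k'" "k' < K" by (cases k) auto
  let ?h = "\<lambda>l. \<Sum>B\<in>cells k J. T k l B * g l B"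
  have "(\<Sum>x\<in>Om {1..m}. R m x * g (lab (P k) J x) (c k J (x k)))
      = (\<Sum>x\<in>Om {1..k}. R k x * g (lab (P k) J x) (c k J (x k)))"
    using less.prems P_sub[of k] by (intro sum_R_extend) (auto intro!: arg_cong2[where f=g] lab_upd_notin)
  also have "\<dots> = (\<Sum>x\<in>Om {1..k'}. R k' x * ?h (lab (P k) J x))"
    unfolding k'(1) sum_R_Suc[OF k'(2)]
    using P_sub_Suc[OF k'(2)] less.prems(1) k'(1)
    by (intro sum.cong refl arg_cong2[where f="(*)"])
       (auto simp flip: sum_ker intro!: sum.cong arg_cong2[where f="(*)"] arg_cong2[where f=g] lab_upd_notin)
  also have "\<dots> = (\<Sum>x\<in>Om {1..K}. q x * ?h (lab (P k) J x))"
  proof (cases "P k = {}")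
    case True
    then show ?thesis using R_total[of k'] k' q_total by (simp flip: sum_distrib_right)
  next
    case False
    let ?m = "Max (P k)"
    note M = P_Max[OF less.prems(1) False]
    \<comment> \<open>\<open>g'\<close> rebuilds the label on \<open>P k\<close> from the label on
      \<open>P ?m\<close> and the cell of \<open>?m\<close>, which together contain all its entries;
      the induction hypothesis at \<open>?m\<close> is applied to it.\<close>
    define g' where "g' l B = ?h (\<lambda>i. if i \<in> P k then if i = ?m then B else l i else undefined)" for l B
    have g': "g' (lab (P ?m) J x) (c ?m J (x ?m)) = ?h (lab (P k) J x)" for x
    proof -
      have "(\<lambda>i. if i \<in> P k then if i = ?m then c ?m J (x ?m) else lab (P ?m) J x i else undefined) = lab (P k) J x"
        using M(3) by (auto simp: lab_def fun_eq_iff)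
      then show ?thesis unfolding g'_def by simp
    qed
    show ?thesis
      using less.IH[of ?m k' g'] M less.prems k' unfolding g' by auto
  qed
  also have "\<dots> = (\<Sum>x\<in>Om {1..K}. q x * g (lab (P k) J x) (c k J (x k)))"
    by (rule sum_T_mass) (use less.prems in auto)
  finally show ?case .
qed

text \<open>\<open>marginal\<close> at \<open>k = Suc m\<close> for a function that ignores the cell
  of the new node, which then integrates out. It turns every error that depends on the parent label
  into an average under \<open>q\<close>.\<close>

lemma marginal_parents:
  assumes "m < K"
  shows "(\<Sum>x\<in>Om {1..m}. R m x * \<phi> (lab (P (Suc m)) J x)) =
    (\<Sum>x\<in>Om {1..K}. q x * \<phi> (lab (P (Suc m)) J x))"
proof -
  have "(\<Sum>x\<in>Om {1..Suc m}. R (Suc m) x * \<phi> (lab (P (Suc m)) J x)) =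
    (\<Sum>x\<in>Om {1..m}. R m x * \<phi> (lab (P (Suc m)) J x))"
    using assms P_sub_Suc[OF assms] by (intro sum_R_extend) (auto intro!: arg_cong[where f=\<phi>] lab_upd_notin)
  then show ?thesis using marginal[of "Suc m" "Suc m" "\<lambda>l _. \<phi> l"] assms by simp
qed

end

section \<open>The coarse chain fitted to an arbitrary law\<close>

context graph_tree
begin

definition rep_cell :: "nat \<Rightarrow> 'c \<Rightarrow> 'b" where
  "rep_cell k B = (SOME u. u \<in> F k \<and> c k J u = B)"

text \<open>
  The second branches only serve to obtain probabilities for cells without mass.
\<close>

definition cell_law :: "((nat \<Rightarrow> 'b) \<Rightarrow> real) \<Rightarrow> nat \<Rightarrow> 'b \<Rightarrow> real" where
  "cell_law q k u =
    (if mass q (\<lambda>x. c k J (x k) = c k J u) > 0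
     then mass q (\<lambda>x. x k = u) / mass q (\<lambda>x. c k J (x k) = c k J u)
     else of_bool (u = rep_cell k (c k J u)))"

definition transition :: "((nat \<Rightarrow> 'b) \<Rightarrow> real) \<Rightarrow> nat \<Rightarrow> (nat \<Rightarrow> 'c) \<Rightarrow> 'c \<Rightarrow> real" where
  "transition q k l B =
    (if mass q (\<lambda>x. lab (P k) J x = l) > 0
     then mass q (\<lambda>x. lab (P k) J x = l \<and> c k J (x k) = B) / mass q (\<lambda>x. lab (P k) J x = l)
     else mass q (\<lambda>x. c k J (x k) = B))"

lemma rep_cell: "B \<in> cells k J \<Longrightarrow> rep_cell k B \<in> F k \<and> c k J (rep_cell k B) = B"
  unfolding rep_cell_def cells_def by (rule someI_ex) auto

lemma mass_point_cell:
  assumes "k \<in> {1..K}"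
  shows "(\<Sum>u | u \<in> F k \<and> c k J u = B. mass q (\<lambda>x. E x \<and> x k = u)) = mass q (\<lambda>x. E x \<and> c k J (x k) = B)"
proof -
  have "(\<Sum>u | u \<in> F k \<and> c k J u = B. mass q (\<lambda>x. E x \<and> x k = u)) =
     (\<Sum>u | u \<in> F k \<and> c k J u = B. mass q (\<lambda>x. (E x \<and> c k J (x k) = B) \<and> x k = u))"
    by (intro sum.cong refl mass_cong) auto
  also have "\<dots> = mass q (\<lambda>x. E x \<and> c k J (x k) = B)"
    using assms Om_app by (intro mass_fibres) auto
  finally show ?thesis .
qed

lemma cell_law_nonneg:
  assumes "\<And>x. x \<in> Om {1..K} \<Longrightarrow> 0 \<le> q x"
  shows "0 \<le> cell_law q k u"
  unfolding cell_law_def using mass_nonneg[OF assms] by auto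

lemma cell_law_total:
  assumes k: "k \<in> {1..K}" and B: "B \<in> cells k J"
  shows "(\<Sum>u | u \<in> F k \<and> c k J u = B. cell_law q k u) = 1"
proof (cases "mass q (\<lambda>x. c k J (x k) = B) > 0")
  case True
  have "(\<Sum>u | u \<in> F k \<and> c k J u = B. cell_law q k u) =
     (\<Sum>u | u \<in> F k \<and> c k J u = B. mass q (\<lambda>x. True \<and> x k = u)) / mass q (\<lambda>x. c k J (x k) = B)"
    unfolding sum_divide_distrib using True by (intro sum.cong) (auto simp: cell_law_def)
  also have "\<dots> = 1" unfolding mass_point_cell[OF k] using True by simp
  finally show ?thesis .
next
  case False
  have "(\<Sum>u | u \<in> F k \<and> c k J u = B. cell_law q k u) = (\<Sum>u | u \<in> F k \<and> c k J u = B. of_bool (u = rep_cell k B))"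
    using False by (intro sum.cong) (auto simp: cell_law_def)
  also have "\<dots> = (\<Sum>u\<in>{rep_cell k B}. 1)"
    using rep_cell[OF B] by (intro sum.mono_neutral_cong_right) auto
  finally show ?thesis by simp
qed

lemma cell_law_mass:
  assumes k: "k \<in> {1..K}" and "\<And>x. x \<in> Om {1..K} \<Longrightarrow> 0 \<le> q x"
  shows "mass q (\<lambda>x. c k J (x k) = c k J u) * cell_law q k u = mass q (\<lambda>x. x k = u)"
proof (cases "mass q (\<lambda>x. c k J (x k) = c k J u) > 0")
  case False
  then have "mass q (\<lambda>x. c k J (x k) = c k J u) = 0"
    using mass_nonneg[of q] assms(2) by (meson linorder_neqE_linordered_idom not_less)
  moreover have "mass q (\<lambda>x. x k = u) \<le> mass q (\<lambda>x. c k J (x k) = c k J u)"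
    using assms(2) by (intro mass_mono) auto
  ultimately show ?thesis using mass_nonneg[of q "\<lambda>x. x k = u"] assms(2) by auto
qed (simp add: cell_law_def)

text \<open>For a label without mass both sides of \<open>T_mass\<close> vanish, and the default
  transition, the marginal law of the cell of node \<open>k\<close>, is a probability. Hence every
  law on the alphabet has a fitted chain, whatever the graph.\<close>

lemma coarse_chain_transition:
  assumes nonneg: "\<And>x. x \<in> Om {1..K} \<Longrightarrow> 0 \<le> q x" and total: "(\<Sum>x\<in>Om {1..K}. q x) = 1"
  shows "coarse_chain F c K P J q (transition q) (cell_law q)"
proof
  note nn = mass_nonneg[of q, OF nonneg]
  have cell_total: "(\<Sum>B\<in>cells k J. mass q (\<lambda>x. E x \<and> c k J (x k) = B)) = mass q E" if "k \<in> {1..K}" for k E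
    using that Om_app c_in_cells by (intro mass_fibres) auto
  fix k l B assume k: "k \<in> {1..K}"
  show "0 \<le> transition q k l B" unfolding transition_def using nn by auto
  show "(\<Sum>B\<in>cells k J. transition q k l B) = 1"
  proof (cases "mass q (\<lambda>x. lab (P k) J x = l) > 0")
    case True
    then show ?thesis unfolding transition_def by (simp add: sum_divide_distrib[symmetric] cell_total[OF k])
  next
    case False
    then show ?thesis unfolding transition_def using cell_total[OF k, of "\<lambda>_. True"] total
      by (simp add: mass_def)
  qed
  show "mass q (\<lambda>x. lab (P k) J x = l) * transition q k l B = mass q (\<lambda>x. lab (P k) J x = l \<and> c k J (x k) = B)"
  proof (cases "mass q (\<lambda>x. lab (P k) J x = l) > 0")
    case False
    then have "mass q (\<lambda>x. lab (P k) J x = l) = 0"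
      using nn by (meson linorder_neqE_linordered_idom not_less)
    moreover have "mass q (\<lambda>x. lab (P k) J x = l \<and> c k J (x k) = B) \<le> mass q (\<lambda>x. lab (P k) J x = l)"
      using nonneg by (intro mass_mono) auto
    ultimately show ?thesis using nn[of "\<lambda>x. lab (P k) J x = l \<and> c k J (x k) = B"] by auto
  qed (simp add: transition_def)
qed (use nonneg total cell_law_nonneg[OF nonneg] cell_law_total in auto)

end

section \<open>Resampling inside coarse cells\<close>

context coarse_chain
begin

text \<open>The points of \<open>Om I\<close> in a product cell form a product set, so the sum of
  products factors into the cell totals of the \<open>w i\<close>.\<close>

lemma within_cell_total:
  assumes "finite I" "I \<subseteq> {1..K}" "x \<in> Om I'" "I \<subseteq> I'"
  shows "(\<Sum>z | z \<in> Om I \<and> lab I J z = lab I J x. \<Prod>i\<in>I. w i (z i)) = 1"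
proof -
  have "{z \<in> Om I. lab I J z = lab I J x} = PiE I (\<lambda>i. {u \<in> F i. c i J u = c i J (x i)})"
    unfolding Om_def lab_eq_iff by (auto simp: PiE_def Pi_def)
  then have "(\<Sum>z | z \<in> Om I \<and> lab I J z = lab I J x. \<Prod>i\<in>I. w i (z i)) =
     (\<Prod>i\<in>I. \<Sum>u | u \<in> F i \<and> c i J u = c i J (x i). w i u)"
    using assms by (simp add: prod_sum_PiE)
  also have "\<dots> = 1"
    using assms w_total Om_app[OF assms(3)] c_in_cells by (intro prod.neutral) (auto simp: subset_iff)
  finally show ?thesis .
qed

text \<open>
  Given the coarse cells, the coordinates are independent with laws \<open>w\<close>; resampling the coordinates
  in \<open>I\<close> inside their cells therefore preserves \<open>R m\<close>.
\<close>

lemma resample: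
  assumes m: "m \<le> K" and I: "I \<subseteq> {1..m}"
  shows "(\<Sum>x\<in>Om {1..m}. R m x * (G (restrict x I) * \<phi> (lab {1..m} J x))) =
    (\<Sum>x\<in>Om {1..m}. R m x * ((\<Sum>z | z \<in> Om I \<and> lab I J z = lab I J x. (\<Prod>i\<in>I. w i (z i)) * G z) * \<phi> (lab {1..m} J x)))"
proof -
  define \<nu> where "\<nu> z = (\<Prod>i\<in>I. w i (z i))" for z
  define ov where "ov x z = (\<lambda>i. if i \<in> I then z i else x i)" for x z :: "nat \<Rightarrow> 'b"
  define Z where "Z x = {z \<in> Om I. lab I J z = lab I J x}" for x
  define S where "S = Sigma (Om {1..m}) Z"
  have finI: "finite I" using I finite_subset by blast
  have finZ: "finite (Z x)" for x unfolding Z_def using finI by simp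
  have Z1: "(\<Sum>z\<in>Z x. \<nu> z) = 1" if "x \<in> Om {1..m}" for x
    unfolding Z_def \<nu>_def using that I m by (intro within_cell_total[OF finI _ that I]) auto
  have lab_ov: "lab I' J (ov x z) = lab I' J x" if "z \<in> Z x" for x z I'
    using that unfolding Z_def by (auto simp: lab_eq_iff ov_def)
  have ov_in: "ov x z \<in> Om {1..m}" if "x \<in> Om {1..m}" "z \<in> Z x" for x z
    using that I unfolding Z_def Om_def ov_def by (auto simp: PiE_def Pi_def extensional_def subset_iff)
  \<comment> \<open>Detailed balance: moving coordinates inside their cells leaves the transition
    factors unchanged and exchanges only the weights \<open>w\<close>.\<close>
  have balance: "R m (ov x z) * \<nu> (restrict x I) = R m x * \<nu> z" if z: "z \<in> Z x" for x z
  proof -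
    have split: "R m y = (\<Prod>k\<in>{1..m}. T k (lab (P k) J y) (c k J (y k))) *
        ((\<Prod>k\<in>{1..m} - I. w k (y k)) * (\<Prod>k\<in>I. w k (y k)))" for y
      unfolding chainw_def prod.distrib using prod.subset_diff[OF I, of "\<lambda>k. w k (y k)"] by simp
    have "c k J (ov x z k) = c k J (x k)" for k
      using z unfolding Z_def ov_def lab_eq_iff by auto
    moreover have "(\<Prod>k\<in>{1..m} - I. w k (ov x z k)) = (\<Prod>k\<in>{1..m} - I. w k (x k))"
      "(\<Prod>k\<in>I. w k (ov x z k)) = (\<Prod>k\<in>I. w k (z k))"
      by (auto simp: ov_def intro!: prod.cong)
    ultimately show ?thesis
      unfolding split[of "ov x z"] split[of x] \<nu>_def by (simp add: lab_ov[OF z] ac_simps cong: prod.cong)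
  qed
  \<comment> \<open>The exchange of old and resampled coordinates is an involution of
    \<open>S\<close> that preserves the weight \<open>R m x * \<nu> z\<close>; reindexing by it
    moves \<open>G\<close> from \<open>restrict x I\<close> to \<open>z\<close>.\<close>
  let ?\<tau> = "\<lambda>(x, z). (ov x z, restrict x I)"
  have invol: "\<forall>a\<in>S. ?\<tau> (?\<tau> a) = a"
    unfolding S_def Z_def Om_def by (auto simp: ov_def fun_eq_iff restrict_def PiE_def extensional_def)
  have maps: "?\<tau> ` S \<subseteq> S"
  proof (clarsimp simp: S_def)
    fix x z assume x: "x \<in> Om {Suc 0..m}" and z: "z \<in> Z x"
    then show "ov x z \<in> Om {Suc 0..m} \<and> restrict x I \<in> Z (ov x z)"
      using ov_in[of x z] lab_ov[OF z, of I] restrict_Om[of x "{Suc 0..m}" I] I unfolding Z_def by auto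
  qed
  have bij: "bij_betw ?\<tau> S S"
    by (rule bij_betw_byWitness[OF invol invol maps maps])
  have "(\<Sum>x\<in>Om {1..m}. R m x * (G (restrict x I) * \<phi> (lab {1..m} J x))) =
     (\<Sum>x\<in>Om {1..m}. R m x * (G (restrict x I) * \<phi> (lab {1..m} J x)) * (\<Sum>z\<in>Z x. \<nu> z))"
    using Z1 by simp
  also have "\<dots> = (\<Sum>(x, z)\<in>S. R m x * \<nu> z * (G (restrict x I) * \<phi> (lab {1..m} J x)))"
    unfolding S_def using finZ by (subst sum.Sigma[symmetric]) (auto simp: sum_distrib_left sum_distrib_right ac_simps)
  also have "\<dots> = (\<Sum>a\<in>S. (\<lambda>(x, z). R m x * \<nu> z * (G (restrict x I) * \<phi> (lab {1..m} J x))) (?\<tau> a))"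
    by (rule sum.reindex_bij_betw[OF bij, symmetric])
  also have "\<dots> = (\<Sum>(x, z)\<in>S. R m x * \<nu> z * (G z * \<phi> (lab {1..m} J x)))"
  proof (intro sum.cong refl, clarify)
    fix x z assume "(x, z) \<in> S"
    then have x: "x \<in> Om {1..m}" and z: "z \<in> Z x" unfolding S_def by auto
    have "restrict (ov x z) I = z"
      using z unfolding Z_def Om_def ov_def by (auto simp: fun_eq_iff restrict_def PiE_def extensional_def)
    then show "R m (ov x z) * \<nu> (restrict x I) * (G (restrict (ov x z) I) * \<phi> (lab {1..m} J (ov x z))) =
       R m x * \<nu> z * (G z * \<phi> (lab {1..m} J x))"
      using balance[OF z] lab_ov[OF z] by simp
  qed
  also have "\<dots> = (\<Sum>x\<in>Om {1..m}. R m x * ((\<Sum>z\<in>Z x. \<nu> z * G z) * \<phi> (lab {1..m} J x)))"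
    unfolding S_def using finZ
    by (subst sum.Sigma[symmetric]) (auto simp: sum_distrib_left sum_distrib_right ac_simps)
  finally show ?thesis unfolding Z_def \<nu>_def .
qed

end

lemma abs_weighted_sum_le:
  fixes a g b :: "'a \<Rightarrow> real"
  assumes "\<And>x. x \<in> S \<Longrightarrow> 0 \<le> a x" "\<And>x. x \<in> S \<Longrightarrow> \<bar>g x\<bar> \<le> b x"
  shows "\<bar>\<Sum>x\<in>S. a x * g x\<bar> \<le> (\<Sum>x\<in>S. a x * b x)"
proof -
  have "\<bar>\<Sum>x\<in>S. a x * g x\<bar> \<le> (\<Sum>x\<in>S. \<bar>a x * g x\<bar>)" by (rule sum_abs)
  also have "\<dots> \<le> (\<Sum>x\<in>S. a x * b x)"
    using assms by (intro sum_mono) (simp add: abs_mult mult_left_mono)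
  finally show ?thesis .
qed

lemma abs_add3_le: "\<bar>a\<bar> \<le> A \<Longrightarrow> \<bar>b\<bar> \<le> B \<Longrightarrow> \<bar>c\<bar> \<le> C \<Longrightarrow> \<bar>a + b + c :: real\<bar> \<le> A + B + C"
  by linarith

lemma abs_triangle3: "\<bar>- a + b - c\<bar> \<le> \<bar>a\<bar> + \<bar>b\<bar> + \<bar>c :: real\<bar>"
  by linarith

section \<open>Bias\<close>

text \<open>
  Quantisation destroys the factorisation of the law along the graph, but only up to an error \<open>\<eta>\<close>
  proportional to the size of the finest cells.
\<close>

locale smooth_model = graph_tree F c K P J
  for F :: "nat \<Rightarrow> 'b set" and c :: "nat \<Rightarrow> nat \<Rightarrow> 'b \<Rightarrow> 'c" and K P J +
  fixes p :: "(nat \<Rightarrow> 'b) \<Rightarrow> real" and \<kappa> :: "nat \<Rightarrow> (nat \<Rightarrow> 'b) \<Rightarrow> 'b \<Rightarrow> real" and \<Lambda> \<eta> :: real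
  assumes p_nonneg: "x \<in> Om {1..K} \<Longrightarrow> 0 \<le> p x"
    and p_total: "(\<Sum>x\<in>Om {1..K}. p x) = 1"
    and \<kappa>_nonneg: "k \<in> {1..K} \<Longrightarrow> z \<in> Om (P k) \<Longrightarrow> u \<in> F k \<Longrightarrow> 0 \<le> \<kappa> k z u"
    and \<kappa>_total: "k \<in> {1..K} \<Longrightarrow> z \<in> Om (P k) \<Longrightarrow> (\<Sum>u\<in>F k. \<kappa> k z u) = 1"
    and \<kappa>_mass: "k \<in> {1..K} \<Longrightarrow> z \<in> Om (P k) \<Longrightarrow> u \<in> F k \<Longrightarrow>
      mass p (\<lambda>x. restrict x (P k) = z \<and> x k = u) = mass p (\<lambda>x. restrict x (P k) = z) * \<kappa> k z u"
    and \<kappa>_TV: "k \<in> {1..K} \<Longrightarrow> z \<in> Om (P k) \<Longrightarrow> z' \<in> Om (P k) \<Longrightarrow> lab (P k) j z = lab (P k) j z' \<Longrightarrow>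
      (\<Sum>u\<in>F k. \<bar>\<kappa> k z u - \<kappa> k z' u\<bar>) \<le> \<Lambda> / 2 ^ j"
    and reverse_TV: "k \<in> {1..K} \<Longrightarrow> u \<in> F k \<Longrightarrow> v \<in> F k \<Longrightarrow> c k J u = c k J v \<Longrightarrow>
      (\<Sum>z\<in>Om (P k). \<bar>mass p (\<lambda>x. restrict x (P k) = z \<and> x k = u) * mass p (\<lambda>x. x k = v)
        - mass p (\<lambda>x. restrict x (P k) = z \<and> x k = v) * mass p (\<lambda>x. x k = u)\<bar>)
      \<le> \<Lambda> / 2 ^ J * (mass p (\<lambda>x. x k = u) * mass p (\<lambda>x. x k = v))"
    and almost_markov: "m < K \<Longrightarrow>
      (\<Sum>x\<in>Om {1..m}. \<Sum>u\<in>F (Suc m). \<bar>mass p (\<lambda>y. restrict y {1..Suc m} = x(Suc m := u))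
        - mass p (\<lambda>y. restrict y {1..m} = x) * \<kappa> (Suc m) (restrict x (P (Suc m))) u\<bar>) \<le> \<eta>"
    and \<Lambda>_nonneg: "0 \<le> \<Lambda>" and \<eta>_nonneg: "0 \<le> \<eta>"
begin

abbreviation r :: real where "r \<equiv> 1 / 2 ^ J"

abbreviation pl :: "nat \<Rightarrow> (nat \<Rightarrow> 'c) \<Rightarrow> real" where
  "pl k l \<equiv> mass p (\<lambda>x. lab (P k) J x = l)"

abbreviation pz :: "nat set \<Rightarrow> (nat \<Rightarrow> 'b) \<Rightarrow> real" where
  "pz I z \<equiv> mass p (\<lambda>x. restrict x I = z)"

abbreviation w :: "nat \<Rightarrow> 'b \<Rightarrow> real" where "w \<equiv> cell_law p"

text \<open>
  For a cell \<open>l\<close> without mass the value of \<open>\<kappa>\<close> at some point of \<open>l\<close> is taken, so that \<open>kbar\<close> inherits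
  the total variation bound of \<open>\<kappa>\<close> at all cells.
\<close>

definition kbar :: "nat \<Rightarrow> (nat \<Rightarrow> 'c) \<Rightarrow> 'b \<Rightarrow> real" where
  "kbar k l u = (if pl k l > 0 then mass p (\<lambda>x. lab (P k) J x = l \<and> x k = u) / pl k l
     else \<kappa> k (SOME z. z \<in> Om (P k) \<and> lab (P k) J z = l) u)"

text \<open>On labels with mass this is \<open>transition p\<close>. The detour through
  \<open>kbar\<close> matters on labels without mass, where the default of \<open>transition\<close>
  has no total variation bound between labels, while \<open>lip_integral\<close> needs one at all
  points.\<close>

definition T :: "nat \<Rightarrow> (nat \<Rightarrow> 'c) \<Rightarrow> 'c \<Rightarrow> real" where
  "T k l B = (\<Sum>u | u \<in> F k \<and> c k J u = B. kbar k l u)"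

text \<open>\<open>D I\<close> measures how far the coordinates in \<open>I\<close> are from independent given their coarse cells.\<close>

definition D :: "nat set \<Rightarrow> real" where
  "D I = (\<Sum>z\<in>Om I. \<bar>mass p (\<lambda>x. lab I J x = lab I J z) * (\<Prod>i\<in>I. w i (z i)) - pz I z\<bar>)"

lemma p_mass_nonneg: "0 \<le> mass p E"
  by (rule mass_nonneg) (rule p_nonneg)

lemma p_mass_total: "mass p (\<lambda>_. True) = 1"
  unfolding mass_def using p_total by simp

lemma w_nonneg: "0 \<le> w k u"
  by (rule cell_law_nonneg[OF p_nonneg])

lemma restrict_P: "k \<in> {1..K} \<Longrightarrow> x \<in> Om {1..K} \<Longrightarrow> restrict x (P k) \<in> Om (P k)"
  using restrict_Om P_sub_nodes by blast

lemma kbar_rep: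
  assumes "l \<in> Lab k"
  obtains z where "z \<in> Om (P k)" "lab (P k) J z = l"
    "z = (SOME z. z \<in> Om (P k) \<and> lab (P k) J z = l)"
proof -
  have "\<exists>z. z \<in> Om (P k) \<and> lab (P k) J z = l" using assms unfolding Lab_def by auto
  from someI_ex[OF this] show ?thesis using that by blast
qed

lemma mass_lab_fibres:
  assumes "k \<in> {1..K}"
  shows "(\<Sum>z | z \<in> Om (P k) \<and> lab (P k) J z = l. mass p (\<lambda>x. restrict x (P k) = z \<and> E x)) =
    mass p (\<lambda>x. lab (P k) J x = l \<and> E x)"
proof -
  have "(\<Sum>z | z \<in> Om (P k) \<and> lab (P k) J z = l. mass p (\<lambda>x. restrict x (P k) = z \<and> E x)) =
    (\<Sum>z | z \<in> Om (P k) \<and> lab (P k) J z = l. mass p (\<lambda>x. (lab (P k) J x = l \<and> E x) \<and> restrict x (P k) = z))"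
    by (intro sum.cong refl mass_cong) auto
  also have "\<dots> = mass p (\<lambda>x. lab (P k) J x = l \<and> E x)"
    using assms finite_P restrict_P by (intro mass_fibres) auto
  finally show ?thesis .
qed

lemma pl_fibres:
  assumes "k \<in> {1..K}"
  shows "(\<Sum>z | z \<in> Om (P k) \<and> lab (P k) J z = l. pz (P k) z) = pl k l"
  using mass_lab_fibres[OF assms, where l = l and E = "\<lambda>_. True"] by simp

lemma kbar_mass:
  assumes "k \<in> {1..K}" "u \<in> F k"
  shows "pl k l * kbar k l u = mass p (\<lambda>x. lab (P k) J x = l \<and> x k = u)"
proof (cases "pl k l > 0")
  case False
  then have "pl k l = 0" using p_mass_nonneg by (meson linorder_neqE_linordered_idom not_less)
  moreover have "mass p (\<lambda>x. lab (P k) J x = l \<and> x k = u) \<le> pl k l"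
    using p_nonneg by (intro mass_mono) auto
  ultimately show ?thesis using p_mass_nonneg[of "\<lambda>x. lab (P k) J x = l \<and> x k = u"] by auto
qed (simp add: kbar_def)

text \<open>On a label with mass the weights are the conditional probabilities of the parent points;
  on a label without mass they are a point mass at the representative chosen in \<open>kbar\<close>.
  All properties of \<open>kbar\<close> then follow from those of \<open>\<kappa>\<close> by
  convexity.\<close>

lemma kbar_average:
  assumes k: "k \<in> {1..K}" and l: "l \<in> Lab k"
  shows "\<exists>a. (\<forall>z\<in>{z. z \<in> Om (P k) \<and> lab (P k) J z = l}. 0 \<le> a z) \<and>
    (\<Sum>z | z \<in> Om (P k) \<and> lab (P k) J z = l. a z) = (1::real) \<and>
    (\<forall>u\<in>F k. kbar k l u = (\<Sum>z | z \<in> Om (P k) \<and> lab (P k) J z = l. a z * \<kappa> k z u))"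
proof (cases "pl k l > 0")
  case True
  show ?thesis
  proof (intro exI[of _ "\<lambda>z. pz (P k) z / pl k l"] conjI ballI)
    show "(\<Sum>z | z \<in> Om (P k) \<and> lab (P k) J z = l. pz (P k) z / pl k l) = 1"
      using True pl_fibres[OF k] by (simp flip: sum_divide_distrib)
    fix u assume u: "u \<in> F k"
    have "mass p (\<lambda>x. lab (P k) J x = l \<and> x k = u) =
      (\<Sum>z | z \<in> Om (P k) \<and> lab (P k) J z = l. pz (P k) z * \<kappa> k z u)"
      using \<kappa>_mass[OF k _ u] by (subst mass_lab_fibres[OF k, symmetric]) (auto intro!: sum.cong)
    then show "kbar k l u = (\<Sum>z | z \<in> Om (P k) \<and> lab (P k) J z = l. pz (P k) z / pl k l * \<kappa> k z u)"
      using True unfolding kbar_def by (simp add: sum_divide_distrib)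
  qed (use True p_mass_nonneg in auto)
next
  case False
  obtain z0 where z0: "z0 \<in> Om (P k)" "lab (P k) J z0 = l"
    "z0 = (SOME z. z \<in> Om (P k) \<and> lab (P k) J z = l)" using kbar_rep[OF l] .
  have fin: "finite {z \<in> Om (P k). lab (P k) J z = l}" using finite_P[OF k] by simp
  have *: "(\<Sum>z | z \<in> Om (P k) \<and> lab (P k) J z = l. of_bool (z = z0) * g z) = (g z0 :: real)" for g
  proof -
    have "(\<Sum>z | z \<in> Om (P k) \<and> lab (P k) J z = l. of_bool (z = z0) * g z) = (\<Sum>z\<in>{z0}. g z)"
      using z0 fin by (intro sum.mono_neutral_cong_right) auto
    then show ?thesis by simp
  qed
  show ?thesis
  proof (intro exI[of _ "\<lambda>z. of_bool (z = z0)"] conjI ballI)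
    show "(\<Sum>z | z \<in> Om (P k) \<and> lab (P k) J z = l. of_bool (z = z0)) = (1::real)"
      using *[of "\<lambda>_. 1"] by simp
    show "kbar k l u = (\<Sum>z | z \<in> Om (P k) \<and> lab (P k) J z = l. of_bool (z = z0) * \<kappa> k z u)" for u
      unfolding * using False z0(3) by (simp add: kbar_def)
  qed simp
qed

lemma kbar_nonneg:
  assumes k: "k \<in> {1..K}" and l: "l \<in> Lab k" and u: "u \<in> F k"
  shows "0 \<le> kbar k l u"
proof -
  obtain a where a: "\<forall>z\<in>{z. z \<in> Om (P k) \<and> lab (P k) J z = l}. 0 \<le> a z"
    "(\<Sum>z | z \<in> Om (P k) \<and> lab (P k) J z = l. a z) = (1::real)"
    "\<forall>u\<in>F k. kbar k l u = (\<Sum>z | z \<in> Om (P k) \<and> lab (P k) J z = l. a z * \<kappa> k z u)"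
    using kbar_average[OF k l] by blast
  show ?thesis
    unfolding a(3)[rule_format, OF u] using a(1) \<kappa>_nonneg[OF k _ u] by (intro sum_nonneg mult_nonneg_nonneg) auto
qed

lemma kbar_total:
  assumes "k \<in> {1..K}" "l \<in> Lab k"
  shows "(\<Sum>u\<in>F k. kbar k l u) = 1"
proof -
  obtain a where a: "\<forall>z\<in>{z. z \<in> Om (P k) \<and> lab (P k) J z = l}. 0 \<le> a z"
    "(\<Sum>z | z \<in> Om (P k) \<and> lab (P k) J z = l. a z) = (1::real)"
    "\<forall>u\<in>F k. kbar k l u = (\<Sum>z | z \<in> Om (P k) \<and> lab (P k) J z = l. a z * \<kappa> k z u)"
    using kbar_average[OF assms] by blast
  have "(\<Sum>u\<in>F k. kbar k l u) = (\<Sum>z | z \<in> Om (P k) \<and> lab (P k) J z = l. a z * (\<Sum>u\<in>F k. \<kappa> k z u))"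
    using a(3) by (simp add: sum_distrib_left sum.swap[of _ _ "F k"])
  then show ?thesis using a(2) \<kappa>_total[OF assms(1)] by simp
qed

text \<open>The distance to \<open>\<nu>\<close> is convex, and \<open>kbar\<close> is an average of
  the kernels at the points of its label.\<close>

lemma kbar_convex:
  assumes k: "k \<in> {1..K}" and l: "l \<in> Lab k"
    and b: "\<And>z. z \<in> Om (P k) \<Longrightarrow> lab (P k) J z = l \<Longrightarrow> (\<Sum>u\<in>F k. \<bar>\<nu> u - \<kappa> k z u\<bar>) \<le> b"
  shows "(\<Sum>u\<in>F k. \<bar>\<nu> u - kbar k l u\<bar>) \<le> b"
proof -
  let ?Z = "{z. z \<in> Om (P k) \<and> lab (P k) J z = l}"
  obtain a where a: "\<forall>z\<in>{z. z \<in> Om (P k) \<and> lab (P k) J z = l}. 0 \<le> a z"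
    "(\<Sum>z | z \<in> Om (P k) \<and> lab (P k) J z = l. a z) = (1::real)"
    "\<forall>u\<in>F k. kbar k l u = (\<Sum>z | z \<in> Om (P k) \<and> lab (P k) J z = l. a z * \<kappa> k z u)"
    using kbar_average[OF k l] by blast
  have "(\<Sum>u\<in>F k. \<bar>\<nu> u - kbar k l u\<bar>) = (\<Sum>u\<in>F k. \<bar>\<Sum>z\<in>?Z. a z * (\<nu> u - \<kappa> k z u)\<bar>)"
    using a(2,3) by (intro sum.cong refl) (simp add: right_diff_distrib sum_subtractf flip: sum_distrib_right)
  also have "\<dots> \<le> (\<Sum>u\<in>F k. \<Sum>z\<in>?Z. a z * \<bar>\<nu> u - \<kappa> k z u\<bar>)"
    using a(1) by (intro sum_mono order.trans[OF sum_abs]) (auto simp: abs_mult)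
  also have "\<dots> = (\<Sum>z\<in>?Z. a z * (\<Sum>u\<in>F k. \<bar>\<nu> u - \<kappa> k z u\<bar>))"
    by (simp add: sum_distrib_left sum.swap[of _ _ "F k"])
  also have "\<dots> \<le> (\<Sum>z\<in>?Z. a z * b)"
    using a(1) b by (intro sum_mono mult_left_mono) auto
  also have "\<dots> = b" using a(2) by (simp flip: sum_distrib_right)
  finally show ?thesis .
qed

lemma kbar_\<kappa>_TV:
  assumes k: "k \<in> {1..K}" and l: "l \<in> Lab k" and z: "z \<in> Om (P k)" and i: "i \<le> J"
    and eq: "\<And>y. y \<in> Om (P k) \<Longrightarrow> lab (P k) J y = l \<Longrightarrow> lab (P k) i z = lab (P k) i y"
  shows "(\<Sum>u\<in>F k. \<bar>\<kappa> k z u - kbar k l u\<bar>) \<le> \<Lambda> / 2 ^ i"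
  using eq by (intro kbar_convex[OF k l] \<kappa>_TV[OF k z]) auto

text \<open>At levels \<open>j \<ge> J\<close> the two labels coincide. Below \<open>J\<close>, each
  point of one label agrees up to level \<open>j\<close> with each point of the other, so
  \<open>\<kappa>_TV\<close> passes to the averages by using convexity in one argument after the
  other.\<close>

lemma kbar_TV:
  assumes k: "k \<in> {1..K}" and x: "x \<in> Om (P k)" and y: "y \<in> Om (P k)" and eq: "lab (P k) j x = lab (P k) j y"
  shows "(\<Sum>u\<in>F k. \<bar>kbar k (lab (P k) J x) u - kbar k (lab (P k) J y) u\<bar>) \<le> \<Lambda> / 2 ^ j"
proof (cases "J \<le> j")
  case True
  then have "lab (P k) J x = lab (P k) J y" using eq lab_coarse by blast
  then show ?thesis using \<Lambda>_nonneg by simp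
next
  case False
  have L: "lab (P k) J x \<in> Lab k" "lab (P k) J y \<in> Lab k" using x y lab_in_Lab by auto
  show ?thesis
  proof (rule kbar_convex[OF k L(2)])
    fix z assume z: "z \<in> Om (P k)" "lab (P k) J z = lab (P k) J y"
    have "(\<Sum>u\<in>F k. \<bar>\<kappa> k z u - kbar k (lab (P k) J x) u\<bar>) \<le> \<Lambda> / 2 ^ j"
    proof (rule kbar_\<kappa>_TV[OF k L(1) z(1)])
      fix y' assume y': "lab (P k) J y' = lab (P k) J x"
      have "lab (P k) j z = lab (P k) j y" by (rule lab_coarse[OF z(2)]) (use False in simp)
      moreover have "lab (P k) j y' = lab (P k) j x" by (rule lab_coarse[OF y']) (use False in simp)
      ultimately show "lab (P k) j z = lab (P k) j y'" using eq by simp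
    qed (use False in simp)
    then show "(\<Sum>u\<in>F k. \<bar>kbar k (lab (P k) J x) u - \<kappa> k z u\<bar>) \<le> \<Lambda> / 2 ^ j"
      by (simp add: abs_minus_commute)
  qed
qed

lemma kbar_same_cell:
  assumes k: "k \<in> {1..K}" and z: "z \<in> Om (P k)"
  shows "(\<Sum>u\<in>F k. \<bar>\<kappa> k z u - kbar k (lab (P k) J z) u\<bar>) \<le> \<Lambda> * r"
  using kbar_\<kappa>_TV[OF k lab_in_Lab[OF z order.refl] z, of J] by simp

lemma sum_T: "(\<Sum>B\<in>cells k J. T k l B * \<phi> B) = (\<Sum>u\<in>F k. kbar k l u * \<phi> (c k J u))"
  unfolding T_def by (rule sum_mult_fibres[symmetric]) (auto simp: cells_def)

text \<open>The coarse chain of the true law is the intermediate between \<open>p\<close> and the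
  fitted chain: \<open>bias\<close> compares it with \<open>p\<close>, and \<open>variance\<close>
  with the chain of the empirical law.\<close>

sublocale coarse: coarse_chain F c K P J p T w
proof
  fix k l B assume k: "k \<in> {1..K}" and l: "l \<in> Lab k" and "B \<in> cells k J"
  show "0 \<le> T k l B"
    unfolding T_def using kbar_nonneg[OF k l] by (intro sum_nonneg) auto
  have "pl k l * T k l B = (\<Sum>u | u \<in> F k \<and> c k J u = B. mass p (\<lambda>x. lab (P k) J x = l \<and> x k = u))"
    unfolding T_def sum_distrib_left using kbar_mass[OF k] by (intro sum.cong) auto
  then show "pl k l * T k l B = mass p (\<lambda>x. lab (P k) J x = l \<and> c k J (x k) = B)"
    by (simp add: mass_point_cell[OF k])
next
  fix k l assume "k \<in> {1..K}" "l \<in> Lab k"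
  then show "(\<Sum>B\<in>cells k J. T k l B) = 1"
    using sum_T[of k l "\<lambda>_. 1"] kbar_total by simp
qed (use p_nonneg p_total w_nonneg cell_law_total in auto)

text \<open>Both kernels share the law \<open>w\<close> inside the cells, so their distance is that
  of the cell masses, and collapsing to cells does not increase the distance of the
  \<open>kbar\<close>.\<close>

lemma ker_TV:
  assumes k: "k \<in> {1..K}" and x: "x \<in> Om (P k)" and y: "y \<in> Om (P k)" and eq: "lab (P k) j x = lab (P k) j y"
  shows "(\<Sum>u\<in>F k. \<bar>coarse.ker k (lab (P k) J x) u - coarse.ker k (lab (P k) J y) u\<bar>) \<le> \<Lambda> / 2 ^ j"
proof -
  let ?x = "lab (P k) J x" and ?y = "lab (P k) J y"
  have "(\<Sum>u\<in>F k. \<bar>coarse.ker k ?x u - coarse.ker k ?y u\<bar>) =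
     (\<Sum>u\<in>F k. w k u * \<bar>T k ?x (c k J u) - T k ?y (c k J u)\<bar>)"
    using w_nonneg unfolding coarse.ker_def
    by (intro sum.cong refl) (simp add: left_diff_distrib[symmetric] abs_mult)
  also have "\<dots> = (\<Sum>B\<in>cells k J. (\<Sum>u | u \<in> F k \<and> c k J u = B. w k u) * \<bar>T k ?x B - T k ?y B\<bar>)"
    by (rule sum_mult_fibres[where h = "c k J" and \<phi> = "\<lambda>B. \<bar>T k ?x B - T k ?y B\<bar>"]) (auto simp: cells_def)
  also have "\<dots> = (\<Sum>B\<in>cells k J. \<bar>\<Sum>u | u \<in> F k \<and> c k J u = B. kbar k ?x u - kbar k ?y u\<bar>)"
    using cell_law_total[OF k] by (intro sum.cong refl) (auto simp: T_def sum_subtractf)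
  also have "\<dots> \<le> (\<Sum>B\<in>cells k J. \<Sum>u | u \<in> F k \<and> c k J u = B. \<bar>kbar k ?x u - kbar k ?y u\<bar>)"
    by (intro sum_mono sum_abs)
  also have "\<dots> = (\<Sum>u\<in>F k. \<bar>kbar k ?x u - kbar k ?y u\<bar>)"
    by (rule sum_fibres) (auto simp: cells_def)
  also have "\<dots> \<le> \<Lambda> / 2 ^ j" by (rule kbar_TV[OF k x y eq])
  finally show ?thesis .
qed

text \<open>Grouping parent points by label contracts the sum of absolute values. As in
  \<open>reverse_TV\<close>, conditional laws given \<open>u\<close> and \<open>v\<close> are
  compared in cross-multiplied form, which stays meaningful when a letter has mass zero.\<close>

lemma reverse_labels:
  assumes k: "k \<in> {1..K}" and u: "u \<in> F k" and v: "v \<in> F k" and eq: "c k J u = c k J v"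
  shows "(\<Sum>l\<in>Lab k. \<bar>mass p (\<lambda>x. lab (P k) J x = l \<and> x k = u) * mass p (\<lambda>x. x k = v)
        - mass p (\<lambda>x. lab (P k) J x = l \<and> x k = v) * mass p (\<lambda>x. x k = u)\<bar>)
      \<le> \<Lambda> * r * (mass p (\<lambda>x. x k = u) * mass p (\<lambda>x. x k = v))"
proof -
  define a where "a z = mass p (\<lambda>x. restrict x (P k) = z \<and> x k = u) * mass p (\<lambda>x. x k = v)
        - mass p (\<lambda>x. restrict x (P k) = z \<and> x k = v) * mass p (\<lambda>x. x k = u)" for z
  have "(\<Sum>l\<in>Lab k. \<bar>mass p (\<lambda>x. lab (P k) J x = l \<and> x k = u) * mass p (\<lambda>x. x k = v)
        - mass p (\<lambda>x. lab (P k) J x = l \<and> x k = v) * mass p (\<lambda>x. x k = u)\<bar>) =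
     (\<Sum>l\<in>Lab k. \<bar>\<Sum>z | z \<in> Om (P k) \<and> lab (P k) J z = l. a z\<bar>)"
    unfolding a_def sum_subtractf sum_distrib_right[symmetric] mass_lab_fibres[OF k] ..
  also have "\<dots> \<le> (\<Sum>l\<in>Lab k. \<Sum>z | z \<in> Om (P k) \<and> lab (P k) J z = l. \<bar>a z\<bar>)"
    by (intro sum_mono sum_abs)
  also have "\<dots> = (\<Sum>z\<in>Om (P k). \<bar>a z\<bar>)"
    using finite_P[OF k] k by (intro sum_fibres) (auto simp: Lab_def)
  also have "\<dots> \<le> \<Lambda> / 2 ^ J * (mass p (\<lambda>x. x k = u) * mass p (\<lambda>x. x k = v))"
    unfolding a_def by (rule reverse_TV[OF k u v eq])
  finally show ?thesis by simp
qed

text \<open>Given its coarse cell, the position of \<open>x k\<close> is almost independent of the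
  parent label. Since \<open>w k u\<close> is a quotient of masses, the error at \<open>u\<close> is
  an average over the letters \<open>v\<close> of the same cell of the cross differences in
  \<open>reverse_labels\<close>; it is at most \<open>\<Lambda> * r\<close> times the mass of
  \<open>u\<close>, and these masses sum to one.\<close>

lemma collapse_error:
  assumes k: "k \<in> {1..K}"
  shows "(\<Sum>l\<in>Lab k. \<Sum>u\<in>F k. \<bar>mass p (\<lambda>x. lab (P k) J x = l \<and> x k = u)
      - mass p (\<lambda>x. lab (P k) J x = l \<and> c k J (x k) = c k J u) * w k u\<bar>) \<le> \<Lambda> * r"
proof -
  define m where "m l u = mass p (\<lambda>x. lab (P k) J x = l \<and> x k = u)" for l u
  define p1 where "p1 u = mass p (\<lambda>x. x k = u)" for u
  have p1: "0 \<le> p1 u" for u unfolding p1_def by (rule p_mass_nonneg)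
  have *: "(\<Sum>l\<in>Lab k. \<bar>m l u - mass p (\<lambda>x. lab (P k) J x = l \<and> c k J (x k) = c k J u) * w k u\<bar>) \<le> \<Lambda> * r * p1 u"
    if u: "u \<in> F k" for u
  proof (cases "mass p (\<lambda>x. c k J (x k) = c k J u) > 0")
    case True
    let ?C = "{v. v \<in> F k \<and> c k J v = c k J u}" and ?pc = "mass p (\<lambda>x. c k J (x k) = c k J u)"
    have pc: "?pc = (\<Sum>v\<in>?C. p1 v)"
      unfolding p1_def using mass_point_cell[OF k, of p "\<lambda>_. True" "c k J u"] by simp
    have "(\<Sum>l\<in>Lab k. \<bar>m l u - mass p (\<lambda>x. lab (P k) J x = l \<and> c k J (x k) = c k J u) * w k u\<bar>)
       = (\<Sum>l\<in>Lab k. \<bar>\<Sum>v\<in>?C. m l u * p1 v - m l v * p1 u\<bar> / ?pc)"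
    proof (intro sum.cong refl)
      fix l
      have "m l u - mass p (\<lambda>x. lab (P k) J x = l \<and> c k J (x k) = c k J u) * w k u
         = (m l u * ?pc - (\<Sum>v\<in>?C. m l v) * p1 u) / ?pc"
        using True unfolding cell_law_def p1_def m_def mass_point_cell[OF k] by (simp add: field_simps)
      also have "\<dots> = (\<Sum>v\<in>?C. m l u * p1 v - m l v * p1 u) / ?pc"
        unfolding pc by (simp add: sum_subtractf sum_distrib_left sum_distrib_right)
      finally show "\<bar>m l u - mass p (\<lambda>x. lab (P k) J x = l \<and> c k J (x k) = c k J u) * w k u\<bar>
         = \<bar>\<Sum>v\<in>?C. m l u * p1 v - m l v * p1 u\<bar> / ?pc"
        using True by (simp add: abs_divide)
    qed
    also have "\<dots> \<le> (\<Sum>l\<in>Lab k. (\<Sum>v\<in>?C. \<bar>m l u * p1 v - m l v * p1 u\<bar>) / ?pc)"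
      using True by (intro sum_mono divide_right_mono sum_abs) auto
    also have "\<dots> = (\<Sum>v\<in>?C. \<Sum>l\<in>Lab k. \<bar>m l u * p1 v - m l v * p1 u\<bar>) / ?pc"
      by (simp add: sum_divide_distrib sum.swap[of _ "Lab k"])
    also have "\<dots> \<le> (\<Sum>v\<in>?C. \<Lambda> * r * (p1 u * p1 v)) / ?pc"
      using True u unfolding m_def p1_def
      by (intro divide_right_mono sum_mono reverse_labels[OF k]) auto
    also have "\<dots> = \<Lambda> * r * p1 u * (\<Sum>v\<in>?C. p1 v) / ?pc"
      by (simp add: sum_distrib_left ac_simps)
    also have "\<dots> = \<Lambda> * r * p1 u" using True unfolding pc by simp
    finally show ?thesis .
  next
    case False
    then have 0: "mass p (\<lambda>x. c k J (x k) = c k J u) = 0"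
      using p_mass_nonneg by (meson linorder_neqE_linordered_idom not_less)
    have "m l u = 0" "mass p (\<lambda>x. lab (P k) J x = l \<and> c k J (x k) = c k J u) = 0" for l
    proof -
      have "m l u \<le> mass p (\<lambda>x. c k J (x k) = c k J u)"
        unfolding m_def using p_nonneg by (intro mass_mono) auto
      then show "m l u = 0"
        using 0 p_mass_nonneg[of "\<lambda>x. lab (P k) J x = l \<and> x k = u"] unfolding m_def by linarith
      have "mass p (\<lambda>x. lab (P k) J x = l \<and> c k J (x k) = c k J u) \<le> mass p (\<lambda>x. c k J (x k) = c k J u)"
        using p_nonneg by (intro mass_mono) auto
      then show "mass p (\<lambda>x. lab (P k) J x = l \<and> c k J (x k) = c k J u) = 0"
        using 0 p_mass_nonneg[of "\<lambda>x. lab (P k) J x = l \<and> c k J (x k) = c k J u"] by linarith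
    qed
    then show ?thesis using p1[of u] \<Lambda>_nonneg by simp
  qed
  have "(\<Sum>u\<in>F k. p1 u) = 1"
    unfolding p1_def using mass_fibres[of "F k" "\<lambda>_. True" "\<lambda>x. x k" p] Om_app k p_mass_total by auto
  then have "(\<Sum>u\<in>F k. \<Lambda> * r * p1 u) = \<Lambda> * r"
    by (simp only: sum_distrib_left[symmetric] mult_1_right)
  moreover have "(\<Sum>u\<in>F k. \<Sum>l\<in>Lab k. \<bar>m l u - mass p (\<lambda>x. lab (P k) J x = l \<and> c k J (x k) = c k J u) * w k u\<bar>)
     \<le> (\<Sum>u\<in>F k. \<Lambda> * r * p1 u)" by (intro sum_mono *)
  ultimately show ?thesis unfolding m_def by (subst sum.swap) simp
qed

text \<open>Summing out the new coordinate turns both the true law and the cellwise product law on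
  \<open>insert i I\<close> into those on \<open>I\<close>, and summation contracts the
  distance.\<close>

lemma D_insert:
  assumes "finite I" "i \<notin> I" "i \<in> {1..K}" "I \<subseteq> {1..K}"
  shows "D I \<le> D (insert i I)"
proof -
  define \<nu> where "\<nu> z = (\<Prod>i\<in>I. w i (z i))" for z
  let ?I = "insert i I"
  let ?a = "\<lambda>z. mass p (\<lambda>x. lab ?I J x = lab ?I J z) * (\<Prod>i\<in>?I. w i (z i)) - pz ?I z"
  have "D I = (\<Sum>z\<in>Om I. \<bar>\<Sum>u\<in>F i. ?a (z(i := u))\<bar>)"
    unfolding D_def
  proof (intro sum.cong refl arg_cong[where f=abs])
    fix z assume z: "z \<in> Om I"
    have lab_eq: "lab ?I J x = lab ?I J (z(i := u)) \<longleftrightarrow> lab I J x = lab I J z \<and> c i J (x i) = c i J u" for x u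
      using assms(2) by (auto simp: lab_eq_iff)
    have res_eq: "restrict x ?I = z(i := u) \<longleftrightarrow> restrict x I = z \<and> x i = u" for x u
    proof
      assume *: "restrict x ?I = z(i := u)"
      have "restrict x I = z"
      proof
        fix j show "restrict x I j = z j"
          using fun_cong[OF *, of j] z assms(2) unfolding Om_def
          by (cases "j \<in> I") (auto simp: PiE_def extensional_def restrict_def split: if_splits)
      qed
      then show "restrict x I = z \<and> x i = u" using fun_cong[OF *, of i] by simp
    qed (auto simp: restrict_def fun_eq_iff)
    have prod_eq: "(\<Prod>j\<in>?I. w j ((z(i := u)) j)) = \<nu> z * w i u" for u
    proof -
      have "(\<Prod>j\<in>I. w j ((z(i := u)) j)) = \<nu> z" unfolding \<nu>_def using assms(2) by (intro prod.cong) auto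
      then show ?thesis using assms(1,2) by simp
    qed
    have "(\<Sum>u\<in>F i. mass p (\<lambda>x. lab I J x = lab I J z \<and> c i J (x i) = c i J u) * w i u)
      = (\<Sum>B\<in>cells i J. (\<Sum>u | u \<in> F i \<and> c i J u = B. w i u) * mass p (\<lambda>x. lab I J x = lab I J z \<and> c i J (x i) = B))"
      by (subst sum_mult_fibres[where h = "c i J", symmetric]) (auto simp: cells_def mult.commute)
    also have "\<dots> = (\<Sum>B\<in>cells i J. mass p (\<lambda>x. lab I J x = lab I J z \<and> c i J (x i) = B))"
      using cell_law_total[OF assms(3)] by (intro sum.cong) auto
    also have "\<dots> = mass p (\<lambda>x. lab I J x = lab I J z)"
      using assms(3) Om_app c_in_cells by (intro mass_fibres) auto
    finally have 1: "(\<Sum>u\<in>F i. mass p (\<lambda>x. lab I J x = lab I J z \<and> c i J (x i) = c i J u) * w i u)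
      = mass p (\<lambda>x. lab I J x = lab I J z)" .
    have 2: "(\<Sum>u\<in>F i. mass p (\<lambda>x. restrict x I = z \<and> x i = u)) = pz I z"
      using assms(3) Om_app by (intro mass_fibres) auto
    have 3: "(\<Sum>u\<in>F i. mass p (\<lambda>x. lab I J x = lab I J z \<and> c i J (x i) = c i J u) * (\<nu> z * w i u))
      = mass p (\<lambda>x. lab I J x = lab I J z) * \<nu> z"
      unfolding 1[symmetric] sum_distrib_right by (simp add: ac_simps)
    show "mass p (\<lambda>x. lab I J x = lab I J z) * (\<Prod>i\<in>I. w i (z i)) - pz I z = (\<Sum>u\<in>F i. ?a (z(i := u)))"
      unfolding lab_eq res_eq prod_eq sum_subtractf 2 3 \<nu>_def[symmetric] ..
  qed
  also have "\<dots> \<le> (\<Sum>z\<in>Om I. \<Sum>u\<in>F i. \<bar>?a (z(i := u))\<bar>)"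
    by (intro sum_mono sum_abs)
  also have "\<dots> = D ?I"
    unfolding D_def by (rule sum_Om_insert[OF assms(2), symmetric])
  finally show ?thesis .
qed

lemma D_mono:
  assumes "finite I'" "I \<subseteq> I'" "I' \<subseteq> {1..K}"
  shows "D I \<le> D I'"
proof -
  have "D I \<le> D (I \<union> S)" if "finite S" "S \<subseteq> {1..K}" for S
    using that
  proof (induction S)
    case (insert i S)
    then have "D I \<le> D (I \<union> S)" by simp
    also have "\<dots> \<le> D (I \<union> insert i S)"
    proof (cases "i \<in> I \<union> S")
      case False
      have "D (I \<union> S) \<le> D (insert i (I \<union> S))"
        using insert False assms finite_subset by (intro D_insert) (auto simp: finite_subset)
      then show ?thesis by simp
    qed (auto simp: insert_absorb)
    finally show ?case .
  qed simp
  from this[of I'] assms show ?thesis by (simp add: Un_absorb1)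
qed

text \<open>Adding \<open>k\<close> to its parents costs \<open>collapse_error\<close> for the
  position of \<open>x k\<close> in its cell and \<open>kbar_same_cell\<close> for the dependence on
  the parents inside theirs, each at most \<open>\<Lambda> * r\<close>; the remaining part is
  \<open>D (P k)\<close>, since \<open>kbar\<close> has mass one.\<close>

lemma D_step:
  assumes k: "k \<in> {1..K}"
  shows "D (insert k (P k)) \<le> D (P k) + 2 * (\<Lambda> * r)"
proof -
  let ?I = "P k"
  define \<nu> where "\<nu> z = (\<Prod>i\<in>?I. w i (z i))" for z
  define L where "L z = lab ?I J z" for z
  define mlc where "mlc l u = mass p (\<lambda>x. lab ?I J x = l \<and> c k J (x k) = c k J u)" for l u
  define ml where "ml l u = mass p (\<lambda>x. lab ?I J x = l \<and> x k = u)" for l u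
  note kI = P_notin[OF k]
  have \<nu>: "0 \<le> \<nu> z" for z unfolding \<nu>_def by (intro prod_nonneg) (auto intro: w_nonneg)
  have LL: "z \<in> Om ?I \<Longrightarrow> L z \<in> Lab k" for z unfolding L_def by (rule lab_in_Lab) auto
  have "D (insert k ?I) = (\<Sum>z\<in>Om ?I. \<Sum>u\<in>F k. \<bar>mlc (L z) u * (\<nu> z * w k u) - pz ?I z * \<kappa> k z u\<bar>)"
    unfolding D_def sum_Om_insert[OF kI]
  proof (intro sum.cong refl arg_cong[where f=abs] arg_cong2[where f="(-)"] arg_cong2[where f="(*)"])
    fix z u assume z: "z \<in> Om ?I" and u: "u \<in> F k"
    show "mass p (\<lambda>x. lab (insert k ?I) J x = lab (insert k ?I) J (z(k := u))) = mlc (L z) u"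
      unfolding mlc_def L_def using kI by (intro mass_cong) (auto simp: lab_eq_iff)
    have "(\<Prod>i\<in>?I. w i ((z(k := u)) i)) = \<nu> z"
      unfolding \<nu>_def using kI by (intro prod.cong) auto
    then show "(\<Prod>i\<in>insert k ?I. w i ((z(k := u)) i)) = \<nu> z * w k u"
      using kI finite_P[OF k] by simp
    show "pz (insert k ?I) (z(k := u)) = pz ?I z * \<kappa> k z u"
      unfolding restrict_insert_eq[OF z kI] by (rule \<kappa>_mass[OF k z u])
  qed
  also have "\<dots> \<le> (\<Sum>z\<in>Om ?I. \<Sum>u\<in>F k. \<nu> z * \<bar>ml (L z) u - mlc (L z) u * w k u\<bar>
      + \<bar>pl k (L z) * \<nu> z - pz ?I z\<bar> * kbar k (L z) u + pz ?I z * \<bar>\<kappa> k z u - kbar k (L z) u\<bar>)"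
  proof (intro sum_mono)
    fix z u assume z: "z \<in> Om ?I" and u: "u \<in> F k"
    have ml: "ml (L z) u = pl k (L z) * kbar k (L z) u"
      unfolding ml_def using kbar_mass[OF k u] by simp
    \<comment> \<open>Three exchanges: the collapsed joint mass for \<open>ml\<close>, the product
      weight for the true mass of \<open>z\<close>, and \<open>kbar\<close> for
      \<open>\<kappa>\<close>.\<close>
    have eq: "mlc (L z) u * (\<nu> z * w k u) - pz ?I z * \<kappa> k z u =
        - (\<nu> z * (ml (L z) u - mlc (L z) u * w k u)) + (pl k (L z) * \<nu> z - pz ?I z) * kbar k (L z) u
        - pz ?I z * (\<kappa> k z u - kbar k (L z) u)"
      unfolding ml by (simp add: algebra_simps)
    have "\<bar>mlc (L z) u * (\<nu> z * w k u) - pz ?I z * \<kappa> k z u\<bar> \<le> \<bar>\<nu> z * (ml (L z) u - mlc (L z) u * w k u)\<bar> + \<bar>(pl k (L z) * \<nu> z - pz ?I z) * kbar k (L z) u\<bar>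
        + \<bar>pz ?I z * (\<kappa> k z u - kbar k (L z) u)\<bar>" unfolding eq by (rule abs_triangle3)
    also have "\<dots> = \<nu> z * \<bar>ml (L z) u - mlc (L z) u * w k u\<bar>
      + \<bar>pl k (L z) * \<nu> z - pz ?I z\<bar> * kbar k (L z) u + pz ?I z * \<bar>\<kappa> k z u - kbar k (L z) u\<bar>"
      unfolding abs_mult abs_of_nonneg[OF \<nu>] abs_of_nonneg[OF kbar_nonneg[OF k LL[OF z] u]]
        abs_of_nonneg[OF p_mass_nonneg] ..
    finally show "\<bar>mlc (L z) u * (\<nu> z * w k u) - pz ?I z * \<kappa> k z u\<bar> \<le> \<dots>" .
  qed
  also have "\<dots> = (\<Sum>z\<in>Om ?I. \<nu> z * (\<Sum>u\<in>F k. \<bar>ml (L z) u - mlc (L z) u * w k u\<bar>))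
      + (\<Sum>z\<in>Om ?I. \<bar>pl k (L z) * \<nu> z - pz ?I z\<bar> * (\<Sum>u\<in>F k. kbar k (L z) u))
      + (\<Sum>z\<in>Om ?I. pz ?I z * (\<Sum>u\<in>F k. \<bar>\<kappa> k z u - kbar k (L z) u\<bar>))"
    by (simp add: sum.distrib sum_distrib_left)
  also have "\<dots> \<le> \<Lambda> * r + D ?I + \<Lambda> * r"
  proof (intro add_mono)
    have "(\<Sum>z\<in>Om ?I. \<nu> z * (\<Sum>u\<in>F k. \<bar>ml (L z) u - mlc (L z) u * w k u\<bar>)) =
      (\<Sum>l\<in>Lab k. (\<Sum>z | z \<in> Om ?I \<and> L z = l. \<nu> z) * (\<Sum>u\<in>F k. \<bar>ml l u - mlc l u * w k u\<bar>))"
      by (rule sum_mult_fibres[where h = L and \<phi> = "\<lambda>l. \<Sum>u\<in>F k. \<bar>ml l u - mlc l u * w k u\<bar>"]) (use LL k finite_P in auto)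
    also have "\<dots> = (\<Sum>l\<in>Lab k. \<Sum>u\<in>F k. \<bar>ml l u - mlc l u * w k u\<bar>)"
    proof (intro sum.cong refl)
      fix l assume "l \<in> Lab k"
      then obtain x where x: "x \<in> Om ?I" "l = lab ?I J x" unfolding Lab_def by auto
      have "(\<Sum>z | z \<in> Om ?I \<and> L z = l. \<nu> z) = 1"
        unfolding \<nu>_def L_def x(2) by (rule coarse.within_cell_total[OF finite_P[OF k] P_sub_nodes[OF k] x(1) order.refl])
      then show "(\<Sum>z | z \<in> Om ?I \<and> L z = l. \<nu> z) * (\<Sum>u\<in>F k. \<bar>ml l u - mlc l u * w k u\<bar>)
        = (\<Sum>u\<in>F k. \<bar>ml l u - mlc l u * w k u\<bar>)" by simp
    qed
    also have "\<dots> \<le> \<Lambda> * r" unfolding ml_def mlc_def by (rule collapse_error[OF k])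
    finally show "(\<Sum>z\<in>Om ?I. \<nu> z * (\<Sum>u\<in>F k. \<bar>ml (L z) u - mlc (L z) u * w k u\<bar>)) \<le> \<Lambda> * r" .
    show "(\<Sum>z\<in>Om ?I. \<bar>pl k (L z) * \<nu> z - pz ?I z\<bar> * (\<Sum>u\<in>F k. kbar k (L z) u)) \<le> D ?I"
      unfolding D_def using kbar_total[OF k LL] by (simp add: L_def \<nu>_def)
    have "(\<Sum>z\<in>Om ?I. pz ?I z * (\<Sum>u\<in>F k. \<bar>\<kappa> k z u - kbar k (L z) u\<bar>)) \<le> (\<Sum>z\<in>Om ?I. pz ?I z * (\<Lambda> * r))"
      unfolding L_def by (intro sum_mono mult_left_mono kbar_same_cell k p_mass_nonneg)
    also have "\<dots> = (\<Sum>z\<in>Om ?I. pz ?I z) * (\<Lambda> * r)" by (simp only: sum_distrib_right)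
    also have "(\<Sum>z\<in>Om ?I. pz ?I z) = 1"
      using mass_fibres[of "Om ?I" "\<lambda>_. True" "\<lambda>x. restrict x ?I" p] finite_P[OF k] restrict_P[OF k] p_mass_total by simp
    finally show "(\<Sum>z\<in>Om ?I. pz ?I z * (\<Sum>u\<in>F k. \<bar>\<kappa> k z u - kbar k (L z) u\<bar>)) \<le> \<Lambda> * r"
      by (simp only: mult_1_left)
  qed
  finally show ?thesis by simp
qed

text \<open>By \<open>P_Max\<close> the parents of \<open>k\<close> lie in the largest parent
  together with its own parents, so \<open>D_mono\<close> and \<open>D_step\<close> reduce to a
  smaller node at the price \<open>2 * (\<Lambda> * r)\<close>.\<close>

lemma D_bound: "k \<in> {1..K} \<Longrightarrow> D (P k) \<le> 2 * real k * (\<Lambda> * r)"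
proof (induction k rule: less_induct)
  case (less k)
  show ?case
  proof (cases "P k = {}")
    case True
    have "D {} = 0" unfolding D_def using p_mass_total by (simp add: restrict_def)
    then show ?thesis using True \<Lambda>_nonneg by simp
  next
    case False
    let ?m = "Max (P k)"
    note M = P_Max[OF less.prems False]
    have m: "?m \<in> {1..K}" using M(1) less.prems by auto
    have "D (P k) \<le> D (insert ?m (P ?m))"
      using M(3) m finite_P[OF m] P_sub_nodes[OF m] by (intro D_mono) auto
    also have "\<dots> \<le> D (P ?m) + 2 * (\<Lambda> * r)" by (rule D_step[OF m])
    also have "\<dots> \<le> 2 * real ?m * (\<Lambda> * r) + 2 * (\<Lambda> * r)"
      using less.IH[of ?m] m M(1) by auto
    also have "\<dots> = 2 * real (Suc ?m) * (\<Lambda> * r)" by (simp add: field_simps)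
    also have "\<dots> \<le> 2 * real k * (\<Lambda> * r)"
      using M(1) \<Lambda>_nonneg by (intro mult_right_mono mult_left_mono) auto
    finally show ?thesis .
  qed
qed

text \<open>The kernel error is split so that each part is a product of two small factors.
  \<open>S1\<close> moves the test function to a representative of the cell: kernel error times
  oscillation. \<open>S3\<close> collapses \<open>x k\<close> inside its cell: an error with no mass
  in any coarse cell, times oscillation. In \<open>S2\<close> the test function is frozen and gives
  no gain; there the kernel is averaged over the parent cell, and the second factor is
  \<open>D\<close>.\<close>

lemma bias_step:
  assumes m: "m < K" and f: "lip (Suc m) \<theta> f"
  shows "\<bar>\<Sum>x\<in>Om {1..m}. coarse.R m x * (\<Sum>u\<in>F (Suc m).
      (\<kappa> (Suc m) (restrict x (P (Suc m))) u - coarse.ker (Suc m) (lab (P (Suc m)) J x) u) * f (x(Suc m := u)))\<bar>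
    \<le> \<theta> * (2 * (\<Lambda> * r * r) + \<Lambda> * r * D (P (Suc m)))"
proof -
  define k where "k = Suc m"
  have k: "k \<in> {1..K}" and Pm: "P k \<subseteq> {1..m}" unfolding k_def using m P_sub_Suc[OF m] by auto
  define L where "L x = lab (P k) J x" for x
  \<comment> \<open>A fixed point in the cell with label \<open>l\<close>: evaluated there, the test
    function depends on the label only, as \<open>coarse.resample\<close> requires.\<close>
  define pi where "pi l = restrict (\<lambda>i. rep_cell i (l i)) {1..m}" for l :: "nat \<Rightarrow> 'c"
  define \<pi> where "\<pi> x = pi (lab {1..m} J x)" for x
  define \<nu> where "\<nu> z = (\<Prod>i\<in>P k. w i (z i))" for z
  define Z where "Z l = {z. z \<in> Om (P k) \<and> lab (P k) J z = l}" for l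
  \<comment> \<open>The true kernel averaged over a parent cell under the product law
    \<open>\<nu>\<close>; on labels with mass \<open>kbar\<close> is the same average under the true
    law, and \<open>D\<close> measures the difference of the two laws.\<close>
  define H where "H l u = (\<Sum>z\<in>Z l. \<nu> z * \<kappa> k z u)" for l u
  note f' = f[folded k_def]
  have \<theta>: "0 \<le> \<theta>" using f by (rule lip_nonneg)
  have upd: "x \<in> Om {1..m} \<Longrightarrow> u \<in> F k \<Longrightarrow> x(k := u) \<in> Om {1..k}" for x u
    unfolding k_def by (rule Om_upd_Suc)
  have lab_upd: "lab {1..m} j x = lab {1..m} j y \<Longrightarrow> c k j u = c k j v \<Longrightarrow>
    lab {1..k} j (x(k := u)) = lab {1..k} j (y(k := v))" for j x y u v
    unfolding k_def by (rule lab_upd_Suc)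
  have rest: "x \<in> Om {1..m} \<Longrightarrow> restrict x (P k) \<in> Om (P k)" for x
    using Pm by (rule restrict_Om[rotated])
  have LL: "x \<in> Om {1..m} \<Longrightarrow> L x \<in> Lab k" for x
    unfolding L_def using Pm by (rule lab_in_Lab[rotated])
  have finZ: "finite (Z l)" for l unfolding Z_def using finite_P[OF k] by simp
  have \<pi>_in: "\<pi> x \<in> Om {1..m}" and \<pi>_lab: "lab {1..m} J (\<pi> x) = lab {1..m} J x" if x: "x \<in> Om {1..m}" for x
  proof -
    have "rep_cell i (c i J (x i)) \<in> F i \<and> c i J (rep_cell i (c i J (x i))) = c i J (x i)" if "i \<in> {1..m}" for i
      using rep_cell[OF c_in_cells[OF Om_app[OF x that]]] .
    then show "\<pi> x \<in> Om {1..m}" "lab {1..m} J (\<pi> x) = lab {1..m} J x"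
      unfolding \<pi>_def pi_def by (auto simp: Om_def lab_def fun_eq_iff)
  qed
  define S1 where "S1 x = (\<Sum>u\<in>F k. (\<kappa> k (restrict x (P k)) u - kbar k (L x) u) * (f (x(k := u)) - f ((\<pi> x)(k := u))))" for x
  define S2 where "S2 x = (\<Sum>u\<in>F k. (\<kappa> k (restrict x (P k)) u - kbar k (L x) u) * f ((\<pi> x)(k := u)))" for x
  define S2' where "S2' x = (\<Sum>u\<in>F k. (H (L x) u - kbar k (L x) u) * f ((\<pi> x)(k := u)))" for x
  define S3 where "S3 x = (\<Sum>u\<in>F k. (kbar k (L x) u - coarse.ker k (L x) u) * f (x(k := u)))" for x
  define \<phi>2 where "\<phi>2 l = (\<Sum>u\<in>F k. \<bar>H l u - kbar k l u\<bar>)" for l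
  define \<phi>3 where "\<phi>3 l = (\<Sum>u\<in>F k. \<bar>kbar k l u - coarse.ker k l u\<bar>)" for l
  have R0: "x \<in> Om {1..m} \<Longrightarrow> 0 \<le> coarse.R m x" for x
    using m by (intro coarse.R_nonneg) auto
  have split: "(\<Sum>u\<in>F k. (\<kappa> k (restrict x (P k)) u - coarse.ker k (L x) u) * f (x(k := u))) = S1 x + S2 x + S3 x" for x
    unfolding S1_def S2_def S3_def sum.distrib[symmetric] by (intro sum.cong refl) (simp add: algebra_simps)
  have marg: "(\<Sum>x\<in>Om {1..m}. coarse.R m x * \<phi> (L x)) = (\<Sum>l\<in>Lab k. pl k l * \<phi> l)" for \<phi>
  proof -
    have "(\<Sum>x\<in>Om {1..m}. coarse.R m x * \<phi> (L x)) = (\<Sum>x\<in>Om {1..K}. p x * \<phi> (L x))"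
      unfolding L_def k_def by (rule coarse.marginal_parents[OF m])
    also have "\<dots> = (\<Sum>l\<in>Lab k. pl k l * \<phi> l)"
      unfolding L_def using k coarse.lab_Lab_nodes by (intro sum_mass) auto
    finally show ?thesis .
  qed
  have ZL: "(\<Sum>z\<in>Z l. \<nu> z) = 1" if "l \<in> Lab k" for l
  proof -
    obtain x where "x \<in> Om (P k)" "l = lab (P k) J x" using \<open>l \<in> Lab k\<close> unfolding Lab_def by auto
    then show ?thesis
      unfolding Z_def \<nu>_def using coarse.within_cell_total[OF finite_P[OF k] P_sub_nodes[OF k] _ order.refl] by simp
  qed

  have 1: "\<bar>\<Sum>x\<in>Om {1..m}. coarse.R m x * S1 x\<bar> \<le> \<theta> * (\<Lambda> * r * r)"
  proof -
    have "\<bar>S1 x\<bar> \<le> \<theta> * (\<Lambda> * r * r)" if x: "x \<in> Om {1..m}" for x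
    proof -
      have "\<bar>S1 x\<bar> \<le> (\<Sum>u\<in>F k. \<bar>\<kappa> k (restrict x (P k)) u - kbar k (L x) u\<bar>) * (\<theta> / 2 ^ J)"
        unfolding S1_def
        by (intro abs_sum_mult_le lipD[OF f'] upd x \<pi>_in lab_upd \<pi>_lab[symmetric] refl)
      also have "\<dots> \<le> \<Lambda> * r * (\<theta> / 2 ^ J)"
      proof (rule mult_right_mono)
        show "(\<Sum>u\<in>F k. \<bar>\<kappa> k (restrict x (P k)) u - kbar k (L x) u\<bar>) \<le> \<Lambda> * r"
          using kbar_same_cell[OF k rest[OF x]] unfolding L_def by simp
      qed (use \<theta> in simp)
      finally show ?thesis by (simp add: ac_simps)
    qed
    then have "\<bar>\<Sum>x\<in>Om {1..m}. coarse.R m x * S1 x\<bar> \<le> (\<Sum>x\<in>Om {1..m}. \<bar>coarse.R m x\<bar>) * (\<theta> * (\<Lambda> * r * r))"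
      by (rule abs_sum_mult_le)
    also have "(\<Sum>x\<in>Om {1..m}. \<bar>coarse.R m x\<bar>) = 1"
      using R0 coarse.R_total[of m] m by simp
    finally show ?thesis by simp
  qed

  have 3: "\<bar>\<Sum>x\<in>Om {1..m}. coarse.R m x * S3 x\<bar> \<le> \<theta> * (\<Lambda> * r * r)"
  proof -
    have S3: "\<bar>S3 x\<bar> \<le> \<phi>3 (L x) * (\<theta> / 2 ^ J)" if x: "x \<in> Om {1..m}" for x
    proof -
      \<comment> \<open>\<open>kbar\<close> and \<open>ker\<close> give the same mass to each coarse
        cell, so the value of \<open>f\<close> at the representative of the cell can be subtracted,
        which leaves the oscillation \<open>\<theta> / 2 ^ J\<close>.\<close>
      define \<psi> where "\<psi> B = f (x(k := rep_cell k B))" for B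
      have "(\<Sum>u\<in>F k. (kbar k (L x) u - coarse.ker k (L x) u) * \<psi> (c k J u)) = 0"
        using sum_T[of k "L x" \<psi>] coarse.sum_ker[OF k, of "L x" \<psi>]
        by (simp add: left_diff_distrib sum_subtractf)
      then have eq: "S3 x = (\<Sum>u\<in>F k. (kbar k (L x) u - coarse.ker k (L x) u) * (f (x(k := u)) - \<psi> (c k J u)))"
        unfolding S3_def by (simp add: right_diff_distrib sum_subtractf)
      show ?thesis
        unfolding eq \<phi>3_def \<psi>_def using rep_cell[OF c_in_cells]
        by (intro abs_sum_mult_le lipD[OF f'] upd x lab_upd refl) auto
    qed
    have "\<bar>\<Sum>x\<in>Om {1..m}. coarse.R m x * S3 x\<bar> \<le> (\<Sum>x\<in>Om {1..m}. coarse.R m x * (\<phi>3 (L x) * (\<theta> / 2 ^ J)))"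
      using R0 S3 by (rule abs_weighted_sum_le)
    also have "\<dots> = (\<Sum>x\<in>Om {1..m}. coarse.R m x * \<phi>3 (L x)) * (\<theta> / 2 ^ J)"
      by (simp only: sum_distrib_right mult.assoc)
    also have "(\<Sum>x\<in>Om {1..m}. coarse.R m x * \<phi>3 (L x)) = (\<Sum>l\<in>Lab k. pl k l * \<phi>3 l)"
      by (rule marg)
    also have "\<dots> = (\<Sum>l\<in>Lab k. \<Sum>u\<in>F k. \<bar>mass p (\<lambda>x. lab (P k) J x = l \<and> x k = u)
      - mass p (\<lambda>x. lab (P k) J x = l \<and> c k J (x k) = c k J u) * w k u\<bar>)"
    proof (intro sum.cong refl)
      fix l assume l: "l \<in> Lab k"
      show "pl k l * \<phi>3 l = (\<Sum>u\<in>F k. \<bar>mass p (\<lambda>x. lab (P k) J x = l \<and> x k = u)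
        - mass p (\<lambda>x. lab (P k) J x = l \<and> c k J (x k) = c k J u) * w k u\<bar>)"
        unfolding \<phi>3_def sum_distrib_left
      proof (intro sum.cong refl)
        fix u assume u: "u \<in> F k"
        have "pl k l * \<bar>kbar k l u - coarse.ker k l u\<bar> = \<bar>pl k l * kbar k l u - pl k l * T k l (c k J u) * w k u\<bar>"
          unfolding coarse.ker_def mult.assoc right_diff_distrib[symmetric] abs_mult abs_of_nonneg[OF p_mass_nonneg] ..
        then show "pl k l * \<bar>kbar k l u - coarse.ker k l u\<bar> = \<bar>mass p (\<lambda>x. lab (P k) J x = l \<and> x k = u)
          - mass p (\<lambda>x. lab (P k) J x = l \<and> c k J (x k) = c k J u) * w k u\<bar>"
          unfolding kbar_mass[OF k u] coarse.T_mass[OF k l c_in_cells[OF u]] .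
      qed
    qed
    also have "\<dots> * (\<theta> / 2 ^ J) \<le> \<Lambda> * r * (\<theta> / 2 ^ J)"
      using \<theta> by (intro mult_right_mono collapse_error[OF k]) auto
    finally show ?thesis by (simp add: ac_simps)
  qed

  \<comment> \<open>With \<open>f\<close> frozen, the position of \<open>x\<close> inside its cell
    enters only through the parents in \<open>\<kappa>\<close>; resampling them replaces this kernel
    by \<open>H\<close>.\<close>
  have resampled: "(\<Sum>x\<in>Om {1..m}. coarse.R m x * S2 x) = (\<Sum>x\<in>Om {1..m}. coarse.R m x * S2' x)"
  proof -
    have "(\<Sum>x\<in>Om {1..m}. coarse.R m x * (\<kappa> k (restrict x (P k)) u * f ((\<pi> x)(k := u)))) =
       (\<Sum>x\<in>Om {1..m}. coarse.R m x * (H (L x) u * f ((\<pi> x)(k := u))))" for u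
      using coarse.resample[OF less_imp_le[OF m] Pm, of "\<lambda>z. \<kappa> k z u" "\<lambda>l. f ((pi l)(k := u))"]
      unfolding H_def Z_def L_def \<pi>_def \<nu>_def .
    then have "(\<Sum>u\<in>F k. \<Sum>x\<in>Om {1..m}. coarse.R m x * (\<kappa> k (restrict x (P k)) u * f ((\<pi> x)(k := u)))) =
       (\<Sum>u\<in>F k. \<Sum>x\<in>Om {1..m}. coarse.R m x * (H (L x) u * f ((\<pi> x)(k := u))))" by simp
    then have "(\<Sum>x\<in>Om {1..m}. coarse.R m x * (\<Sum>u\<in>F k. \<kappa> k (restrict x (P k)) u * f ((\<pi> x)(k := u)))) =
       (\<Sum>x\<in>Om {1..m}. coarse.R m x * (\<Sum>u\<in>F k. H (L x) u * f ((\<pi> x)(k := u))))"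
      unfolding sum.swap[of _ "Om {1..m}" "F k"] sum_distrib_left .
    then show ?thesis
      unfolding S2_def S2'_def left_diff_distrib sum_subtractf right_diff_distrib by simp
  qed
  have 2: "\<bar>\<Sum>x\<in>Om {1..m}. coarse.R m x * S2' x\<bar> \<le> \<theta> * (\<Lambda> * r * D (P k))"
  proof -
    have S2': "\<bar>S2' x\<bar> \<le> \<phi>2 (L x) * \<theta>" if x: "x \<in> Om {1..m}" for x
    proof -
      obtain u0 where u0: "u0 \<in> F k" using neF by blast
      have "(\<Sum>u\<in>F k. H (L x) u) = (\<Sum>z\<in>Z (L x). \<nu> z * (\<Sum>u\<in>F k. \<kappa> k z u))"
        unfolding H_def sum_distrib_left by (rule sum.swap)
      also have "\<dots> = 1" using \<kappa>_total[OF k] ZL[OF LL[OF x]] by (simp add: Z_def)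
      finally have "(\<Sum>u\<in>F k. (H (L x) u - kbar k (L x) u)) = 0"
        using kbar_total[OF k LL[OF x]] by (simp add: sum_subtractf)
      then have "(\<Sum>u\<in>F k. (H (L x) u - kbar k (L x) u) * f ((\<pi> x)(k := u0))) = 0"
        by (simp flip: sum_distrib_right)
      then have eq: "S2' x = (\<Sum>u\<in>F k. (H (L x) u - kbar k (L x) u) * (f ((\<pi> x)(k := u)) - f ((\<pi> x)(k := u0))))"
        unfolding S2'_def right_diff_distrib sum_subtractf by simp
      show ?thesis
        unfolding eq \<phi>2_def by (intro abs_sum_mult_le lip_osc[OF f'] upd \<pi>_in x u0)
    qed
    have "\<bar>\<Sum>x\<in>Om {1..m}. coarse.R m x * S2' x\<bar> \<le> (\<Sum>x\<in>Om {1..m}. coarse.R m x * (\<phi>2 (L x) * \<theta>))"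
      using R0 S2' by (rule abs_weighted_sum_le)
    also have "\<dots> = (\<Sum>x\<in>Om {1..m}. coarse.R m x * \<phi>2 (L x)) * \<theta>"
      by (simp only: sum_distrib_right mult.assoc)
    finally have bound: "\<bar>\<Sum>x\<in>Om {1..m}. coarse.R m x * S2' x\<bar> \<le> (\<Sum>x\<in>Om {1..m}. coarse.R m x * \<phi>2 (L x)) * \<theta>" .
    have "(\<Sum>l\<in>Lab k. pl k l * \<phi>2 l) \<le> (\<Sum>l\<in>Lab k. \<Sum>z\<in>Z l. \<bar>pl k (lab (P k) J z) * \<nu> z - pz (P k) z\<bar> * (\<Lambda> * r))"
    proof (intro sum_mono)
      fix l assume l: "l \<in> Lab k"
      define a where "a z = pl k l * \<nu> z - pz (P k) z" for z
      \<comment> \<open>Both laws give the label the mass \<open>pl k l\<close>, so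
        \<open>kbar\<close> can be subtracted from \<open>\<kappa>\<close> under the signed weights
        \<open>a\<close>: this gains \<open>\<Lambda> * r\<close> on top of the total weight, which
        sums to \<open>D (P k)\<close>.\<close>
      have a0: "(\<Sum>z\<in>Z l. a z) = 0"
        using ZL[OF l] pl_fibres[OF k, of l] unfolding a_def Z_def sum_subtractf
        by (simp flip: sum_distrib_left)
      have "pl k l * \<phi>2 l = (\<Sum>u\<in>F k. \<bar>\<Sum>z\<in>Z l. a z * (\<kappa> k z u - kbar k l u)\<bar>)"
        unfolding \<phi>2_def sum_distrib_left
      proof (intro sum.cong refl)
        fix u assume u: "u \<in> F k"
        have e: "pl k l * kbar k l u = (\<Sum>z\<in>Z l. pz (P k) z * \<kappa> k z u)"
          unfolding kbar_mass[OF k u] mass_lab_fibres[OF k, symmetric] Z_def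
          using \<kappa>_mass[OF k _ u] by (intro sum.cong) auto
        have "pl k l * (H l u - kbar k l u) = (\<Sum>z\<in>Z l. a z * \<kappa> k z u)"
          unfolding H_def a_def right_diff_distrib left_diff_distrib sum_subtractf sum_distrib_left mult.assoc e ..
        also have "\<dots> = (\<Sum>z\<in>Z l. a z * (\<kappa> k z u - kbar k l u))"
          unfolding right_diff_distrib sum_subtractf sum_distrib_right[symmetric] a0 by simp
        finally have e': "pl k l * (H l u - kbar k l u) = (\<Sum>z\<in>Z l. a z * (\<kappa> k z u - kbar k l u))" .
        show "pl k l * \<bar>H l u - kbar k l u\<bar> = \<bar>\<Sum>z\<in>Z l. a z * (\<kappa> k z u - kbar k l u)\<bar>"
          unfolding e'[symmetric] abs_mult abs_of_nonneg[OF p_mass_nonneg] ..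
      qed
      also have "\<dots> \<le> (\<Sum>u\<in>F k. \<Sum>z\<in>Z l. \<bar>a z\<bar> * \<bar>\<kappa> k z u - kbar k l u\<bar>)"
        by (intro sum_mono order.trans[OF sum_abs]) (simp add: abs_mult)
      also have "\<dots> = (\<Sum>z\<in>Z l. \<bar>a z\<bar> * (\<Sum>u\<in>F k. \<bar>\<kappa> k z u - kbar k l u\<bar>))"
        unfolding sum_distrib_left by (rule sum.swap)
      also have "\<dots> \<le> (\<Sum>z\<in>Z l. \<bar>a z\<bar> * (\<Lambda> * r))"
        using kbar_same_cell[OF k] unfolding Z_def by (intro sum_mono mult_left_mono) auto
      also have "\<dots> = (\<Sum>z\<in>Z l. \<bar>pl k (lab (P k) J z) * \<nu> z - pz (P k) z\<bar> * (\<Lambda> * r))"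
        unfolding a_def Z_def by (intro sum.cong) auto
      finally show "pl k l * \<phi>2 l \<le> \<dots>" .
    qed
    also have "\<dots> = (\<Sum>z\<in>Om (P k). \<bar>pl k (lab (P k) J z) * \<nu> z - pz (P k) z\<bar> * (\<Lambda> * r))"
      unfolding Z_def using finite_P[OF k] k by (intro sum_fibres) (auto simp: Lab_def)
    also have "\<dots> = \<Lambda> * r * D (P k)"
      unfolding D_def \<nu>_def sum_distrib_left by (simp only: mult.commute)
    finally have "(\<Sum>l\<in>Lab k. pl k l * \<phi>2 l) * \<theta> \<le> \<Lambda> * r * D (P k) * \<theta>"
      using \<theta> by (rule mult_right_mono)
    from order.trans[OF bound[unfolded marg] this] show ?thesis by (simp only: mult.commute)
  qed

  have "(\<Sum>x\<in>Om {1..m}. coarse.R m x * (\<Sum>u\<in>F k. (\<kappa> k (restrict x (P k)) u - coarse.ker k (L x) u) * f (x(k := u))))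
    = (\<Sum>x\<in>Om {1..m}. coarse.R m x * S1 x) + (\<Sum>x\<in>Om {1..m}. coarse.R m x * S2' x) + (\<Sum>x\<in>Om {1..m}. coarse.R m x * S3 x)"
    unfolding split resampled[symmetric] sum.distrib[symmetric] by (simp only: distrib_left)
  from abs_add3_le[OF 1 2 3, folded this]
  have "\<bar>\<Sum>x\<in>Om {1..m}. coarse.R m x * (\<Sum>u\<in>F k. (\<kappa> k (restrict x (P k)) u - coarse.ker k (L x) u) * f (x(k := u)))\<bar>
    \<le> \<theta> * (\<Lambda> * r * r) + \<theta> * (\<Lambda> * r * D (P k)) + \<theta> * (\<Lambda> * r * r)" .
  also have "\<dots> = \<theta> * (2 * (\<Lambda> * r * r) + \<Lambda> * r * D (P k))" by (simp only: distrib_left mult_2)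
  finally show ?thesis unfolding k_def L_def .
qed

text \<open>\<open>chain_error\<close> with the true kernels. Passing from the marginal of
  \<open>p\<close> on \<open>m\<close> nodes to the next one costs \<open>\<eta>\<close>, because
  the quantised law is only almost Markov, and the coarse chain costs \<open>bias_step\<close> with
  \<open>D\<close> replaced by \<open>D_bound\<close>.\<close>

theorem bias:
  assumes f: "lip K \<theta> f"
  shows "\<bar>\<Sum>x\<in>Om {1..K}. (p x - coarse.R K x) * f x\<bar> \<le>
    \<theta> * (real K * (1 + \<Lambda>) ^ K * (\<eta> + 2 * (\<Lambda> * r * r) + 2 * real K * (\<Lambda> * r) * (\<Lambda> * r)))"
proof -
  define e where "e = \<eta> + 2 * (\<Lambda> * r * r) + 2 * real K * (\<Lambda> * r) * (\<Lambda> * r)"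
  define A where "A m x = pz {1..m} x" for m x
  define \<kappa>' where "\<kappa>' m x u = \<kappa> (Suc m) (restrict x (P (Suc m))) u" for m x u
  have rest: "x \<in> Om {1..m} \<Longrightarrow> restrict x (P (Suc m)) \<in> Om (P (Suc m))" if "m < K" for m x
    using P_sub_Suc[OF that] by (rule restrict_Om[rotated])
  have step: "\<bar>(\<Sum>x\<in>Om {1..Suc m}. (A (Suc m) x - coarse.R (Suc m) x) * f x) -
       (\<Sum>x\<in>Om {1..m}. (A m x - coarse.R m x) * (\<Sum>u\<in>F (Suc m). \<kappa>' m x u * f (x(Suc m := u))))\<bar> \<le> \<theta> * e"
    if m: "m < K" and f: "lip (Suc m) \<theta> f" for m f \<theta>
  proof -
    have \<theta>: "0 \<le> \<theta>" using f by (rule lip_nonneg)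
    obtain x0 where x0: "x0 \<in> Om {1..Suc m}" using Om_nonempty by blast
    define a where "a x u = A (Suc m) (x(Suc m := u)) - A m x * \<kappa>' m x u" for x u
    have A_total: "(\<Sum>x\<in>Om {1..i}. A i x) = 1" if "i \<le> K" for i
      unfolding A_def using mass_fibres[of "Om {1..i}" "\<lambda>_. True" "\<lambda>x. restrict x {1..i}" p]
        restrict_Om[of _ "{1..K}" "{1..i}"] that p_mass_total by simp
    have "(\<Sum>x\<in>Om {1..m}. \<Sum>u\<in>F (Suc m). a x u) = (\<Sum>x\<in>Om {1..Suc m}. A (Suc m) x) - (\<Sum>x\<in>Om {1..m}. A m x)"
      unfolding a_def sum_subtractf sum_Om_Suc using \<kappa>_total[of "Suc m"] rest[OF m] m
      by (simp add: \<kappa>'_def flip: sum_distrib_left)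
    \<comment> \<open>The defect of the Markov property has total mass zero, so \<open>f\<close> can
      be centred at \<open>x0\<close> and enters only through its oscillation.\<close>
    then have a0: "(\<Sum>x\<in>Om {1..m}. \<Sum>u\<in>F (Suc m). a x u) = 0" using A_total m by simp
    have "(\<Sum>x\<in>Om {1..m}. \<Sum>u\<in>F (Suc m). a x u * f (x(Suc m := u))) =
       (\<Sum>x\<in>Om {1..m}. \<Sum>u\<in>F (Suc m). a x u * (f (x(Suc m := u)) - f x0))"
      unfolding right_diff_distrib sum_subtractf sum_distrib_right[symmetric] a0 by simp
    then have 1: "\<bar>\<Sum>x\<in>Om {1..m}. \<Sum>u\<in>F (Suc m). a x u * f (x(Suc m := u))\<bar> \<le>
       (\<Sum>x\<in>Om {1..m}. \<bar>\<Sum>u\<in>F (Suc m). a x u * (f (x(Suc m := u)) - f x0)\<bar>)" by (simp only: sum_abs)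
    have "(\<Sum>x\<in>Om {1..m}. \<bar>\<Sum>u\<in>F (Suc m). a x u * (f (x(Suc m := u)) - f x0)\<bar>) \<le>
      (\<Sum>x\<in>Om {1..m}. (\<Sum>u\<in>F (Suc m). \<bar>a x u\<bar>) * \<theta>)"
      by (intro sum_mono abs_sum_mult_le lip_osc[OF f] Om_upd_Suc x0)
    also have "\<dots> \<le> \<eta> * \<theta>"
      using almost_markov[OF m] \<theta> unfolding sum_distrib_right[symmetric] a_def A_def \<kappa>'_def
      by (intro mult_right_mono) auto
    finally have 2: "\<bar>\<Sum>x\<in>Om {1..m}. \<Sum>u\<in>F (Suc m). a x u * f (x(Suc m := u))\<bar> \<le> \<theta> * \<eta>"
      using 1 by (simp add: mult.commute)
    have "\<Lambda> * r * D (P (Suc m)) \<le> \<Lambda> * r * (2 * real (Suc m) * (\<Lambda> * r))"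
      using m \<Lambda>_nonneg D_bound[of "Suc m"] by (intro mult_left_mono) auto
    also have "\<dots> \<le> \<Lambda> * r * (2 * real K * (\<Lambda> * r))"
      using m \<Lambda>_nonneg by (intro mult_left_mono mult_right_mono) auto
    finally have "\<theta> * (2 * (\<Lambda> * r * r) + \<Lambda> * r * D (P (Suc m))) \<le> \<theta> * (2 * (\<Lambda> * r * r) + \<Lambda> * r * (2 * real K * (\<Lambda> * r)))"
      using \<theta> by (intro mult_left_mono) auto
    note 3 = order.trans[OF bias_step[OF m f] this]
    have eq: "(\<Sum>x\<in>Om {1..Suc m}. (A (Suc m) x - coarse.R (Suc m) x) * f x) -
       (\<Sum>x\<in>Om {1..m}. (A m x - coarse.R m x) * (\<Sum>u\<in>F (Suc m). \<kappa>' m x u * f (x(Suc m := u)))) =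
       (\<Sum>x\<in>Om {1..m}. \<Sum>u\<in>F (Suc m). a x u * f (x(Suc m := u))) +
       (\<Sum>x\<in>Om {1..m}. coarse.R m x * (\<Sum>u\<in>F (Suc m).
          (\<kappa> (Suc m) (restrict x (P (Suc m))) u - coarse.ker (Suc m) (lab (P (Suc m)) J x) u) * f (x(Suc m := u))))"
      unfolding sum_Om_Suc sum_subtractf[symmetric] sum.distrib[symmetric] sum_distrib_left coarse.R_Suc[OF m] a_def \<kappa>'_def
      by (intro sum.cong refl) (simp add: algebra_simps)
    have "2 * real K * (\<Lambda> * r) * (\<Lambda> * r) = \<Lambda> * r * (2 * real K * (\<Lambda> * r))" by (simp only: ac_simps)
    then have "\<theta> * e = \<theta> * \<eta> + \<theta> * (2 * (\<Lambda> * r * r) + \<Lambda> * r * (2 * real K * (\<Lambda> * r)))"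
      unfolding e_def by (simp only: distrib_left add.assoc)
    note te = this
    show ?thesis unfolding eq te by (rule order.trans[OF abs_triangle_ineq add_mono[OF 2 3]])
  qed
  have "\<bar>\<Sum>x\<in>Om {1..K}. (A K x - coarse.R K x) * f x\<bar> \<le> \<theta> * (real K * (1 + \<Lambda>) ^ K * e)"
  proof (rule chain_error[where \<kappa> = \<kappa>' and K = K and A = A and B = coarse.R and \<Lambda> = \<Lambda> and e = e])
    fix m x y j assume m: "m < K" and x: "x \<in> Om {1..m}" and y: "y \<in> Om {1..m}" and xy: "lab {1..m} j x = lab {1..m} j y"
    have "lab (P (Suc m)) j (restrict x (P (Suc m))) = lab (P (Suc m)) j (restrict y (P (Suc m)))"
      using lab_mono[OF xy P_sub_Suc[OF m]] by simp
    then show "(\<Sum>u\<in>F (Suc m). \<bar>\<kappa>' m x u - \<kappa>' m y u\<bar>) \<le> \<Lambda> / 2 ^ j"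
      unfolding \<kappa>'_def using m by (intro \<kappa>_TV rest x y) auto
  next
    fix x assume "x \<in> Om {}"
    then show "A 0 x = coarse.R 0 x"
      unfolding A_def chainw_def using p_mass_total by (simp add: restrict_def)
  qed (use step f \<kappa>_nonneg \<kappa>_total rest \<Lambda>_nonneg \<eta>_nonneg in \<open>auto simp: \<kappa>'_def e_def\<close>)
  moreover have "A K x = p x" if x: "x \<in> Om {1..K}" for x
  proof -
    have "restrict y {1..K} = y" if "y \<in> Om {1..K}" for y
      using that unfolding Om_def by (rule PiE_restrict)
    then have "{y \<in> Om {1..K}. restrict y {1..K} = x} = {x}" using x by auto
    then show ?thesis unfolding A_def mass_def by simp
  qed
  ultimately show ?thesis unfolding e_def by simp
qed

end

section \<open>Stochastic error\<close>

context tree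
begin

definition rep :: "nat \<Rightarrow> nat \<Rightarrow> 'c \<Rightarrow> 'b" where
  "rep k j A = (SOME u. u \<in> F k \<and> c k j u = A)"

lemma rep: "u \<in> F k \<Longrightarrow> rep k j (c k j u) \<in> F k \<and> c k j (rep k j (c k j u)) = c k j u"
  unfolding rep_def by (rule someI_ex) auto

text \<open>Chaining: \<open>h\<close> is the sum of its increments between representatives of
  consecutive levels. Cells of level \<open>M\<close> are points, the root term is constant and
  disappears because \<open>m\<close> has mass zero, and the increment at level \<open>j\<close> is
  constant on cells of level \<open>Suc j\<close> and at most
  \<open>\<theta> / 2 ^ j\<close>.\<close>

lemma telescope_bound:
  fixes h m :: "'b \<Rightarrow> real" and \<theta> :: real
  assumes inj: "\<And>u v. u \<in> F k \<Longrightarrow> v \<in> F k \<Longrightarrow> c k M u = c k M v \<Longrightarrow> u = v"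
    and h: "\<And>u v j. u \<in> F k \<Longrightarrow> v \<in> F k \<Longrightarrow> c k j u = c k j v \<Longrightarrow> \<bar>h u - h v\<bar> \<le> \<theta> / 2 ^ j"
    and zero: "(\<Sum>u\<in>F k. m u) = 0"
  shows "\<bar>\<Sum>u\<in>F k. m u * h u\<bar> \<le>
    \<theta> * (\<Sum>j<M. 1 / 2 ^ j * (\<Sum>A\<in>c k (Suc j) ` F k. \<bar>\<Sum>u | u \<in> F k \<and> c k (Suc j) u = A. m u\<bar>))"
proof -
  define H where "H j u = h (rep k j (c k j u))" for j u
  define g where "g j A = h (rep k (Suc j) A) - h (rep k j (c k j (rep k (Suc j) A)))" for j A
  define \<mu> where "\<mu> j A = (\<Sum>u | u \<in> F k \<and> c k j u = A. m u)" for j A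
  obtain u0 where u0: "u0 \<in> F k" using neF by blast
  have H_M: "H M u = h u" if u: "u \<in> F k" for u
  proof -
    have "rep k M (c k M u) = u" using rep[OF u, of M] by (intro inj[OF _ u]) auto
    then show ?thesis unfolding H_def by simp
  qed
  have "c k 0 u = c k 0 u0" if "u \<in> F k" for u using c_root[OF that u0] .
  then have H_0: "H 0 u = H 0 u0" if "u \<in> F k" for u
    unfolding H_def using that by simp
  have g: "H (Suc j) u - H j u = g j (c k (Suc j) u)" if u: "u \<in> F k" for j u
  proof -
    have "c k j (rep k (Suc j) (c k (Suc j) u)) = c k j u"
      using rep[OF u, of "Suc j"] c_refine[of k j] by blast
    then show ?thesis unfolding H_def g_def by simp
  qed
  have g_le: "\<bar>g j A\<bar> \<le> \<theta> / 2 ^ j" if A: "A \<in> c k (Suc j) ` F k" for j A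
  proof -
    obtain u where u: "u \<in> F k" "A = c k (Suc j) u" using A by auto
    let ?v = "rep k (Suc j) A"
    have v: "?v \<in> F k" using rep[OF u(1), of "Suc j"] u(2) by simp
    show ?thesis unfolding g_def using rep[OF v, of j] v by (intro h) auto
  qed
  have "(\<Sum>u\<in>F k. m u * h u) = (\<Sum>u\<in>F k. m u * (H 0 u0 + (\<Sum>j<M. H (Suc j) u - H j u)))"
  proof (intro sum.cong refl)
    fix u assume u: "u \<in> F k"
    have "(\<Sum>j<M. H (Suc j) u - H j u) = H M u - H 0 u" by (rule sum_lessThan_telescope[of "\<lambda>j. H j u"])
    then show "m u * h u = m u * (H 0 u0 + (\<Sum>j<M. H (Suc j) u - H j u))"
      using H_M[OF u] H_0[OF u] by simp
  qed
  also have "\<dots> = (\<Sum>u\<in>F k. m u) * H 0 u0 + (\<Sum>u\<in>F k. \<Sum>j<M. m u * (H (Suc j) u - H j u))"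
    unfolding distrib_left sum.distrib sum_distrib_right sum_distrib_left ..
  also have "\<dots> = (\<Sum>j<M. \<Sum>u\<in>F k. m u * (H (Suc j) u - H j u))"
    unfolding zero sum.swap[of _ "{..<M}"] by simp
  also have "\<dots> = (\<Sum>j<M. \<Sum>A\<in>c k (Suc j) ` F k. \<mu> (Suc j) A * g j A)"
  proof (intro sum.cong refl)
    fix j
    have "(\<Sum>u\<in>F k. m u * (H (Suc j) u - H j u)) = (\<Sum>u\<in>F k. m u * g j (c k (Suc j) u))"
      using g by (intro sum.cong refl) auto
    also have "\<dots> = (\<Sum>A\<in>c k (Suc j) ` F k. \<mu> (Suc j) A * g j A)"
      unfolding \<mu>_def by (rule sum_mult_fibres) auto
    finally show "(\<Sum>u\<in>F k. m u * (H (Suc j) u - H j u)) = (\<Sum>A\<in>c k (Suc j) ` F k. \<mu> (Suc j) A * g j A)" .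
  qed
  finally have eq: "(\<Sum>u\<in>F k. m u * h u) = (\<Sum>j<M. \<Sum>A\<in>c k (Suc j) ` F k. \<mu> (Suc j) A * g j A)" .
  have "\<bar>\<Sum>u\<in>F k. m u * h u\<bar> \<le> (\<Sum>j<M. \<bar>\<Sum>A\<in>c k (Suc j) ` F k. \<mu> (Suc j) A * g j A\<bar>)"
    unfolding eq by (rule sum_abs)
  also have "\<dots> \<le> (\<Sum>j<M. (\<Sum>A\<in>c k (Suc j) ` F k. \<bar>\<mu> (Suc j) A\<bar>) * (\<theta> / 2 ^ j))"
    by (intro sum_mono abs_sum_mult_le g_le)
  also have "\<dots> = \<theta> * (\<Sum>j<M. 1 / 2 ^ j * (\<Sum>A\<in>c k (Suc j) ` F k. \<bar>\<mu> (Suc j) A\<bar>))"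
    unfolding sum_distrib_left[of \<theta>] by (intro sum.cong refl) simp
  finally show ?thesis unfolding \<mu>_def .
qed

end

section \<open>Cell masses reproduced by the coarse chain\<close>

context coarse_chain
begin

text \<open>A cell of level \<open>i \<le> J\<close> is a union of level-\<open>J\<close> cells, and
  on these the chain reproduces the joint masses with the parent label. Membership is read off any
  representative of the coarse cell, which is what \<open>\<phi>\<close> does.\<close>

lemma cell_mass:
  assumes k: "k \<in> {1..K}" and l: "l \<in> Lab k" and i: "i \<le> J"
  shows "mass q (\<lambda>x. lab (P k) J x = l) * (\<Sum>u | u \<in> F k \<and> c k i u = A. ker k l u) =
    mass q (\<lambda>x. lab (P k) J x = l \<and> c k i (x k) = A)"
proof -
  define \<phi> :: "'c \<Rightarrow> real" where "\<phi> B = of_bool (c k i (rep_cell k B) = A)" for B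
  have \<phi>: "\<phi> (c k J u) = of_bool (c k i u = A)" if "u \<in> F k" for u
  proof -
    have "c k J (rep_cell k (c k J u)) = c k J u" using rep_cell[OF c_in_cells[OF that]] by simp
    then have "c k i (rep_cell k (c k J u)) = c k i u" using i by (rule c_coarse)
    then show ?thesis unfolding \<phi>_def by simp
  qed
  have "(\<Sum>u | u \<in> F k \<and> c k i u = A. ker k l u) = (\<Sum>u\<in>F k. ker k l u * of_bool (c k i u = A))"
    by (intro sum.mono_neutral_cong_left) auto
  also have "\<dots> = (\<Sum>u\<in>F k. ker k l u * \<phi> (c k J u))"
    using \<phi> by (intro sum.cong refl) simp
  also have "\<dots> = (\<Sum>B\<in>cells k J. T k l B * \<phi> B)"
    by (rule sum_ker[OF k])
  finally have 1: "(\<Sum>u | u \<in> F k \<and> c k i u = A. ker k l u) = (\<Sum>B\<in>cells k J. T k l B * \<phi> B)" .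
  have "mass q (\<lambda>x. lab (P k) J x = l) * (\<Sum>B\<in>cells k J. T k l B * \<phi> B) =
     (\<Sum>x\<in>Om {1..K}. q x * (\<Sum>B\<in>cells k J. T k (lab (P k) J x) B * (of_bool (lab (P k) J x = l) * \<phi> B)))"
    unfolding mass_def sum_distrib_right by (intro sum.mono_neutral_cong_left) auto
  also have "\<dots> = (\<Sum>x\<in>Om {1..K}. q x * (of_bool (lab (P k) J x = l) * \<phi> (c k J (x k))))"
    by (rule sum_T_mass[OF k, of "\<lambda>l' B. of_bool (l' = l) * \<phi> B"])
  also have "\<dots> = (\<Sum>x\<in>Om {1..K}. q x * of_bool (lab (P k) J x = l \<and> c k i (x k) = A))"
    using \<phi> Om_app k by (intro sum.cong refl) auto
  also have "\<dots> = mass q (\<lambda>x. lab (P k) J x = l \<and> c k i (x k) = A)"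
    unfolding mass_def by (intro sum.mono_neutral_cong_right) auto
  finally show ?thesis unfolding 1 .
qed

lemma sum_T_labels:
  assumes k: "k \<in> {1..K}" and B: "B \<in> cells k J"
  shows "(\<Sum>l\<in>Lab k. mass q (\<lambda>x. lab (P k) J x = l) * T k l B) = mass q (\<lambda>x. c k J (x k) = B)"
proof -
  have "(\<Sum>l\<in>Lab k. mass q (\<lambda>x. lab (P k) J x = l) * T k l B) =
    (\<Sum>l\<in>Lab k. mass q (\<lambda>x. c k J (x k) = B \<and> lab (P k) J x = l))"
    using T_mass[OF k _ B] by (intro sum.cong) (auto simp: conj_commute)
  also have "\<dots> = mass q (\<lambda>x. c k J (x k) = B)"
    using k lab_Lab_nodes by (intro mass_fibres) auto
  finally show ?thesis .
qed

end

context graph_tree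
begin

text \<open>
  The averages of \<open>g1\<close> and \<open>g2\<close> under the true law vanish, so that under the empirical law they are
  pure fluctuations; the errors of the transitions and of the laws inside the cells are expressed
  through them.
\<close>

definition g1 :: "(nat \<Rightarrow> (nat \<Rightarrow> 'c) \<Rightarrow> 'b \<Rightarrow> real) \<Rightarrow> nat \<Rightarrow> nat \<Rightarrow> (nat \<Rightarrow> 'c) \<Rightarrow> 'c \<Rightarrow> (nat \<Rightarrow> 'b) \<Rightarrow> real" where
  "g1 \<rho> k i l A x = of_bool (lab (P k) J x = l) *
     ((\<Sum>u | u \<in> F k \<and> c k i u = A. \<rho> k l u) - of_bool (c k i (x k) = A))"

definition g2 :: "(nat \<Rightarrow> 'b \<Rightarrow> real) \<Rightarrow> nat \<Rightarrow> nat \<Rightarrow> 'c \<Rightarrow> (nat \<Rightarrow> 'b) \<Rightarrow> real" where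
  "g2 w k i A x = (\<Sum>u | u \<in> F k \<and> c k i u = A. of_bool (c k J (x k) = c k J u) * w k u) - of_bool (c k i (x k) = A)"

lemma sum_g1:
  "(\<Sum>x\<in>Om {1..K}. q x * g1 \<rho> k i l A x) =
    mass q (\<lambda>x. lab (P k) J x = l) * (\<Sum>u | u \<in> F k \<and> c k i u = A. \<rho> k l u) -
    mass q (\<lambda>x. lab (P k) J x = l \<and> c k i (x k) = A)"
proof -
  let ?s = "\<Sum>u | u \<in> F k \<and> c k i u = A. \<rho> k l u"
  have "(\<Sum>x\<in>Om {1..K}. q x * g1 \<rho> k i l A x) =
     (\<Sum>x\<in>Om {1..K}. q x * of_bool (lab (P k) J x = l)) * ?s -
     (\<Sum>x\<in>Om {1..K}. q x * of_bool (lab (P k) J x = l \<and> c k i (x k) = A))"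
    unfolding g1_def sum_distrib_right sum_subtractf[symmetric]
    by (intro sum.cong refl) (simp add: algebra_simps of_bool_conj)
  moreover have "mass q E = (\<Sum>x\<in>Om {1..K}. q x * of_bool (E x))" for E
    unfolding mass_def by (intro sum.mono_neutral_cong_left) auto
  ultimately show ?thesis by simp
qed

lemma sum_g2:
  assumes k: "k \<in> {1..K}"
  shows "(\<Sum>x\<in>Om {1..K}. q x * g2 w k i A x) =
    (\<Sum>u | u \<in> F k \<and> c k i u = A. mass q (\<lambda>x. c k J (x k) = c k J u) * w k u - mass q (\<lambda>x. x k = u))"
proof -
  have m: "mass q E = (\<Sum>x\<in>Om {1..K}. q x * of_bool (E x))" for E
    unfolding mass_def by (intro sum.mono_neutral_cong_left) auto
  have A: "(\<Sum>u | u \<in> F k \<and> c k i u = A. mass q (\<lambda>x. x k = u)) = mass q (\<lambda>x. c k i (x k) = A)"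
  proof -
    have "(\<Sum>u | u \<in> F k \<and> c k i u = A. mass q (\<lambda>x. x k = u)) =
      (\<Sum>u | u \<in> F k \<and> c k i u = A. mass q (\<lambda>x. c k i (x k) = A \<and> x k = u))"
      by (intro sum.cong refl mass_cong) auto
    also have "\<dots> = mass q (\<lambda>x. c k i (x k) = A)" using k Om_app by (intro mass_fibres) auto
    finally show ?thesis .
  qed
  have "(\<Sum>x\<in>Om {1..K}. q x * g2 w k i A x) =
    (\<Sum>x\<in>Om {1..K}. \<Sum>u | u \<in> F k \<and> c k i u = A. q x * of_bool (c k J (x k) = c k J u) * w k u) -
    (\<Sum>x\<in>Om {1..K}. q x * of_bool (c k i (x k) = A))"
    unfolding g2_def right_diff_distrib sum_subtractf sum_distrib_left mult.assoc ..
  also have "(\<Sum>x\<in>Om {1..K}. \<Sum>u | u \<in> F k \<and> c k i u = A. q x * of_bool (c k J (x k) = c k J u) * w k u) =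
    (\<Sum>u | u \<in> F k \<and> c k i u = A. mass q (\<lambda>x. c k J (x k) = c k J u) * w k u)"
    unfolding m sum_distrib_right by (rule sum.swap)
  also have "(\<Sum>x\<in>Om {1..K}. q x * of_bool (c k i (x k) = A)) = mass q (\<lambda>x. c k i (x k) = A)"
    by (rule m[symmetric])
  finally show ?thesis unfolding A[symmetric] sum_subtractf .
qed

end

section \<open>The fitted chain against the coarse chain of the true law\<close>

locale empirical_model = smooth_model F c K P J p \<kappa> \<Lambda> \<eta>
  for F :: "nat \<Rightarrow> 'b set" and c :: "nat \<Rightarrow> nat \<Rightarrow> 'b \<Rightarrow> 'c" and K P J p \<kappa> \<Lambda> \<eta> +
  fixes q :: "(nat \<Rightarrow> 'b) \<Rightarrow> real" and M :: nat
  assumes emp_nonneg: "x \<in> Om {1..K} \<Longrightarrow> 0 \<le> q x"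
    and emp_total: "(\<Sum>x\<in>Om {1..K}. q x) = 1"
    and c_inj: "u \<in> F k \<Longrightarrow> v \<in> F k \<Longrightarrow> c k M u = c k M v \<Longrightarrow> u = v"
begin

sublocale emp: coarse_chain F c K P J q "transition q" "cell_law q"
  using emp_nonneg emp_total by (rule coarse_chain_transition)

abbreviation ql :: "nat \<Rightarrow> (nat \<Rightarrow> 'c) \<Rightarrow> real" where
  "ql k l \<equiv> mass q (\<lambda>x. lab (P k) J x = l)"

text \<open>The label weights are the empirical ones, because the kernel differences are integrated
  against \<open>emp.R\<close>, whose parent marginals are those of \<open>q\<close>.\<close>

definition W :: "nat \<Rightarrow> nat \<Rightarrow> real" where
  "W k i = (\<Sum>l\<in>Lab k. ql k l * (\<Sum>A\<in>cells k i. \<bar>\<Sum>u | u \<in> F k \<and> c k i u = A. coarse.ker k l u - emp.ker k l u\<bar>))"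

definition N1 :: "nat \<Rightarrow> nat \<Rightarrow> real" where
  "N1 k i = (\<Sum>l\<in>Lab k. \<Sum>A\<in>cells k i. \<bar>\<Sum>x\<in>Om {1..K}. q x * g1 coarse.ker k i l A x\<bar>)"

definition N2 :: "nat \<Rightarrow> nat \<Rightarrow> real" where
  "N2 k i = (\<Sum>A\<in>cells k i. \<bar>\<Sum>x\<in>Om {1..K}. q x * g2 w k i A x\<bar>)"

definition V :: "nat \<Rightarrow> real" where
  "V k = (\<Sum>j<M. 1 / 2 ^ j * W k (Suc j))"

lemma q_mass_nonneg: "0 \<le> mass q E"
  by (rule mass_nonneg) (rule emp_nonneg)

text \<open>Up to level \<open>J\<close> the empirical label mass times the fitted kernel is an
  empirical joint mass, by \<open>cell_mass\<close>; the random denominator cancels and a linear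
  statistic of \<open>q\<close> remains.\<close>

lemma W_coarse:
  assumes k: "k \<in> {1..K}" and i: "i \<le> J"
  shows "W k i = N1 k i"
  unfolding W_def N1_def sum_distrib_left
proof (intro sum.cong refl)
  fix l A assume l: "l \<in> Lab k"
  have "ql k l * \<bar>\<Sum>u | u \<in> F k \<and> c k i u = A. coarse.ker k l u - emp.ker k l u\<bar> =
    \<bar>ql k l * (\<Sum>u | u \<in> F k \<and> c k i u = A. coarse.ker k l u) - ql k l * (\<Sum>u | u \<in> F k \<and> c k i u = A. emp.ker k l u)\<bar>"
    unfolding right_diff_distrib[symmetric] sum_subtractf[symmetric] abs_mult abs_of_nonneg[OF q_mass_nonneg] ..
  then show "ql k l * \<bar>\<Sum>u | u \<in> F k \<and> c k i u = A. coarse.ker k l u - emp.ker k l u\<bar> =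
     \<bar>\<Sum>x\<in>Om {1..K}. q x * g1 coarse.ker k i l A x\<bar>"
    unfolding sum_g1 emp.cell_mass[OF k l i] .
qed

lemma N2_eq:
  assumes k: "k \<in> {1..K}"
  shows "N2 k i = (\<Sum>A\<in>cells k i. \<bar>\<Sum>u | u \<in> F k \<and> c k i u = A.
      mass q (\<lambda>x. c k J (x k) = c k J u) * (w k u - cell_law q k u)\<bar>)"
proof -
  have "mass q (\<lambda>x. c k J (x k) = c k J u) * cell_law q k u = mass q (\<lambda>x. x k = u)" for u
    by (rule cell_law_mass[OF k]) (rule emp_nonneg)
  then show ?thesis unfolding N2_def sum_g2[OF k] right_diff_distrib by simp
qed

text \<open>Below the coarse level the difference of kernels is \<open>w\<close> times the error of
  the transitions plus the fitted transition times the error of \<open>w\<close>. The first part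
  sums to the error at level \<open>J\<close>. In the second, summing over the labels turns the
  transitions into the empirical mass of the coarse cell, which again cancels a denominator.\<close>

lemma W_fine:
  assumes k: "k \<in> {1..K}" and i: "J \<le> i"
  shows "W k i \<le> N1 k J + N2 k i"
proof -
  define t where "t l B = \<bar>T k l B - transition q k l B\<bar>" for l B
  define d where "d u = w k u - cell_law q k u" for u
  \<comment> \<open>The coarse cell that contains the fine cell \<open>A\<close>; the transition is
    constant on it.\<close>
  define b where "b A = c k J (rep k i A)" for A
  have b: "b (c k i u) = c k J u" if "u \<in> F k" for u
    unfolding b_def using rep[OF that, of i] c_coarse[OF _ i] by blast
  have bA: "b A \<in> cells k J" if "A \<in> cells k i" for A
    using that b c_in_cells unfolding cells_def by auto
  have *: "\<bar>\<Sum>u | u \<in> F k \<and> c k i u = A. coarse.ker k l u - emp.ker k l u\<bar> \<le>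
     (\<Sum>u | u \<in> F k \<and> c k i u = A. w k u * t l (c k J u)) + transition q k l (b A) * \<bar>\<Sum>u | u \<in> F k \<and> c k i u = A. d u\<bar>"
    if l: "l \<in> Lab k" and A: "A \<in> cells k i" for l A
  proof -
    have "(\<Sum>u | u \<in> F k \<and> c k i u = A. coarse.ker k l u - emp.ker k l u) =
      (\<Sum>u | u \<in> F k \<and> c k i u = A. w k u * (T k l (c k J u) - transition q k l (c k J u)) + transition q k l (b A) * d u)"
      unfolding coarse.ker_def emp.ker_def d_def using b
      by (intro sum.cong refl) (auto simp: algebra_simps)
    then have eq: "(\<Sum>u | u \<in> F k \<and> c k i u = A. coarse.ker k l u - emp.ker k l u) =
      (\<Sum>u | u \<in> F k \<and> c k i u = A. w k u * (T k l (c k J u) - transition q k l (c k J u))) +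
      transition q k l (b A) * (\<Sum>u | u \<in> F k \<and> c k i u = A. d u)"
      unfolding sum.distrib sum_distrib_left .
    have s1: "\<bar>\<Sum>u | u \<in> F k \<and> c k i u = A. w k u * (T k l (c k J u) - transition q k l (c k J u))\<bar> \<le>
      (\<Sum>u | u \<in> F k \<and> c k i u = A. w k u * t l (c k J u))"
      unfolding t_def using w_nonneg by (intro abs_weighted_sum_le) auto
    have s2: "\<bar>transition q k l (b A) * (\<Sum>u | u \<in> F k \<and> c k i u = A. d u)\<bar> =
      transition q k l (b A) * \<bar>\<Sum>u | u \<in> F k \<and> c k i u = A. d u\<bar>"
      unfolding abs_mult abs_of_nonneg[OF emp.T_nonneg[OF k l bA[OF A]]] ..
    show ?thesis unfolding eq by (rule order.trans[OF abs_triangle_ineq add_mono[OF s1 eq_refl[OF s2]]])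
  qed
  have first: "(\<Sum>A\<in>cells k i. \<Sum>u | u \<in> F k \<and> c k i u = A. w k u * t l (c k J u)) =
      (\<Sum>A\<in>cells k J. \<bar>\<Sum>u | u \<in> F k \<and> c k J u = A. coarse.ker k l u - emp.ker k l u\<bar>)" for l
  proof -
    have "(\<Sum>A\<in>cells k i. \<Sum>u | u \<in> F k \<and> c k i u = A. w k u * t l (c k J u)) = (\<Sum>u\<in>F k. w k u * t l (c k J u))"
      by (rule sum_fibres) (auto simp: cells_def)
    also have "\<dots> = (\<Sum>B\<in>cells k J. (\<Sum>u | u \<in> F k \<and> c k J u = B. w k u) * t l B)"
      by (rule sum_mult_fibres) (auto simp: cells_def)
    also have "\<dots> = (\<Sum>B\<in>cells k J. \<bar>\<Sum>u | u \<in> F k \<and> c k J u = B. coarse.ker k l u - emp.ker k l u\<bar>)"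
    proof (intro sum.cong refl)
      fix B assume B: "B \<in> cells k J"
      have "(\<Sum>u | u \<in> F k \<and> c k J u = B. coarse.ker k l u - emp.ker k l u) =
        T k l B * (\<Sum>u | u \<in> F k \<and> c k J u = B. w k u) - transition q k l B * (\<Sum>u | u \<in> F k \<and> c k J u = B. cell_law q k u)"
        unfolding sum_distrib_left sum_subtractf[symmetric] coarse.ker_def emp.ker_def by (intro sum.cong) auto
      then show "(\<Sum>u | u \<in> F k \<and> c k J u = B. w k u) * t l B =
        \<bar>\<Sum>u | u \<in> F k \<and> c k J u = B. coarse.ker k l u - emp.ker k l u\<bar>"
        unfolding coarse.w_total[OF k B] emp.w_total[OF k B] t_def by simp
    qed
    finally show ?thesis .
  qed
  have second: "(\<Sum>l\<in>Lab k. ql k l * (\<Sum>A\<in>cells k i. transition q k l (b A) * \<bar>\<Sum>u | u \<in> F k \<and> c k i u = A. d u\<bar>)) = N2 k i"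
  proof -
    have "(\<Sum>l\<in>Lab k. ql k l * (\<Sum>A\<in>cells k i. transition q k l (b A) * \<bar>\<Sum>u | u \<in> F k \<and> c k i u = A. d u\<bar>)) =
      (\<Sum>A\<in>cells k i. (\<Sum>l\<in>Lab k. ql k l * transition q k l (b A)) * \<bar>\<Sum>u | u \<in> F k \<and> c k i u = A. d u\<bar>)"
      unfolding sum_distrib_left sum_distrib_right mult.assoc by (rule sum.swap)
    also have "\<dots> = (\<Sum>A\<in>cells k i. mass q (\<lambda>x. c k J (x k) = b A) * \<bar>\<Sum>u | u \<in> F k \<and> c k i u = A. d u\<bar>)"
      using emp.sum_T_labels[OF k bA] by (intro sum.cong) auto
    also have "\<dots> = N2 k i"
      unfolding N2_eq[OF k]
    proof (intro sum.cong refl)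
      fix A
      have "(\<Sum>u | u \<in> F k \<and> c k i u = A. mass q (\<lambda>x. c k J (x k) = c k J u) * (w k u - cell_law q k u)) =
        mass q (\<lambda>x. c k J (x k) = b A) * (\<Sum>u | u \<in> F k \<and> c k i u = A. d u)"
        unfolding sum_distrib_left d_def using b by (intro sum.cong) auto
      then show "mass q (\<lambda>x. c k J (x k) = b A) * \<bar>\<Sum>u | u \<in> F k \<and> c k i u = A. d u\<bar> =
        \<bar>\<Sum>u | u \<in> F k \<and> c k i u = A. mass q (\<lambda>x. c k J (x k) = c k J u) * (w k u - cell_law q k u)\<bar>"
        by (simp only: abs_mult abs_of_nonneg[OF q_mass_nonneg])
    qed
    finally show ?thesis .
  qed
  have "W k i \<le> (\<Sum>l\<in>Lab k. ql k l * (\<Sum>A\<in>cells k i. (\<Sum>u | u \<in> F k \<and> c k i u = A. w k u * t l (c k J u)) +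
      transition q k l (b A) * \<bar>\<Sum>u | u \<in> F k \<and> c k i u = A. d u\<bar>))"
    unfolding W_def by (intro sum_mono mult_left_mono * q_mass_nonneg)
  also have "\<dots> = W k J + N2 k i"
    unfolding sum.distrib distrib_left second first W_def ..
  finally show ?thesis using W_coarse[OF k order.refl] by simp
qed

lemma V_le:
  assumes k: "k \<in> {1..K}"
  shows "V k \<le> (\<Sum>j<M. 1 / 2 ^ j * (if Suc j \<le> J then N1 k (Suc j) else N1 k J + N2 k (Suc j)))"
  unfolding V_def using W_coarse[OF k] W_fine[OF k] by (intro sum_mono mult_left_mono) auto

lemma W_nonneg: "0 \<le> W k i"
  unfolding W_def by (intro sum_nonneg mult_nonneg_nonneg q_mass_nonneg) auto

lemma V_nonneg: "0 \<le> V k"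
  unfolding V_def by (intro sum_nonneg mult_nonneg_nonneg W_nonneg) auto

text \<open>For fixed \<open>x\<close> the two kernels have equal mass, so
  \<open>telescope_bound\<close> applies to the last coordinate. The resulting bound depends on the
  parent label only, so the average under \<open>emp.R\<close> becomes one under
  \<open>q\<close>.\<close>

lemma variance_step:
  assumes m: "m < K" and f: "lip (Suc m) \<theta> f"
  shows "\<bar>\<Sum>x\<in>Om {1..m}. emp.R m x * (\<Sum>u\<in>F (Suc m).
      (coarse.ker (Suc m) (lab (P (Suc m)) J x) u - emp.ker (Suc m) (lab (P (Suc m)) J x) u) * f (x(Suc m := u)))\<bar>
    \<le> \<theta> * V (Suc m)"
proof -
  define k where "k = Suc m"
  have k: "k \<in> {1..K}" unfolding k_def using m by auto
  define \<phi> where "\<phi> l = (\<Sum>j<M. 1 / 2 ^ j * (\<Sum>A\<in>cells k (Suc j). \<bar>\<Sum>u | u \<in> F k \<and> c k (Suc j) u = A. coarse.ker k l u - emp.ker k l u\<bar>))" for l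
  have 1: "\<bar>\<Sum>u\<in>F k. (coarse.ker k (lab (P k) J x) u - emp.ker k (lab (P k) J x) u) * f (x(k := u))\<bar> \<le> \<theta> * \<phi> (lab (P k) J x)"
    if x: "x \<in> Om {1..m}" for x
    unfolding \<phi>_def cells_def
  proof (rule telescope_bound[where h = "\<lambda>u. f (x(k := u))"])
    fix u v j assume "u \<in> F k" "v \<in> F k" "c k j u = c k j v"
    then show "\<bar>f (x(k := u)) - f (x(k := v))\<bar> \<le> \<theta> / 2 ^ j"
      using x unfolding k_def by (intro lipD[OF f] Om_upd_Suc lab_upd_Suc refl)
  next
    have "lab (P k) J x \<in> Lab k" unfolding k_def by (rule coarse.lab_Lab[OF m x])
    then show "(\<Sum>u\<in>F k. coarse.ker k (lab (P k) J x) u - emp.ker k (lab (P k) J x) u) = 0"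
      unfolding sum_subtractf using coarse.ker_total[OF k] emp.ker_total[OF k] by simp
  qed (rule c_inj)
  have "\<bar>\<Sum>x\<in>Om {1..m}. emp.R m x * (\<Sum>u\<in>F k.
      (coarse.ker k (lab (P k) J x) u - emp.ker k (lab (P k) J x) u) * f (x(k := u)))\<bar> \<le>
    (\<Sum>x\<in>Om {1..m}. emp.R m x * (\<theta> * \<phi> (lab (P k) J x)))"
    by (rule abs_weighted_sum_le[OF emp.R_nonneg[OF less_imp_le[OF m]] 1])
  also have "\<dots> = \<theta> * (\<Sum>x\<in>Om {1..m}. emp.R m x * \<phi> (lab (P k) J x))"
    unfolding sum_distrib_left by (simp only: mult.left_commute)
  also have "(\<Sum>x\<in>Om {1..m}. emp.R m x * \<phi> (lab (P k) J x)) = (\<Sum>x\<in>Om {1..K}. q x * \<phi> (lab (P k) J x))"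
    unfolding k_def by (rule emp.marginal_parents[OF m])
  also have "\<dots> = (\<Sum>l\<in>Lab k. ql k l * \<phi> l)"
    using k coarse.lab_Lab_nodes by (intro sum_mass) auto
  also have "\<dots> = V k"
    unfolding \<phi>_def V_def W_def sum_distrib_left sum.swap[of _ "{..<M}" "Lab k"] by (simp only: mult.left_commute)
  finally show ?thesis unfolding k_def .
qed

text \<open>\<open>chain_error\<close> with the kernels of the true coarse chain: these satisfy the
  total variation bound \<open>ker_TV\<close>, whereas no such bound is available for the fitted
  kernels.\<close>

theorem variance:
  assumes f: "lip K \<theta> f"
  shows "\<bar>\<Sum>x\<in>Om {1..K}. (coarse.R K x - emp.R K x) * f x\<bar> \<le>
    \<theta> * (real K * (1 + \<Lambda>) ^ K * (\<Sum>k\<in>{1..K}. V k))"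
proof -
  define \<kappa>' where "\<kappa>' m x u = coarse.ker (Suc m) (lab (P (Suc m)) J x) u" for m x u
  have step: "\<bar>(\<Sum>x\<in>Om {1..Suc m}. (coarse.R (Suc m) x - emp.R (Suc m) x) * f x) -
       (\<Sum>x\<in>Om {1..m}. (coarse.R m x - emp.R m x) * (\<Sum>u\<in>F (Suc m). \<kappa>' m x u * f (x(Suc m := u))))\<bar>
     \<le> \<theta> * (\<Sum>k\<in>{1..K}. V k)"
    if m: "m < K" and f: "lip (Suc m) \<theta> f" for m f \<theta>
  proof -
    have eq: "(\<Sum>x\<in>Om {1..Suc m}. (coarse.R (Suc m) x - emp.R (Suc m) x) * f x) -
       (\<Sum>x\<in>Om {1..m}. (coarse.R m x - emp.R m x) * (\<Sum>u\<in>F (Suc m). \<kappa>' m x u * f (x(Suc m := u)))) =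
       (\<Sum>x\<in>Om {1..m}. emp.R m x * (\<Sum>u\<in>F (Suc m).
          (coarse.ker (Suc m) (lab (P (Suc m)) J x) u - emp.ker (Suc m) (lab (P (Suc m)) J x) u) * f (x(Suc m := u))))"
      unfolding sum_Om_Suc sum_subtractf[symmetric] sum_distrib_left coarse.R_Suc[OF m] emp.R_Suc[OF m] \<kappa>'_def
      by (intro sum.cong refl) (simp add: algebra_simps)
    have "V (Suc m) \<le> (\<Sum>k\<in>{1..K}. V k)"
      using m V_nonneg by (intro member_le_sum) auto
    then have "\<theta> * V (Suc m) \<le> \<theta> * (\<Sum>k\<in>{1..K}. V k)"
      using lip_nonneg[OF f] by (rule mult_left_mono)
    then show ?thesis unfolding eq by (rule order.trans[OF variance_step[OF m f]])
  qed
  show ?thesis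
  proof (rule chain_error[where \<kappa> = \<kappa>' and K = K and A = coarse.R and B = emp.R and \<Lambda> = \<Lambda>])
    fix m x y j assume m: "m < K" and x: "x \<in> Om {1..m}" and y: "y \<in> Om {1..m}" and xy: "lab {1..m} j x = lab {1..m} j y"
    have rest: "restrict x (P (Suc m)) \<in> Om (P (Suc m))" "restrict y (P (Suc m)) \<in> Om (P (Suc m))"
      using x y P_sub_Suc[OF m] restrict_Om by blast+
    have "lab (P (Suc m)) j (restrict x (P (Suc m))) = lab (P (Suc m)) j (restrict y (P (Suc m)))"
      using lab_mono[OF xy P_sub_Suc[OF m]] by simp
    from ker_TV[OF _ rest this] m
    show "(\<Sum>u\<in>F (Suc m). \<bar>\<kappa>' m x u - \<kappa>' m y u\<bar>) \<le> \<Lambda> / 2 ^ j"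
      unfolding \<kappa>'_def by simp
  next
    fix m x u assume "m < K" "x \<in> Om {1..m}" "u \<in> F (Suc m)"
    then show "0 \<le> \<kappa>' m x u" unfolding \<kappa>'_def by (intro coarse.ker_nonneg coarse.lab_Lab) auto
  next
    fix m x assume "m < K" "x \<in> Om {1..m}"
    then show "(\<Sum>u\<in>F (Suc m). \<kappa>' m x u) = 1"
      unfolding \<kappa>'_def by (intro coarse.ker_total coarse.lab_Lab) auto
  next
    show "0 \<le> (\<Sum>k\<in>{1..K}. V k)" by (intro sum_nonneg V_nonneg)
  qed (use step f \<Lambda>_nonneg in \<open>auto simp: chainw_def\<close>)
qed

end

section \<open>Coupling on a tree\<close>

text \<open>Greedy matching from the leaves to the root: each cell matches as much mass as both laws
  have in it before the surplus is passed to the next larger cell. Mass matched at level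
  \<open>j\<close> was left over in the cells of level \<open>Suc j\<close>, hence is at most their
  total discrepancy, and costs at most \<open>1 / 2 ^ j\<close> per unit.\<close>

lemma tree_coupling:
  fixes L :: "nat \<Rightarrow> 'a \<Rightarrow> 'c" and P Q :: "'a \<Rightarrow> real"
  assumes fin: "finite S" and refine: "\<And>j x y. L (Suc j) x = L (Suc j) y \<Longrightarrow> L j x = L j y"
    and root: "\<And>x y. x \<in> S \<Longrightarrow> y \<in> S \<Longrightarrow> L 0 x = L 0 y"
    and inj: "\<And>x y. x \<in> S \<Longrightarrow> y \<in> S \<Longrightarrow> L M x = L M y \<Longrightarrow> x = y"
    and P: "\<And>x. x \<in> S \<Longrightarrow> 0 \<le> P x" and P1: "(\<Sum>x\<in>S. P x) = 1"
    and Q: "\<And>x. x \<in> S \<Longrightarrow> 0 \<le> Q x" and Q1: "(\<Sum>x\<in>S. Q x) = 1"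
    and C0: "\<And>x y. x \<in> S \<Longrightarrow> y \<in> S \<Longrightarrow> 0 \<le> C x y"
    and C: "\<And>x y j. x \<in> S \<Longrightarrow> y \<in> S \<Longrightarrow> j \<le> M \<Longrightarrow> L j x = L j y \<Longrightarrow> C x y \<le> 1 / 2 ^ j"
  shows "\<exists>\<pi>. (\<forall>x\<in>S. \<forall>y\<in>S. 0 \<le> \<pi> x y) \<and>
    (\<forall>x\<in>S. (\<Sum>y\<in>S. \<pi> x y) = P x) \<and> (\<forall>y\<in>S. (\<Sum>x\<in>S. \<pi> x y) = Q y) \<and>
    (\<Sum>x\<in>S. \<Sum>y\<in>S. \<pi> x y * C x y) \<le>
      1 / 2 ^ M + (\<Sum>j<M. 1 / 2 ^ j * (\<Sum>A\<in>L (Suc j) ` S. \<bar>\<Sum>x | x \<in> S \<and> L (Suc j) x = A. P x - Q x\<bar>))"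
proof -
  define cell where "cell j A = {x. x \<in> S \<and> L j x = A}" for j A
  define gap where "gap j = (\<Sum>A\<in>L j ` S. \<bar>(\<Sum>x\<in>cell j A. P x) - (\<Sum>x\<in>cell j A. Q x)\<bar>)" for j
  have fin_cell [simp]: "finite (cell j A)" for j A unfolding cell_def using fin by simp
  have cell_sum: "(\<Sum>A\<in>L j ` S. \<Sum>x\<in>cell j A. f x) = (\<Sum>x\<in>S. f x)" for j and f :: "'a \<Rightarrow> real"
    unfolding cell_def using fin by (intro sum_fibres) auto
  \<comment> \<open>The invariant of the matching: a partial coupling inside the
    level-\<open>j\<close> cells whose mass in each cell is the smaller of the two masses, together
    with the cost so far.\<close>
  define good where "good j \<pi> \<longleftrightarrow>
     (\<forall>x\<in>S. \<forall>y\<in>S. 0 \<le> \<pi> x y \<and> (L j x \<noteq> L j y \<longrightarrow> \<pi> x y = 0)) \<and>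
     (\<forall>x\<in>S. (\<Sum>y\<in>S. \<pi> x y) \<le> P x) \<and> (\<forall>y\<in>S. (\<Sum>x\<in>S. \<pi> x y) \<le> Q y) \<and>
     (\<forall>A\<in>L j ` S. (\<Sum>x\<in>cell j A. \<Sum>y\<in>S. \<pi> x y) = min (\<Sum>x\<in>cell j A. P x) (\<Sum>x\<in>cell j A. Q x)) \<and>
     (\<Sum>x\<in>S. \<Sum>y\<in>S. \<pi> x y * C x y) \<le> 1 / 2 ^ M + (\<Sum>i\<in>{j..<M}. 1 / 2 ^ i * gap (Suc i))"
    for j and \<pi> :: "'a \<Rightarrow> 'a \<Rightarrow> real"
  have "\<exists>\<pi>. good j \<pi>" if "j \<le> M" for j
    using that
  proof (induction j rule: inc_induct)
    case base
    define \<pi> where "\<pi> x y = (if x = y then min (P x) (Q x) else 0)" for x y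
    have row: "(\<Sum>y\<in>S. \<pi> x y) = min (P x) (Q x)" if "x \<in> S" for x
      unfolding \<pi>_def using that fin by simp
    have col: "(\<Sum>x\<in>S. \<pi> x y) = min (P y) (Q y)" if "y \<in> S" for y
      unfolding \<pi>_def using that fin by (simp add: sum.delta)
    have "cell M (L M x) = {x}" if "x \<in> S" for x
      unfolding cell_def using inj[OF _ that] that by auto
    then have 4: "\<forall>A\<in>L M ` S. (\<Sum>x\<in>cell M A. \<Sum>y\<in>S. \<pi> x y) = min (\<Sum>x\<in>cell M A. P x) (\<Sum>x\<in>cell M A. Q x)"
      using row by auto
    have "(\<Sum>x\<in>S. \<Sum>y\<in>S. \<pi> x y * C x y) = (\<Sum>x\<in>S. min (P x) (Q x) * C x x)"
      unfolding \<pi>_def using fin by (intro sum.cong refl) (simp add: if_distrib[of "\<lambda>t. t * _"] cong: if_cong)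
    also have "\<dots> \<le> (\<Sum>x\<in>S. P x * (1 / 2 ^ M))"
    proof (intro sum_mono mult_mono)
      fix x assume "x \<in> S" then show "C x x \<le> 1 / 2 ^ M" "0 \<le> C x x" "0 \<le> P x" using C[of x x M] C0 P by auto
    qed simp
    also have "\<dots> = 1 / 2 ^ M" unfolding sum_distrib_right[symmetric] P1 by simp
    finally have "(\<Sum>x\<in>S. \<Sum>y\<in>S. \<pi> x y * C x y) \<le> 1 / 2 ^ M" .
    then have "good M \<pi>"
      unfolding good_def using row col 4 P Q by (auto simp: \<pi>_def)
    then show ?case by blast
  next
    case (step j)
    then obtain \<pi> where \<pi>: "good (Suc j) \<pi>" by blast
    define r where "r x = (\<Sum>y\<in>S. \<pi> x y)" for x
    define s where "s y = (\<Sum>x\<in>S. \<pi> x y)" for y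
    have nn: "0 \<le> \<pi> x y" if "x \<in> S" "y \<in> S" for x y using \<pi> that unfolding good_def by blast
    have diag: "L (Suc j) x = L (Suc j) y" if "x \<in> S" "y \<in> S" "\<pi> x y \<noteq> 0" for x y
      using \<pi> that unfolding good_def by blast
    have rP: "r x \<le> P x" if "x \<in> S" for x using \<pi> that unfolding good_def r_def by blast
    have sQ: "s x \<le> Q x" if "x \<in> S" for x using \<pi> that unfolding good_def s_def by blast
    have rmin: "(\<Sum>x\<in>cell (Suc j) B. r x) = min (\<Sum>x\<in>cell (Suc j) B. P x) (\<Sum>x\<in>cell (Suc j) B. Q x)"
      if "B \<in> L (Suc j) ` S" for B using \<pi> that unfolding good_def r_def by blast
    have cost: "(\<Sum>x\<in>S. \<Sum>y\<in>S. \<pi> x y * C x y) \<le> 1 / 2 ^ M + (\<Sum>i\<in>{Suc j..<M}. 1 / 2 ^ i * gap (Suc i))"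
      using \<pi> unfolding good_def by blast
    define a where "a A = (\<Sum>x\<in>cell j A. P x - r x)" for A
    define b where "b A = (\<Sum>x\<in>cell j A. Q x - s x)" for A
    define t where "t A = max (a A) (b A)" for A
    \<comment> \<open>The surpluses in a cell are matched proportionally. Dividing by the larger of
      the two totals exhausts the smaller one; if \<open>t\<close> is zero there is no surplus and
      the quotient is zero as well.\<close>
    define \<delta> where "\<delta> x y = (if L j x = L j y then (P x - r x) * (Q y - s y) / t (L j x) else 0)" for x y
    have a0: "0 \<le> a A" for A unfolding a_def using rP by (intro sum_nonneg) (auto simp: cell_def)
    have b0: "0 \<le> b A" for A unfolding b_def using sQ by (intro sum_nonneg) (auto simp: cell_def)
    have t0: "0 \<le> t A" for A unfolding t_def using a0[of A] by simp
    have \<delta>0: "0 \<le> \<delta> x y" if "x \<in> S" "y \<in> S" for x y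
      unfolding \<delta>_def using rP[OF that(1)] sQ[OF that(2)] t0 by auto
    have \<delta>row: "(\<Sum>y\<in>S. \<delta> x y) = (P x - r x) * (b (L j x) / t (L j x))" if "x \<in> S" for x
    proof -
      have "(\<Sum>y\<in>S. \<delta> x y) = (\<Sum>y\<in>cell j (L j x). (P x - r x) * (Q y - s y) / t (L j x))"
        unfolding \<delta>_def cell_def using fin by (intro sum.mono_neutral_cong_right) auto
      then show ?thesis unfolding b_def by (simp add: sum_distrib_left sum_divide_distrib)
    qed
    have \<delta>col: "(\<Sum>x\<in>S. \<delta> x y) = (Q y - s y) * (a (L j y) / t (L j y))" if "y \<in> S" for y
    proof -
      have "(\<Sum>x\<in>S. \<delta> x y) = (\<Sum>x\<in>cell j (L j y). (P x - r x) * (Q y - s y) / t (L j y))"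
        unfolding \<delta>_def cell_def using fin by (intro sum.mono_neutral_cong_right) auto
      then show ?thesis unfolding a_def by (simp add: sum_distrib_left sum_divide_distrib mult.commute)
    qed
    have bt: "b A / t A \<le> 1" "a A / t A \<le> 1" for A
      using a0[of A] b0[of A] unfolding t_def by (auto simp: divide_le_eq)
    have abt: "a A * (b A / t A) = min (a A) (b A)" for A
      using a0[of A] b0[of A] unfolding t_def min_def max_def by auto
    have \<delta>cell: "(\<Sum>x\<in>cell j A. \<Sum>y\<in>S. \<delta> x y) = min (a A) (b A)" for A
    proof -
      have "(\<Sum>x\<in>cell j A. \<Sum>y\<in>S. \<delta> x y) = (\<Sum>x\<in>cell j A. (P x - r x) * (b A / t A))"
        using \<delta>row by (intro sum.cong) (auto simp: cell_def)
      then show ?thesis unfolding sum_distrib_right[symmetric] a_def[symmetric] abt .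
    qed
    have off: "\<pi> x y = 0" if "x \<in> S" "y \<in> S" "L j x \<noteq> L j y" for x y
      using diag[OF that(1,2)] refine[of j x y] that(3) by blast
    then have off': "\<And>x y. x \<in> S \<Longrightarrow> y \<in> S \<Longrightarrow> \<pi> x y \<noteq> 0 \<Longrightarrow> L j y = L j x" by metis
    have rs: "(\<Sum>x\<in>cell j A. r x) = (\<Sum>y\<in>cell j A. s y)" for A
    proof -
      have "(\<Sum>x\<in>cell j A. r x) = (\<Sum>x\<in>cell j A. \<Sum>y\<in>cell j A. \<pi> x y)"
        unfolding r_def
      proof (rule sum.cong[OF refl])
        fix x assume x: "x \<in> cell j A"
        show "(\<Sum>y\<in>S. \<pi> x y) = (\<Sum>y\<in>cell j A. \<pi> x y)"
          using x off' fin unfolding cell_def by (intro sum.mono_neutral_right) auto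
      qed
      also have "\<dots> = (\<Sum>y\<in>cell j A. \<Sum>x\<in>cell j A. \<pi> x y)" by (rule sum.swap)
      also have "\<dots> = (\<Sum>y\<in>cell j A. s y)"
        unfolding s_def
      proof (rule sum.cong[OF refl])
        fix y assume y: "y \<in> cell j A"
        show "(\<Sum>x\<in>cell j A. \<pi> x y) = (\<Sum>x\<in>S. \<pi> x y)"
          using y off'[symmetric] fin unfolding cell_def by (intro sum.mono_neutral_left) auto
      qed
      finally show ?thesis .
    qed
    \<comment> \<open>The surplus of \<open>P\<close> in a cell of level \<open>Suc j\<close> is the
      positive part of the mass difference there.\<close>
    have sum_a: "(\<Sum>A\<in>L j ` S. a A) \<le> gap (Suc j)"
    proof -
      have "(\<Sum>A\<in>L j ` S. a A) = (\<Sum>B\<in>L (Suc j) ` S. \<Sum>x\<in>cell (Suc j) B. P x - r x)"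
        unfolding a_def cell_sum ..
      also have "\<dots> \<le> gap (Suc j)"
        unfolding gap_def using rmin by (intro sum_mono) (auto simp: sum_subtractf min_def)
      finally show ?thesis .
    qed
    have \<delta>cost: "(\<Sum>x\<in>S. \<Sum>y\<in>S. \<delta> x y * C x y) \<le> 1 / 2 ^ j * gap (Suc j)"
    proof -
      have "(\<Sum>x\<in>S. \<Sum>y\<in>S. \<delta> x y * C x y) \<le> (\<Sum>x\<in>S. \<Sum>y\<in>S. \<delta> x y * (1 / 2 ^ j))"
      proof (intro sum_mono)
        fix x y assume xy: "x \<in> S" "y \<in> S"
        show "\<delta> x y * C x y \<le> \<delta> x y * (1 / 2 ^ j)"
        proof (cases "L j x = L j y")
          case True
          then show ?thesis using xy step(1,2) by (intro mult_left_mono C \<delta>0) auto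
        qed (simp add: \<delta>_def)
      qed
      also have "\<dots> = 1 / 2 ^ j * (\<Sum>x\<in>S. \<Sum>y\<in>S. \<delta> x y)"
        by (simp add: sum_distrib_left)
      also have "(\<Sum>x\<in>S. \<Sum>y\<in>S. \<delta> x y) = (\<Sum>A\<in>L j ` S. min (a A) (b A))"
        using cell_sum[where j = j and f = "\<lambda>x. \<Sum>y\<in>S. \<delta> x y"] unfolding \<delta>cell by simp
      also have "1 / 2 ^ j * (\<Sum>A\<in>L j ` S. min (a A) (b A)) \<le> 1 / 2 ^ j * (\<Sum>A\<in>L j ` S. a A)"
        by (intro mult_left_mono sum_mono) auto
      also have "\<dots> \<le> 1 / 2 ^ j * gap (Suc j)" using sum_a by (intro mult_left_mono) auto
      finally show ?thesis .
    qed
    have "good j (\<lambda>x y. \<pi> x y + \<delta> x y)"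
      unfolding good_def
    proof (intro conjI ballI impI)
      fix x y assume xy: "x \<in> S" "y \<in> S"
      show "0 \<le> \<pi> x y + \<delta> x y" using nn \<delta>0 xy by simp
      assume "L j x \<noteq> L j y"
      then show "\<pi> x y + \<delta> x y = 0" using diag[OF xy] refine[of j x y] unfolding \<delta>_def by auto
    next
      fix x assume x: "x \<in> S"
      have "(P x - r x) * (b (L j x) / t (L j x)) \<le> (P x - r x) * 1"
        using rP[OF x] bt by (intro mult_left_mono) auto
      then show "(\<Sum>y\<in>S. \<pi> x y + \<delta> x y) \<le> P x"
        unfolding sum.distrib \<delta>row[OF x] r_def[symmetric] by simp
    next
      fix y assume y: "y \<in> S"
      have "(Q y - s y) * (a (L j y) / t (L j y)) \<le> (Q y - s y) * 1"
        using sQ[OF y] bt by (intro mult_left_mono) auto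
      then show "(\<Sum>x\<in>S. \<pi> x y + \<delta> x y) \<le> Q y"
        unfolding sum.distrib \<delta>col[OF y] s_def[symmetric] by simp
    next
      fix A
      have "a A = (\<Sum>x\<in>cell j A. P x) - (\<Sum>x\<in>cell j A. r x)" "b A = (\<Sum>x\<in>cell j A. Q x) - (\<Sum>x\<in>cell j A. r x)"
        unfolding a_def b_def sum_subtractf rs by auto
      then show "(\<Sum>x\<in>cell j A. \<Sum>y\<in>S. \<pi> x y + \<delta> x y) = min (\<Sum>x\<in>cell j A. P x) (\<Sum>x\<in>cell j A. Q x)"
        unfolding sum.distrib \<delta>cell r_def[symmetric] by auto
    next
      have "{j..<M} = insert j {Suc j..<M}" using step by auto
      then show "(\<Sum>x\<in>S. \<Sum>y\<in>S. (\<pi> x y + \<delta> x y) * C x y) \<le> 1 / 2 ^ M + (\<Sum>i\<in>{j..<M}. 1 / 2 ^ i * gap (Suc i))"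
        using cost \<delta>cost by (simp add: distrib_right sum.distrib)
    qed
    then show ?case by blast
  qed
  from this[of 0] obtain \<pi> where \<pi>: "good 0 \<pi>" by auto
  obtain x0 where x0: "x0 \<in> S" using P1 by fastforce
  have S: "cell 0 (L 0 x0) = S" unfolding cell_def using root[OF _ x0] by auto
  \<comment> \<open>At the root both laws have mass one, so everything is matched and the
    inequalities for the marginals become equalities.\<close>
  have total: "(\<Sum>x\<in>S. \<Sum>y\<in>S. \<pi> x y) = 1"
    using \<pi> x0 S P1 Q1 unfolding good_def by fastforce
  have row: "(\<Sum>y\<in>S. \<pi> x y) = P x" if "x \<in> S" for x
  proof (rule ccontr)
    assume "(\<Sum>y\<in>S. \<pi> x y) \<noteq> P x"
    then have "(\<Sum>x\<in>S. \<Sum>y\<in>S. \<pi> x y) < (\<Sum>x\<in>S. P x)"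
      using \<pi> that fin unfolding good_def by (intro sum_strict_mono_ex1) (auto simp: less_le)
    then show False using total P1 by simp
  qed
  have col: "(\<Sum>x\<in>S. \<pi> x y) = Q y" if "y \<in> S" for y
  proof (rule ccontr)
    assume "(\<Sum>x\<in>S. \<pi> x y) \<noteq> Q y"
    then have "(\<Sum>y\<in>S. \<Sum>x\<in>S. \<pi> x y) < (\<Sum>y\<in>S. Q y)"
      using \<pi> that fin unfolding good_def by (intro sum_strict_mono_ex1) (auto simp: less_le)
    then show False using total Q1 sum.swap[of \<pi> S S] by simp
  qed
  show ?thesis
  proof (intro exI[of _ \<pi>] conjI ballI)
    show "(\<Sum>x\<in>S. \<Sum>y\<in>S. \<pi> x y * C x y) \<le>
      1 / 2 ^ M + (\<Sum>j<M. 1 / 2 ^ j * (\<Sum>A\<in>L (Suc j) ` S. \<bar>\<Sum>x | x \<in> S \<and> L (Suc j) x = A. P x - Q x\<bar>))"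
      using \<pi> unfolding good_def gap_def cell_def sum_subtractf by (simp add: atLeast0LessThan)
  qed (use \<pi> row col in \<open>auto simp: good_def\<close>)
qed

section \<open>Quantisation of the cube\<close>

definition alphabet :: "(nat \<Rightarrow> nat) \<Rightarrow> nat \<Rightarrow> nat \<Rightarrow> (nat \<Rightarrow> nat) set" where
  "alphabet d M k = {..<d k} \<rightarrow>\<^sub>E {..<2 ^ M}"

text \<open>Deletes the last \<open>M - j\<close> binary digits. The subtraction is truncated, so
  all levels from \<open>M\<close> on are the finest one.\<close>

definition coarsen :: "(nat \<Rightarrow> nat) \<Rightarrow> nat \<Rightarrow> nat \<Rightarrow> nat \<Rightarrow> (nat \<Rightarrow> nat) \<Rightarrow> nat \<Rightarrow> nat" where
  "coarsen d M k j u = restrict (\<lambda>i. u i div 2 ^ (M - j)) {..<d k}"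

text \<open>The minimum puts the right end point \<open>1\<close> into the last interval.\<close>

definition quantize :: "(nat \<Rightarrow> nat) \<Rightarrow> nat \<Rightarrow> nat set \<Rightarrow> point \<Rightarrow> nat \<Rightarrow> nat \<Rightarrow> nat" where
  "quantize d M I x = restrict (\<lambda>k. restrict (\<lambda>i. min (nat \<lfloor>2 ^ M * x k i\<rfloor>) (2 ^ M - 1)) {..<d k}) I"

text \<open>The lower corner of each cell, a right inverse of \<open>quantize\<close> by
  \<open>quantize_grid\<close>.\<close>

definition grid :: "(nat \<Rightarrow> nat) \<Rightarrow> nat \<Rightarrow> nat set \<Rightarrow> (nat \<Rightarrow> nat \<Rightarrow> nat) \<Rightarrow> point" where
  "grid d M I b = restrict (\<lambda>k. restrict (\<lambda>i. real (b k i) / 2 ^ M) {..<d k}) I"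

interpretation T: tree "alphabet d M" "coarsen d M" for d M
proof
  show "finite (alphabet d M k)" "alphabet d M k \<noteq> {}" for k
  proof -
    have "restrict (\<lambda>_. 0) {..<d k} \<in> alphabet d M k" unfolding alphabet_def by auto
    then show "alphabet d M k \<noteq> {}" by blast
    show "finite (alphabet d M k)" unfolding alphabet_def by (intro finite_PiE) auto
  qed
  show "coarsen d M k j u = coarsen d M k j v" if eq: "coarsen d M k (Suc j) u = coarsen d M k (Suc j) v" for k j u v
  proof (cases "Suc j \<le> M")
    case True
    then have M: "M - j = Suc (M - Suc j)" by simp
    have "u i div 2 ^ (M - j) = v i div 2 ^ (M - j)" if "i < d k" for i
    proof -
      have "u i div 2 ^ (M - Suc j) = v i div 2 ^ (M - Suc j)"
        using fun_cong[OF eq, of i] that unfolding coarsen_def by simp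
      then show ?thesis unfolding M power_Suc2 div_mult2_eq by simp
    qed
    then show ?thesis unfolding coarsen_def by (auto simp: restrict_def)
  next
    case False
    then show ?thesis using eq unfolding coarsen_def by simp
  qed
  show "coarsen d M k 0 u = coarsen d M k 0 v" if "u \<in> alphabet d M k" "v \<in> alphabet d M k" for k u v
    using that unfolding coarsen_def alphabet_def by (auto simp: restrict_def fun_eq_iff PiE_def Pi_def)
qed

lemma coarsen_inj:
  assumes "u \<in> alphabet d M k" "v \<in> alphabet d M k" "coarsen d M k M u = coarsen d M k M v"
  shows "u = v"
  using assms unfolding coarsen_def alphabet_def by (simp add: PiE_restrict)

lemma coarsen_inj_iff:
  assumes "u \<in> alphabet d M k" "v \<in> alphabet d M k" "M \<le> j" "coarsen d M k j u = coarsen d M k j v"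
  shows "u = v"
  using assms unfolding coarsen_def alphabet_def by (simp add: PiE_restrict)

lemma card_coarsen:
  assumes "j \<le> M"
  shows "card (coarsen d M k j ` alphabet d M k) \<le> 2 ^ (j * d k)"
proof -
  have "coarsen d M k j ` alphabet d M k \<subseteq> {..<d k} \<rightarrow>\<^sub>E {..<2 ^ j}"
  proof
    fix a assume "a \<in> coarsen d M k j ` alphabet d M k"
    then obtain u where u: "u \<in> alphabet d M k" "a = coarsen d M k j u" by auto
    have "u i div 2 ^ (M - j) < 2 ^ j" if "i < d k" for i
    proof -
      have "u i < 2 ^ M" using u(1) that unfolding alphabet_def by auto
      also have "(2::nat) ^ M = 2 ^ j * 2 ^ (M - j)" using assms by (simp flip: power_add)
      finally show ?thesis by (simp add: less_mult_imp_div_less)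
    qed
    then show "a \<in> {..<d k} \<rightarrow>\<^sub>E {..<2 ^ j}" unfolding u(2) coarsen_def by auto
  qed
  then have "card (coarsen d M k j ` alphabet d M k) \<le> card ({..<d k} \<rightarrow>\<^sub>E {..<2 ^ j :: nat})"
    by (intro card_mono finite_PiE) auto
  also have "\<dots> = 2 ^ (j * d k)"
    by (simp add: card_PiE power_mult)
  finally show ?thesis .
qed

lemma quantize_restrict: "I' \<subseteq> I \<Longrightarrow> restrict (quantize d M I x) I' = quantize d M I' x"
  unfolding quantize_def by (auto simp: restrict_def fun_eq_iff)

lemma quantize_of_restrict: "I' \<subseteq> I \<Longrightarrow> quantize d M I' (restrict x I) = quantize d M I' x"
  unfolding quantize_def by (auto simp: restrict_def fun_eq_iff)

lemma quantize_Om [simp]: "quantize d M I x \<in> T.Om d M I"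
  unfolding quantize_def T.Om_def alphabet_def
  by (auto simp: min_less_iff_disj)

lemma space_Xs: "space (Xs d I) = PiE I (\<lambda>k. {..<d k} \<rightarrow>\<^sub>E {0..1})"
  unfolding Xs_def cube_def by (simp add: space_PiM space_restrict_space)

lemma grid_space: "b \<in> T.Om d M I \<Longrightarrow> grid d M I b \<in> space (Xs d I)"
proof -
  assume b: "b \<in> T.Om d M I"
  have "real (b k i) \<le> 2 ^ M" if "k \<in> I" "i < d k" for k i
  proof -
    have "b k i < 2 ^ M" using b that unfolding T.Om_def alphabet_def by fastforce
    then have "real (b k i) \<le> real (2 ^ M)" by (intro of_nat_mono) simp
    then show ?thesis by simp
  qed
  then show ?thesis
    unfolding grid_def space_Xs by (auto simp: divide_le_eq)
qed

lemma quantize_grid: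
  assumes "b \<in> T.Om d M I"
  shows "quantize d M I (grid d M I b) = b"
proof -
  have b: "b k i < 2 ^ M" if "k \<in> I" "i < d k" for k i
    using assms that unfolding T.Om_def alphabet_def by fastforce
  have "min (nat \<lfloor>2 ^ M * (real (b k i) / 2 ^ M)\<rfloor>) (2 ^ M - 1) = b k i" if "k \<in> I" "i < d k" for k i
    using b[OF that] by (simp add: min_def)
  then have "quantize d M I (grid d M I b) = restrict (\<lambda>k. restrict (b k) {..<d k}) I"
    unfolding quantize_def grid_def by (auto simp: restrict_def fun_eq_iff)
  also have "\<dots> = b"
    using assms unfolding T.Om_def alphabet_def by (auto simp: restrict_def fun_eq_iff PiE_def extensional_def Pi_def)
  finally show ?thesis .
qed

lemma quantize_interval:
  fixes t :: real
  assumes "0 \<le> t" "t \<le> 1"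
  shows "real (min (nat \<lfloor>2 ^ M * t\<rfloor>) (2 ^ M - 1)) \<le> 2 ^ M * t"
    "2 ^ M * t \<le> real (min (nat \<lfloor>2 ^ M * t\<rfloor>) (2 ^ M - 1)) + 1"
proof -
  have *: "real (nat \<lfloor>2 ^ M * t\<rfloor>) \<le> 2 ^ M * t" "2 ^ M * t \<le> real (nat \<lfloor>2 ^ M * t\<rfloor>) + 1"
    using assms by (auto simp: of_nat_nat)
  show "real (min (nat \<lfloor>2 ^ M * t\<rfloor>) (2 ^ M - 1)) \<le> 2 ^ M * t"
    by (rule order.trans[OF _ *(1)]) simp
  have "2 ^ M * t \<le> 2 ^ M" using assms by simp
  also have "\<dots> = real (2 ^ M - 1) + 1" by (simp add: of_nat_diff)
  finally show "2 ^ M * t \<le> real (min (nat \<lfloor>2 ^ M * t\<rfloor>) (2 ^ M - 1)) + 1"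
    using *(2) unfolding min_def by presburger
qed

text \<open>Equal quotients place both points in one closed dyadic interval of length
  \<open>1 / 2 ^ j\<close>. The upper bounds are not strict, because the last interval contains the
  point \<open>1\<close>.\<close>

lemma div_interval:
  fixes a b :: nat and s t :: real
  assumes j: "j \<le> M" and eq: "a div 2 ^ (M - j) = b div 2 ^ (M - j)"
    and s: "real a \<le> 2 ^ M * s" "2 ^ M * s \<le> real a + 1"
    and t: "real b \<le> 2 ^ M * t" "2 ^ M * t \<le> real b + 1"
  shows "\<bar>s - t\<bar> \<le> 1 / 2 ^ j"
proof -
  define N where "N = (2::nat) ^ (M - j)"
  define e where "e = a div N"
  have N: "0 < N" unfolding N_def by simp
  have M: "(2::real) ^ M = 2 ^ j * real N" unfolding N_def using j by (simp flip: power_add)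
  have bounds: "N * e \<le> n" "n + 1 \<le> N * (e + 1)" if "n div N = e" for n
    using that N div_times_less_eq_dividend[of n N] dividend_less_times_div[of N n]
    by (auto simp: mult.commute algebra_simps)
  have be: "b div N = e" using eq unfolding e_def N_def by simp
  note ba = bounds[OF e_def[symmetric]] bounds[OF be]
  have "real N * real e \<le> real a" "real a + 1 \<le> real N * (real e + 1)"
    "real N * real e \<le> real b" "real b + 1 \<le> real N * (real e + 1)"
    using ba by (metis of_nat_mult of_nat_le_iff, metis of_nat_mult of_nat_le_iff of_nat_add of_nat_1,
      metis of_nat_mult of_nat_le_iff, metis of_nat_mult of_nat_le_iff of_nat_add of_nat_1)
  then have "\<bar>2 ^ M * s - 2 ^ M * t\<bar> \<le> real N"
    using s t by (simp add: algebra_simps abs_le_iff)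
  then have "2 ^ M * \<bar>s - t\<bar> \<le> real N"
    by (simp add: abs_mult flip: right_diff_distrib)
  then show ?thesis using N unfolding M by (simp add: field_simps)
qed

lemma sup_dist_le:
  assumes I: "finite I" and x: "x \<in> space (Xs d I)" and y: "y \<in> space (Xs d I)" and j: "j \<le> M"
    and eq: "T.lab d M I j (quantize d M I x) = T.lab d M I j (quantize d M I y)"
  shows "sup_dist d I x y \<le> 1 / 2 ^ j"
proof -
  have "\<bar>x k i - y k i\<bar> \<le> 1 / 2 ^ j" if k: "k \<in> I" and i: "i < d k" for k i
  proof -
    let ?q = "\<lambda>t::real. min (nat \<lfloor>2 ^ M * t\<rfloor>) (2 ^ M - 1)"
    have xy: "0 \<le> x k i" "x k i \<le> 1" "0 \<le> y k i" "y k i \<le> 1"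
      using x y k i unfolding space_Xs by (auto simp: PiE_iff)
    have "coarsen d M k j (quantize d M I x k) i = coarsen d M k j (quantize d M I y k) i"
      using eq k unfolding T.lab_eq_iff by simp
    then have "?q (x k i) div 2 ^ (M - j) = ?q (y k i) div 2 ^ (M - j)"
      using k i unfolding coarsen_def quantize_def by simp
    then show ?thesis
      using quantize_interval[OF xy(1,2), of M] quantize_interval[OF xy(3,4), of M] by (intro div_interval[OF j])
  qed
  then show ?thesis
    unfolding sup_dist_def using I by (subst Max_le_iff) auto
qed

lemma sup_dist_nonneg: "finite I \<Longrightarrow> 0 \<le> sup_dist d I x y"
  unfolding sup_dist_def by (intro Max_ge) auto

lemma measurable_coordinate:
  assumes "k \<in> I" "i < d k"
  shows "(\<lambda>x. x k i) \<in> borel_measurable (Xs d I)"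
proof -
  have 1: "(\<lambda>x. x k) \<in> Xs d I \<rightarrow>\<^sub>M cube (d k)"
    unfolding Xs_def using assms(1) by (rule measurable_component_singleton)
  have "(\<lambda>v. v i) \<in> cube (d k) \<rightarrow>\<^sub>M restrict_space borel {0..1}"
    unfolding cube_def using assms(2) by (intro measurable_component_singleton) simp
  then have 2: "(\<lambda>v. v i) \<in> borel_measurable (cube (d k))"
    by (rule measurable_restrict_space2_iff[THEN iffD1, THEN conjunct1])
  show ?thesis using measurable_compose[OF 1 2] .
qed

lemma measurable_quantize:
  assumes I: "finite I" and I': "I' \<subseteq> I"
  shows "quantize d M I' \<in> Xs d I \<rightarrow>\<^sub>M count_space (T.Om d M I')"
proof (subst measurable_count_space_eq2)
  have fin: "finite I'" using I I' finite_subset by blast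
  show "finite (T.Om d M I')" using fin by simp
  show "quantize d M I' \<in> space (Xs d I) \<rightarrow> T.Om d M I' \<and>
    (\<forall>a\<in>T.Om d M I'. quantize d M I' -` {a} \<inter> space (Xs d I) \<in> sets (Xs d I))"
  proof (intro conjI ballI)
    fix a assume a: "a \<in> T.Om d M I'"
    have "quantize d M I' -` {a} \<inter> space (Xs d I) =
      {x \<in> space (Xs d I). \<forall>k\<in>I'. \<forall>i\<in>{..<d k}. min (nat \<lfloor>2 ^ M * x k i\<rfloor>) (2 ^ M - 1) = a k i}"
    proof -
      have "quantize d M I' x = a \<longleftrightarrow> (\<forall>k\<in>I'. \<forall>i\<in>{..<d k}. min (nat \<lfloor>2 ^ M * x k i\<rfloor>) (2 ^ M - 1) = a k i)" for x
      proof
        assume "\<forall>k\<in>I'. \<forall>i\<in>{..<d k}. min (nat \<lfloor>2 ^ M * x k i\<rfloor>) (2 ^ M - 1) = a k i"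
        then have "quantize d M I' x = restrict (\<lambda>k. restrict (a k) {..<d k}) I'"
          unfolding quantize_def by (auto simp: restrict_def fun_eq_iff)
        also have "\<dots> = a"
          using a unfolding T.Om_def alphabet_def
          by (auto simp: restrict_def fun_eq_iff PiE_def extensional_def Pi_def)
        finally show "quantize d M I' x = a" .
      qed (auto simp: quantize_def)
      then show ?thesis by auto
    qed
    also have "\<dots> \<in> sets (Xs d I)"
    proof (intro sets.sets_Collect_finite_All fin finite_lessThan)
      fix k i assume "k \<in> I'" "i \<in> {..<d k}"
      then have [measurable]: "(\<lambda>x. x k i) \<in> borel_measurable (Xs d I)"
        using I' by (intro measurable_coordinate) auto
      show "{x \<in> space (Xs d I). min (nat \<lfloor>2 ^ M * x k i\<rfloor>) (2 ^ M - 1) = a k i} \<in> sets (Xs d I)"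
        by measurable
    qed
    finally show "quantize d M I' -` {a} \<inter> space (Xs d I) \<in> sets (Xs d I)" .
  qed simp
qed

text \<open>The test function \<open>indicator A - 1 / 2\<close> is admissible and its constant
  cancels between probability measures. The supremum is over reals, so that it dominates this value
  only after the set is shown to be bounded above.\<close>

lemma TV_event:
  assumes M: "prob_space M" and N: "prob_space N" and sets: "sets M = sets N" and A: "A \<in> sets M"
  shows "measure M A - measure N A \<le> TV M N"
proof -
  interpret M: prob_space M by fact
  interpret N: prob_space N by fact
  have bound: "\<bar>\<integral>x. f x \<partial>L\<bar> \<le> 1 / 2"
    if "prob_space L" "f \<in> borel_measurable L" "\<forall>x\<in>space L. \<bar>f x\<bar> \<le> 1 / 2" for f :: "'a \<Rightarrow> real" and L
  proof -
    interpret L: prob_space L by fact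
    have f: "integrable L f"
      using that by (intro L.integrable_const_bound[where B = "1/2"]) (auto simp: AE_I2)
    have "(\<integral>x. f x \<partial>L) \<le> 1 / 2" using f that(3) by (intro L.integral_le_const AE_I2) (auto simp: abs_le_iff)
    moreover have "- (1 / 2) \<le> (\<integral>x. f x \<partial>L)"
      using f that(3) by (intro L.integral_ge_const AE_I2) (force simp: abs_le_iff)+
    ultimately show ?thesis by (simp add: abs_le_iff)
  qed
  define f :: "'a \<Rightarrow> real" where "f x = indicator A x - 1 / 2" for x
  have sp: "space M = space N" using sets by (rule sets_eq_imp_space_eq)
  have fin: "emeasure M A < top" "emeasure N A < top" by (auto simp: M.emeasure_eq_measure N.emeasure_eq_measure)
  have "measure M A - measure N A = (\<integral>x. f x \<partial>M) - (\<integral>x. f x \<partial>N)"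
    unfolding f_def using A sets fin sp M.prob_space N.prob_space
    by (simp add: Bochner_Integration.integral_diff sets.Int_space_eq2)
  also have "\<dots> \<le> TV M N"
    unfolding TV_def
  proof (rule cSUP_upper)
    show "f \<in> {f \<in> borel_measurable M. \<forall>x\<in>space M. \<bar>f x\<bar> \<le> 1 / 2}"
      using A unfolding f_def by (auto simp: indicator_def)
    have "(\<integral>x. f x \<partial>M) - (\<integral>x. f x \<partial>N) \<le> 1"
      if f: "f \<in> borel_measurable M" "\<forall>x\<in>space M. \<bar>f x\<bar> \<le> 1 / 2" for f :: "'a \<Rightarrow> real"
    proof -
      have "f \<in> borel_measurable N" using f(1) sets by (simp cong: measurable_cong_sets)
      then show ?thesis
        using bound[OF M, of f] bound[OF N, of f] f sp by (simp add: abs_le_iff)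
    qed
    then show "bdd_above ((\<lambda>f :: 'a \<Rightarrow> real. (\<integral>x. f x \<partial>M) - (\<integral>x. f x \<partial>N)) ` {f \<in> borel_measurable M. \<forall>x\<in>space M. \<bar>f x\<bar> \<le> 1 / 2})"
      by (intro bdd_aboveI[where M = 1]) auto
  qed
  finally show ?thesis .
qed

text \<open>For equal totals the positive and negative parts of the difference agree, so the sum is
  twice the excess on \<open>{x \<in> A. g x < f x}\<close>. This is the origin of the factor
  \<open>2\<close> in front of \<open>\<bar>L\<bar>\<close> later.\<close>

lemma sum_abs_diff_le:
  fixes f g :: "'a \<Rightarrow> real"
  assumes fin: "finite A" and eq: "sum f A = sum g A"
    and le: "\<And>S. S \<subseteq> A \<Longrightarrow> sum f S \<le> sum g S + b"
  shows "(\<Sum>x\<in>A. \<bar>f x - g x\<bar>) \<le> 2 * b"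
proof -
  let ?S = "{x \<in> A. g x < f x}"
  have "(\<Sum>x\<in>A. \<bar>f x - g x\<bar>) = (\<Sum>x\<in>A. 2 * (if x \<in> ?S then f x - g x else 0) - (f x - g x))"
    by (intro sum.cong) auto
  also have "\<dots> = 2 * (\<Sum>x\<in>A. if x \<in> ?S then f x - g x else 0) - (sum f A - sum g A)"
    by (simp add: sum_subtractf sum_distrib_left)
  also have "(\<Sum>x\<in>A. if x \<in> ?S then f x - g x else 0) = (\<Sum>x\<in>?S. f x - g x)"
    using fin by (intro sum.mono_neutral_cong_right) auto
  also have "\<dots> \<le> b" using le[of ?S] by (simp add: sum_subtractf)
  finally show ?thesis using eq by simp
qed

section \<open>The quantised law\<close>

locale law =
  fixes d :: "nat \<Rightarrow> nat" and M K :: nat and \<mu> :: "point measure"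
  assumes \<mu>_space: "\<mu> \<in> space (prob_algebra (Xs d {1..K}))"
begin

lemma sets_\<mu> [measurable_cong]: "sets \<mu> = sets (Xs d {1..K})" and prob_\<mu>: "prob_space \<mu>"
  using \<mu>_space by (auto simp: space_prob_algebra)

lemma space_\<mu>: "space \<mu> = space (Xs d {1..K})"
  using sets_\<mu> by (rule sets_eq_imp_space_eq)

sublocale \<mu>: prob_space \<mu> by (rule prob_\<mu>)

abbreviation Om where "Om \<equiv> T.Om d M"
abbreviation qz where "qz \<equiv> quantize d M"

definition p :: "(nat \<Rightarrow> nat \<Rightarrow> nat) \<Rightarrow> real" where
  "p a = measure \<mu> {x \<in> space \<mu>. qz {1..K} x = a}"

definition cell :: "nat set \<Rightarrow> (nat \<Rightarrow> nat \<Rightarrow> nat) set \<Rightarrow> point set" where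
  "cell I S = {y \<in> space (Xs d I). qz I y \<in> S}"

text \<open>Agrees with \<open>mass\<close> for the law \<open>p\<close>, but does not refer to a
  graph, so that kernels in both directions are treated before one is fixed.\<close>

definition cmass :: "((nat \<Rightarrow> nat \<Rightarrow> nat) \<Rightarrow> bool) \<Rightarrow> real" where
  "cmass E = sum p {a \<in> Om {1..K}. E a}"

lemma qz_measurable: "finite I \<Longrightarrow> qz I \<in> Xs d I \<rightarrow>\<^sub>M count_space (Om I)"
  by (rule measurable_quantize) auto

lemma cell_sets: "finite I \<Longrightarrow> S \<subseteq> Om I \<Longrightarrow> cell I S \<in> sets (Xs d I)"
  using measurable_sets[OF qz_measurable, of I S] unfolding cell_def vimage_def Int_def by (simp add: conj_commute)

lemma restrict_measurable: "I \<subseteq> I' \<Longrightarrow> (\<lambda>x. restrict x I) \<in> Xs d I' \<rightarrow>\<^sub>M Xs d I"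
  unfolding Xs_def by (rule measurable_restrict_subset)

lemma restrict_measurable_\<mu>: "I \<subseteq> {1..K} \<Longrightarrow> (\<lambda>x. restrict x I) \<in> \<mu> \<rightarrow>\<^sub>M Xs d I"
  unfolding measurable_cong_sets[OF sets_\<mu> refl] by (rule restrict_measurable)

lemma event_measurable: "{x \<in> space \<mu>. E (qz {1..K} x)} \<in> sets \<mu>"
proof -
  have "{x \<in> space \<mu>. E (qz {1..K} x)} = cell {1..K} {a \<in> Om {1..K}. E a}"
    unfolding cell_def space_\<mu> by auto
  then show ?thesis using cell_sets[of "{1..K}" "{a \<in> Om {1..K}. E a}"] sets_\<mu> by auto
qed

lemma cmass_eq: "cmass E = measure \<mu> {x \<in> space \<mu>. E (qz {1..K} x)}"
proof -
  have "{x \<in> space \<mu>. E (qz {1..K} x)} = (\<Union>a\<in>{a \<in> Om {1..K}. E a}. {x \<in> space \<mu>. qz {1..K} x = a})"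
    by auto
  moreover have "measure \<mu> (\<Union>a\<in>{a \<in> Om {1..K}. E a}. {x \<in> space \<mu>. qz {1..K} x = a}) = cmass E"
    unfolding cmass_def p_def using event_measurable[of "\<lambda>a. a = _"]
    by (intro \<mu>.finite_measure_finite_Union) (auto simp: disjoint_family_on_def)
  ultimately show ?thesis by simp
qed

lemma p_nonneg: "0 \<le> p a"
  unfolding p_def by simp

lemma p_total: "sum p (Om {1..K}) = 1"
  using cmass_eq[of "\<lambda>_. True"] \<mu>.prob_space unfolding cmass_def by simp

lemma cmass_restrict:
  assumes "I \<subseteq> {1..K}" "J \<subseteq> {1..K}"
  shows "cmass (\<lambda>a. restrict a I \<in> A \<and> restrict a J \<in> B) =
    measure \<mu> {x \<in> space \<mu>. restrict x I \<in> cell I A \<and> restrict x J \<in> cell J B}"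
proof -
  have "restrict x I \<in> space (Xs d I)" if "x \<in> space \<mu>" "I \<subseteq> {1..K}" for x I
    using measurable_space[OF restrict_measurable_\<mu>[OF that(2)] that(1)] .
  then have "{x \<in> space \<mu>. restrict (qz {1..K} x) I \<in> A \<and> restrict (qz {1..K} x) J \<in> B} =
    {x \<in> space \<mu>. restrict x I \<in> cell I A \<and> restrict x J \<in> cell J B}"
    using assms unfolding cell_def by (auto simp: quantize_restrict quantize_of_restrict)
  then show ?thesis unfolding cmass_eq by simp
qed

lemma cmass_fibres:
  assumes "finite Z" "\<And>a. a \<in> Om {1..K} \<Longrightarrow> E a \<Longrightarrow> h a \<in> Z"
  shows "(\<Sum>l\<in>Z. cmass (\<lambda>a. E a \<and> h a = l)) = cmass E"
proof -
  have "(\<Sum>l\<in>Z. cmass (\<lambda>a. E a \<and> h a = l)) = (\<Sum>l\<in>Z. \<Sum>x | x \<in> {x \<in> Om {1..K}. E x} \<and> h x = l. p x)"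
    unfolding cmass_def by (intro sum.cong refl arg_cong2[where f=sum]) auto
  also have "\<dots> = cmass E"
    unfolding cmass_def using assms by (intro sum_fibres) auto
  finally show ?thesis .
qed

text \<open>The quantised conditional law is an average of \<open>\<kappa>'\<close> over the points
  of a cell, and a Lipschitz bound for a kernel survives averaging. The index sets \<open>I\<close>
  and \<open>J\<close> are arbitrary, since the result is used from the parents to a node and from a
  node to its parents.\<close>

lemma averaged_kernel:
  assumes I: "I \<subseteq> {1..K}" and J: "J \<subseteq> {1..K}" and \<kappa>': "cond_dist d \<mu> I J \<kappa>'"
    and TV: "\<forall>x\<in>space (Xs d I). \<forall>y\<in>space (Xs d I). TV (\<kappa>' x) (\<kappa>' y) \<le> L * sup_dist d I x y"
  shows "\<exists>\<kappa>. (\<forall>z\<in>Om I. \<forall>v\<in>Om J. 0 \<le> \<kappa> z v) \<and> (\<forall>z\<in>Om I. (\<Sum>v\<in>Om J. \<kappa> z v) = 1) \<and>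
    (\<forall>z\<in>Om I. \<forall>v\<in>Om J. cmass (\<lambda>a. restrict a I = z \<and> restrict a J = v) = cmass (\<lambda>a. restrict a I = z) * \<kappa> z v) \<and>
    (\<forall>z\<in>Om I. \<forall>z'\<in>Om I. \<forall>j. T.lab d M I j z = T.lab d M I j z' \<longrightarrow>
       (\<Sum>v\<in>Om J. \<bar>\<kappa> z v - \<kappa> z' v\<bar>) \<le> 2 * \<bar>L\<bar> / 2 ^ j) \<and>
    (\<forall>y\<in>space (Xs d I). \<forall>S\<subseteq>Om J. measure (\<kappa>' y) (cell J S) \<le> (\<Sum>v\<in>S. \<kappa> (qz I y) v) + \<bar>L\<bar> / 2 ^ M)"
proof -
  have finI: "finite I" and finJ: "finite J" using I J finite_subset by auto
  note [simp] = finI finJ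
  have \<kappa>'_meas: "\<kappa>' \<in> Xs d I \<rightarrow>\<^sub>M prob_algebra (Xs d J)"
    and \<kappa>'_eq: "\<And>A B. A \<in> sets (Xs d I) \<Longrightarrow> B \<in> sets (Xs d J) \<Longrightarrow>
        emeasure \<mu> {x \<in> space \<mu>. restrict x I \<in> A \<and> restrict x J \<in> B} =
        (\<integral>\<^sup>+ y\<in>A. emeasure (\<kappa>' y) B \<partial>distr \<mu> (Xs d I) (\<lambda>x. restrict x I))"
    using \<kappa>' unfolding cond_dist_def by auto
  have \<kappa>'_prob: "prob_space (\<kappa>' y)" and \<kappa>'_sets: "sets (\<kappa>' y) = sets (Xs d J)" if "y \<in> space (Xs d I)" for y
    using measurable_space[OF \<kappa>'_meas that] by (auto simp: space_prob_algebra)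
  define \<nu> where "\<nu> = distr \<mu> (Xs d I) (\<lambda>x. restrict x I)"
  define k where "k y S = measure (\<kappa>' y) (cell J S)" for y S
  define m where "m z = cmass (\<lambda>a. restrict a I = z)" for z
  \<comment> \<open>For a cell without mass the kernel at its grid point is used, so that the
    Lipschitz bound holds at all letters.\<close>
  define \<kappa> where "\<kappa> z v = (if m z > 0 then cmass (\<lambda>a. restrict a I = z \<and> restrict a J = v) / m z
      else k (grid d M I z) {v})" for z v
  have m0: "0 \<le> m z" for z unfolding m_def cmass_eq by simp
  have cellJ: "S \<subseteq> Om J \<Longrightarrow> cell J S \<in> sets (Xs d J)" for S by (rule cell_sets) auto
  have cellI: "z \<in> Om I \<Longrightarrow> cell I {z} \<in> sets (Xs d I)" for z by (rule cell_sets) auto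
  have k_sum: "k y S = (\<Sum>v\<in>S. k y {v})" if y: "y \<in> space (Xs d I)" and S: "S \<subseteq> Om J" for y S
  proof -
    interpret P: prob_space "\<kappa>' y" using y by (rule \<kappa>'_prob)
    have "finite S" using S by (rule finite_subset) simp
    moreover have "cell J S = (\<Union>v\<in>S. cell J {v})" unfolding cell_def by auto
    moreover have "cell J {v} \<in> sets (\<kappa>' y)" if "v \<in> S" for v
      using cellJ[of "{v}"] S that unfolding \<kappa>'_sets[OF y] by auto
    ultimately show ?thesis
      unfolding k_def using P.finite_measure_finite_Union[of S "\<lambda>v. cell J {v}"]
      by (auto simp: disjoint_family_on_def cell_def)
  qed
  have k_total: "k y (Om J) = 1" if y: "y \<in> space (Xs d I)" for y
  proof -
    interpret P: prob_space "\<kappa>' y" using y by (rule \<kappa>'_prob)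
    have "cell J (Om J) = space (\<kappa>' y)"
      using sets_eq_imp_space_eq[OF \<kappa>'_sets[OF y]] unfolding cell_def by auto
    then show ?thesis unfolding k_def using P.prob_space by simp
  qed
  have k_lip: "k y S \<le> k y' S + \<bar>L\<bar> / 2 ^ j"
    if y: "y \<in> space (Xs d I)" "y' \<in> space (Xs d I)" and S: "S \<subseteq> Om J"
      and j: "T.lab d M I j (qz I y) = T.lab d M I j (qz I y')" "j \<le> M" for y y' S j
  proof -
    have "k y S - k y' S \<le> TV (\<kappa>' y) (\<kappa>' y')"
      unfolding k_def using y \<kappa>'_sets cellJ[OF S] by (intro TV_event \<kappa>'_prob) auto
    also have "\<dots> \<le> L * sup_dist d I y y'" using TV y by blast
    also have "\<dots> \<le> \<bar>L\<bar> * sup_dist d I y y'"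
      by (intro mult_right_mono sup_dist_nonneg) auto
    also have "\<dots> \<le> \<bar>L\<bar> * (1 / 2 ^ j)"
      by (intro mult_left_mono sup_dist_le[OF finI y j(2) j(1)]) auto
    finally show ?thesis by simp
  qed
  have \<kappa>_sum: "m z * (\<Sum>v\<in>S. \<kappa> z v) = cmass (\<lambda>a. restrict a I = z \<and> restrict a J \<in> S)"
    if "m z > 0" "S \<subseteq> Om J" for z S
  proof -
    have "finite S" using that(2) by (rule finite_subset) simp
    have "m z * (\<Sum>v\<in>S. \<kappa> z v) = (\<Sum>v\<in>S. cmass (\<lambda>a. (restrict a I = z \<and> restrict a J \<in> S) \<and> restrict a J = v))"
      unfolding sum_distrib_left
    proof (intro sum.cong refl)
      fix v assume "v \<in> S"
      then have "(\<lambda>a. (restrict a I = z \<and> restrict a J \<in> S) \<and> restrict a J = v) = (\<lambda>a. restrict a I = z \<and> restrict a J = v)"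
        by auto
      then show "m z * \<kappa> z v = cmass (\<lambda>a. (restrict a I = z \<and> restrict a J \<in> S) \<and> restrict a J = v)"
        unfolding \<kappa>_def using that(1) by simp
    qed
    also have "\<dots> = cmass (\<lambda>a. restrict a I = z \<and> restrict a J \<in> S)"
      using \<open>finite S\<close> by (intro cmass_fibres) auto
    finally show ?thesis .
  qed
  \<comment> \<open>An upper bound for \<open>\<kappa>'\<close> on the whole cell bounds its
    average; in the case without mass the grid point itself lies in the cell.\<close>
  have upper: "(\<Sum>v\<in>S. \<kappa> z v) \<le> t"
    if z: "z \<in> Om I" and S: "S \<subseteq> Om J" and t: "\<And>y. y \<in> cell I {z} \<Longrightarrow> k y S \<le> t" for z S t
  proof (cases "m z > 0")
    case True
    have "grid d M I z \<in> cell I {z}" unfolding cell_def using grid_space[OF z] quantize_grid[OF z] by simp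
    then have t0: "0 \<le> t" using t[of "grid d M I z"] unfolding k_def by (meson measure_nonneg order.trans)
    have "ennreal (cmass (\<lambda>a. restrict a I \<in> {z} \<and> restrict a J \<in> S)) =
      emeasure \<mu> {x \<in> space \<mu>. restrict x I \<in> cell I {z} \<and> restrict x J \<in> cell J S}"
      unfolding cmass_restrict[OF I J] by (simp add: \<mu>.emeasure_eq_measure)
    also have "\<dots> = (\<integral>\<^sup>+ y\<in>cell I {z}. emeasure (\<kappa>' y) (cell J S) \<partial>\<nu>)"
      unfolding \<nu>_def using cellI[OF z] cellJ[OF S] by (rule \<kappa>'_eq)
    also have "\<dots> \<le> (\<integral>\<^sup>+ y\<in>cell I {z}. ennreal t \<partial>\<nu>)"
    proof (intro nn_integral_mono)
      fix y
      show "emeasure (\<kappa>' y) (cell J S) * indicator (cell I {z}) y \<le> ennreal t * indicator (cell I {z}) y"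
      proof (cases "y \<in> cell I {z}")
        case True
        then have "y \<in> space (Xs d I)" unfolding cell_def by simp
        then interpret P: prob_space "\<kappa>' y" by (rule \<kappa>'_prob)
        show ?thesis using t[OF True] True unfolding k_def by (simp add: P.emeasure_eq_measure ennreal_leI)
      qed simp
    qed
    also have "\<dots> = ennreal t * emeasure \<nu> (cell I {z})"
      using cellI[OF z] by (simp add: \<nu>_def nn_integral_cmult_indicator)
    also have "emeasure \<nu> (cell I {z}) = ennreal (m z)"
    proof -
      have "emeasure \<nu> (cell I {z}) = emeasure \<mu> {x \<in> space \<mu>. restrict x I \<in> cell I {z} \<and> restrict x {} \<in> cell {} (Om {})}"
        unfolding \<nu>_def using cellI[OF z] restrict_measurable_\<mu>[OF I]
        by (subst emeasure_distr) (auto intro!: arg_cong2[where f = emeasure] simp: cell_def space_Xs quantize_def)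
      also have "\<dots> = ennreal (cmass (\<lambda>a. restrict a I \<in> {z} \<and> restrict a {} \<in> Om {}))"
        unfolding cmass_restrict[OF I empty_subsetI] by (simp add: \<mu>.emeasure_eq_measure)
      also have "\<dots> = ennreal (m z)" unfolding m_def by (simp add: restrict_def)
      finally show ?thesis .
    qed
    also have "ennreal t * ennreal (m z) = ennreal (t * m z)" using t0 m0 by (simp add: ennreal_mult)
    finally have "cmass (\<lambda>a. restrict a I \<in> {z} \<and> restrict a J \<in> S) \<le> t * m z"
      unfolding ennreal_le_iff[OF mult_nonneg_nonneg[OF t0 m0]] .
    then have "cmass (\<lambda>a. restrict a I = z \<and> restrict a J \<in> S) \<le> t * m z"
      by (simp only: singleton_iff)
    then have "m z * (\<Sum>v\<in>S. \<kappa> z v) \<le> m z * t" unfolding \<kappa>_sum[OF True S] by (simp add: mult.commute)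
    then show ?thesis using True by simp
  next
    case False
    have g: "grid d M I z \<in> cell I {z}" unfolding cell_def using grid_space[OF z] quantize_grid[OF z] by simp
    have "(\<Sum>v\<in>S. \<kappa> z v) = k (grid d M I z) S"
      unfolding k_sum[OF grid_space[OF z] S] using False by (simp add: \<kappa>_def)
    then show ?thesis using t[OF g] by simp
  qed
  have \<kappa>_nonneg: "0 \<le> \<kappa> z v" for z v
    unfolding \<kappa>_def cmass_eq k_def using m0 by simp
  have \<kappa>_total: "(\<Sum>v\<in>Om J. \<kappa> z v) = 1" if z: "z \<in> Om I" for z
  proof (cases "m z > 0")
    case True
    have "restrict a J \<in> Om J" if "a \<in> Om {1..K}" for a using that J by (rule T.restrict_Om)
    then have "cmass (\<lambda>a. restrict a I = z \<and> restrict a J \<in> Om J) = m z"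
      unfolding m_def cmass_def by (intro sum.cong) auto
    then show ?thesis using \<kappa>_sum[OF True, of "Om J"] True by simp
  next
    case False
    then show ?thesis using k_sum[OF grid_space[OF z], of "Om J"] k_total[OF grid_space[OF z]] by (simp add: \<kappa>_def)
  qed
  have \<kappa>_mass: "cmass (\<lambda>a. restrict a I = z \<and> restrict a J = v) = m z * \<kappa> z v" for z v
  proof (cases "m z > 0")
    case False
    then have "m z = 0" using m0[of z] by simp
    moreover have "cmass (\<lambda>a. restrict a I = z \<and> restrict a J = v) \<le> m z"
      unfolding m_def cmass_def using p_nonneg by (intro sum_mono2) auto
    moreover have "0 \<le> cmass (\<lambda>a. restrict a I = z \<and> restrict a J = v)" unfolding cmass_eq by simp
    ultimately show ?thesis by simp
  qed (simp add: \<kappa>_def)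
  have complement: "sum f S = 1 - sum f (Om J - S)" if "S \<subseteq> Om J" "sum f (Om J) = 1" for f :: "_ \<Rightarrow> real" and S
    using sum.subset_diff[OF that(1), of f] that(2) by simp
  \<comment> \<open>The opposite inequality follows from \<open>upper\<close> for the complement of
    \<open>S\<close>.\<close>
  have k_\<kappa>: "k y S \<le> (\<Sum>v\<in>S. \<kappa> z v) + \<bar>L\<bar> / 2 ^ j"
    if y: "y \<in> space (Xs d I)" and z: "z \<in> Om I" and S: "S \<subseteq> Om J"
      and j: "T.lab d M I j (qz I y) = T.lab d M I j z" "j \<le> M" for y z S j
  proof -
    have "(\<Sum>v\<in>Om J - S. \<kappa> z v) \<le> k y (Om J - S) + \<bar>L\<bar> / 2 ^ j"
      using y j by (intro upper[OF z] k_lip) (auto simp: cell_def)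
    moreover have "k y S = 1 - k y (Om J - S)"
      using complement[OF S, of "\<lambda>v. k y {v}"] k_sum[OF y, of "Om J"] k_total[OF y] k_sum[OF y S] k_sum[OF y, of "Om J - S"]
      by simp
    ultimately show ?thesis using complement[OF S \<kappa>_total[OF z]] by simp
  qed
  have \<kappa>_le: "(\<Sum>v\<in>S. \<kappa> z v) \<le> (\<Sum>v\<in>S. \<kappa> z' v) + \<bar>L\<bar> / 2 ^ j"
    if z: "z \<in> Om I" "z' \<in> Om I" and S: "S \<subseteq> Om J" and j: "T.lab d M I j z = T.lab d M I j z'" "j \<le> M" for z z' S j
    using z j by (intro upper[OF z(1) S] k_\<kappa>[OF _ z(2) S]) (auto simp: cell_def)
  have \<kappa>_TV: "(\<Sum>v\<in>Om J. \<bar>\<kappa> z v - \<kappa> z' v\<bar>) \<le> 2 * \<bar>L\<bar> / 2 ^ j"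
    if z: "z \<in> Om I" "z' \<in> Om I" and j: "T.lab d M I j z = T.lab d M I j z'" for z z' j
  proof (cases "j \<le> M")
    case True
    have "(\<Sum>v\<in>Om J. \<bar>\<kappa> z v - \<kappa> z' v\<bar>) \<le> 2 * (\<bar>L\<bar> / 2 ^ j)"
      using \<kappa>_total z j True by (intro sum_abs_diff_le \<kappa>_le) auto
    then show ?thesis by simp
  next
    case False
    \<comment> \<open>Beyond level \<open>M\<close> equal labels mean equal points, so no bound at
      the finer scale is required.\<close>
    have "z = z'"
    proof (rule PiE_ext[of z I "alphabet d M" z'])
      show "z \<in> PiE I (alphabet d M)" "z' \<in> PiE I (alphabet d M)" using z unfolding T.Om_def by auto
      fix i assume i: "i \<in> I"
      have "M \<le> j" using False by simp
      moreover have "z i \<in> alphabet d M i" "z' i \<in> alphabet d M i" using z i T.Om_app by auto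
      ultimately show "z i = z' i" using coarsen_inj_iff j i unfolding T.lab_eq_iff by blast
    qed
    then show ?thesis by simp
  qed
  show ?thesis
  proof (intro exI[of _ \<kappa>] conjI ballI allI impI)
    fix y S assume "y \<in> space (Xs d I)" "S \<subseteq> Om J"
    then show "measure (\<kappa>' y) (cell J S) \<le> (\<Sum>v\<in>S. \<kappa> (qz I y) v) + \<bar>L\<bar> / 2 ^ M"
      using k_\<kappa>[of y "qz I y" S M] unfolding k_def by simp
  qed (use \<kappa>_nonneg \<kappa>_total \<kappa>_mass \<kappa>_TV in \<open>auto simp: m_def\<close>)
qed

end

section \<open>Laws that factor along the graph\<close>

locale graph_law = law d M K \<mu>
  for d M K \<mu> +
  fixes G :: "(nat \<times> nat) set" and L :: real
  assumes dag: "sorted_dag K G" and conn: "\<forall>k\<in>{1..K}. fully_connected G (pa G k)"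
    and graph: "\<mu> \<in> graph_measures K d G" and lipschitz: "TV_lipschitz K d G L \<mu>"
begin

lemma pa_sub: "k \<in> {1..K} \<Longrightarrow> pa G k \<subseteq> {1..<k}"
  using dag unfolding sorted_dag_def pa_def by fastforce

lemma pa_nodes: "k \<in> {1..K} \<Longrightarrow> pa G k \<subseteq> {1..K}"
  using pa_sub by fastforce

lemma pa_Suc: "m < K \<Longrightarrow> pa G (Suc m) \<subseteq> {1..m}"
  using pa_sub[of "Suc m"] by (auto simp: less_Suc_eq_le)

definition \<kappa>0 :: "nat \<Rightarrow> point \<Rightarrow> point measure" where
  "\<kappa>0 = (SOME \<kappa>. (\<forall>k\<in>{1..K}. cond_dist d \<mu> (pa G k) {k} (\<kappa> k)) \<and> \<mu> = kernel_prod d G \<kappa> K)"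

lemma \<kappa>0_cond: "k \<in> {1..K} \<Longrightarrow> cond_dist d \<mu> (pa G k) {k} (\<kappa>0 k)"
  and \<mu>_eq: "\<mu> = kernel_prod d G \<kappa>0 K"
proof -
  have "\<exists>\<kappa>. (\<forall>k\<in>{1..K}. cond_dist d \<mu> (pa G k) {k} (\<kappa> k)) \<and> \<mu> = kernel_prod d G \<kappa> K"
    using graph unfolding graph_measures_def by blast
  from someI_ex[OF this] show "k \<in> {1..K} \<Longrightarrow> cond_dist d \<mu> (pa G k) {k} (\<kappa>0 k)" "\<mu> = kernel_prod d G \<kappa>0 K"
    unfolding \<kappa>0_def by auto
qed

lemma \<kappa>0_measurable: "k \<in> {1..K} \<Longrightarrow> \<kappa>0 k \<in> Xs d (pa G k) \<rightarrow>\<^sub>M prob_algebra (Xs d {k})"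
  using \<kappa>0_cond unfolding cond_dist_def by blast

text \<open>Treats nodes with and without parents alike. Without parents the condition is void, but
  the space of parent values is a single point and the distance of a law to itself is zero. Passing
  to \<open>\<bar>L\<bar>\<close> makes the constant nonnegative.\<close>

lemma lipschitz_version:
  assumes k: "k \<in> {1..K}"
  shows "\<exists>\<kappa>. cond_dist d \<mu> (pa G k) {k} \<kappa> \<and>
    (\<forall>x\<in>space (Xs d (pa G k)). \<forall>y\<in>space (Xs d (pa G k)). TV (\<kappa> x) (\<kappa> y) \<le> \<bar>L\<bar> * sup_dist d (pa G k) x y)"
proof (cases "pa G k = {}")
  case True
  have "TV (\<kappa>0 k x) (\<kappa>0 k y) \<le> \<bar>L\<bar> * sup_dist d {} x y" if "x \<in> space (Xs d {})" "y \<in> space (Xs d {})" for x y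
  proof -
    have xy: "x = y" using that unfolding space_Xs by simp
    have "prob_space (\<kappa>0 k y)"
      using measurable_space[OF \<kappa>0_measurable[OF k]] that True by (simp add: space_prob_algebra)
    then have ne: "{f \<in> borel_measurable (\<kappa>0 k y). \<forall>x\<in>space (\<kappa>0 k y). \<bar>f x\<bar> \<le> 1 / (2::real)} \<noteq> {}"
      by (intro ex_in_conv[THEN iffD1] exI[of _ "\<lambda>_. 0"]) simp
    have "TV (\<kappa>0 k y) (\<kappa>0 k y) = 0"
      unfolding TV_def using ne by (simp del: Collect_empty_eq)
    then show ?thesis using xy sup_dist_nonneg[of "{}" d x y] by simp
  qed
  then show ?thesis using \<kappa>0_cond[OF k] True by auto
next
  case False
  then have "2 \<le> k" using pa_sub[OF k] by (cases "k = 1") (use k in auto)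
  then have "TV_lipschitz_cond d \<mu> L (pa G k) {k}"
    using lipschitz k unfolding TV_lipschitz_def by auto
  then obtain \<kappa> where \<kappa>: "cond_dist d \<mu> (pa G k) {k} \<kappa>"
    "\<forall>x\<in>space (Xs d (pa G k)). \<forall>y\<in>space (Xs d (pa G k)). TV (\<kappa> x) (\<kappa> y) \<le> L * sup_dist d (pa G k) x y"
    unfolding TV_lipschitz_cond_def using False by auto
  have "finite (pa G k)" using pa_sub[OF k] finite_subset by blast
  then have "L * sup_dist d (pa G k) x y \<le> \<bar>L\<bar> * sup_dist d (pa G k) x y" for x y
    by (intro mult_right_mono sup_dist_nonneg) auto
  then show ?thesis using \<kappa> by (meson order.trans)
qed

lemma reverse_version:
  assumes k: "k \<in> {1..K}" and ne: "pa G k \<noteq> {}"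
  shows "\<exists>\<kappa>. cond_dist d \<mu> {k} (pa G k) \<kappa> \<and>
    (\<forall>x\<in>space (Xs d {k}). \<forall>y\<in>space (Xs d {k}). TV (\<kappa> x) (\<kappa> y) \<le> L * sup_dist d {k} x y)"
proof -
  have "2 \<le> k" using pa_sub[OF k] ne by (cases "k = 1") (use k in auto)
  then have "TV_lipschitz_cond d \<mu> L {k} (pa G k)"
    using lipschitz k unfolding TV_lipschitz_def by auto
  then show ?thesis unfolding TV_lipschitz_cond_def using ne by auto
qed

abbreviation Q :: "nat \<Rightarrow> point measure" where "Q \<equiv> kernel_prod d G \<kappa>0"

lemma step_measurable:
  assumes m: "m < K"
  shows "(\<lambda>x. distr (\<kappa>0 (Suc m) (restrict x (pa G (Suc m)))) (Xs d {1..Suc m})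
              (\<lambda>y. merge {1..m} {Suc m} (x, y))) \<in> Xs d {1..m} \<rightarrow>\<^sub>M prob_algebra (Xs d {1..Suc m})"
proof (rule measurable_distr_prob_space2)
  show "(\<lambda>x. \<kappa>0 (Suc m) (restrict x (pa G (Suc m)))) \<in> Xs d {1..m} \<rightarrow>\<^sub>M prob_algebra (Xs d {Suc m})"
    using m by (intro measurable_compose[OF restrict_measurable[OF pa_Suc[OF m]] \<kappa>0_measurable]) auto
  have "{1..m} \<union> {Suc m} = {1..Suc m}" by auto
  then show "(\<lambda>(x, y). merge {1..m} {Suc m} (x, y)) \<in> Xs d {1..m} \<Otimes>\<^sub>M Xs d {Suc m} \<rightarrow>\<^sub>M Xs d {1..Suc m}"
    using measurable_merge[of "{1..m}" "{Suc m}" "\<lambda>i. cube (d i)"] unfolding Xs_def case_prod_eta by (simp only:)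
qed

lemma Q_prob: "m \<le> K \<Longrightarrow> Q m \<in> space (prob_algebra (Xs d {1..m}))"
proof (induction m)
  case 0
  have "(\<lambda>_. undefined) \<in> space (Xs d {})" unfolding space_Xs by simp
  then show ?case by (simp add: space_prob_algebra prob_space_return)
next
  case (Suc m)
  then have m: "m < K" by simp
  have Q: "Q m \<in> space (prob_algebra (Xs d {1..m}))" using Suc by simp
  then have s: "sets (Q m) = sets (Xs d {1..m})" "prob_space (Q m)" by (auto simp: space_prob_algebra)
  have "space (Q m) \<noteq> {}" using s(2) prob_space.not_empty by blast
  have "prob_space (Q (Suc m))"
    using prob_space_bind'[OF Q step_measurable[OF m]] by simp
  moreover have "sets (Q (Suc m)) = sets (Xs d {1..Suc m})"
    using sets_bind'[OF Q step_measurable[OF m]] by simp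
  ultimately show ?case by (simp add: space_prob_algebra)
qed

lemma Q_event:
  assumes m: "m < K" and A: "A \<in> sets (Xs d {1..m})" and B: "B \<in> sets (Xs d {Suc m})"
  shows "emeasure (Q (Suc m)) {x \<in> space (Xs d {1..Suc m}). restrict x {1..m} \<in> A \<and> restrict x {Suc m} \<in> B} =
    (\<integral>\<^sup>+x\<in>A. emeasure (\<kappa>0 (Suc m) (restrict x (pa G (Suc m)))) B \<partial>Q m)"
proof -
  let ?E = "{x \<in> space (Xs d {1..Suc m}). restrict x {1..m} \<in> A \<and> restrict x {Suc m} \<in> B}"
  have Q: "Q m \<in> space (prob_algebra (Xs d {1..m}))" using Q_prob m by simp
  then have sp: "space (Q m) = space (Xs d {1..m})" by (auto simp: space_prob_algebra dest: sets_eq_imp_space_eq)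
  have E: "?E \<in> sets (Xs d {1..Suc m})"
  proof -
    have [measurable]: "(\<lambda>x. restrict x {1..m}) \<in> Xs d {1..Suc m} \<rightarrow>\<^sub>M Xs d {1..m}"
      "(\<lambda>x. restrict x {Suc m}) \<in> Xs d {1..Suc m} \<rightarrow>\<^sub>M Xs d {Suc m}"
      by (auto intro!: restrict_measurable)
    show ?thesis using A B by measurable
  qed
  have "emeasure (Q (Suc m)) ?E = (\<integral>\<^sup>+x. emeasure (distr (\<kappa>0 (Suc m) (restrict x (pa G (Suc m)))) (Xs d {1..Suc m})
              (\<lambda>y. merge {1..m} {Suc m} (x, y))) ?E \<partial>Q m)"
    using emeasure_bind_prob_algebra[OF Q step_measurable[OF m] E] by simp
  also have "\<dots> = (\<integral>\<^sup>+x\<in>A. emeasure (\<kappa>0 (Suc m) (restrict x (pa G (Suc m)))) B \<partial>Q m)"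
  proof (rule nn_integral_cong)
    fix x assume "x \<in> space (Q m)"
    then have x: "x \<in> space (Xs d {1..m})" using sp by simp
    have rx: "restrict x (pa G (Suc m)) \<in> space (Xs d (pa G (Suc m)))"
      using measurable_space[OF restrict_measurable[OF pa_Suc[OF m]] x] .
    let ?k = "\<kappa>0 (Suc m) (restrict x (pa G (Suc m)))"
    have k: "sets ?k = sets (Xs d {Suc m})"
      using measurable_space[OF \<kappa>0_measurable rx] m by (simp add: space_prob_algebra)
    have un: "{1..m} \<union> {Suc m} = {1..Suc m}" by auto
    have "merge {1..m} {Suc m} \<in> Xs d {1..m} \<Otimes>\<^sub>M Xs d {Suc m} \<rightarrow>\<^sub>M Xs d {1..Suc m}"
      using measurable_merge[of "{1..m}" "{Suc m}" "\<lambda>i. cube (d i)"] un unfolding Xs_def by simp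
    then have "(\<lambda>y. merge {1..m} {Suc m} (x, y)) \<in> Xs d {Suc m} \<rightarrow>\<^sub>M Xs d {1..Suc m}"
      using measurable_Pair1'[OF x] by (rule measurable_compose[rotated])
    then have mm: "(\<lambda>y. merge {1..m} {Suc m} (x, y)) \<in> ?k \<rightarrow>\<^sub>M Xs d {1..Suc m}"
      unfolding measurable_cong_sets[OF k refl] .
    have "(\<lambda>y. merge {1..m} {Suc m} (x, y)) -` ?E \<inter> space ?k = (if x \<in> A then B else {})"
    proof -
      have "restrict (merge {1..m} {Suc m} (x, y)) {1..m} = x" for y
        using x unfolding space_Xs by (auto simp: merge_def restrict_def fun_eq_iff PiE_def extensional_def)
      moreover have "restrict (merge {1..m} {Suc m} (x, y)) {Suc m} = y" if "y \<in> space ?k" for y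
        using that sets_eq_imp_space_eq[OF k] unfolding space_Xs
        by (auto simp: merge_def restrict_def fun_eq_iff PiE_def extensional_def)
      moreover have "B \<subseteq> space ?k" using sets.sets_into_space[OF B] sets_eq_imp_space_eq[OF k] by simp
      moreover have "merge {1..m} {Suc m} (x, y) \<in> space (Xs d {1..Suc m})" if "y \<in> space ?k" for y
        using measurable_space[OF mm that] .
      ultimately show ?thesis by (auto split: if_splits)
    qed
    then show "emeasure (distr ?k (Xs d {1..Suc m}) (\<lambda>y. merge {1..m} {Suc m} (x, y))) ?E =
      emeasure ?k B * indicator A x"
      by (subst emeasure_distr[OF mm E]) auto
  qed
  finally show ?thesis .
qed

lemma Q_marginal_Suc:
  assumes m: "m < K"
  shows "distr (Q (Suc m)) (Xs d {1..m}) (\<lambda>x. restrict x {1..m}) = Q m"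
proof (rule measure_eqI)
  have Q: "sets (Q m) = sets (Xs d {1..m})" "sets (Q (Suc m)) = sets (Xs d {1..Suc m})"
    using Q_prob[of m] Q_prob[of "Suc m"] m by (auto simp: space_prob_algebra)
  then show "sets (distr (Q (Suc m)) (Xs d {1..m}) (\<lambda>x. restrict x {1..m})) = sets (Q m)" by simp
  fix A assume "A \<in> sets (distr (Q (Suc m)) (Xs d {1..m}) (\<lambda>x. restrict x {1..m}))"
  then have A: "A \<in> sets (Xs d {1..m})" by simp
  have r: "(\<lambda>x. restrict x {1..m}) \<in> Q (Suc m) \<rightarrow>\<^sub>M Xs d {1..m}"
    unfolding measurable_cong_sets[OF Q(2) refl] by (rule restrict_measurable) auto
  have r2: "restrict x {Suc m} \<in> space (Xs d {Suc m})" if "x \<in> space (Xs d {1..Suc m})" for x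
    using measurable_space[OF restrict_measurable[of "{Suc m}" "{1..Suc m}"] that] by simp
  have "emeasure (distr (Q (Suc m)) (Xs d {1..m}) (\<lambda>x. restrict x {1..m})) A =
    emeasure (Q (Suc m)) {x \<in> space (Xs d {1..Suc m}). restrict x {1..m} \<in> A \<and> restrict x {Suc m} \<in> space (Xs d {Suc m})}"
    unfolding emeasure_distr[OF r A] using r2 sets_eq_imp_space_eq[OF Q(2)]
    by (intro arg_cong2[where f = emeasure]) auto
  also have "\<dots> = (\<integral>\<^sup>+x\<in>A. emeasure (\<kappa>0 (Suc m) (restrict x (pa G (Suc m)))) (space (Xs d {Suc m})) \<partial>Q m)"
    by (rule Q_event[OF m A]) simp
  also have "\<dots> = (\<integral>\<^sup>+x\<in>A. 1 \<partial>Q m)"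
  proof (rule nn_integral_cong)
    fix x assume "x \<in> space (Q m)"
    then have x: "x \<in> space (Xs d {1..m})" using sets_eq_imp_space_eq[OF Q(1)] by simp
    have rx: "restrict x (pa G (Suc m)) \<in> space (Xs d (pa G (Suc m)))"
      using measurable_space[OF restrict_measurable[OF pa_Suc[OF m]] x] .
    have "\<kappa>0 (Suc m) (restrict x (pa G (Suc m))) \<in> space (prob_algebra (Xs d {Suc m}))"
      using measurable_space[OF \<kappa>0_measurable rx] m by simp
    from in_space_prob_algebra[OF this]
    show "emeasure (\<kappa>0 (Suc m) (restrict x (pa G (Suc m)))) (space (Xs d {Suc m})) * indicator A x = 1 * indicator A x"
      by simp
  qed
  also have "\<dots> = emeasure (Q m) A" using A Q by simp
  finally show "emeasure (distr (Q (Suc m)) (Xs d {1..m}) (\<lambda>x. restrict x {1..m})) A = emeasure (Q m) A" .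
qed

text \<open>Removing the last node removes its factor from the product; descending from
  \<open>K\<close>, where the product is \<open>\<mu>\<close>, shows that the partial products are
  the marginals of \<open>\<mu>\<close>.\<close>

lemma Q_marginal: "m \<le> K \<Longrightarrow> distr \<mu> (Xs d {1..m}) (\<lambda>x. restrict x {1..m}) = Q m"
proof (induction m rule: inc_induct)
  case base
  have "distr \<mu> (Xs d {1..K}) (\<lambda>x. restrict x {1..K}) = distr \<mu> \<mu> (\<lambda>x. x)"
    using sets_\<mu> space_\<mu> by (intro distr_cong) (auto simp: space_Xs PiE_restrict)
  also have "\<dots> = \<mu>" by (rule distr_id)
  finally show ?case unfolding \<mu>_eq[symmetric] .
next
  case (step m)
  then have m: "m < K" by simp
  have "Q m = distr (distr \<mu> (Xs d {1..Suc m}) (\<lambda>x. restrict x {1..Suc m})) (Xs d {1..m}) (\<lambda>x. restrict x {1..m})"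
    unfolding step.IH using Q_marginal_Suc[OF m] by (rule sym)
  also have "\<dots> = distr \<mu> (Xs d {1..m}) ((\<lambda>x. restrict x {1..m}) \<circ> (\<lambda>x. restrict x {1..Suc m}))"
    using m by (intro distr_distr restrict_measurable restrict_measurable_\<mu>) auto
  also have "(\<lambda>x. restrict x {1..m}) \<circ> (\<lambda>x. restrict x {1..Suc m}) = (\<lambda>x::point. restrict x {1..m})"
    by (auto simp: restrict_def fun_eq_iff)
  finally show ?case ..
qed

text \<open>The kernels that build \<open>\<mu>\<close> need not be the Lipschitz ones. Both have
  the same integrals over all sets of parent values, so they agree almost surely on each fixed
  event, which suffices for exchanging them under integrals.\<close>

lemma version_AE:
  assumes k: "k \<in> {1..K}" and \<kappa>: "cond_dist d \<mu> (pa G k) {k} \<kappa>" and B: "B \<in> sets (Xs d {k})"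
  shows "AE y in distr \<mu> (Xs d (pa G k)) (\<lambda>x. restrict x (pa G k)). emeasure (\<kappa>0 k y) B = emeasure (\<kappa> y) B"
proof -
  let ?\<nu> = "distr \<mu> (Xs d (pa G k)) (\<lambda>x. restrict x (pa G k))"
  interpret \<nu>: prob_space ?\<nu>
    using restrict_measurable_\<mu>[OF pa_nodes[OF k]] by (rule \<mu>.prob_space_distr)
  have meas: "(\<lambda>y. emeasure (\<kappa>' y) B) \<in> borel_measurable ?\<nu>" if "cond_dist d \<mu> (pa G k) {k} \<kappa>'" for \<kappa>'
  proof -
    have "\<kappa>' \<in> Xs d (pa G k) \<rightarrow>\<^sub>M prob_algebra (Xs d {k})" using that unfolding cond_dist_def by simp
    from measurable_compose[OF measurable_prob_algebraD[OF this] measurable_emeasure_subprob_algebra[OF B]]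
    show ?thesis by simp
  qed
  show ?thesis
  proof (rule \<nu>.density_unique_finite_measure)
    fix A assume "A \<in> sets ?\<nu>"
    then have A: "A \<in> sets (Xs d (pa G k))" by simp
    show "(\<integral>\<^sup>+ y\<in>A. emeasure (\<kappa>0 k y) B \<partial>?\<nu>) = (\<integral>\<^sup>+ y\<in>A. emeasure (\<kappa> y) B \<partial>?\<nu>)"
      (is "?l = ?r")
    proof -
      have "emeasure \<mu> {x \<in> space \<mu>. restrict x (pa G k) \<in> A \<and> restrict x {k} \<in> B} = ?l"
        using \<kappa>0_cond[OF k] A B unfolding cond_dist_def by blast
      moreover have "emeasure \<mu> {x \<in> space \<mu>. restrict x (pa G k) \<in> A \<and> restrict x {k} \<in> B} = ?r"
        using \<kappa> A B unfolding cond_dist_def by blast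
      ultimately show ?thesis by (rule trans[OF sym])
    qed
  qed (use meas \<kappa> \<kappa>0_cond[OF k] in auto)
qed

end

abbreviation single :: "nat \<Rightarrow> (nat \<Rightarrow> nat) \<Rightarrow> nat \<Rightarrow> nat \<Rightarrow> nat" where
  "single k u \<equiv> (\<lambda>_. undefined)(k := u)"

context law
begin

lemma sum_single: "sum g (Om {k}) = (\<Sum>u\<in>alphabet d M k. g (single k u))"
  using T.sum_Om_insert[of k "{}" g d M] by (simp add: fun_upd_def)

lemma single_Om: "u \<in> alphabet d M k \<Longrightarrow> single k u \<in> Om {k}"
  using T.Om_upd[of "\<lambda>_. undefined" d M "{}" u k] by simp

lemma restrict_single: "restrict a {k} = single k u \<longleftrightarrow> a k = u"
  by (auto simp: restrict_def fun_eq_iff)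

lemma single_inj: "single k u = single k v \<longleftrightarrow> u = v"
  by (metis fun_upd_same)

end

section \<open>Kernels between the alphabets\<close>

context graph_law
begin

lemma graph_tree: "graph_tree (alphabet d M) (coarsen d M) K (pa G)"
proof (intro graph_tree.intro graph_tree_axioms.intro T.tree_axioms)
  show "pa G k \<subseteq> {1..<k}" if "k \<in> {1..K}" for k using pa_sub[OF that] .
  show "i \<in> pa G l" if "k \<in> {1..K}" "i \<in> pa G k" "l \<in> pa G k" "i < l" for k i l
    using conn that unfolding fully_connected_def pa_def by blast
qed

lemma mass_cmass: "graph_tree.mass (alphabet d M) K p E = cmass E"
  unfolding graph_tree.mass_def[OF graph_tree] cmass_def ..

text \<open>Collects what \<open>smooth_model\<close> demands of the forward kernel of a single
  node, so that the kernels can be chosen node by node.\<close>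

definition good_kernel :: "nat \<Rightarrow> ((nat \<Rightarrow> nat \<Rightarrow> nat) \<Rightarrow> (nat \<Rightarrow> nat) \<Rightarrow> real) \<Rightarrow> bool" where
  "good_kernel k \<kappa> \<longleftrightarrow>
    (\<forall>z\<in>Om (pa G k). \<forall>u\<in>alphabet d M k. 0 \<le> \<kappa> z u) \<and>
    (\<forall>z\<in>Om (pa G k). (\<Sum>u\<in>alphabet d M k. \<kappa> z u) = 1) \<and>
    (\<forall>z\<in>Om (pa G k). \<forall>u\<in>alphabet d M k.
       cmass (\<lambda>a. restrict a (pa G k) = z \<and> a k = u) = cmass (\<lambda>a. restrict a (pa G k) = z) * \<kappa> z u) \<and>
    (\<forall>z\<in>Om (pa G k). \<forall>z'\<in>Om (pa G k). \<forall>j. T.lab d M (pa G k) j z = T.lab d M (pa G k) j z' \<longrightarrow>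
       (\<Sum>u\<in>alphabet d M k. \<bar>\<kappa> z u - \<kappa> z' u\<bar>) \<le> 2 * \<bar>L\<bar> / 2 ^ j) \<and>
    (\<Sum>x\<in>Om {1..k - 1}. \<Sum>u\<in>alphabet d M k. \<bar>cmass (\<lambda>a. restrict a {1..k} = x(k := u))
        - cmass (\<lambda>a. restrict a {1..k - 1} = x) * \<kappa> (restrict x (pa G k)) u\<bar>) \<le> 2 * \<bar>L\<bar> / 2 ^ M"

text \<open>The Markov property in integrated form: the new node given the whole past is governed by
  its parents, for any version of the kernel, since \<open>version_AE\<close> is transported to the
  marginal \<open>Q m\<close> along the projection to the parents.\<close>

lemma joint_event:
  assumes m: "m < K" and A: "A \<in> sets (Xs d {1..m})" and B: "B \<in> sets (Xs d {Suc m})"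
    and \<kappa>: "cond_dist d \<mu> (pa G (Suc m)) {Suc m} \<kappa>"
  shows "emeasure \<mu> {x \<in> space \<mu>. restrict x {1..m} \<in> A \<and> restrict x {Suc m} \<in> B} =
    (\<integral>\<^sup>+x\<in>A. emeasure (\<kappa> (restrict x (pa G (Suc m)))) B \<partial>Q m)"
proof -
  let ?k = "Suc m" and ?P = "pa G (Suc m)"
  let ?E = "{x \<in> space (Xs d {1..Suc m}). restrict x {1..m} \<in> A \<and> restrict x {Suc m} \<in> B}"
  have k: "?k \<in> {1..K}" using m by simp
  have E: "?E \<in> sets (Xs d {1..Suc m})"
  proof -
    have [measurable]: "(\<lambda>x. restrict x {1..m}) \<in> Xs d {1..Suc m} \<rightarrow>\<^sub>M Xs d {1..m}"
      "(\<lambda>x. restrict x {Suc m}) \<in> Xs d {1..Suc m} \<rightarrow>\<^sub>M Xs d {Suc m}"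
      by (auto intro!: restrict_measurable)
    show ?thesis using A B by measurable
  qed
  have r: "(\<lambda>x. restrict x {1..?k}) \<in> \<mu> \<rightarrow>\<^sub>M Xs d {1..?k}"
    using m by (intro restrict_measurable_\<mu>) auto
  have "emeasure \<mu> {x \<in> space \<mu>. restrict x {1..m} \<in> A \<and> restrict x {Suc m} \<in> B} =
    emeasure (distr \<mu> (Xs d {1..?k}) (\<lambda>x. restrict x {1..?k})) ?E"
  proof (subst emeasure_distr[OF r E], intro arg_cong2[where f = emeasure] refl)
    have "restrict (restrict x {1..?k}) {1..m} = restrict x {1..m}" "restrict (restrict x {1..?k}) {?k} = restrict x {?k}"
      for x :: point by (auto simp: restrict_def fun_eq_iff)
    then show "{x \<in> space \<mu>. restrict x {1..m} \<in> A \<and> restrict x {Suc m} \<in> B} = (\<lambda>x. restrict x {1..?k}) -` ?E \<inter> space \<mu>"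
      using measurable_space[OF r] by auto
  qed
  also have "\<dots> = emeasure (Q ?k) ?E" using Q_marginal[of ?k] m by simp
  also have "\<dots> = (\<integral>\<^sup>+x\<in>A. emeasure (\<kappa>0 ?k (restrict x ?P)) B \<partial>Q m)" by (rule Q_event[OF m A B])
  also have "\<dots> = (\<integral>\<^sup>+x\<in>A. emeasure (\<kappa> (restrict x ?P)) B \<partial>Q m)"
  proof (rule nn_integral_cong_AE)
    have Qm: "sets (Q m) = sets (Xs d {1..m})" using Q_prob[of m] m by (simp add: space_prob_algebra)
    have rP: "(\<lambda>x. restrict x ?P) \<in> Q m \<rightarrow>\<^sub>M Xs d ?P"
      unfolding measurable_cong_sets[OF Qm refl] by (rule restrict_measurable[OF pa_Suc[OF m]])
    have "distr (Q m) (Xs d ?P) (\<lambda>x. restrict x ?P) = distr (distr \<mu> (Xs d {1..m}) (\<lambda>x. restrict x {1..m})) (Xs d ?P) (\<lambda>x. restrict x ?P)"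
      using Q_marginal[of m] m by simp
    also have "\<dots> = distr \<mu> (Xs d ?P) ((\<lambda>x. restrict x ?P) \<circ> (\<lambda>x. restrict x {1..m}))"
      using m by (intro distr_distr restrict_measurable restrict_measurable_\<mu> pa_Suc) auto
    also have "(\<lambda>x. restrict x ?P) \<circ> (\<lambda>x. restrict x {1..m}) = (\<lambda>x::point. restrict x ?P)"
      using pa_Suc[OF m] by (auto simp: restrict_def fun_eq_iff)
    finally have eq: "distr (Q m) (Xs d ?P) (\<lambda>x. restrict x ?P) = distr \<mu> (Xs d ?P) (\<lambda>x. restrict x ?P)" .
    have "AE y in distr (Q m) (Xs d ?P) (\<lambda>x. restrict x ?P). emeasure (\<kappa>0 ?k y) B = emeasure (\<kappa> y) B"
      unfolding eq by (rule version_AE[OF k \<kappa> B])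
    from AE_distrD[OF rP this]
    show "AE x in Q m. emeasure (\<kappa>0 ?k (restrict x ?P)) B * indicator A x = emeasure (\<kappa> (restrict x ?P)) B * indicator A x"
      by eventually_elim simp
  qed
  finally show ?thesis .
qed

text \<open>All but the last requirement come from \<open>averaged_kernel\<close>. For the almost
  Markov property, the law of node \<open>k\<close> given a finest cell of the past is an average of
  \<open>\<kappa>'\<close> over that cell, and there \<open>\<kappa>'\<close> differs from the
  quantised kernel by at most \<open>\<bar>L\<bar> / 2 ^ M\<close> on each event.\<close>

lemma good_kernel_ex:
  assumes k: "k \<in> {1..K}"
  shows "\<exists>\<kappa>. good_kernel k \<kappa>"
proof -
  let ?P = "pa G k"
  obtain m where m: "k = Suc m" "m < K" using k by (cases k) auto
  obtain \<kappa>' where \<kappa>': "cond_dist d \<mu> ?P {k} \<kappa>'"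
    "\<forall>x\<in>space (Xs d ?P). \<forall>y\<in>space (Xs d ?P). TV (\<kappa>' x) (\<kappa>' y) \<le> \<bar>L\<bar> * sup_dist d ?P x y"
    using lipschitz_version[OF k] by blast
  have "{k} \<subseteq> {1..K}" using k by auto
  from averaged_kernel[OF pa_nodes[OF k] this \<kappa>']
  obtain \<kappa>v where nonneg: "\<forall>z\<in>Om ?P. \<forall>v\<in>Om {k}. 0 \<le> \<kappa>v z v" and total: "\<forall>z\<in>Om ?P. (\<Sum>v\<in>Om {k}. \<kappa>v z v) = 1"
    and mass: "\<forall>z\<in>Om ?P. \<forall>v\<in>Om {k}. cmass (\<lambda>a. restrict a ?P = z \<and> restrict a {k} = v) = cmass (\<lambda>a. restrict a ?P = z) * \<kappa>v z v"
    and TV: "\<forall>z\<in>Om ?P. \<forall>z'\<in>Om ?P. \<forall>j. T.lab d M ?P j z = T.lab d M ?P j z' \<longrightarrow>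
       (\<Sum>v\<in>Om {k}. \<bar>\<kappa>v z v - \<kappa>v z' v\<bar>) \<le> 2 * \<bar>\<bar>L\<bar>\<bar> / 2 ^ j"
    and close: "\<forall>y\<in>space (Xs d ?P). \<forall>S\<subseteq>Om {k}. measure (\<kappa>' y) (cell {k} S) \<le> (\<Sum>v\<in>S. \<kappa>v (qz ?P y) v) + \<bar>\<bar>L\<bar>\<bar> / 2 ^ M"
    by blast
  define \<kappa> where "\<kappa> z u = \<kappa>v z (single k u)" for z u
  have Qm: "sets (Q m) = sets (Xs d {1..m})" "prob_space (Q m)"
    using Q_prob[of m] m by (auto simp: space_prob_algebra)
  interpret Qm: prob_space "Q m" by (rule Qm)
  have one: "(\<Sum>u\<in>alphabet d M k. \<bar>cmass (\<lambda>a. restrict a {1..k} = x(k := u)) -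
      cmass (\<lambda>a. restrict a {1..m} = x) * \<kappa> (restrict x ?P) u\<bar>) \<le> 2 * (cmass (\<lambda>a. restrict a {1..m} = x) * (\<bar>L\<bar> / 2 ^ M))"
    if x: "x \<in> Om {1..m}" for x
  proof -
    define cx where "cx = cmass (\<lambda>a. restrict a {1..m} = x)"
    have cx0: "0 \<le> cx" unfolding cx_def cmass_eq by simp
    have xP: "restrict x ?P \<in> Om ?P" using x pa_Suc[OF m(2)] unfolding m(1) by (rule T.restrict_Om)
    have ins: "{1..k} = insert k {1..m}" unfolding m(1) by auto
    have split: "restrict a {1..k} = x(k := u) \<longleftrightarrow> restrict a {1..m} = x \<and> a k = u" for a u
      unfolding ins by (rule T.restrict_insert_eq[OF x]) (simp add: m(1))
    have total_k: "(\<Sum>u\<in>alphabet d M k. cmass (\<lambda>a. restrict a {1..k} = x(k := u))) = cx"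
      unfolding split cx_def using k T.Om_app by (intro cmass_fibres) auto
    have cellx: "cell {1..m} {x} \<in> sets (Xs d {1..m})" using x by (intro cell_sets) auto
    have mx: "emeasure (Q m) (cell {1..m} {x}) = ennreal cx"
    proof -
      have r: "(\<lambda>x. restrict x {1..m}) \<in> \<mu> \<rightarrow>\<^sub>M Xs d {1..m}" using m by (intro restrict_measurable_\<mu>) auto
      have sub: "{1..m} \<subseteq> {1..K}" using m by auto
      have "emeasure (Q m) (cell {1..m} {x}) = emeasure (distr \<mu> (Xs d {1..m}) (\<lambda>x. restrict x {1..m})) (cell {1..m} {x})"
        using Q_marginal[of m] m by simp
      also have "\<dots> = emeasure \<mu> {y \<in> space \<mu>. restrict y {1..m} \<in> cell {1..m} {x} \<and> restrict y {1..m} \<in> cell {1..m} (Om {1..m})}"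
        unfolding emeasure_distr[OF r cellx] by (intro arg_cong2[where f = emeasure]) (auto simp: cell_def)
      also have "\<dots> = ennreal (cmass (\<lambda>a. restrict a {1..m} \<in> {x} \<and> restrict a {1..m} \<in> Om {1..m}))"
        unfolding cmass_restrict[OF sub sub] by (simp add: \<mu>.emeasure_eq_measure)
      also have "cmass (\<lambda>a. restrict a {1..m} \<in> {x} \<and> restrict a {1..m} \<in> Om {1..m}) = cx"
        unfolding cx_def cmass_def using x by (intro sum.cong) auto
      finally show ?thesis .
    qed
    \<comment> \<open>A one-sided bound for all \<open>S\<close> is enough: both families sum to
      \<open>cx\<close>, so \<open>sum_abs_diff_le\<close> converts it into the sum of absolute
      values.\<close>
    have upper: "(\<Sum>u\<in>S. cmass (\<lambda>a. restrict a {1..k} = x(k := u))) \<le> (\<Sum>u\<in>S. cx * \<kappa> (restrict x ?P) u) + cx * (\<bar>L\<bar> / 2 ^ M)"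
      if S: "S \<subseteq> alphabet d M k" for S
    proof -
      let ?S = "single k ` S"
      have S': "?S \<subseteq> Om {k}" using S single_Om by blast
      have finS: "finite S" using S by (rule finite_subset) simp
      have cellS: "cell {k} ?S \<in> sets (Xs d {k})" using S' by (intro cell_sets) auto
      define t where "t = (\<Sum>u\<in>S. \<kappa> (restrict x ?P) u) + \<bar>L\<bar> / 2 ^ M"
      have t0: "0 \<le> t"
        unfolding t_def \<kappa>_def using nonneg xP S single_Om by (intro add_nonneg_nonneg sum_nonneg) auto
      have kS: "(\<Sum>v\<in>?S. \<kappa>v z v) = (\<Sum>u\<in>S. \<kappa> z u)" for z
        unfolding \<kappa>_def by (subst sum.reindex) (auto simp: inj_on_def single_inj)
      have subs: "{1..m} \<subseteq> {1..K}" "{k} \<subseteq> {1..K}" using m by auto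
      have "(\<Sum>u\<in>S. cmass (\<lambda>a. restrict a {1..k} = x(k := u))) =
        (\<Sum>u\<in>S. cmass (\<lambda>a. (restrict a {1..m} = x \<and> a k \<in> S) \<and> a k = u))"
        unfolding split cmass_def by (intro sum.cong refl arg_cong2[where f = sum]) auto
      also have "\<dots> = cmass (\<lambda>a. restrict a {1..m} = x \<and> a k \<in> S)"
        using finS by (intro cmass_fibres) auto
      also have "\<dots> = cmass (\<lambda>a. restrict a {1..m} \<in> {x} \<and> restrict a {k} \<in> ?S)"
        unfolding cmass_def image_iff restrict_single by (intro sum.cong) auto
      finally have eq: "(\<Sum>u\<in>S. cmass (\<lambda>a. restrict a {1..k} = x(k := u))) = \<dots>" .
      have "ennreal (cmass (\<lambda>a. restrict a {1..m} \<in> {x} \<and> restrict a {k} \<in> ?S)) =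
        emeasure \<mu> {y \<in> space \<mu>. restrict y {1..m} \<in> cell {1..m} {x} \<and> restrict y {k} \<in> cell {k} ?S}"
        unfolding cmass_restrict[OF subs] by (simp add: \<mu>.emeasure_eq_measure)
      also have "\<dots> = (\<integral>\<^sup>+y\<in>cell {1..m} {x}. emeasure (\<kappa>' (restrict y ?P)) (cell {k} ?S) \<partial>Q m)"
        using joint_event[OF m(2) cellx, of "cell {k} ?S" \<kappa>'] cellS \<kappa>'(1) unfolding m(1) by blast
      also have "\<dots> \<le> (\<integral>\<^sup>+y\<in>cell {1..m} {x}. ennreal t \<partial>Q m)"
      proof (rule nn_integral_mono)
        fix y
        show "emeasure (\<kappa>' (restrict y ?P)) (cell {k} ?S) * indicator (cell {1..m} {x}) y \<le> ennreal t * indicator (cell {1..m} {x}) y"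
        proof (cases "y \<in> cell {1..m} {x}")
          case True
          then have y: "y \<in> space (Xs d {1..m})" "qz {1..m} y = x" unfolding cell_def by auto
          have sub: "?P \<subseteq> {1..m}" using pa_Suc[OF m(2)] unfolding m(1) .
          have yP: "restrict y ?P \<in> space (Xs d ?P)"
            using measurable_space[OF restrict_measurable[OF sub] y(1)] .
          have "\<kappa>' \<in> Xs d ?P \<rightarrow>\<^sub>M prob_algebra (Xs d {k})" using \<kappa>'(1) unfolding cond_dist_def by simp
          from measurable_space[OF this yP] interpret P: prob_space "\<kappa>' (restrict y ?P)"
            by (simp add: space_prob_algebra)
          have qP: "qz ?P (restrict y ?P) = restrict x ?P"
            using y(2) quantize_restrict[OF sub, of d M y] quantize_of_restrict[of ?P ?P d M y] by simp
          then have "measure (\<kappa>' (restrict y ?P)) (cell {k} ?S) \<le> t"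
            using close[rule_format, OF yP S'] unfolding qP kS t_def by simp
          then show ?thesis using True by (simp add: P.emeasure_eq_measure ennreal_leI)
        qed simp
      qed
      also have "\<dots> = ennreal t * ennreal cx"
        unfolding mx[symmetric] using cellx Qm(1) by (simp add: nn_integral_cmult_indicator)
      also have "\<dots> = ennreal (t * cx)" using t0 cx0 by (simp add: ennreal_mult)
      finally have "cmass (\<lambda>a. restrict a {1..m} \<in> {x} \<and> restrict a {k} \<in> ?S) \<le> t * cx"
        unfolding ennreal_le_iff[OF mult_nonneg_nonneg[OF t0 cx0]] .
      then show ?thesis unfolding eq t_def by (simp only: distrib_left sum_distrib_left[symmetric] mult.commute[of _ cx])
    qed
    have "(\<Sum>u\<in>alphabet d M k. \<kappa> (restrict x ?P) u) = 1"
      using total xP unfolding \<kappa>_def sum_single by blast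
    then have "(\<Sum>u\<in>alphabet d M k. cx * \<kappa> (restrict x ?P) u) = cx"
      by (simp flip: sum_distrib_left)
    then show ?thesis
      unfolding cx_def[symmetric] using upper total_k by (intro sum_abs_diff_le) auto
  qed
  have "(\<Sum>x\<in>Om {1..m}. cmass (\<lambda>a. restrict a {1..m} = x)) = 1"
  proof -
    have "(\<Sum>x\<in>Om {1..m}. cmass (\<lambda>a. True \<and> restrict a {1..m} = x)) = cmass (\<lambda>_. True)"
      using m T.restrict_Om[of _ d M "{1..K}" "{1..m}"] by (intro cmass_fibres) auto
    then show ?thesis using p_total unfolding cmass_def by simp
  qed
  then have "(\<Sum>x\<in>Om {1..m}. 2 * (cmass (\<lambda>a. restrict a {1..m} = x) * (\<bar>L\<bar> / 2 ^ M))) = 2 * \<bar>L\<bar> / 2 ^ M"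
    unfolding sum_distrib_left[symmetric] sum_distrib_right[symmetric] by simp
  moreover have "(\<Sum>x\<in>Om {1..m}. \<Sum>u\<in>alphabet d M k. \<bar>cmass (\<lambda>a. restrict a {1..k} = x(k := u))
        - cmass (\<lambda>a. restrict a {1..m} = x) * \<kappa> (restrict x ?P) u\<bar>) \<le>
      (\<Sum>x\<in>Om {1..m}. 2 * (cmass (\<lambda>a. restrict a {1..m} = x) * (\<bar>L\<bar> / 2 ^ M)))"
    by (intro sum_mono one)
  moreover have "cmass (\<lambda>a. restrict a ?P = z \<and> a k = u) = cmass (\<lambda>a. restrict a ?P = z) * \<kappa> z u"
    if "z \<in> Om ?P" "u \<in> alphabet d M k" for z u
    using mass[rule_format, OF that(1) single_Om[OF that(2)]] unfolding restrict_single \<kappa>_def .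
  ultimately have "good_kernel k \<kappa>"
    unfolding good_kernel_def using nonneg total TV single_Om m(1)
    by (auto simp: \<kappa>_def sum_single restrict_single)
  then show ?thesis by blast
qed

text \<open>For the quantised reverse kernel each cross difference is the product of the two letter
  masses with a difference of kernel values, so the Lipschitz bound of
  \<open>averaged_kernel\<close> applies. Without parents the difference is zero.\<close>

lemma reverse_kernel:
  assumes k: "k \<in> {1..K}" and u: "u \<in> alphabet d M k" and v: "v \<in> alphabet d M k"
    and eq: "coarsen d M k J u = coarsen d M k J v"
  shows "(\<Sum>z\<in>Om (pa G k). \<bar>cmass (\<lambda>x. restrict x (pa G k) = z \<and> x k = u) * cmass (\<lambda>x. x k = v)
        - cmass (\<lambda>x. restrict x (pa G k) = z \<and> x k = v) * cmass (\<lambda>x. x k = u)\<bar>)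
      \<le> 2 * \<bar>L\<bar> / 2 ^ J * (cmass (\<lambda>x. x k = u) * cmass (\<lambda>x. x k = v))"
proof (cases "pa G k = {}")
  case True
  have "restrict x {} = (\<lambda>_. undefined)" for x :: "nat \<Rightarrow> nat \<Rightarrow> nat" by (simp add: restrict_def)
  then show ?thesis unfolding True by (simp add: cmass_eq)
next
  case False
  let ?P = "pa G k"
  obtain \<kappa>' where \<kappa>': "cond_dist d \<mu> {k} ?P \<kappa>'"
    "\<forall>x\<in>space (Xs d {k}). \<forall>y\<in>space (Xs d {k}). TV (\<kappa>' x) (\<kappa>' y) \<le> L * sup_dist d {k} x y"
    using reverse_version[OF k False] by blast
  have "{k} \<subseteq> {1..K}" using k by auto
  from averaged_kernel[OF this pa_nodes[OF k] \<kappa>']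
  obtain \<kappa> where mass: "\<forall>z\<in>Om {k}. \<forall>v\<in>Om ?P. cmass (\<lambda>a. restrict a {k} = z \<and> restrict a ?P = v) = cmass (\<lambda>a. restrict a {k} = z) * \<kappa> z v"
    and TV: "\<forall>z\<in>Om {k}. \<forall>z'\<in>Om {k}. \<forall>j. T.lab d M {k} j z = T.lab d M {k} j z' \<longrightarrow>
       (\<Sum>v\<in>Om ?P. \<bar>\<kappa> z v - \<kappa> z' v\<bar>) \<le> 2 * \<bar>L\<bar> / 2 ^ j"
    by blast
  have m: "cmass (\<lambda>x. restrict x ?P = z \<and> x k = w) = cmass (\<lambda>x. x k = w) * \<kappa> (single k w) z"
    if "z \<in> Om ?P" "w \<in> alphabet d M k" for z w
    using mass[rule_format, OF single_Om[OF that(2)] that(1)] unfolding restrict_single by (simp add: conj_commute)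
  have nn: "0 \<le> cmass E" for E unfolding cmass_eq by simp
  have "(\<Sum>z\<in>Om ?P. \<bar>cmass (\<lambda>x. restrict x ?P = z \<and> x k = u) * cmass (\<lambda>x. x k = v)
        - cmass (\<lambda>x. restrict x ?P = z \<and> x k = v) * cmass (\<lambda>x. x k = u)\<bar>) =
     (\<Sum>z\<in>Om ?P. (cmass (\<lambda>x. x k = u) * cmass (\<lambda>x. x k = v)) * \<bar>\<kappa> (single k u) z - \<kappa> (single k v) z\<bar>)"
  proof (intro sum.cong refl)
    fix z assume z: "z \<in> Om ?P"
    have "cmass (\<lambda>x. restrict x ?P = z \<and> x k = u) * cmass (\<lambda>x. x k = v)
        - cmass (\<lambda>x. restrict x ?P = z \<and> x k = v) * cmass (\<lambda>x. x k = u) =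
      (cmass (\<lambda>x. x k = u) * cmass (\<lambda>x. x k = v)) * (\<kappa> (single k u) z - \<kappa> (single k v) z)"
      unfolding m[OF z u] m[OF z v] by (simp add: algebra_simps)
    then show "\<bar>cmass (\<lambda>x. restrict x ?P = z \<and> x k = u) * cmass (\<lambda>x. x k = v)
        - cmass (\<lambda>x. restrict x ?P = z \<and> x k = v) * cmass (\<lambda>x. x k = u)\<bar> =
      (cmass (\<lambda>x. x k = u) * cmass (\<lambda>x. x k = v)) * \<bar>\<kappa> (single k u) z - \<kappa> (single k v) z\<bar>"
      by (simp only: abs_mult abs_of_nonneg[OF nn])
  qed
  also have "\<dots> = (cmass (\<lambda>x. x k = u) * cmass (\<lambda>x. x k = v)) * (\<Sum>z\<in>Om ?P. \<bar>\<kappa> (single k u) z - \<kappa> (single k v) z\<bar>)"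
    by (rule sum_distrib_left[symmetric])
  also have "\<dots> \<le> (cmass (\<lambda>x. x k = u) * cmass (\<lambda>x. x k = v)) * (2 * \<bar>L\<bar> / 2 ^ J)"
  proof (rule mult_left_mono)
    have "T.lab d M {k} J (single k u) = T.lab d M {k} J (single k v)" using eq by (simp add: T.lab_eq_iff)
    then show "(\<Sum>z\<in>Om ?P. \<bar>\<kappa> (single k u) z - \<kappa> (single k v) z\<bar>) \<le> 2 * \<bar>L\<bar> / 2 ^ J"
      using TV single_Om[OF u] single_Om[OF v] by blast
  qed (intro mult_nonneg_nonneg nn)
  finally show ?thesis by (simp only: mult.commute)
qed

lemma smooth_model_ex:
  "\<exists>\<kappa>. smooth_model (alphabet d M) (coarsen d M) K (pa G) J p \<kappa> (2 * \<bar>L\<bar>) (2 * \<bar>L\<bar> / 2 ^ M)"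
proof -
  have "\<forall>k\<in>{1..K}. \<exists>\<kappa>. good_kernel k \<kappa>" using good_kernel_ex by blast
  then obtain \<kappa> where \<kappa>: "\<And>k. k \<in> {1..K} \<Longrightarrow> good_kernel k (\<kappa> k)" by metis
  have "smooth_model (alphabet d M) (coarsen d M) K (pa G) J p \<kappa> (2 * \<bar>L\<bar>) (2 * \<bar>L\<bar> / 2 ^ M)"
  proof (intro smooth_model.intro smooth_model_axioms.intro graph_tree, unfold mass_cmass)
    show "0 \<le> p x" for x by (rule p_nonneg)
    show "sum p (Om {1..K}) = 1" by (rule p_total)
  next
    fix k u v assume "k \<in> {1..K}" "u \<in> alphabet d M k" "v \<in> alphabet d M k" "coarsen d M k J u = coarsen d M k J v"
    then show "(\<Sum>z\<in>Om (pa G k). \<bar>cmass (\<lambda>x. restrict x (pa G k) = z \<and> x k = u) * cmass (\<lambda>x. x k = v)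
        - cmass (\<lambda>x. restrict x (pa G k) = z \<and> x k = v) * cmass (\<lambda>x. x k = u)\<bar>)
      \<le> 2 * \<bar>L\<bar> / 2 ^ J * (cmass (\<lambda>x. x k = u) * cmass (\<lambda>x. x k = v))"
      by (rule reverse_kernel)
  next
    fix m assume "m < K"
    then have "good_kernel (Suc m) (\<kappa> (Suc m))" using \<kappa> by simp
    then show "(\<Sum>x\<in>Om {1..m}. \<Sum>u\<in>alphabet d M (Suc m). \<bar>cmass (\<lambda>y. restrict y {1..Suc m} = x(Suc m := u))
        - cmass (\<lambda>y. restrict y {1..m} = x) * \<kappa> (Suc m) (restrict x (pa G (Suc m))) u\<bar>) \<le> 2 * \<bar>L\<bar> / 2 ^ M"
      unfolding good_kernel_def by simp
  qed (use \<kappa> in \<open>auto simp: good_kernel_def\<close>)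
  then show ?thesis by blast
qed

end

section \<open>From grid measures to the Wasserstein distance\<close>

definition grid_measure :: "(nat \<Rightarrow> nat) \<Rightarrow> nat \<Rightarrow> nat \<Rightarrow> ((nat \<Rightarrow> nat \<Rightarrow> nat) \<Rightarrow> real) \<Rightarrow> point measure" where
  "grid_measure d M K w = distr (point_measure (T.Om d M {1..K}) (\<lambda>a. ennreal (w a))) (Xs d {1..K}) (grid d M {1..K})"

lemma sets_grid_measure [simp]: "sets (grid_measure d M K w) = sets (Xs d {1..K})"
  unfolding grid_measure_def by simp

lemma grid_measurable: "grid d M {1..K} \<in> point_measure (T.Om d M {1..K}) w \<rightarrow>\<^sub>M Xs d {1..K}"
  unfolding point_measure_def using grid_space by (auto simp: measurable_density_eq1)

lemma nn_integral_grid_measure: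
  assumes "f \<in> borel_measurable (Xs d {1..K})"
  shows "(\<integral>\<^sup>+x. f x \<partial>grid_measure d M K w) = (\<Sum>a\<in>T.Om d M {1..K}. ennreal (w a) * f (grid d M {1..K} a))"
  unfolding grid_measure_def
  by (subst nn_integral_distr[OF grid_measurable]) (use assms in \<open>auto simp: nn_integral_point_measure_finite\<close>)

lemma prob_space_grid_measure:
  assumes "\<And>a. a \<in> T.Om d M {1..K} \<Longrightarrow> 0 \<le> w a" "(\<Sum>a\<in>T.Om d M {1..K}. w a) = 1"
  shows "prob_space (grid_measure d M K w)"
  unfolding grid_measure_def
proof (rule prob_space.prob_space_distr[OF _ grid_measurable])
  show "prob_space (point_measure (T.Om d M {1..K}) (\<lambda>a. ennreal (w a)))"
  proof (rule prob_space_point_measure)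
    show "(\<Sum>a\<in>T.Om d M {1..K}. ennreal (w a)) = 1"
      using assms by (subst sum_ennreal) auto
  qed auto
qed

context law
begin

lemma nn_integral_quantize:
  fixes g :: "(nat \<Rightarrow> nat \<Rightarrow> nat) \<Rightarrow> ennreal"
  shows "(\<integral>\<^sup>+x. g (qz {1..K} x) \<partial>\<mu>) = (\<Sum>a\<in>Om {1..K}. ennreal (p a) * g a)"
proof -
  have ev: "{x \<in> space \<mu>. qz {1..K} x = a} \<in> sets \<mu>" for a by (rule event_measurable)
  have "(\<integral>\<^sup>+x. g (qz {1..K} x) \<partial>\<mu>) = (\<integral>\<^sup>+x. (\<Sum>a\<in>Om {1..K}. g a * indicator {x \<in> space \<mu>. qz {1..K} x = a} x) \<partial>\<mu>)"
  proof (rule nn_integral_cong)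
    fix x assume x: "x \<in> space \<mu>"
    have "(\<Sum>a\<in>Om {1..K}. g a * indicator {x \<in> space \<mu>. qz {1..K} x = a} x) = (\<Sum>a\<in>{qz {1..K} x}. g a)"
      using x by (intro sum.mono_neutral_cong_right) (auto simp: indicator_def)
    then show "g (qz {1..K} x) = (\<Sum>a\<in>Om {1..K}. g a * indicator {x \<in> space \<mu>. qz {1..K} x = a} x)" by simp
  qed
  also have "\<dots> = (\<Sum>a\<in>Om {1..K}. \<integral>\<^sup>+x. g a * indicator {x \<in> space \<mu>. qz {1..K} x = a} x \<partial>\<mu>)"
    using ev by (intro nn_integral_sum) auto
  also have "\<dots> = (\<Sum>a\<in>Om {1..K}. ennreal (p a) * g a)"
    using ev by (intro sum.cong refl) (simp add: nn_integral_cmult_indicator p_def \<mu>.emeasure_eq_measure mult.commute)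
  finally show ?thesis .
qed

text \<open>The coupling of \<open>tree_coupling\<close> on letters is lifted to the cube: given
  \<open>x\<close>, draw a letter from the conditional law of the coupling at the letter of
  \<open>x\<close> and go to its grid point. The cost is computed on letters because the sup-norm
  distance is dominated by the ultrametric of the tree.\<close>

lemma wasserstein_grid_le:
  assumes w0: "\<And>a. a \<in> Om {1..K} \<Longrightarrow> 0 \<le> w a" and w1: "(\<Sum>a\<in>Om {1..K}. w a) = 1"
  shows "wasserstein (sup_dist d {1..K}) \<mu> (grid_measure d M K w) \<le>
    ennreal (1 / 2 ^ M + (\<Sum>j<M. 1 / 2 ^ j *
      (\<Sum>A\<in>T.lab d M {1..K} (Suc j) ` Om {1..K}. \<bar>\<Sum>x | x \<in> Om {1..K} \<and> T.lab d M {1..K} (Suc j) x = A. p x - w x\<bar>)))"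
    (is "_ \<le> ennreal ?bound")
proof -
  let ?S = "Om {1..K}" and ?q = "qz {1..K}" and ?L = "T.lab d M {1..K}"
  let ?E = "grid_measure d M K w"
  \<comment> \<open>The ultrametric, truncated at level \<open>M\<close>: the size of the smallest
    common cell.\<close>
  define C :: "(nat \<Rightarrow> nat \<Rightarrow> nat) \<Rightarrow> (nat \<Rightarrow> nat \<Rightarrow> nat) \<Rightarrow> real"
    where "C a b = Min ((\<lambda>j. 1 / 2 ^ j) ` {j. j \<le> M \<and> ?L j a = ?L j b})" for a b
  have Cfin: "finite ((\<lambda>j. 1 / 2 ^ j :: real) ` {j. j \<le> M \<and> ?L j a = ?L j b})" for a b by simp
  have Cne: "(\<lambda>j. 1 / 2 ^ j :: real) ` {j. j \<le> M \<and> ?L j a = ?L j b} \<noteq> {}" if "a \<in> ?S" "b \<in> ?S" for a b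
    using T.lab_root[OF that] by auto
  have C_le: "C a b \<le> 1 / 2 ^ j" if "j \<le> M" "?L j a = ?L j b" for a b j
    unfolding C_def using that by (intro Min_le Cfin) auto
  have C_ge: "t \<le> C a b" if "a \<in> ?S" "b \<in> ?S" "\<And>j. j \<le> M \<Longrightarrow> ?L j a = ?L j b \<Longrightarrow> t \<le> 1 / 2 ^ j" for a b t
    unfolding C_def using that Cne[OF that(1,2)] by (subst Min_ge_iff[OF Cfin]) auto
  have C0: "0 \<le> C a b" if "a \<in> ?S" "b \<in> ?S" for a b
    using that by (rule C_ge) auto
  have Linj: "x = y" if "x \<in> ?S" "y \<in> ?S" "?L M x = ?L M y" for x y
  proof (rule PiE_ext[of x "{1..K}" "alphabet d M" y])
    show "x \<in> PiE {1..K} (alphabet d M)" "y \<in> PiE {1..K} (alphabet d M)" using that(1,2) unfolding T.Om_def by auto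
    fix i assume i: "i \<in> {1..K}"
    have "coarsen d M i M (x i) = coarsen d M i M (y i)" using that(3) i unfolding T.lab_eq_iff by blast
    then show "x i = y i" by (rule coarsen_inj[OF T.Om_app[OF that(1) i] T.Om_app[OF that(2) i]])
  qed
  have Lref: "?L j x = ?L j y" if "?L (Suc j) x = ?L (Suc j) y" for j x y
    by (rule T.lab_coarse[OF that]) simp
  have finS: "finite ?S" by simp
  have "\<exists>\<pi>. (\<forall>a\<in>?S. \<forall>b\<in>?S. 0 \<le> \<pi> a b) \<and> (\<forall>a\<in>?S. (\<Sum>b\<in>?S. \<pi> a b) = p a) \<and>
    (\<forall>b\<in>?S. (\<Sum>a\<in>?S. \<pi> a b) = w b) \<and> (\<Sum>a\<in>?S. \<Sum>b\<in>?S. \<pi> a b * C a b) \<le> ?bound"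
    by (rule tree_coupling[where S = ?S and L = ?L and M = M and P = p and Q = w and C = C, OF finS Lref T.lab_root Linj p_nonneg p_total w0 w1 C0 C_le])
  then obtain \<pi> where \<pi>0: "\<And>a b. a \<in> ?S \<Longrightarrow> b \<in> ?S \<Longrightarrow> 0 \<le> \<pi> a b"
    and row: "\<And>a. a \<in> ?S \<Longrightarrow> (\<Sum>b\<in>?S. \<pi> a b) = p a" and col: "\<And>b. b \<in> ?S \<Longrightarrow> (\<Sum>a\<in>?S. \<pi> a b) = w b"
    and cost: "(\<Sum>a\<in>?S. \<Sum>b\<in>?S. \<pi> a b * C a b) \<le> ?bound"
    by blast
  \<comment> \<open>The conditional probability of the letter \<open>b\<close> given the letter of
    \<open>x\<close>, used as density with respect to \<open>\<mu>\<close> times counting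
    measure.\<close>
  define h where "h x b = ennreal (\<pi> (?q x) b / p (?q x))" for x b
  have q_in: "?q x \<in> ?S" for x by simp
  have q_meas: "?q \<in> \<mu> \<rightarrow>\<^sub>M count_space ?S"
    unfolding measurable_cong_sets[OF sets_\<mu> refl] by (rule qz_measurable) simp
  have h_meas [measurable]: "(\<lambda>z. h (fst z) (snd z)) \<in> borel_measurable (\<mu> \<Otimes>\<^sub>M count_space ?S)"
  proof -
    have 1: "(\<lambda>z. (?q (fst z), snd z)) \<in> \<mu> \<Otimes>\<^sub>M count_space ?S \<rightarrow>\<^sub>M count_space ?S \<Otimes>\<^sub>M count_space ?S"
      by (intro measurable_Pair measurable_compose[OF measurable_fst q_meas] measurable_snd)
    have "count_space ?S \<Otimes>\<^sub>M count_space ?S = count_space (?S \<times> ?S)"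
      by (intro pair_measure_countable) (auto intro: countable_finite)
    then have "(\<lambda>z. ennreal (\<pi> (fst z) (snd z) / p (fst z))) \<in> borel_measurable (count_space ?S \<Otimes>\<^sub>M count_space ?S)"
      by simp
    from measurable_compose[OF 1 this] show ?thesis unfolding h_def by simp
  qed
  define \<Gamma> where "\<Gamma> = density (\<mu> \<Otimes>\<^sub>M count_space ?S) (\<lambda>z. h (fst z) (snd z))"
  define \<Xi> where "\<Xi> = distr \<Gamma> (\<mu> \<Otimes>\<^sub>M ?E) (\<lambda>z. (fst z, grid d M {1..K} (snd z)))"
  have "grid d M {1..K} \<in> count_space ?S \<rightarrow>\<^sub>M ?E"
    unfolding measurable_cong_sets[OF refl sets_grid_measure] using grid_space by auto
  then have g': "(\<lambda>z. (fst z, grid d M {1..K} (snd z))) \<in> \<mu> \<Otimes>\<^sub>M count_space ?S \<rightarrow>\<^sub>M \<mu> \<Otimes>\<^sub>M ?E"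
    by (intro measurable_Pair measurable_fst measurable_compose[OF measurable_snd])
  then have g_meas: "(\<lambda>z. (fst z, grid d M {1..K} (snd z))) \<in> \<Gamma> \<rightarrow>\<^sub>M \<mu> \<Otimes>\<^sub>M ?E"
    unfolding \<Gamma>_def by (simp only: measurable_density_eq1)
  interpret count: sigma_finite_measure "count_space ?S" by (rule sigma_finite_measure_count_space_finite) simp
  have int: "(\<integral>\<^sup>+z. f z \<partial>\<Xi>) = (\<integral>\<^sup>+x. (\<Sum>b\<in>?S. h x b * f (x, grid d M {1..K} b)) \<partial>\<mu>)"
    if f [measurable]: "f \<in> borel_measurable (\<mu> \<Otimes>\<^sub>M ?E)" for f
  proof -
    have hf: "(\<lambda>z. h (fst z) (snd z) * f (fst z, grid d M {1..K} (snd z))) \<in> borel_measurable (\<mu> \<Otimes>\<^sub>M count_space ?S)"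
      by (intro borel_measurable_times_ennreal h_meas measurable_compose[OF g' f])
    have "(\<integral>\<^sup>+z. f z \<partial>\<Xi>) = (\<integral>\<^sup>+z. f (fst z, grid d M {1..K} (snd z)) \<partial>\<Gamma>)"
      unfolding \<Xi>_def using f by (subst nn_integral_distr[OF g_meas]) auto
    also have "\<dots> = (\<integral>\<^sup>+z. h (fst z) (snd z) * f (fst z, grid d M {1..K} (snd z)) \<partial>(\<mu> \<Otimes>\<^sub>M count_space ?S))"
      unfolding \<Gamma>_def by (rule nn_integral_density[OF h_meas measurable_compose[OF g' f]])
    also have "\<dots> = (\<integral>\<^sup>+x. \<integral>\<^sup>+b. h x b * f (x, grid d M {1..K} b) \<partial>count_space ?S \<partial>\<mu>)"
      using count.nn_integral_fst[OF hf] by simp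
    finally show ?thesis by (simp add: nn_integral_count_space_finite)
  qed
  have h_sum: "(\<Sum>b\<in>?S. h x b) = 1" if "p (?q x) \<noteq> 0" for x
  proof -
    have "(\<Sum>b\<in>?S. h x b) = ennreal (\<Sum>b\<in>?S. \<pi> (?q x) b / p (?q x))"
      unfolding h_def using \<pi>0[OF q_in] p_nonneg by (intro sum_ennreal) auto
    also have "(\<Sum>b\<in>?S. \<pi> (?q x) b / p (?q x)) = 1"
      using row[OF q_in] that by (simp flip: sum_divide_distrib)
    finally show ?thesis by simp
  qed
  \<comment> \<open>Letters of mass zero, where the quotient in \<open>h\<close> degenerates, are
    hit with probability zero.\<close>
  have AE: "AE x in \<mu>. p (?q x) \<noteq> 0"
  proof -
    have "measure \<mu> {x \<in> space \<mu>. p (?q x) = 0} = 0"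
      using cmass_eq[of "\<lambda>a. p a = 0"] unfolding cmass_def by simp
    then show ?thesis
      using event_measurable[of "\<lambda>a. p a = 0"] by (subst AE_iff_measurable[OF _ refl]) (auto simp: \<mu>.emeasure_eq_measure)
  qed
  have cancel: "ennreal (p a) * ennreal (\<pi> a b / p a) = ennreal (\<pi> a b)" if "a \<in> ?S" "b \<in> ?S" for a b
  proof (cases "p a = 0")
    case True
    have "\<pi> a b = 0" using row[OF that(1)] \<pi>0[OF that(1)] that(2) True by (simp add: sum_nonneg_eq_0_iff)
    then show ?thesis by simp
  next
    case False
    then show ?thesis using p_nonneg[of a] \<pi>0[OF that] by (simp flip: ennreal_mult)
  qed
  have sum_int: "(\<integral>\<^sup>+x. (\<Sum>b\<in>?S. h x b * g (?q x) b) \<partial>\<mu>) = (\<Sum>a\<in>?S. \<Sum>b\<in>?S. ennreal (\<pi> a b) * g a b)" for g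
  proof -
    have "(\<integral>\<^sup>+x. (\<Sum>b\<in>?S. h x b * g (?q x) b) \<partial>\<mu>) = (\<Sum>a\<in>?S. ennreal (p a) * (\<Sum>b\<in>?S. ennreal (\<pi> a b / p a) * g a b))"
      unfolding h_def by (rule nn_integral_quantize[of "\<lambda>a. \<Sum>b\<in>?S. ennreal (\<pi> a b / p a) * g a b"])
    also have "\<dots> = (\<Sum>a\<in>?S. \<Sum>b\<in>?S. ennreal (\<pi> a b) * g a b)"
      unfolding sum_distrib_left mult.assoc[symmetric] using cancel by (intro sum.cong refl) auto
    finally show ?thesis .
  qed
  have fst_m: "fst \<in> \<Xi> \<rightarrow>\<^sub>M \<mu>" and snd_m: "snd \<in> \<Xi> \<rightarrow>\<^sub>M ?E" unfolding \<Xi>_def by auto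
  have fst_eq: "distr \<Xi> \<mu> fst = \<mu>"
  proof (rule measure_eqI)
    fix A assume "A \<in> sets (distr \<Xi> \<mu> fst)"
    then have A [measurable]: "A \<in> sets \<mu>" by simp
    have "emeasure (distr \<Xi> \<mu> fst) A = (\<integral>\<^sup>+z. indicator A (fst z) \<partial>\<Xi>)"
      using nn_integral_distr[OF fst_m, of "indicator A"] A by simp
    also have "\<dots> = (\<integral>\<^sup>+x. (\<Sum>b\<in>?S. h x b * indicator A x) \<partial>\<mu>)"
      by (subst int) auto
    also have "\<dots> = (\<integral>\<^sup>+x. indicator A x \<partial>\<mu>)"
    proof (rule nn_integral_cong_AE)
      show "AE x in \<mu>. (\<Sum>b\<in>?S. h x b * indicator A x) = indicator A x"
        using AE
      proof eventually_elim
        case (elim x)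
        show ?case unfolding sum_distrib_right[symmetric] h_sum[OF elim] by simp
      qed
    qed
    also have "\<dots> = emeasure \<mu> A" by simp
    finally show "emeasure (distr \<Xi> \<mu> fst) A = emeasure \<mu> A" .
  qed simp
  have snd_eq: "distr \<Xi> ?E snd = ?E"
  proof (rule measure_eqI)
    fix A assume "A \<in> sets (distr \<Xi> ?E snd)"
    then have A [measurable]: "A \<in> sets (Xs d {1..K})" and A' [measurable]: "A \<in> sets ?E" by simp_all
    let ?i = "\<lambda>b. indicator A (grid d M {1..K} b) :: ennreal"
    have "emeasure (distr \<Xi> ?E snd) A = (\<integral>\<^sup>+z. indicator A (snd z) \<partial>\<Xi>)"
      using nn_integral_distr[OF snd_m, of "indicator A"] A' by simp
    also have "\<dots> = (\<integral>\<^sup>+x. (\<Sum>b\<in>?S. h x b * ?i b) \<partial>\<mu>)"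
      by (subst int) auto
    also have "\<dots> = (\<Sum>a\<in>?S. \<Sum>b\<in>?S. ennreal (\<pi> a b) * ?i b)"
      by (rule sum_int[of "\<lambda>_. ?i"])
    also have "\<dots> = (\<Sum>b\<in>?S. (\<Sum>a\<in>?S. ennreal (\<pi> a b)) * ?i b)"
      unfolding sum_distrib_right by (rule sum.swap)
    also have "\<dots> = (\<Sum>b\<in>?S. ennreal (w b) * ?i b)"
      using \<pi>0 col by (intro sum.cong refl) (simp add: sum_ennreal)
    also have "\<dots> = (\<integral>\<^sup>+x. indicator A x \<partial>?E)"
      using A by (intro nn_integral_grid_measure[symmetric] borel_measurable_indicator)
    also have "\<dots> = emeasure ?E A" using A' by (rule nn_integral_indicator)
    finally show "emeasure (distr \<Xi> ?E snd) A = emeasure ?E A" .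
  qed simp
  have "prob_space \<Xi>" using prob_space_distrD[OF fst_m] prob_\<mu> unfolding fst_eq by simp
  then have coupling: "\<Xi> \<in> couplings \<mu> ?E"
    unfolding couplings_def using fst_eq snd_eq by (simp add: space_prob_algebra \<Xi>_def)
  have "wasserstein (sup_dist d {1..K}) \<mu> ?E \<le> (\<integral>\<^sup>+z. ennreal (sup_dist d {1..K} (fst z) (snd z)) \<partial>\<Xi>)"
    unfolding wasserstein_def using coupling by (rule INF_lower)
  also have "\<dots> \<le> (\<integral>\<^sup>+z. ennreal (C (?q (fst z)) (?q (snd z))) \<partial>\<Xi>)"
  proof (intro nn_integral_mono ennreal_leI C_ge q_in)
    fix z j assume z: "z \<in> space \<Xi>" and j: "j \<le> M" "?L j (?q (fst z)) = ?L j (?q (snd z))"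
    have "fst z \<in> space (Xs d {1..K})" "snd z \<in> space (Xs d {1..K})"
      using measurable_space[OF fst_m z] measurable_space[OF snd_m z] space_\<mu> sets_eq_imp_space_eq[OF sets_grid_measure] by auto
    then show "sup_dist d {1..K} (fst z) (snd z) \<le> 1 / 2 ^ j"
      using j by (intro sup_dist_le) auto
  qed
  also have "\<dots> = (\<integral>\<^sup>+x. (\<Sum>b\<in>?S. h x b * ennreal (C (?q x) b)) \<partial>\<mu>)"
  proof -
    have q_meas': "?q \<in> ?E \<rightarrow>\<^sub>M count_space ?S"
      unfolding measurable_cong_sets[OF sets_grid_measure refl] by (rule qz_measurable) simp
    have 1: "(\<lambda>z. (?q (fst z), ?q (snd z))) \<in> \<mu> \<Otimes>\<^sub>M ?E \<rightarrow>\<^sub>M count_space ?S \<Otimes>\<^sub>M count_space ?S"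
      by (intro measurable_Pair measurable_compose[OF measurable_fst q_meas] measurable_compose[OF measurable_snd q_meas'])
    have "count_space ?S \<Otimes>\<^sub>M count_space ?S = count_space (?S \<times> ?S)"
      by (intro pair_measure_countable) (auto intro: countable_finite)
    then have "(\<lambda>z. ennreal (C (fst z) (snd z))) \<in> borel_measurable (count_space ?S \<Otimes>\<^sub>M count_space ?S)" by simp
    from measurable_compose[OF 1 this] have "(\<lambda>z. ennreal (C (?q (fst z)) (?q (snd z)))) \<in> borel_measurable (\<mu> \<Otimes>\<^sub>M ?E)" by simp
    from int[OF this] show ?thesis by (simp add: quantize_grid cong: sum.cong)
  qed
  also have "\<dots> = (\<Sum>a\<in>?S. \<Sum>b\<in>?S. ennreal (\<pi> a b) * ennreal (C a b))" by (rule sum_int)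
  also have "\<dots> = ennreal (\<Sum>a\<in>?S. \<Sum>b\<in>?S. \<pi> a b * C a b)"
    using \<pi>0 C0 by (simp add: ennreal_mult sum_nonneg flip: sum_ennreal cong: sum.cong)
  also have "\<dots> \<le> ennreal ?bound" using cost by (rule ennreal_leI)
  finally show ?thesis .
qed

end

section \<open>Fluctuations of the empirical law\<close>

context law
begin

lemma quantize_measurable_fun:
  fixes g :: "(nat \<Rightarrow> nat \<Rightarrow> nat) \<Rightarrow> 'e::topological_space"
  shows "(\<lambda>x. g (qz {1..K} x)) \<in> borel_measurable \<mu>"
proof -
  have "qz {1..K} \<in> \<mu> \<rightarrow>\<^sub>M count_space (Om {1..K})"
    unfolding measurable_cong_sets[OF sets_\<mu> refl] by (rule qz_measurable) simp
  then show ?thesis by (rule measurable_compose) simp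
qed

lemma integral_quantize:
  fixes g :: "(nat \<Rightarrow> nat \<Rightarrow> nat) \<Rightarrow> real"
  shows "(\<integral>x. g (qz {1..K} x) \<partial>\<mu>) = (\<Sum>a\<in>Om {1..K}. p a * g a)"
proof -
  have ev: "{x \<in> space \<mu>. qz {1..K} x = a} \<in> sets \<mu>" for a by (rule event_measurable)
  have "(\<integral>x. g (qz {1..K} x) \<partial>\<mu>) = (\<integral>x. (\<Sum>a\<in>Om {1..K}. g a * indicator {x \<in> space \<mu>. qz {1..K} x = a} x) \<partial>\<mu>)"
  proof (rule Bochner_Integration.integral_cong[OF refl])
    fix x assume x: "x \<in> space \<mu>"
    have "(\<Sum>a\<in>Om {1..K}. g a * indicator {x \<in> space \<mu>. qz {1..K} x = a} x) = (\<Sum>a\<in>{qz {1..K} x}. g a)"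
      using x by (intro sum.mono_neutral_cong_right) (auto simp: indicator_def)
    then show "g (qz {1..K} x) = (\<Sum>a\<in>Om {1..K}. g a * indicator {x \<in> space \<mu>. qz {1..K} x = a} x)" by simp
  qed
  also have "\<dots> = (\<Sum>a\<in>Om {1..K}. \<integral>x. g a * indicator {x \<in> space \<mu>. qz {1..K} x = a} x \<partial>\<mu>)"
    using ev by (intro Bochner_Integration.integral_sum integrable_mult_right integrable_real_indicator)
      (auto simp: \<mu>.emeasure_eq_measure)
  also have "\<dots> = (\<Sum>a\<in>Om {1..K}. p a * g a)"
    using ev by (intro sum.cong refl) (simp add: p_def sets.Int_space_eq2)
  finally show ?thesis .
qed

lemma quantize_sum_bounded:
  fixes g :: "(nat \<Rightarrow> nat \<Rightarrow> nat) \<Rightarrow> real"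
  shows "\<bar>\<Sum>i\<in>I. g (qz {1..K} (X i))\<bar> \<le> real (card I) * (\<Sum>a\<in>Om {1..K}. \<bar>g a\<bar>)"
proof -
  have "\<bar>g (qz {1..K} x)\<bar> \<le> (\<Sum>a\<in>Om {1..K}. \<bar>g a\<bar>)" for x
    by (rule member_le_sum[of "qz {1..K} x" _ "\<lambda>a. \<bar>g a\<bar>"]) auto
  then have "(\<Sum>i\<in>I. \<bar>g (qz {1..K} (X i))\<bar>) \<le> (\<Sum>i\<in>I. \<Sum>a\<in>Om {1..K}. \<bar>g a\<bar>)" by (intro sum_mono)
  also have "\<dots> = real (card I) * (\<Sum>a\<in>Om {1..K}. \<bar>g a\<bar>)" by simp
  finally show ?thesis by (rule order.trans[OF sum_abs])
qed

lemma quantize_sum_measurable: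
  fixes g :: "(nat \<Rightarrow> nat \<Rightarrow> nat) \<Rightarrow> real"
  assumes "finite I"
  shows "(\<lambda>X. \<Sum>i\<in>I. g (qz {1..K} (X i))) \<in> borel_measurable (PiM I (\<lambda>_. \<mu>))"
proof (rule borel_measurable_sum)
  fix i assume "i \<in> I"
  then have "(\<lambda>X. X i) \<in> PiM I (\<lambda>_. \<mu>) \<rightarrow>\<^sub>M \<mu>" by (rule measurable_component_singleton)
  from measurable_compose[OF this quantize_measurable_fun[of g]]
  show "(\<lambda>X. g (qz {1..K} (X i))) \<in> borel_measurable (PiM I (\<lambda>_. \<mu>))" .
qed

lemma prob_PiM: "prob_space (PiM I (\<lambda>_. \<mu>))"
  by (rule prob_space_PiM) (rule prob_\<mu>)

text \<open>Induction over the sample: integrating out one observation makes its cross term vanish,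
  because \<open>g\<close> has mean zero. The alphabet is finite, so all sums are bounded and
  integrability is automatic.\<close>

lemma second_moment:
  fixes g :: "(nat \<Rightarrow> nat \<Rightarrow> nat) \<Rightarrow> real" and I :: "nat set"
  assumes "finite I" and mean: "(\<Sum>a\<in>Om {1..K}. p a * g a) = 0"
  shows "(\<integral>X. (\<Sum>i\<in>I. g (qz {1..K} (X i)))\<^sup>2 \<partial>PiM I (\<lambda>_. \<mu>)) = real (card I) * (\<Sum>a\<in>Om {1..K}. p a * (g a)\<^sup>2)"
    and "integrable (PiM I (\<lambda>_. \<mu>)) (\<lambda>X. (\<Sum>i\<in>I. g (qz {1..K} (X i)))\<^sup>2)"
proof -
  interpret product_prob_space "\<lambda>_. \<mu>" by unfold_locales
  have int: "integrable (PiM I (\<lambda>_. \<mu>)) (\<lambda>X. (\<Sum>i\<in>I. g (qz {1..K} (X i)))\<^sup>2)" if "finite I" for I :: "nat set"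
  proof -
    interpret PI: prob_space "PiM I (\<lambda>_. \<mu>)" by (rule prob_PiM)
    show ?thesis
    proof (rule PI.integrable_const_bound)
      show "AE X in PiM I (\<lambda>_. \<mu>). norm ((\<Sum>i\<in>I. g (qz {1..K} (X i)))\<^sup>2) \<le> (real (card I) * (\<Sum>a\<in>Om {1..K}. \<bar>g a\<bar>))\<^sup>2"
        using quantize_sum_bounded by (intro AE_I2) (simp add: abs_le_square_iff[symmetric] sum_nonneg)
    qed (intro borel_measurable_power quantize_sum_measurable that)
  qed
  show "integrable (PiM I (\<lambda>_. \<mu>)) (\<lambda>X. (\<Sum>i\<in>I. g (qz {1..K} (X i)))\<^sup>2)" by (rule int) fact
  show "(\<integral>X. (\<Sum>i\<in>I. g (qz {1..K} (X i)))\<^sup>2 \<partial>PiM I (\<lambda>_. \<mu>)) = real (card I) * (\<Sum>a\<in>Om {1..K}. p a * (g a)\<^sup>2)"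
    using \<open>finite I\<close>
  proof (induction I)
    case empty
    then show ?case by simp
  next
    case (insert i I)
    interpret PI: prob_space "PiM I (\<lambda>_. \<mu>)" by (rule prob_PiM)
    define S where "S X = (\<Sum>j\<in>I. g (qz {1..K} (X j)))" for X :: "nat \<Rightarrow> point"
    have "(\<integral>X. (\<Sum>j\<in>insert i I. g (qz {1..K} (X j)))\<^sup>2 \<partial>PiM (insert i I) (\<lambda>_. \<mu>)) =
      (\<integral>X. (\<integral>y. (\<Sum>j\<in>insert i I. g (qz {1..K} ((X(i := y)) j)))\<^sup>2 \<partial>\<mu>) \<partial>PiM I (\<lambda>_. \<mu>))"
      using insert by (intro product_integral_insert int) auto
    also have "\<dots> = (\<integral>X. (S X)\<^sup>2 + (\<Sum>a\<in>Om {1..K}. p a * (g a)\<^sup>2) \<partial>PiM I (\<lambda>_. \<mu>))"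
    proof (rule Bochner_Integration.integral_cong[OF refl])
      fix X
      have "(\<Sum>j\<in>insert i I. g (qz {1..K} ((X(i := y)) j))) = g (qz {1..K} y) + S X" for y
      proof -
        have "(\<Sum>j\<in>I. g (qz {1..K} ((X(i := y)) j))) = S X"
          unfolding S_def using insert by (intro sum.cong) auto
        then show ?thesis using insert by simp
      qed
      then have "(\<integral>y. (\<Sum>j\<in>insert i I. g (qz {1..K} ((X(i := y)) j)))\<^sup>2 \<partial>\<mu>) =
        (\<integral>y. (\<lambda>a. (g a + S X)\<^sup>2) (qz {1..K} y) \<partial>\<mu>)" by simp
      also have "\<dots> = (\<Sum>a\<in>Om {1..K}. p a * (g a + S X)\<^sup>2)" by (rule integral_quantize)
      also have "\<dots> = (\<Sum>a\<in>Om {1..K}. p a * (g a)\<^sup>2) + 2 * S X * (\<Sum>a\<in>Om {1..K}. p a * g a) + (S X)\<^sup>2 * (\<Sum>a\<in>Om {1..K}. p a)"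
        unfolding sum_distrib_left sum.distrib[symmetric] by (intro sum.cong refl) (simp add: power2_eq_square algebra_simps)
      finally show "(\<integral>y. (\<Sum>j\<in>insert i I. g (qz {1..K} ((X(i := y)) j)))\<^sup>2 \<partial>\<mu>) = (S X)\<^sup>2 + (\<Sum>a\<in>Om {1..K}. p a * (g a)\<^sup>2)"
        unfolding mean p_total by simp
    qed
    also have "\<dots> = real (card (insert i I)) * (\<Sum>a\<in>Om {1..K}. p a * (g a)\<^sup>2)"
      using insert int[of I] unfolding S_def
      by (subst Bochner_Integration.integral_add) (auto simp: PI.prob_space algebra_simps)
    finally show ?case .
  qed
qed

text \<open>Cauchy-Schwarz in the form of Young's inequality, applied pointwise, so that only second
  moments are integrated. Only the sum of the variances over all test functions enters, which is why
  many small cells are affordable.\<close>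

lemma expected_empirical_deviation:
  fixes g :: "'z \<Rightarrow> (nat \<Rightarrow> nat \<Rightarrow> nat) \<Rightarrow> real" and I :: "nat set"
  assumes I: "finite I" "I \<noteq> {}" and C: "finite C" "real (card C) \<le> N" "0 < N" and "0 < v"
    and mean: "\<And>z. z \<in> C \<Longrightarrow> (\<Sum>a\<in>Om {1..K}. p a * g z a) = 0"
    and var: "(\<Sum>z\<in>C. \<Sum>a\<in>Om {1..K}. p a * (g z a)\<^sup>2) \<le> v"
  shows "(\<integral>\<^sup>+X. ennreal (\<Sum>z\<in>C. \<bar>(\<Sum>i\<in>I. g z (qz {1..K} (X i))) / real (card I)\<bar>) \<partial>PiM I (\<lambda>_. \<mu>)) \<le>
    ennreal (sqrt (v * N / real (card I)))"
proof -
  interpret PI: prob_space "PiM I (\<lambda>_. \<mu>)" by (rule prob_PiM)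
  define m where "m = real (card I)"
  have m: "0 < m" unfolding m_def using I by (simp add: card_gt_0_iff)
  \<comment> \<open>The minimiser of the final bound
    \<open>v / (2 * m * t) + N * t / 2\<close>.\<close>
  define t where "t = sqrt (v / (m * N))"
  have t: "0 < t" unfolding t_def using m \<open>0 < N\<close> \<open>0 < v\<close> by simp
  define S where "S z X = (\<Sum>i\<in>I. g z (qz {1..K} (X i)))" for z X
  have young: "\<bar>s / m\<bar> \<le> s\<^sup>2 * (1 / (2 * m\<^sup>2 * t)) + t / 2" for s :: real
  proof -
    define u where "u = \<bar>s / m\<bar>"
    have "u\<^sup>2 = (s / m)\<^sup>2" unfolding u_def by (rule power2_abs)
    moreover have "2 * u * t \<le> u\<^sup>2 + t * t"
      using sum_squares_bound[of u t] by (simp add: power2_eq_square)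
    ultimately have "2 * \<bar>s / m\<bar> * t \<le> (s / m)\<^sup>2 + t * t" unfolding u_def[symmetric] by simp
    then have "\<bar>s / m\<bar> \<le> ((s / m)\<^sup>2 + t * t) / (2 * t)" using t by (simp add: pos_le_divide_eq ac_simps)
    also have "\<dots> = s\<^sup>2 * (1 / (2 * m\<^sup>2 * t)) + t / 2" using t m by (simp add: field_simps power2_eq_square)
    finally show ?thesis .
  qed
  have int: "integrable (PiM I (\<lambda>_. \<mu>)) (\<lambda>X. (S z X)\<^sup>2)" if "z \<in> C" for z
    unfolding S_def by (rule second_moment[OF I(1) mean[OF that]])
  have int': "integrable (PiM I (\<lambda>_. \<mu>)) (\<lambda>X. \<Sum>z\<in>C. (S z X)\<^sup>2 * (1 / (2 * m\<^sup>2 * t)) + t / 2)"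
    using int by (intro Bochner_Integration.integrable_sum Bochner_Integration.integrable_add integrable_mult_left) auto
  have "(\<integral>\<^sup>+X. ennreal (\<Sum>z\<in>C. \<bar>S z X / m\<bar>) \<partial>PiM I (\<lambda>_. \<mu>)) \<le>
    (\<integral>\<^sup>+X. ennreal (\<Sum>z\<in>C. (S z X)\<^sup>2 * (1 / (2 * m\<^sup>2 * t)) + t / 2) \<partial>PiM I (\<lambda>_. \<mu>))"
    by (intro nn_integral_mono ennreal_leI sum_mono young)
  also have "\<dots> = ennreal (\<integral>X. (\<Sum>z\<in>C. (S z X)\<^sup>2 * (1 / (2 * m\<^sup>2 * t)) + t / 2) \<partial>PiM I (\<lambda>_. \<mu>))"
    using t m by (intro nn_integral_eq_integral[OF int'] AE_I2 sum_nonneg) simp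
  also have "(\<integral>X. (\<Sum>z\<in>C. (S z X)\<^sup>2 * (1 / (2 * m\<^sup>2 * t)) + t / 2) \<partial>PiM I (\<lambda>_. \<mu>)) =
     (\<Sum>z\<in>C. m * (\<Sum>a\<in>Om {1..K}. p a * (g z a)\<^sup>2) * (1 / (2 * m\<^sup>2 * t)) + t / 2)"
  proof (subst Bochner_Integration.integral_sum)
    show "integrable (PiM I (\<lambda>_. \<mu>)) (\<lambda>X. (S z X)\<^sup>2 * (1 / (2 * m\<^sup>2 * t)) + t / 2)" if "z \<in> C" for z
      using int[OF that] by (intro Bochner_Integration.integrable_add integrable_mult_left) auto
    show "(\<Sum>z\<in>C. \<integral>X. (S z X)\<^sup>2 * (1 / (2 * m\<^sup>2 * t)) + t / 2 \<partial>PiM I (\<lambda>_. \<mu>)) =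
      (\<Sum>z\<in>C. m * (\<Sum>a\<in>Om {1..K}. p a * (g z a)\<^sup>2) * (1 / (2 * m\<^sup>2 * t)) + t / 2)"
    proof (intro sum.cong refl)
      fix z assume z: "z \<in> C"
      have sm: "(\<integral>X. (S z X)\<^sup>2 \<partial>PiM I (\<lambda>_. \<mu>)) = m * (\<Sum>a\<in>Om {1..K}. p a * (g z a)\<^sup>2)"
        unfolding S_def m_def by (rule second_moment[OF I(1) mean[OF z]])
      have "(\<integral>X. (S z X)\<^sup>2 * (1 / (2 * m\<^sup>2 * t)) + t / 2 \<partial>PiM I (\<lambda>_. \<mu>)) =
        (\<integral>X. (S z X)\<^sup>2 * (1 / (2 * m\<^sup>2 * t)) \<partial>PiM I (\<lambda>_. \<mu>)) + (\<integral>X. t / 2 \<partial>PiM I (\<lambda>_. \<mu>))"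
        using int[OF z] by (intro Bochner_Integration.integral_add integrable_mult_left) auto
      then show "(\<integral>X. (S z X)\<^sup>2 * (1 / (2 * m\<^sup>2 * t)) + t / 2 \<partial>PiM I (\<lambda>_. \<mu>)) =
        m * (\<Sum>a\<in>Om {1..K}. p a * (g z a)\<^sup>2) * (1 / (2 * m\<^sup>2 * t)) + t / 2"
        by (simp only: integral_mult_left_zero sm PI.prob_space lebesgue_integral_const scaleR_one)
    qed
  qed
  also have "\<dots> = (\<Sum>z\<in>C. \<Sum>a\<in>Om {1..K}. p a * (g z a)\<^sup>2) * (1 / (2 * m * t)) + real (card C) * (t / 2)"
  proof -
    have "m * s * (1 / (2 * m\<^sup>2 * t)) = s * (1 / (2 * m * t))" for s
      using m t by (simp add: power2_eq_square)
    then show ?thesis unfolding sum.distrib sum_distrib_right[of _ C] by simp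
  qed
  also have "ennreal \<dots> \<le> ennreal (v * (1 / (2 * m * t)) + N * (t / 2))"
    using var C t m by (intro ennreal_leI add_mono mult_right_mono) auto
  also have "v * (1 / (2 * m * t)) + N * (t / 2) = sqrt (v * N / m)"
  proof -
    have tt: "t * t = v / (m * N)" unfolding t_def using \<open>0 < v\<close> m \<open>0 < N\<close> by simp
    have "v * (1 / (2 * m * t)) = N * (t * t) / (2 * t)" unfolding tt using m t \<open>0 < N\<close> by (simp add: field_simps)
    also have "\<dots> = N * (t / 2)" using t by simp
    finally have "v * (1 / (2 * m * t)) + N * (t / 2) = N * t" by simp
    moreover have "(N * t)\<^sup>2 = v * N / m"
      using m \<open>0 < N\<close> unfolding power_mult_distrib power2_eq_square[of t] tt by (simp add: field_simps power2_eq_square)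
    moreover have "0 \<le> N * t" using t \<open>0 < N\<close> by simp
    ultimately show ?thesis by (metis real_sqrt_unique)
  qed
  finally show ?thesis unfolding S_def m_def .
qed

end

section \<open>Selection of the graph\<close>

lemma geometric_tail: "(\<Sum>i\<in>{j..<M}. 1 / 2 ^ i) \<le> 2 / (2 ^ j :: real)"
proof (cases "j \<le> M")
  case True
  have "(\<Sum>i\<in>{j..<M}. 1 / 2 ^ i) = 2 / 2 ^ j - 2 / (2 ^ M :: real)"
    using True
  proof (induction M rule: dec_induct)
    case (step n)
    have "(\<Sum>i\<in>{j..<Suc n}. 1 / 2 ^ i) = (\<Sum>i\<in>{j..<n}. 1 / 2 ^ i) + 1 / (2 ^ n :: real)"
      using step by simp
    then show ?case unfolding step.IH by simp
  qed simp
  then show ?thesis by simp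
qed simp

context tree
begin

text \<open>The discrepancy term of \<open>tree_coupling\<close>, an upper bound for the Wasserstein
  distance up to \<open>1 / 2 ^ M\<close>.\<close>

definition gap :: "nat \<Rightarrow> nat \<Rightarrow> ((nat \<Rightarrow> 'b) \<Rightarrow> real) \<Rightarrow> ((nat \<Rightarrow> 'b) \<Rightarrow> real) \<Rightarrow> real" where
  "gap K M P Q = (\<Sum>j<M. 1 / 2 ^ j * (\<Sum>A\<in>lab {1..K} (Suc j) ` Om {1..K}.
      \<bar>\<Sum>x | x \<in> Om {1..K} \<and> lab {1..K} (Suc j) x = A. P x - Q x\<bar>))"

text \<open>The signs of the cell discrepancies: paired with \<open>P - Q\<close> this function
  returns \<open>gap\<close>, so the bound becomes a linear functional of the law and can be
  estimated by an empirical mean.\<close>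

definition witness :: "nat \<Rightarrow> nat \<Rightarrow> ((nat \<Rightarrow> 'b) \<Rightarrow> real) \<Rightarrow> ((nat \<Rightarrow> 'b) \<Rightarrow> real) \<Rightarrow> (nat \<Rightarrow> 'b) \<Rightarrow> real" where
  "witness K M P Q x = (\<Sum>j<M. 1 / 2 ^ j *
      sgn (\<Sum>y | y \<in> Om {1..K} \<and> lab {1..K} (Suc j) y = lab {1..K} (Suc j) x. P y - Q y))"

lemma sum_witness: "(\<Sum>x\<in>Om {1..K}. (P x - Q x) * witness K M P Q x) = gap K M P Q"
proof -
  define s where "s j A = (\<Sum>y | y \<in> Om {1..K} \<and> lab {1..K} (Suc j) y = A. P y - Q y)" for j A
  have "(\<Sum>x\<in>Om {1..K}. (P x - Q x) * witness K M P Q x) =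
    (\<Sum>x\<in>Om {1..K}. \<Sum>j<M. 1 / 2 ^ j * ((P x - Q x) * sgn (s j (lab {1..K} (Suc j) x))))"
    unfolding witness_def s_def sum_distrib_left by (simp only: mult.left_commute)
  also have "\<dots> = (\<Sum>j<M. 1 / 2 ^ j * (\<Sum>x\<in>Om {1..K}. (P x - Q x) * sgn (s j (lab {1..K} (Suc j) x))))"
    unfolding sum_distrib_left by (rule sum.swap)
  also have "\<dots> = (\<Sum>j<M. 1 / 2 ^ j * (\<Sum>A\<in>lab {1..K} (Suc j) ` Om {1..K}. \<bar>s j A\<bar>))"
  proof (intro sum.cong refl arg_cong2[where f = "(*)"])
    fix j
    have "(\<Sum>x\<in>Om {1..K}. (P x - Q x) * sgn (s j (lab {1..K} (Suc j) x))) =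
       (\<Sum>A\<in>lab {1..K} (Suc j) ` Om {1..K}. s j A * sgn (s j A))"
      unfolding s_def by (subst sum_mult_fibres[where h = "lab {1..K} (Suc j)", symmetric]) auto
    then show "(\<Sum>x\<in>Om {1..K}. (P x - Q x) * sgn (s j (lab {1..K} (Suc j) x))) =
       (\<Sum>A\<in>lab {1..K} (Suc j) ` Om {1..K}. \<bar>s j A\<bar>)"
      by (simp only: abs_sgn)
  qed
  finally show ?thesis unfolding gap_def s_def .
qed

lemma abs_witness_le: "\<bar>witness K M P Q x\<bar> \<le> 2"
proof -
  have "\<bar>witness K M P Q x\<bar> \<le> (\<Sum>j<M. 1 / 2 ^ j)"
    unfolding witness_def by (rule order.trans[OF sum_abs]) (intro sum_mono, simp add: abs_mult abs_sgn_eq)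
  also have "\<dots> \<le> 2" using geometric_tail[of 0 M] by (simp add: atLeast0LessThan)
  finally show ?thesis .
qed

text \<open>If \<open>x\<close> and \<open>y\<close> share a label of level \<open>j\<close>, the
  signs at cells of level \<open>Suc i \<le> j\<close> agree; the other terms differ by at most
  \<open>2 / 2 ^ i\<close>, and these sum to \<open>4 / 2 ^ j\<close>.\<close>

lemma lip_witness: "lip K 4 (witness K M P Q)"
  unfolding lip_def
proof (intro ballI allI impI)
  fix x y j assume eq: "lab {1..K} j x = lab {1..K} j y"
  define \<sigma> where "\<sigma> i x = sgn (\<Sum>y | y \<in> Om {1..K} \<and> lab {1..K} (Suc i) y = lab {1..K} (Suc i) x. P y - Q y)" for i x
  have 0: "\<sigma> i x = \<sigma> i y" if "i < j" for i
  proof -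
    have "lab {1..K} (Suc i) x = lab {1..K} (Suc i) y" using eq by (rule lab_coarse) (use that in simp)
    then show ?thesis unfolding \<sigma>_def by simp
  qed
  have 2: "\<bar>\<sigma> i x - \<sigma> i y\<bar> \<le> 2" for i unfolding \<sigma>_def by (auto simp: sgn_if)
  have "\<bar>witness K M P Q x - witness K M P Q y\<bar> = \<bar>\<Sum>i<M. 1 / 2 ^ i * (\<sigma> i x - \<sigma> i y)\<bar>"
    unfolding witness_def \<sigma>_def right_diff_distrib sum_subtractf ..
  also have "\<dots> \<le> (\<Sum>i<M. 1 / 2 ^ i * (if i < j then 0 else 2))"
    using 0 2 by (intro abs_weighted_sum_le) auto
  also have "\<dots> = (\<Sum>i\<in>{j..<M}. 1 / 2 ^ i * 2)"
    by (intro sum.mono_neutral_cong_right) auto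
  also have "\<dots> \<le> 4 / 2 ^ j"
    using geometric_tail[of j M] unfolding sum_distrib_right[symmetric] by simp
  finally show "\<bar>witness K M P Q x - witness K M P Q y\<bar> \<le> 4 / 2 ^ j" .
qed

definition score :: "nat \<Rightarrow> nat \<Rightarrow> ('g \<Rightarrow> (nat \<Rightarrow> 'b) \<Rightarrow> real) \<Rightarrow> 'g set \<Rightarrow> ((nat \<Rightarrow> 'b) \<Rightarrow> real) \<Rightarrow> 'g \<Rightarrow> real" where
  "score K M R S e G = Max ((\<lambda>(G1, G2). \<bar>\<Sum>x\<in>Om {1..K}. (R G x - e x) * witness K M (R G1) (R G2) x\<bar>) ` (S \<times> S))"

definition select :: "nat \<Rightarrow> nat \<Rightarrow> ('g \<Rightarrow> (nat \<Rightarrow> 'b) \<Rightarrow> real) \<Rightarrow> 'g set \<Rightarrow> ((nat \<Rightarrow> 'b) \<Rightarrow> real) \<Rightarrow> 'g" where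
  "select K M R S e = arg_min_on (score K M R S e) S"

lemma select_in: "finite S \<Longrightarrow> S \<noteq> {} \<Longrightarrow> select K M R S e \<in> S"
  unfolding select_def by (rule arg_min_if_finite)

text \<open>The minimum distance selection only tests the candidates against the finitely many
  functions that witness their mutual distances, so it costs only the deviation of the validation
  sample on these functions.\<close>

lemma selection:
  assumes S: "finite S" "G \<in> S"
    and \<delta>: "\<And>f \<theta>. lip K \<theta> f \<Longrightarrow> \<bar>\<Sum>x\<in>Om {1..K}. (p x - R G x) * f x\<bar> \<le> \<theta> * \<delta>"
  shows "gap K M p (R (select K M R S e)) \<le> 12 * \<delta> +
    2 * (\<Sum>(G1, G2)\<in>S \<times> S. \<bar>\<Sum>x\<in>Om {1..K}. (p x - e x) * witness K M (R G1) (R G2) x\<bar>)"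
proof -
  let ?H = "select K M R S e"
  define dev where "dev G1 G2 = \<bar>\<Sum>x\<in>Om {1..K}. (p x - e x) * witness K M (R G1) (R G2) x\<bar>" for G1 G2
  have H: "?H \<in> S" using S by (intro select_in) auto
  have le_score: "\<bar>\<Sum>x\<in>Om {1..K}. (R G' x - e x) * witness K M (R G1) (R G2) x\<bar> \<le> score K M R S e G'"
    if "G1 \<in> S" "G2 \<in> S" for G' G1 G2
    unfolding score_def using S that by (intro Max_ge) auto
  have "score K M R S e ?H \<le> score K M R S e G"
  proof -
    have "S \<noteq> {}" using S(2) by blast
    from arg_min_if_finite(2)[OF S(1) this, of "score K M R S e"] S(2)
    show ?thesis unfolding select_def by (auto simp: not_less)
  qed
  moreover have "score K M R S e G \<le> 4 * \<delta> + (\<Sum>(G1, G2)\<in>S \<times> S. dev G1 G2)"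
  proof -
    have "\<bar>\<Sum>x\<in>Om {1..K}. (R G x - e x) * witness K M (R G1) (R G2) x\<bar> \<le> 4 * \<delta> + (\<Sum>(G1, G2)\<in>S \<times> S. dev G1 G2)"
      if "G1 \<in> S" "G2 \<in> S" for G1 G2
    proof -
      have "dev G1 G2 \<le> (\<Sum>(G1, G2)\<in>S \<times> S. dev G1 G2)"
        using member_le_sum[of "(G1, G2)" "S \<times> S" "\<lambda>(G1, G2). dev G1 G2"] S that by (auto simp: dev_def)
      moreover have "\<bar>\<Sum>x\<in>Om {1..K}. (p x - R G x) * witness K M (R G1) (R G2) x\<bar> \<le> 4 * \<delta>"
        by (rule \<delta>[OF lip_witness])
      moreover have "(\<Sum>x\<in>Om {1..K}. (R G x - e x) * witness K M (R G1) (R G2) x) =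
        (\<Sum>x\<in>Om {1..K}. (p x - e x) * witness K M (R G1) (R G2) x) -
        (\<Sum>x\<in>Om {1..K}. (p x - R G x) * witness K M (R G1) (R G2) x)"
        unfolding sum_subtractf[symmetric] by (intro sum.cong refl) (simp add: algebra_simps)
      ultimately show ?thesis unfolding dev_def by linarith
    qed
    then show ?thesis unfolding score_def using S by (subst Max_le_iff) auto
  qed
  ultimately have sc: "score K M R S e ?H \<le> 4 * \<delta> + (\<Sum>(G1, G2)\<in>S \<times> S. dev G1 G2)"
    "score K M R S e G \<le> 4 * \<delta> + (\<Sum>(G1, G2)\<in>S \<times> S. dev G1 G2)" by auto
  have gap_p: "gap K M p (R G) \<le> 4 * \<delta>"
    using \<delta>[OF lip_witness[of K M p "R G"]] unfolding sum_witness by simp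
  have gap_H: "gap K M (R G) (R ?H) \<le> score K M R S e G + score K M R S e ?H"
  proof -
    have "gap K M (R G) (R ?H) = (\<Sum>x\<in>Om {1..K}. (R G x - e x) * witness K M (R G) (R ?H) x) -
       (\<Sum>x\<in>Om {1..K}. (R ?H x - e x) * witness K M (R G) (R ?H) x)"
      unfolding sum_witness[symmetric] sum_subtractf[symmetric] by (intro sum.cong refl) (simp add: algebra_simps)
    then show ?thesis using le_score[OF S(2) H, of G] le_score[OF S(2) H, of ?H] by linarith
  qed
  have "gap K M p (R ?H) \<le> gap K M p (R G) + gap K M (R G) (R ?H)"
    unfolding gap_def sum.distrib[symmetric] distrib_left[symmetric]
  proof (intro sum_mono mult_left_mono)
    fix j A
    have "(\<Sum>x | x \<in> Om {1..K} \<and> lab {1..K} (Suc j) x = A. p x - R ?H x) =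
      (\<Sum>x | x \<in> Om {1..K} \<and> lab {1..K} (Suc j) x = A. p x - R G x) +
      (\<Sum>x | x \<in> Om {1..K} \<and> lab {1..K} (Suc j) x = A. R G x - R ?H x)"
      unfolding sum.distrib[symmetric] by simp
    then show "\<bar>\<Sum>x | x \<in> Om {1..K} \<and> lab {1..K} (Suc j) x = A. p x - R ?H x\<bar> \<le>
      \<bar>\<Sum>x | x \<in> Om {1..K} \<and> lab {1..K} (Suc j) x = A. p x - R G x\<bar> +
      \<bar>\<Sum>x | x \<in> Om {1..K} \<and> lab {1..K} (Suc j) x = A. R G x - R ?H x\<bar>" by linarith
  qed simp
  \<comment> \<open>The constants: \<open>4 * \<delta>\<close> for the distance of \<open>G\<close>
    itself and, for each of the two scores, another \<open>4 * \<delta>\<close> plus the total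
    deviation.\<close>
  then show ?thesis using gap_p gap_H sc unfolding dev_def by linarith
qed

end

section \<open>Rates\<close>

lemma level_bounds:
  fixes n :: nat and t :: real
  assumes "1 \<le> n" "0 < t"
  defines "J \<equiv> nat \<lfloor>log 2 (real n) / t\<rfloor>"
  shows "2 ^ J \<le> real n powr (1 / t)" "real n powr (1 / t) \<le> 2 * 2 ^ J" "real J \<le> log 2 (real n) / t"
proof -
  define x where "x = log 2 (real n) / t"
  have x: "0 \<le> x" unfolding x_def using assms by simp
  then have J: "real J \<le> x" "x \<le> real J + 1" unfolding J_def x_def by linarith+
  have eq: "2 powr x = real n powr (1 / t)"
    unfolding x_def using assms by (metis (no_types, lifting) divide_inverse mult.commute mult_1 of_nat_0_less_iff
      one_neq_zero order_less_le_trans powr_log_cancel powr_powr zero_less_numeral zero_less_one numeral_One num.distinct(1) numeral_eq_iff)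
  have "2 powr real J \<le> 2 powr x" "2 powr x \<le> 2 powr (real J + 1)" using J by simp_all
  then show "2 ^ J \<le> real n powr (1 / t)" "real n powr (1 / t) \<le> 2 * 2 ^ J"
    unfolding eq by (simp_all add: powr_realpow powr_add)
  show "real J \<le> log 2 (real n) / t" using J unfolding x_def by simp
qed

lemma level_power_bound:
  fixes n J q :: nat and t s :: real
  assumes n: "1 \<le> n" and J: "2 ^ J \<le> real n powr (1 / t)" and q: "real q / t - 1 = - 2 * s"
  shows "2 ^ (J * q) / real n \<le> (real n powr - s)\<^sup>2"
proof -
  have "(2 ^ J) ^ q \<le> (real n powr (1 / t)) ^ q" using J by (rule power_mono) simp
  also have "\<dots> = real n powr (real q / t)" using n by (simp add: powr_powr flip: powr_realpow)
  finally have "2 ^ (J * q) / real n \<le> real n powr (real q / t) / real n powr 1"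
    using n by (simp add: power_mult divide_right_mono)
  also have "\<dots> = real n powr (- 2 * s)" unfolding powr_diff[symmetric] q ..
  also have "\<dots> = (real n powr - s)\<^sup>2" using n by (simp add: powr_powr mult.commute flip: powr_realpow powr_numeral)
  finally show ?thesis .
qed

text \<open>With \<open>t \<ge> 2\<close> the denominator \<open>2 * ln 2\<close> exceeds one, so
  the number of levels is bounded by the natural logarithm without a further constant.\<close>

lemma level_log_bound:
  fixes n J :: nat and t :: real
  assumes "1 \<le> n" "2 \<le> t" "real J \<le> log 2 (real n) / t"
  shows "real J \<le> max 1 (ln (real n))"
proof -
  have ln0: "0 \<le> ln (real n)" using assms by simp
  have "real J \<le> log 2 (real n) / 2"
    using assms by (intro order.trans[OF assms(3)] divide_left_mono) auto
  also have "\<dots> = ln (real n) / (2 * ln 2)" by (simp add: log_def)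
  also have "\<dots> \<le> ln (real n) / 1"
    using ln2_ge_two_thirds ln0 by (intro divide_left_mono) auto
  finally show ?thesis by simp
qed

text \<open>Up to level \<open>J\<close> every term of the first kind is at most
  \<open>A * R1\<close>, since \<open>max 2 dk\<close> makes the exponents increase towards
  \<open>J\<close>; the number of levels gives the logarithm. Above \<open>J\<close> the term is
  frozen and the weights are summable. Terms of the second kind are at most \<open>A * R2\<close> up
  to a level \<open>j0\<close>, and their trivial bound has a geometric tail beyond it.\<close>

lemma sum_levels_bound:
  fixes n M dp dk D e J :: nat
  assumes n: "2 \<le> n" and D: "dp + max 2 dk \<le> D" and e: "max 2 dk \<le> e"
    and J: "J = nat \<lfloor>log 2 (real n) / (2 + real D)\<rfloor>"
  defines "s1 \<equiv> \<lambda>i. sqrt (6 * (2 ^ (J * dp) * 2 ^ (i * dk)) / real n)"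
    and "s2 \<equiv> \<lambda>i. min 2 (sqrt (6 * 2 ^ (i * dk) / real n))"
  shows "(\<Sum>j<M. 1 / 2 ^ j * (if Suc j \<le> J then s1 (Suc j) else s1 J + s2 (Suc j))) \<le>
    (3 * sqrt (6 * 2 ^ e) + 8) * max 1 (ln (real n)) *
      (real n powr (- 2 / (2 + real D)) + real n powr (- 1 / real e))"
proof -
  define lg where "lg = max 1 (ln (real n))"
  define R1 where "R1 = real n powr - (2 / (2 + real D))"
  define R2 where "R2 = real n powr - (1 / real e)"
  define A where "A = sqrt (6 * 2 ^ e)"
  \<comment> \<open>The level with cell side about \<open>n powr (- 1 / e)\<close>, where the bound
    \<open>2\<close> takes over from the fluctuation bound.\<close>
  define j0 where "j0 = nat \<lfloor>log 2 (real n) / real e\<rfloor>"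
  have n1: "1 \<le> n" using n by simp
  have e2: "2 \<le> e" and D2: "2 \<le> D" using D e by auto
  note lJ = level_bounds[OF n1, of "2 + real D", folded J]
  note l0 = level_bounds[OF n1, of "real e", folded j0_def]
  have lgJ: "real J \<le> lg" unfolding lg_def using lJ(3) D2 by (intro level_log_bound[OF n1, of "2 + real D"]) auto
  have lg0: "real j0 \<le> lg" unfolding lg_def using l0(3) e2 by (intro level_log_bound[OF n1, of "real e"]) auto
  have pJ: "2 ^ (J * (D - 2)) / real n \<le> R1\<^sup>2"
    unfolding R1_def using lJ(1) D2 by (intro level_power_bound[OF n1, of _ "2 + real D"]) (auto simp: field_simps of_nat_diff)
  have p0: "2 ^ (j0 * (e - 2)) / real n \<le> R2\<^sup>2"
    unfolding R2_def using l0(1) e2 by (intro level_power_bound[OF n1, of _ "real e"]) (auto simp: field_simps of_nat_diff)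
  have R: "0 \<le> R1" "0 \<le> R2" unfolding R1_def R2_def by auto
  have A: "0 \<le> A" "A\<^sup>2 = 6 * 2 ^ e" unfolding A_def by auto
  have lg: "1 \<le> lg" unfolding lg_def by simp
  have level_term: "1 / 2 ^ j * sqrt (6 * x / real n) \<le> A * R"
    if x: "0 \<le> x" "x \<le> 2 ^ e * (4 ^ j * y)" and y: "y / real n \<le> R\<^sup>2" and "0 \<le> R" for j x y R
  proof (rule power2_le_imp_le)
    have "(1 / 2 ^ j * sqrt (6 * x / real n))\<^sup>2 = 6 * x / (4 ^ j * real n)"
    proof -
      have "(2 ^ j)\<^sup>2 = (4::real) ^ j" by (simp add: power2_eq_square flip: power_mult_distrib)
      then show ?thesis using x(1) n by (simp add: power_mult_distrib power_divide)
    qed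
    also have "\<dots> \<le> 6 * (2 ^ e * (4 ^ j * y)) / (4 ^ j * real n)"
      using x(2) by (intro divide_right_mono mult_left_mono) auto
    also have "\<dots> = 6 * 2 ^ e * (y / real n)" by simp
    also have "\<dots> \<le> 6 * 2 ^ e * R\<^sup>2" using y by (intro mult_left_mono) auto
    also have "\<dots> = (A * R)\<^sup>2" using A(2) by (simp add: power_mult_distrib)
    finally show "(1 / 2 ^ j * sqrt (6 * x / real n))\<^sup>2 \<le> (A * R)\<^sup>2" .
    show "0 \<le> A * R" using A(1) \<open>0 \<le> R\<close> by simp
  qed
  have four: "(4::real) ^ j = 2 ^ (2 * j)" for j by (simp add: power_mult)
  have t1: "1 / 2 ^ j * s1 (Suc j) \<le> A * R1" if j: "j < J" for j
    unfolding s1_def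
  proof (rule level_term[OF _ _ pJ R(1)])
    \<comment> \<open>The summand \<open>e\<close> pays for the shift between the weight of level
      \<open>j\<close> and the cells of level \<open>Suc j\<close>; the \<open>2 * j\<close> is
      cancelled by the squared weight.\<close>
    have "J * dp + Suc j * dk \<le> e + (2 * j + J * (D - 2))"
    proof -
      have "Suc j * dk \<le> Suc j * max 2 dk" by (intro mult_left_mono) auto
      also have "\<dots> = max 2 dk + (2 * j + j * (max 2 dk - 2))"
      proof -
        have "max 2 dk = 2 + (max 2 dk - 2)" by simp
        then have "j * max 2 dk = j * 2 + j * (max 2 dk - 2)" by (metis distrib_left)
        then show ?thesis by simp
      qed
      also have "j * (max 2 dk - 2) \<le> J * (max 2 dk - 2)" using j by (intro mult_right_mono) auto
      finally have "Suc j * dk \<le> max 2 dk + (2 * j + J * (max 2 dk - 2))" by simp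
      moreover have "J * dp + J * (max 2 dk - 2) \<le> J * (D - 2)"
        unfolding distrib_left[symmetric] using D by (intro mult_left_mono) auto
      ultimately show ?thesis using e by linarith
    qed
    then have "(2::real) ^ (J * dp + Suc j * dk) \<le> 2 ^ (e + (2 * j + J * (D - 2)))" by (intro power_increasing) auto
    then show "2 ^ (J * dp) * 2 ^ (Suc j * dk) \<le> (2::real) ^ e * (4 ^ j * 2 ^ (J * (D - 2)))"
      unfolding four power_add .
  qed simp
  have t2: "1 / 2 ^ J * s1 J \<le> A * R1"
    unfolding s1_def
  proof (rule level_term[OF _ _ pJ R(1)])
    have "J * dp + J * dk \<le> e + (2 * J + J * (D - 2))"
    proof -
      have "J * dp + J * dk \<le> J * D" unfolding distrib_left[symmetric] using D by (intro mult_left_mono) auto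
      also have "J * D = J * (2 + (D - 2))" using D2 by (simp only: le_add_diff_inverse)
      also have "\<dots> = J * 2 + J * (D - 2)" by (rule distrib_left)
      finally show ?thesis by linarith
    qed
    then have "(2::real) ^ (J * dp + J * dk) \<le> 2 ^ (e + (2 * J + J * (D - 2)))" by (intro power_increasing) auto
    then show "2 ^ (J * dp) * 2 ^ (J * dk) \<le> (2::real) ^ e * (4 ^ J * 2 ^ (J * (D - 2)))"
      unfolding four power_add .
  qed simp
  have t3: "1 / 2 ^ j * s2 (Suc j) \<le> A * R2" if j: "j < j0" for j
  proof -
    have "1 / 2 ^ j * s2 (Suc j) \<le> 1 / 2 ^ j * sqrt (6 * 2 ^ (Suc j * dk) / real n)"
      unfolding s2_def by (intro mult_left_mono) auto
    also have "\<dots> \<le> A * R2"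
    proof (rule level_term[OF _ _ p0 R(2)])
      have "Suc j * dk \<le> e + (2 * j + j0 * (e - 2))"
      proof -
        have "Suc j * dk \<le> Suc j * e" using e by (intro mult_left_mono) auto
        also have "\<dots> = e + j * (2 + (e - 2))" using e2 by (simp only: le_add_diff_inverse mult_Suc)
        also have "\<dots> = e + (j * 2 + j * (e - 2))" by (simp only: distrib_left)
        finally have "Suc j * dk \<le> e + (j * 2 + j * (e - 2))" .
        moreover have "j * (e - 2) \<le> j0 * (e - 2)" using j by (intro mult_right_mono) auto
        ultimately show ?thesis by linarith
      qed
      then have "(2::real) ^ (Suc j * dk) \<le> 2 ^ (e + (2 * j + j0 * (e - 2)))" by (intro power_increasing) auto
      then show "2 ^ (Suc j * dk) \<le> (2::real) ^ e * (4 ^ j * 2 ^ (j0 * (e - 2)))"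
        unfolding four power_add .
    qed simp
    finally show ?thesis .
  qed
  have s0: "0 \<le> s1 i" "0 \<le> s2 i" "s2 i \<le> 2" for i unfolding s1_def s2_def by auto
  have "(\<Sum>j<M. 1 / 2 ^ j * (if Suc j \<le> J then s1 (Suc j) else s1 J + s2 (Suc j))) \<le>
     (\<Sum>j<M. (if j < J then A * R1 else 0) + (if J \<le> j then 1 / 2 ^ j * s1 J else 0) +
       ((if j < j0 then A * R2 else 0) + (if j0 \<le> j then 1 / 2 ^ j * 2 else 0)))"
  proof (intro sum_mono)
    fix j
    have "1 / 2 ^ j * s2 (Suc j) \<le> (if j < j0 then A * R2 else 0) + (if j0 \<le> j then 1 / 2 ^ j * 2 else 0)"
      using t3[of j] mult_left_mono[OF s0(3)[of "Suc j"], of "1 / 2 ^ j"] by auto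
    moreover have "0 \<le> (if j < j0 then A * R2 else 0) + (if j0 \<le> j then 1 / 2 ^ j * 2 else 0)"
      using A R by auto
    ultimately show "1 / 2 ^ j * (if Suc j \<le> J then s1 (Suc j) else s1 J + s2 (Suc j)) \<le>
       (if j < J then A * R1 else 0) + (if J \<le> j then 1 / 2 ^ j * s1 J else 0) +
       ((if j < j0 then A * R2 else 0) + (if j0 \<le> j then 1 / 2 ^ j * 2 else 0))"
      using t1[of j] by (cases "j < J") (auto simp: distrib_left)
  qed
  also have "\<dots> = (\<Sum>j<M. if j < J then A * R1 else 0) + (\<Sum>j<M. if J \<le> j then 1 / 2 ^ j * s1 J else 0) +
       ((\<Sum>j<M. if j < j0 then A * R2 else 0) + (\<Sum>j<M. if j0 \<le> j then 1 / 2 ^ j * 2 else 0))"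
    by (simp only: sum.distrib)
  also have "\<dots> \<le> lg * (A * R1) + 2 * (A * R1) + (lg * (A * R2) + 8 * R2)"
  proof (intro add_mono)
    have count: "(\<Sum>j<M. if j < i then b else 0) \<le> real i * b" if "0 \<le> b" for i and b :: real
    proof -
      have "(\<Sum>j<M. if j < i then b else 0) = (\<Sum>j\<in>{..<M} \<inter> {..<i}. b)"
        by (intro sum.mono_neutral_cong_right) auto
      also have "\<dots> \<le> (\<Sum>j<i. b)" using that by (intro sum_mono2) auto
      finally show ?thesis by simp
    qed
    have tail: "(\<Sum>j<M. if i \<le> j then 1 / 2 ^ j * b else 0) \<le> 2 / 2 ^ i * b" if "0 \<le> b" for i and b :: real
    proof -
      have "(\<Sum>j<M. if i \<le> j then 1 / 2 ^ j * b else 0) = (\<Sum>j\<in>{i..<M}. 1 / 2 ^ j) * b"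
        unfolding sum_distrib_right by (intro sum.mono_neutral_cong_right) auto
      also have "\<dots> \<le> 2 / 2 ^ i * b" using that by (intro mult_right_mono geometric_tail)
      finally show ?thesis .
    qed
    show "(\<Sum>j<M. if j < J then A * R1 else 0) \<le> lg * (A * R1)"
      using count[of "A * R1" J] mult_right_mono[OF lgJ, of "A * R1"] A R by simp
    show "(\<Sum>j<M. if j < j0 then A * R2 else 0) \<le> lg * (A * R2)"
      using count[of "A * R2" j0] mult_right_mono[OF lg0, of "A * R2"] A R by simp
    show "(\<Sum>j<M. if J \<le> j then 1 / 2 ^ j * s1 J else 0) \<le> 2 * (A * R1)"
      using tail[OF s0(1), of J J] t2 by simp
    have "1 / 2 ^ j0 \<le> 2 * R2"
    proof -
      have pos: "0 < real n powr (1 / real e)" using n by simp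
      have "1 / 2 ^ j0 \<le> 2 / real n powr (1 / real e)"
        using l0(2) e2 pos by (simp add: field_simps)
      then show ?thesis unfolding R2_def by (simp add: powr_minus_divide)
    qed
    then show "(\<Sum>j<M. if j0 \<le> j then 1 / 2 ^ j * 2 else 0) \<le> 8 * R2"
      using tail[of 2 j0] by simp
  qed
  also have "\<dots> \<le> (3 * A + 8) * lg * (R1 + R2)"
  proof -
    have "2 * (A * R1) \<le> 2 * (lg * (A * R1))" "R2 \<le> lg * R2" "0 \<le> lg * (A * R2)" "0 \<le> lg * R1"
      using lg A R mult_right_mono[OF lg, of "A * R1"] mult_right_mono[OF lg, of R2] by auto
    then show ?thesis by (simp add: algebra_simps)
  qed
  finally show ?thesis unfolding A_def lg_def R1_def R2_def minus_divide_left .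
qed

lemma sq_diff_le:
  fixes s b :: real
  assumes "0 \<le> s" "s \<le> 1" "0 \<le> b" "b \<le> 1"
  shows "(s - b)\<^sup>2 \<le> s + b"
proof -
  have "(s - b)\<^sup>2 = s * s + b * b - 2 * (s * b)" by (simp add: power2_eq_square algebra_simps)
  moreover have "s * s \<le> s" "b * b \<le> b" "0 \<le> s * b"
    using assms by (auto intro: mult_left_le)
  ultimately show ?thesis by linarith
qed

section \<open>Variances of the fluctuation functions\<close>

context coarse_chain
begin

lemma sum_cells: "(\<Sum>A\<in>cells k i. \<Sum>u | u \<in> F k \<and> c k i u = A. f u) = (\<Sum>u\<in>F k. f u :: real)"
  by (rule sum_fibres) (auto simp: cells_def)

lemma sum_of_bool_cells: "u \<in> F k \<Longrightarrow> (\<Sum>A\<in>cells k i. of_bool (c k i u = A)) = (1 :: real)"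
  using c_in_cells[of u k i] by (simp add: of_bool_def)

text \<open>Only the label of \<open>x\<close> contributes, and there a probability vector is
  compared with a unit vector; \<open>sq_diff_le\<close> bounds the squares by the entries. The
  total is at most two however many cells there are.\<close>

lemma g1_square:
  assumes k: "k \<in> {1..K}" and x: "x \<in> Om {1..K}"
  shows "(\<Sum>l\<in>Lab k. \<Sum>A\<in>cells k i. (g1 ker k i l A x)\<^sup>2) \<le> 2"
proof -
  let ?l = "lab (P k) J x"
  have l: "?l \<in> Lab k" using k x by (rule lab_Lab_nodes)
  define s where "s A = (\<Sum>u | u \<in> F k \<and> c k i u = A. ker k ?l u)" for A
  have s0: "0 \<le> s A" for A unfolding s_def using ker_nonneg[OF k l] by (intro sum_nonneg) auto
  have stot: "(\<Sum>A\<in>cells k i. s A) = 1" unfolding s_def sum_cells by (rule ker_total[OF k l])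
  have s1: "s A \<le> 1" if "A \<in> cells k i" for A
    using member_le_sum[of A "cells k i" s] that s0 stot by simp
  have "(\<Sum>l\<in>Lab k. \<Sum>A\<in>cells k i. (g1 ker k i l A x)\<^sup>2) = (\<Sum>l\<in>{?l}. \<Sum>A\<in>cells k i. (g1 ker k i l A x)\<^sup>2)"
    using k l by (intro sum.mono_neutral_right) (auto simp: g1_def)
  also have "\<dots> = (\<Sum>A\<in>cells k i. (s A - of_bool (c k i (x k) = A))\<^sup>2)"
    unfolding g1_def s_def by simp
  also have "\<dots> \<le> (\<Sum>A\<in>cells k i. s A + of_bool (c k i (x k) = A))"
    using s0 s1 by (intro sum_mono sq_diff_le) auto
  also have "\<dots> = 2" unfolding sum.distrib stot using sum_of_bool_cells[OF Om_app[OF x k]] by simp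
  finally show ?thesis .
qed

lemma g2_parts:
  assumes k: "k \<in> {1..K}" and x: "x \<in> Om {1..K}"
  defines "s \<equiv> \<lambda>i A. \<Sum>u | u \<in> F k \<and> c k i u = A. of_bool (c k J (x k) = c k J u) * w k u"
  shows "0 \<le> s i A" "(\<Sum>A\<in>cells k i. s i A) = 1" "A \<in> cells k i \<Longrightarrow> s i A \<le> 1"
proof -
  show s0: "0 \<le> s i A" for i A unfolding s_def using w_nonneg[OF k] by (intro sum_nonneg mult_nonneg_nonneg) auto
  have "(\<Sum>A\<in>cells k i. s i A) = (\<Sum>u\<in>F k. of_bool (c k J (x k) = c k J u) * w k u)"
    unfolding s_def by (rule sum_cells)
  also have "\<dots> = (\<Sum>u | u \<in> F k \<and> c k J u = c k J (x k). w k u)"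
    by (intro sum.mono_neutral_cong_right) auto
  also have "\<dots> = 1" using w_total[OF k c_in_cells[OF Om_app[OF x k]]] .
  finally show stot: "(\<Sum>A\<in>cells k i. s i A) = 1" .
  show "s i A \<le> 1" if "A \<in> cells k i"
    using member_le_sum[of A "cells k i" "s i"] that s0 stot by simp
qed

lemma g2_square:
  assumes k: "k \<in> {1..K}" and x: "x \<in> Om {1..K}"
  shows "(\<Sum>A\<in>cells k i. (g2 w k i A x)\<^sup>2) \<le> 2"
proof -
  have "(\<Sum>A\<in>cells k i. (g2 w k i A x)\<^sup>2) \<le> (\<Sum>A\<in>cells k i.
      (\<Sum>u | u \<in> F k \<and> c k i u = A. of_bool (c k J (x k) = c k J u) * w k u) + of_bool (c k i (x k) = A))"
    unfolding g2_def using g2_parts[OF k x] by (intro sum_mono sq_diff_le) auto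
  also have "\<dots> = 2" unfolding sum.distrib g2_parts(2)[OF k x] using sum_of_bool_cells[OF Om_app[OF x k]] by simp
  finally show ?thesis .
qed

text \<open>The same comparison of two probability vectors without squares; it yields the
  deterministic bound \<open>N2_le\<close>.\<close>

lemma g2_abs:
  assumes k: "k \<in> {1..K}" and x: "x \<in> Om {1..K}"
  shows "(\<Sum>A\<in>cells k i. \<bar>g2 w k i A x\<bar>) \<le> 2"
proof -
  have "(\<Sum>A\<in>cells k i. \<bar>g2 w k i A x\<bar>) \<le> (\<Sum>A\<in>cells k i.
      (\<Sum>u | u \<in> F k \<and> c k i u = A. of_bool (c k J (x k) = c k J u) * w k u) + of_bool (c k i (x k) = A))"
    unfolding g2_def using g2_parts(1)[OF k x]
    by (intro sum_mono order.trans[OF abs_triangle_ineq4] add_mono) auto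
  also have "\<dots> = 2" unfolding sum.distrib g2_parts(2)[OF k x] using sum_of_bool_cells[OF Om_app[OF x k]] by simp
  finally show ?thesis .
qed

lemma g1_mean: "k \<in> {1..K} \<Longrightarrow> l \<in> Lab k \<Longrightarrow> i \<le> J \<Longrightarrow> (\<Sum>x\<in>Om {1..K}. q x * g1 ker k i l A x) = 0"
  unfolding sum_g1 using cell_mass by simp

lemma card_Lab_le:
  assumes k: "k \<in> {1..K}"
  shows "card (Lab k) \<le> (\<Prod>i\<in>P k. card (cells i J))"
proof -
  have fin: "finite (P k)" using finite_P[OF k] .
  have "Lab k \<subseteq> PiE (P k) (\<lambda>i. cells i J)"
    unfolding Lab_def lab_def using Om_app c_in_cells by fastforce
  then have "card (Lab k) \<le> card (PiE (P k) (\<lambda>i. cells i J))"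
    using fin by (intro card_mono finite_PiE) auto
  then show ?thesis using fin by (simp add: card_PiE)
qed

end

section \<open>Total error of the fitted chain\<close>

context empirical_model
begin

text \<open>
  The bound by \<open>2\<close> takes over at the levels with more than about \<open>n\<close> cells.
\<close>

definition V_bound :: "nat \<Rightarrow> real" where
  "V_bound k = (\<Sum>j<M. 1 / 2 ^ j * (if Suc j \<le> J then N1 k (Suc j) else N1 k J + min 2 (N2 k (Suc j))))"

lemma N2_le:
  assumes k: "k \<in> {1..K}"
  shows "N2 k i \<le> 2"
proof -
  have "N2 k i \<le> (\<Sum>A\<in>cells k i. \<Sum>x\<in>Om {1..K}. q x * \<bar>g2 w k i A x\<bar>)"
    unfolding N2_def using emp_nonneg
    by (intro sum_mono order.trans[OF sum_abs]) (auto simp: abs_mult intro!: sum_mono)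
  also have "\<dots> = (\<Sum>x\<in>Om {1..K}. q x * (\<Sum>A\<in>cells k i. \<bar>g2 w k i A x\<bar>))"
    unfolding sum_distrib_left by (rule sum.swap)
  also have "\<dots> \<le> (\<Sum>x\<in>Om {1..K}. q x * 2)"
    using emp_nonneg coarse.g2_abs[OF k] by (intro sum_mono mult_left_mono) auto
  also have "\<dots> = 2" unfolding sum_distrib_right[symmetric] emp_total by simp
  finally show ?thesis .
qed

lemma V_le_bound: "k \<in> {1..K} \<Longrightarrow> V k \<le> V_bound k"
proof -
  assume k: "k \<in> {1..K}"
  show "V k \<le> V_bound k" unfolding V_bound_def min_absorb2[OF N2_le[OF k]] by (rule V_le[OF k])
qed

lemma fit_error:
  assumes f: "lip K \<theta> f"
  shows "\<bar>\<Sum>x\<in>Om {1..K}. (p x - emp.R K x) * f x\<bar> \<le> \<theta> * (real K * (1 + \<Lambda>) ^ K *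
    (\<eta> + 2 * (\<Lambda> * r * r) + 2 * real K * (\<Lambda> * r) * (\<Lambda> * r) + (\<Sum>k\<in>{1..K}. V_bound k)))"
proof -
  have \<theta>: "0 \<le> \<theta>" using f by (rule lip_nonneg)
  have eq: "(\<Sum>x\<in>Om {1..K}. (p x - emp.R K x) * f x) =
    (\<Sum>x\<in>Om {1..K}. (p x - coarse.R K x) * f x) + (\<Sum>x\<in>Om {1..K}. (coarse.R K x - emp.R K x) * f x)"
    unfolding sum.distrib[symmetric] by (intro sum.cong refl) (simp add: algebra_simps)
  have "\<theta> * (real K * (1 + \<Lambda>) ^ K * (\<Sum>k\<in>{1..K}. V k)) \<le> \<theta> * (real K * (1 + \<Lambda>) ^ K * (\<Sum>k\<in>{1..K}. V_bound k))"
    using \<theta> \<Lambda>_nonneg V_le_bound by (intro mult_left_mono sum_mono) auto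
  note v = order.trans[OF variance[OF f] this]
  show ?thesis
    unfolding eq by (rule order.trans[OF order.trans[OF abs_triangle_ineq add_mono[OF bias[OF f] v]]])
      (simp only: distrib_left[symmetric] order.refl)
qed

end

section \<open>Empirical laws of the quantised sample\<close>

definition emp :: "nat set \<Rightarrow> (nat \<Rightarrow> 'a) \<Rightarrow> 'a \<Rightarrow> real" where
  "emp I \<omega> a = (\<Sum>i\<in>I. of_bool (\<omega> i = a)) / real (card I)"

lemma emp_cong: "(\<And>i. i \<in> I \<Longrightarrow> \<omega> i = \<omega>' i) \<Longrightarrow> emp I \<omega> = emp I \<omega>'"
  unfolding emp_def by (intro ext arg_cong2[where f = "(/)"] sum.cong) auto

lemma emp_nonneg: "0 \<le> emp I \<omega> a"
  unfolding emp_def by (intro divide_nonneg_nonneg sum_nonneg) auto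

lemma sum_emp:
  assumes "finite S" "\<And>i. i \<in> I \<Longrightarrow> \<omega> i \<in> S"
  shows "(\<Sum>a\<in>S. emp I \<omega> a * g a) = (\<Sum>i\<in>I. g (\<omega> i)) / real (card I)"
proof -
  have "(\<Sum>a\<in>S. emp I \<omega> a * g a) = (\<Sum>a\<in>S. \<Sum>i\<in>I. of_bool (\<omega> i = a) * g a) / real (card I)"
    unfolding emp_def by (simp add: sum_divide_distrib sum_distrib_right)
  also have "(\<Sum>a\<in>S. \<Sum>i\<in>I. of_bool (\<omega> i = a) * g a) = (\<Sum>i\<in>I. \<Sum>a\<in>S. of_bool (\<omega> i = a) * g a)"
    by (rule sum.swap)
  also have "\<dots> = (\<Sum>i\<in>I. g (\<omega> i))"
  proof (intro sum.cong refl)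
    fix i assume i: "i \<in> I"
    have "(\<Sum>a\<in>S. of_bool (\<omega> i = a) * g a) = (\<Sum>a\<in>{\<omega> i}. g a)"
      using assms i by (intro sum.mono_neutral_cong_right) auto
    then show "(\<Sum>a\<in>S. of_bool (\<omega> i = a) * g a) = g (\<omega> i)" by simp
  qed
  finally show ?thesis .
qed

lemma emp_total:
  assumes "finite S" "\<And>i. i \<in> I \<Longrightarrow> \<omega> i \<in> S" "finite I" "I \<noteq> {}"
  shows "(\<Sum>a\<in>S. emp I \<omega> a) = 1"
  using sum_emp[of S I \<omega> "\<lambda>_. 1"] assms by simp

context law
begin

abbreviation emp_law :: "nat set \<Rightarrow> (nat \<Rightarrow> point) \<Rightarrow> (nat \<Rightarrow> nat \<Rightarrow> nat) \<Rightarrow> real" where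
  "emp_law I X \<equiv> emp I (\<lambda>i. qz {1..K} (X i))"

lemma quantize_vector_measurable:
  assumes "finite I" and sets: "\<And>i. i \<in> I \<Longrightarrow> sets (N i) = sets (Xs d {1..K})"
  shows "(\<lambda>X. restrict (\<lambda>i. qz {1..K} (X i)) I) \<in> PiM I N \<rightarrow>\<^sub>M count_space (PiE I (\<lambda>_. Om {1..K}))"
proof (subst measurable_count_space_eq2)
  show "finite (PiE I (\<lambda>_. Om {1..K}))" using assms(1) by (intro finite_PiE) auto
  show "(\<lambda>X. restrict (\<lambda>i. qz {1..K} (X i)) I) \<in> space (PiM I N) \<rightarrow> PiE I (\<lambda>_. Om {1..K}) \<and>
    (\<forall>a\<in>PiE I (\<lambda>_. Om {1..K}). (\<lambda>X. restrict (\<lambda>i. qz {1..K} (X i)) I) -` {a} \<inter> space (PiM I N) \<in> sets (PiM I N))"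
  proof (intro conjI ballI)
    fix a assume a: "a \<in> PiE I (\<lambda>_. Om {1..K})"
    have "(\<lambda>X. restrict (\<lambda>i. qz {1..K} (X i)) I) -` {a} \<inter> space (PiM I N) =
      {X \<in> space (PiM I N). \<forall>i\<in>I. qz {1..K} (X i) = a i}"
      using a by (auto simp: fun_eq_iff restrict_def PiE_def extensional_def split: if_splits)
    also have "\<dots> \<in> sets (PiM I N)"
    proof (intro sets.sets_Collect_finite_All assms(1))
      fix i assume i: "i \<in> I"
      have "(\<lambda>X. X i) \<in> PiM I N \<rightarrow>\<^sub>M N i" using i by (rule measurable_component_singleton)
      moreover have "qz {1..K} \<in> N i \<rightarrow>\<^sub>M count_space (Om {1..K})"
        unfolding measurable_cong_sets[OF sets[OF i] refl] by (rule qz_measurable) simp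
      ultimately have "(\<lambda>X. qz {1..K} (X i)) \<in> PiM I N \<rightarrow>\<^sub>M count_space (Om {1..K})"
        by (rule measurable_compose)
      from measurable_sets[OF this, of "{a i}"] a i
      have "(\<lambda>X. qz {1..K} (X i)) -` {a i} \<inter> space (PiM I N) \<in> sets (PiM I N)" by auto
      moreover have "(\<lambda>X. qz {1..K} (X i)) -` {a i} \<inter> space (PiM I N) = {X \<in> space (PiM I N). qz {1..K} (X i) = a i}"
        by auto
      ultimately show "{X \<in> space (PiM I N). qz {1..K} (X i) = a i} \<in> sets (PiM I N)" by simp
    qed
    finally show "(\<lambda>X. restrict (\<lambda>i. qz {1..K} (X i)) I) -` {a} \<inter> space (PiM I N) \<in> sets (PiM I N)" .
  qed auto
qed

lemma emp_law_restrict: "I \<subseteq> I' \<Longrightarrow> emp_law I X = emp I (restrict (\<lambda>i. qz {1..K} (X i)) I')"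
  by (rule emp_cong) auto

text \<open>The empirical laws depend on the sample through a vector of letters, which has finitely
  many values; hence \<open>h\<close> may be arbitrary, in particular it may involve the selection
  of a graph.\<close>

lemma emp_law_measurable:
  fixes h :: "_ \<Rightarrow> _ \<Rightarrow> 'e::topological_space"
  assumes I: "finite I" "I1 \<subseteq> I" "I2 \<subseteq> I"
  shows "(\<lambda>X. h (emp_law I1 X) (emp_law I2 X)) \<in> borel_measurable (PiM I (\<lambda>_. \<mu>))"
  unfolding emp_law_restrict[OF I(2)] emp_law_restrict[OF I(3)]
  by (rule measurable_compose[OF quantize_vector_measurable]) (use I(1) sets_\<mu> in auto)

lemma emp_law_integrable:
  fixes h :: "_ \<Rightarrow> real"
  assumes I: "finite I"
  shows "integrable (PiM I (\<lambda>_. \<mu>)) (\<lambda>X. h (emp_law I X))"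
proof -
  interpret PI: prob_space "PiM I (\<lambda>_. \<mu>)" by (rule prob_PiM)
  let ?\<Omega> = "PiE I (\<lambda>_. Om {1..K})"
  have fin: "finite ?\<Omega>" using I by (intro finite_PiE) auto
  have "\<bar>h (emp_law I X)\<bar> \<le> (\<Sum>\<omega>\<in>?\<Omega>. \<bar>h (emp I \<omega>)\<bar>)" for X
    unfolding emp_law_restrict[OF order.refl]
    using fin by (intro member_le_sum[of _ ?\<Omega> "\<lambda>\<omega>. \<bar>h (emp I \<omega>)\<bar>"]) auto
  then show ?thesis
    using emp_law_measurable[OF I order.refl order.refl, of "\<lambda>q _. h q"]
    by (intro PI.integrable_const_bound[where B = "\<Sum>\<omega>\<in>?\<Omega>. \<bar>h (emp I \<omega>)\<bar>"]) auto
qed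

text \<open>Squares that sum to at most two at each letter give total variance at most two,
  uniformly in the number of test functions.\<close>

lemma expected_deviation_real:
  fixes g :: "'z \<Rightarrow> (nat \<Rightarrow> nat \<Rightarrow> nat) \<Rightarrow> real" and I :: "nat set"
  assumes I: "finite I" "I \<noteq> {}" and C: "finite C" "real (card C) \<le> N" "0 < N"
    and mean: "\<And>z. z \<in> C \<Longrightarrow> (\<Sum>a\<in>Om {1..K}. p a * g z a) = 0"
    and sq: "\<And>a. a \<in> Om {1..K} \<Longrightarrow> (\<Sum>z\<in>C. (g z a)\<^sup>2) \<le> 2"
  shows "(\<integral>X. (\<Sum>z\<in>C. \<bar>\<Sum>a\<in>Om {1..K}. emp_law I X a * g z a\<bar>) \<partial>PiM I (\<lambda>_. \<mu>)) \<le> sqrt (2 * N / real (card I))"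
proof -
  have "(\<Sum>z\<in>C. \<Sum>a\<in>Om {1..K}. p a * (g z a)\<^sup>2) = (\<Sum>a\<in>Om {1..K}. p a * (\<Sum>z\<in>C. (g z a)\<^sup>2))"
    unfolding sum_distrib_left by (rule sum.swap)
  also have "\<dots> \<le> (\<Sum>a\<in>Om {1..K}. p a * 2)"
    using sq p_nonneg by (intro sum_mono mult_left_mono)
  also have "\<dots> = 2" unfolding sum_distrib_right[symmetric] p_total by simp
  finally have var: "(\<Sum>z\<in>C. \<Sum>a\<in>Om {1..K}. p a * (g z a)\<^sup>2) \<le> 2" .
  let ?f = "\<lambda>X. \<Sum>z\<in>C. \<bar>\<Sum>a\<in>Om {1..K}. emp_law I X a * g z a\<bar>"
  have int: "integrable (PiM I (\<lambda>_. \<mu>)) ?f"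
    by (rule emp_law_integrable[OF I(1), of "\<lambda>q. \<Sum>z\<in>C. \<bar>\<Sum>a\<in>Om {1..K}. q a * g z a\<bar>"])
  have "ennreal (\<integral>X. ?f X \<partial>PiM I (\<lambda>_. \<mu>)) = (\<integral>\<^sup>+X. ennreal (?f X) \<partial>PiM I (\<lambda>_. \<mu>))"
    by (rule nn_integral_eq_integral[symmetric, OF int]) (simp add: sum_nonneg)
  also have "\<dots> = (\<integral>\<^sup>+X. ennreal (\<Sum>z\<in>C. \<bar>(\<Sum>i\<in>I. g z (qz {1..K} (X i))) / real (card I)\<bar>) \<partial>PiM I (\<lambda>_. \<mu>))"
    by (subst sum_emp) auto
  also have "\<dots> \<le> ennreal (sqrt (2 * N / real (card I)))"
    using expected_empirical_deviation[OF I C _ mean var] by simp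
  finally show ?thesis by (subst (asm) ennreal_le_iff) (use C in auto)
qed

end

section \<open>The fitted law for one graph\<close>

definition fit :: "(nat \<Rightarrow> nat) \<Rightarrow> nat \<Rightarrow> nat \<Rightarrow> nat \<Rightarrow> (nat \<times> nat) set \<Rightarrow>
    ((nat \<Rightarrow> nat \<Rightarrow> nat) \<Rightarrow> real) \<Rightarrow> (nat \<Rightarrow> nat \<Rightarrow> nat) \<Rightarrow> real" where
  "fit d M K J G q = graph_tree.chainw (coarsen d M) (pa G) J
     (graph_tree.transition (alphabet d M) (coarsen d M) K (pa G) J q)
     (graph_tree.cell_law (alphabet d M) (coarsen d M) K J q) K"

definition graphs :: "nat \<Rightarrow> (nat \<times> nat) set set" where
  "graphs K = {G. sorted_dag K G \<and> (\<forall>k\<in>{1..K}. fully_connected G (pa G k))}"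

text \<open>Up to rounding \<open>2 ^ J = n powr (1 / (2 + d_loc))\<close>, computable from the
  candidate graph and \<open>n\<close> without knowledge of \<open>L\<close>.\<close>

definition level :: "nat \<Rightarrow> (nat \<Rightarrow> nat) \<Rightarrow> nat \<Rightarrow> (nat \<times> nat) set \<Rightarrow> nat" where
  "level K d n G = nat \<lfloor>log 2 (real n) / (2 + real (d_loc K d G))\<rfloor>"

lemma finite_graphs [simp]: "finite (graphs K)"
  by (rule finite_subset[of _ "Pow ({1..K} \<times> {1..K})"]) (auto simp: graphs_def sorted_dag_def)

lemma graph_tree_graphs:
  assumes "G \<in> graphs K"
  shows "graph_tree (alphabet d M) (coarsen d M) K (pa G)"
proof (intro graph_tree.intro graph_tree_axioms.intro T.tree_axioms)
  show "pa G k \<subseteq> {1..<k}" if "k \<in> {1..K}" for k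
    using assms unfolding graphs_def sorted_dag_def pa_def by fastforce
  show "i \<in> pa G l" if "k \<in> {1..K}" "i \<in> pa G k" "l \<in> pa G k" "i < l" for k i l
    using assms that unfolding graphs_def fully_connected_def pa_def by blast
qed

lemma fit_pmf:
  assumes G: "G \<in> graphs K" and q: "\<And>a. a \<in> T.Om d M {1..K} \<Longrightarrow> 0 \<le> q a" "(\<Sum>a\<in>T.Om d M {1..K}. q a) = 1"
  shows "a \<in> T.Om d M {1..K} \<Longrightarrow> 0 \<le> fit d M K J G q a" "(\<Sum>a\<in>T.Om d M {1..K}. fit d M K J G q a) = 1"
proof -
  interpret C: coarse_chain "alphabet d M" "coarsen d M" K "pa G" J q
    "graph_tree.transition (alphabet d M) (coarsen d M) K (pa G) J q"
    "graph_tree.cell_law (alphabet d M) (coarsen d M) K J q"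
    using q by (rule graph_tree.coarse_chain_transition[OF graph_tree_graphs[OF G]])
  show "a \<in> T.Om d M {1..K} \<Longrightarrow> 0 \<le> fit d M K J G q a"
    unfolding fit_def by (rule C.R_nonneg[OF order.refl])
  show "(\<Sum>a\<in>T.Om d M {1..K}. fit d M K J G q a) = 1"
    unfolding fit_def by (rule C.R_total[OF order.refl])
qed

definition fit_const :: "nat \<Rightarrow> (nat \<Rightarrow> nat) \<Rightarrow> real \<Rightarrow> real" where
  "fit_const K d \<Lambda> = real K * (1 + \<Lambda>) ^ K *
    (9 * \<Lambda> + 8 * real K * \<Lambda>\<^sup>2 + real K * (3 * sqrt (6 * 2 ^ d_max K d) + 8))"

definition rate :: "nat \<Rightarrow> (nat \<Rightarrow> nat) \<Rightarrow> nat \<Rightarrow> (nat \<times> nat) set \<Rightarrow> real" where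
  "rate K d n G = max 1 (ln (real n)) *
    (real n powr (- 2 / (2 + real (d_loc K d G))) + real n powr (- 1 / real (d_max K d)))"

lemma d_max_ge: "k \<in> {1..K} \<Longrightarrow> max 2 (d k) \<le> d_max K d"
  unfolding d_max_def by (intro Max_ge) auto

lemma d_loc_ge: "k \<in> {1..K} \<Longrightarrow> (\<Sum>l\<in>pa G k. d l) + max 2 (d k) \<le> d_loc K d G"
  unfolding d_loc_def by (subst add.commute, intro Max_ge) auto

text \<open>The terms that the rate has to absorb: the quantisation error, the validation error and
  the squared mesh. For the first two \<open>d_max \<ge> 2\<close> is decisive; the factor
  \<open>4\<close> comes from rounding the level down.\<close>

lemma rate_ge:
  assumes "1 \<le> K" "1 \<le> n"
  shows "1 / real n \<le> rate K d n G" "real n powr - (1 / 2) \<le> rate K d n G" "(1 / 2 ^ level K d n G)\<^sup>2 \<le> 4 * rate K d n G"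
    "0 \<le> rate K d n G"
proof -
  define R1 where "R1 = real n powr (- 2 / (2 + real (d_loc K d G)))"
  define R2 where "R2 = real n powr (- 1 / real (d_max K d))"
  have R: "0 \<le> R1" "0 \<le> R2" unfolding R1_def R2_def by auto
  have sum: "R1 + R2 \<le> rate K d n G"
    unfolding rate_def R1_def[symmetric] R2_def[symmetric] using R mult_right_mono[of 1 "max 1 (ln (real n))" "R1 + R2"] by simp
  have e: "2 \<le> d_max K d" using d_max_ge[of 1 K d] assms by auto
  then have D: "1 / real (d_max K d) \<le> 1 / 2" by (simp add: field_simps)
  have "real n powr - 1 \<le> R2"
    unfolding R2_def by (rule powr_mono) (use D assms in linarith)+
  then have "1 / real n \<le> R2" using assms by (simp add: powr_minus_divide)
  then show "1 / real n \<le> rate K d n G" using sum R by linarith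
  have "real n powr - (1 / 2) \<le> R2"
    unfolding R2_def by (rule powr_mono) (use D assms in linarith)+
  then show "real n powr - (1 / 2) \<le> rate K d n G" using sum R by linarith
  show "0 \<le> rate K d n G" using sum R by simp
  have "real n powr (1 / (2 + real (d_loc K d G))) \<le> 2 * 2 ^ level K d n G"
    unfolding level_def using assms by (intro level_bounds) auto
  moreover have "0 < real n powr (1 / (2 + real (d_loc K d G)))" using assms by simp
  ultimately have "1 / 2 ^ level K d n G \<le> 2 * real n powr (- (1 / (2 + real (d_loc K d G))))"
    by (simp add: powr_minus_divide field_simps)
  then have "(1 / 2 ^ level K d n G)\<^sup>2 \<le> (2 * real n powr (- (1 / (2 + real (d_loc K d G)))))\<^sup>2"
    by (intro power_mono) auto
  also have "\<dots> = 4 * (real n powr (- (1 / (2 + real (d_loc K d G)))))\<^sup>2" by (simp add: power_mult_distrib)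
  also have "(real n powr (- (1 / (2 + real (d_loc K d G)))))\<^sup>2 = R1"
    unfolding R1_def power2_eq_square powr_add[symmetric] by (rule arg_cong[where f = "\<lambda>t. real n powr t"]) (simp add: field_simps)
  finally show "(1 / 2 ^ level K d n G)\<^sup>2 \<le> 4 * rate K d n G" using sum R by simp
qed

context graph_law
begin

text \<open>The bound \<open>\<delta>\<close> holds for all test functions at once and is a function
  of the empirical law. It can therefore be integrated over the sample and also be used in
  \<open>selection\<close>, whose test functions depend on the same half of the sample.\<close>

lemma expected_fit_error:
  assumes K: "1 \<le> K" and I: "finite I" "I \<noteq> {}" and n: "2 \<le> n" "real n \<le> 3 * real (card I)" and M: "M = n"
  defines "J \<equiv> level K d n G" and "\<Lambda> \<equiv> 2 * \<bar>L\<bar>"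
  shows "\<exists>\<delta>. (\<forall>X f \<theta>. T.lip d M K \<theta> f \<longrightarrow>
      \<bar>\<Sum>x\<in>Om {1..K}. (p x - fit d M K J G (emp_law I X) x) * f x\<bar> \<le> \<theta> * \<delta> (emp_law I X)) \<and>
    (\<forall>X. 0 \<le> \<delta> (emp_law I X)) \<and>
    (\<integral>X. \<delta> (emp_law I X) \<partial>PiM I (\<lambda>_. \<mu>)) \<le> fit_const K d \<Lambda> * rate K d n G"
proof -
  let ?P = "PiM I (\<lambda>_. \<mu>)"
  interpret PI: prob_space ?P by (rule prob_PiM)
  obtain \<kappa> where \<kappa>: "smooth_model (alphabet d M) (coarsen d M) K (pa G) J p \<kappa> (2 * \<bar>L\<bar>) (2 * \<bar>L\<bar> / 2 ^ M)"
    using smooth_model_ex by blast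
  interpret S: smooth_model "alphabet d M" "coarsen d M" K "pa G" J p \<kappa> \<Lambda> "\<Lambda> / 2 ^ M"
    unfolding \<Lambda>_def by (rule \<kappa>)
  define N1 where "N1 q k i = (\<Sum>l\<in>S.Lab k. \<Sum>A\<in>S.cells k i. \<bar>\<Sum>x\<in>Om {1..K}. q x * S.g1 S.coarse.ker k i l A x\<bar>)" for q k i
  define N2 where "N2 q k i = (\<Sum>A\<in>S.cells k i. \<bar>\<Sum>x\<in>Om {1..K}. q x * S.g2 S.w k i A x\<bar>)" for q k i
  define V where "V q k = (\<Sum>j<M. 1 / 2 ^ j * (if Suc j \<le> J then N1 q k (Suc j) else N1 q k J + min 2 (N2 q k (Suc j))))" for q k
  define c where "c = real K * (1 + \<Lambda>) ^ K"
  define b where "b = \<Lambda> / 2 ^ M + 2 * (\<Lambda> * (1 / 2 ^ J) * (1 / 2 ^ J)) + 2 * real K * (\<Lambda> * (1 / 2 ^ J)) * (\<Lambda> * (1 / 2 ^ J))"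
  define \<delta> where "\<delta> q = c * (b + (\<Sum>k\<in>{1..K}. V q k))" for q
  have \<Lambda>0: "0 \<le> \<Lambda>" unfolding \<Lambda>_def by simp
  have c0: "0 \<le> c" unfolding c_def using \<Lambda>0 by simp
  have N0: "0 \<le> N1 q k i" "0 \<le> N2 q k i" for q k i unfolding N1_def N2_def by (auto intro!: sum_nonneg)
  have V0: "0 \<le> V q k" for q k unfolding V_def using N0 by (auto intro!: sum_nonneg)
  have b0: "0 \<le> b" unfolding b_def using \<Lambda>0 by simp
  have 1: "\<bar>\<Sum>x\<in>Om {1..K}. (p x - fit d M K J G (emp_law I X) x) * f x\<bar> \<le> \<theta> * \<delta> (emp_law I X)"
    if f: "T.lip d M K \<theta> f" for X f \<theta>
  proof -
    interpret E: empirical_model "alphabet d M" "coarsen d M" K "pa G" J p \<kappa> \<Lambda> "\<Lambda> / 2 ^ M" "emp_law I X" M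
    proof
      show "0 \<le> emp_law I X x" for x by (rule emp_nonneg)
      show "(\<Sum>x\<in>Om {1..K}. emp_law I X x) = 1" using I by (intro emp_total) auto
      show "u = v" if "u \<in> alphabet d M k" "v \<in> alphabet d M k" "coarsen d M k M u = coarsen d M k M v" for u v k
        using that by (rule coarsen_inj)
    qed
    have "E.V_bound k = V (emp_law I X) k" for k
      unfolding E.V_bound_def V_def E.N1_def E.N2_def N1_def N2_def ..
    then show ?thesis
      using E.fit_error[OF f] unfolding \<delta>_def fit_def c_def b_def by simp
  qed
  have int: "integrable ?P (\<lambda>X. h (emp_law I X))" for h :: "_ \<Rightarrow> real"
    by (rule emp_law_integrable[OF I(1)])
  define dp where "dp k = (\<Sum>l\<in>pa G k. d l)" for k
  define s1 where "s1 k i = sqrt (6 * (2 ^ (J * dp k) * 2 ^ (i * d k)) / real n)" for k i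
  define s2 where "s2 k i = min 2 (sqrt (6 * 2 ^ (i * d k) / real n))" for k i
  \<comment> \<open>The factor three between \<open>n\<close> and the size of the subsample turns
    the variance constant \<open>2\<close> into the \<open>6\<close> of
    \<open>sum_levels_bound\<close>.\<close>
  have six: "2 * N / real (card I) \<le> 6 * N / real n" if "0 \<le> N" for N :: real
  proof -
    have "0 < real (card I)" using I by (simp add: card_gt_0_iff)
    moreover have "N * real n \<le> N * (3 * real (card I))" using n(2) that by (rule mult_left_mono)
    ultimately show ?thesis using n by (simp add: field_simps)
  qed
  \<comment> \<open>Holds since \<open>2 ^ J \<le> n < 2 ^ n\<close>, so the coarse level is at most
    the finest one and \<open>card_coarsen\<close> applies to it.\<close>
  have JM: "J \<le> M"
  proof -
    have "2 ^ J \<le> real n powr (1 / (2 + real (d_loc K d G)))"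
      unfolding J_def level_def using n by (intro level_bounds) auto
    also have "\<dots> \<le> real n powr 1" using n by (intro powr_mono) auto
    also have "\<dots> < 2 ^ n" using of_nat_less_two_power[of n] by simp
    finally show ?thesis unfolding M by simp
  qed
  have cells_card: "real (card (S.cells k i)) \<le> 2 ^ (i * d k)" if "i \<le> M" for k i
  proof -
    have "real (card (S.cells k i)) \<le> real (2 ^ (i * d k))"
      unfolding S.cells_def using card_coarsen[OF that] by (rule of_nat_mono)
    then show ?thesis by simp
  qed
  have Lab_card: "real (card (S.Lab k)) \<le> 2 ^ (J * dp k)" if k: "k \<in> {1..K}" for k
  proof -
    have "real (card (S.Lab k)) \<le> (\<Prod>i\<in>pa G k. real (card (S.cells i J)))"
      using of_nat_mono[OF S.coarse.card_Lab_le[OF k]] by simp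
    also have "\<dots> \<le> (\<Prod>i\<in>pa G k. 2 ^ (J * d i))"
      using cells_card[OF JM] by (intro prod_mono) auto
    also have "\<dots> = 2 ^ (J * dp k)" unfolding dp_def by (simp add: power_sum sum_distrib_left)
    finally show ?thesis .
  qed
  have EN1: "(\<integral>X. N1 (emp_law I X) k i \<partial>?P) \<le> s1 k i" if k: "k \<in> {1..K}" and i: "i \<le> J" for k i
  proof -
    let ?C = "S.Lab k \<times> S.cells k i" and ?N = "2 ^ (J * dp k) * 2 ^ (i * d k) :: real"
    have "(\<integral>X. (\<Sum>z\<in>?C. \<bar>\<Sum>a\<in>Om {1..K}. emp_law I X a * S.g1 S.coarse.ker k i (fst z) (snd z) a\<bar>) \<partial>?P) \<le> sqrt (2 * ?N / real (card I))"
    proof (rule expected_deviation_real[OF I])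
      show "finite ?C" using k by simp
      show "real (card ?C) \<le> ?N"
        unfolding card_cartesian_product of_nat_mult using i JM by (intro mult_mono Lab_card[OF k] cells_card) auto
      show "(\<Sum>a\<in>Om {1..K}. p a * S.g1 S.coarse.ker k i (fst z) (snd z) a) = 0" if "z \<in> ?C" for z
        using that k i by (intro S.coarse.g1_mean) auto
      show "(\<Sum>z\<in>?C. (S.g1 S.coarse.ker k i (fst z) (snd z) a)\<^sup>2) \<le> 2" if "a \<in> Om {1..K}" for a
        using S.coarse.g1_square[OF k that, of i] by (simp add: sum.cartesian_product split_def)
    qed simp
    also have "\<dots> \<le> s1 k i" unfolding s1_def by (intro real_sqrt_le_mono six) simp
    finally show ?thesis unfolding N1_def by (simp add: sum.cartesian_product split_def)
  qed
  have EN2: "(\<integral>X. min 2 (N2 (emp_law I X) k i) \<partial>?P) \<le> s2 k i" if k: "k \<in> {1..K}" and i: "i \<le> M" for k i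
  proof -
    let ?N = "2 ^ (i * d k) :: real"
    have "(\<integral>X. N2 (emp_law I X) k i \<partial>?P) \<le> sqrt (2 * ?N / real (card I))"
      unfolding N2_def
    proof (rule expected_deviation_real[OF I])
      show "finite (S.cells k i)" by simp
      show "real (card (S.cells k i)) \<le> ?N" using i by (rule cells_card)
      show "(\<Sum>a\<in>Om {1..K}. p a * S.g2 S.w k i A a) = 0" for A
        unfolding S.sum_g2[OF k] S.cell_law_mass[OF k p_nonneg] by simp
      show "(\<Sum>A\<in>S.cells k i. (S.g2 S.w k i A a)\<^sup>2) \<le> 2" if "a \<in> Om {1..K}" for a
        by (rule S.coarse.g2_square[OF k that])
    qed simp
    also have "\<dots> \<le> sqrt (6 * ?N / real n)" by (intro real_sqrt_le_mono six) simp
    finally have a: "(\<integral>X. N2 (emp_law I X) k i \<partial>?P) \<le> sqrt (6 * ?N / real n)" .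
    have "(\<integral>X. min 2 (N2 (emp_law I X) k i) \<partial>?P) \<le> (\<integral>X. N2 (emp_law I X) k i \<partial>?P)"
      by (intro integral_mono int[of "\<lambda>q. min 2 (N2 q k i)"] int[of "\<lambda>q. N2 q k i"]) auto
    moreover have "(\<integral>X. min 2 (N2 (emp_law I X) k i) \<partial>?P) \<le> 2"
      by (intro PI.integral_le_const int[of "\<lambda>q. min 2 (N2 q k i)"] AE_I2) auto
    ultimately show ?thesis unfolding s2_def using a by auto
  qed
  have EV: "(\<integral>X. V (emp_law I X) k \<partial>?P) \<le> (3 * sqrt (6 * 2 ^ d_max K d) + 8) * rate K d n G" if k: "k \<in> {1..K}" for k
  proof -
    have "(\<integral>X. V (emp_law I X) k \<partial>?P) = (\<Sum>j<M. \<integral>X. 1 / 2 ^ j *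
        (if Suc j \<le> J then N1 (emp_law I X) k (Suc j) else N1 (emp_law I X) k J + min 2 (N2 (emp_law I X) k (Suc j))) \<partial>?P)"
      unfolding V_def
      by (rule Bochner_Integration.integral_sum)
        (rule int[of "\<lambda>q. 1 / 2 ^ j * (if Suc j \<le> J then N1 q k (Suc j) else N1 q k J + min 2 (N2 q k (Suc j)))" for j])
    also have "\<dots> \<le> (\<Sum>j<M. 1 / 2 ^ j * (if Suc j \<le> J then s1 k (Suc j) else s1 k J + s2 k (Suc j)))"
    proof (intro sum_mono)
      fix j assume j: "j \<in> {..<M}"
      show "(\<integral>X. 1 / 2 ^ j * (if Suc j \<le> J then N1 (emp_law I X) k (Suc j) else N1 (emp_law I X) k J + min 2 (N2 (emp_law I X) k (Suc j))) \<partial>?P)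
        \<le> 1 / 2 ^ j * (if Suc j \<le> J then s1 k (Suc j) else s1 k J + s2 k (Suc j))"
      proof (cases "Suc j \<le> J")
        case True
        have "(\<integral>X. 1 / 2 ^ j * N1 (emp_law I X) k (Suc j) \<partial>?P) = 1 / 2 ^ j * (\<integral>X. N1 (emp_law I X) k (Suc j) \<partial>?P)"
          by (rule integral_mult_right_zero)
        then show ?thesis using True EN1[OF k True] by (simp add: mult_left_mono divide_right_mono)
      next
        case False
        have "(\<integral>X. 1 / 2 ^ j * (N1 (emp_law I X) k J + min 2 (N2 (emp_law I X) k (Suc j))) \<partial>?P) =
           1 / 2 ^ j * (\<integral>X. N1 (emp_law I X) k J + min 2 (N2 (emp_law I X) k (Suc j)) \<partial>?P)"
          by (rule integral_mult_right_zero)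
        also have "(\<integral>X. N1 (emp_law I X) k J + min 2 (N2 (emp_law I X) k (Suc j)) \<partial>?P) =
           (\<integral>X. N1 (emp_law I X) k J \<partial>?P) + (\<integral>X. min 2 (N2 (emp_law I X) k (Suc j)) \<partial>?P)"
          by (intro Bochner_Integration.integral_add int[of "\<lambda>q. N1 q k J"] int[of "\<lambda>q. min 2 (N2 q k (Suc j))"])
        finally have "(\<integral>X. 1 / 2 ^ j * (N1 (emp_law I X) k J + min 2 (N2 (emp_law I X) k (Suc j))) \<partial>?P) \<le>
           1 / 2 ^ j * (s1 k J + s2 k (Suc j))"
          using EN1[OF k order.refl] EN2[OF k, of "Suc j"] j by (simp add: divide_right_mono add_mono)
        then show ?thesis using False by simp
      qed
    qed
    also have "\<dots> \<le> (3 * sqrt (6 * 2 ^ d_max K d) + 8) * max 1 (ln (real n)) *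
      (real n powr (- 2 / (2 + real (d_loc K d G))) + real n powr (- 1 / real (d_max K d)))"
      unfolding s1_def s2_def
      by (rule sum_levels_bound[OF n(1) d_loc_ge[OF k, where d = d and G = G, folded dp_def] d_max_ge[OF k, where d = d]]) (simp add: J_def level_def)
    finally show ?thesis unfolding rate_def by (simp only: mult.assoc)
  qed
  have n1: "1 \<le> n" using n by simp
  note rg = rate_ge[OF K n1, of d G]
  \<comment> \<open>One \<open>\<Lambda>\<close> comes from quantisation, the other eight from twice
    the squared mesh, which is at most four times the rate; the same factor gives
    \<open>8 * real K\<close>.\<close>
  have "b \<le> (9 * \<Lambda> + 8 * real K * \<Lambda>\<^sup>2) * rate K d n G"
  proof -
    have "1 / 2 ^ M \<le> 1 / real n"
      unfolding M using of_nat_less_two_power[of n] n by (intro divide_left_mono) auto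
    then have "1 / 2 ^ M \<le> rate K d n G" using rg(1) by linarith
    then have "\<Lambda> * (1 / 2 ^ M) \<le> \<Lambda> * rate K d n G" using \<Lambda>0 by (rule mult_left_mono)
    moreover have "(2 * \<Lambda> + 2 * real K * \<Lambda>\<^sup>2) * (1 / 2 ^ J)\<^sup>2 \<le> (2 * \<Lambda> + 2 * real K * \<Lambda>\<^sup>2) * (4 * rate K d n G)"
      using \<Lambda>0 rg(3) unfolding J_def by (intro mult_left_mono) auto
    moreover have "b = \<Lambda> * (1 / 2 ^ M) + (2 * \<Lambda> + 2 * real K * \<Lambda>\<^sup>2) * (1 / 2 ^ J)\<^sup>2"
      unfolding b_def power2_eq_square by (simp add: algebra_simps)
    ultimately show ?thesis by (simp add: algebra_simps)
  qed
  moreover have "(\<Sum>k\<in>{1..K}. \<integral>X. V (emp_law I X) k \<partial>?P) \<le> (\<Sum>k\<in>{1..K}. (3 * sqrt (6 * 2 ^ d_max K d) + 8) * rate K d n G)"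
    by (intro sum_mono EV)
  ultimately have "b + (\<Sum>k\<in>{1..K}. \<integral>X. V (emp_law I X) k \<partial>?P) \<le>
    (9 * \<Lambda> + 8 * real K * \<Lambda>\<^sup>2 + real K * (3 * sqrt (6 * 2 ^ d_max K d) + 8)) * rate K d n G"
    by (simp add: algebra_simps)
  then have "c * (b + (\<Sum>k\<in>{1..K}. \<integral>X. V (emp_law I X) k \<partial>?P)) \<le> fit_const K d \<Lambda> * rate K d n G"
    unfolding fit_const_def c_def[symmetric] mult.assoc using c0 by (intro mult_left_mono) auto
  moreover have "(\<integral>X. \<delta> (emp_law I X) \<partial>?P) = c * (b + (\<Sum>k\<in>{1..K}. \<integral>X. V (emp_law I X) k \<partial>?P))"
  proof -
    have "(\<integral>X. \<delta> (emp_law I X) \<partial>?P) = c * (\<integral>X. b + (\<Sum>k\<in>{1..K}. V (emp_law I X) k) \<partial>?P)"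
      unfolding \<delta>_def by (rule integral_mult_right_zero)
    also have "(\<integral>X. b + (\<Sum>k\<in>{1..K}. V (emp_law I X) k) \<partial>?P) = (\<integral>X. b \<partial>?P) + (\<integral>X. (\<Sum>k\<in>{1..K}. V (emp_law I X) k) \<partial>?P)"
      by (intro Bochner_Integration.integral_add int[of "\<lambda>_. b"] int[of "\<lambda>q. \<Sum>k\<in>{1..K}. V q k"])
    also have "(\<integral>X. (\<Sum>k\<in>{1..K}. V (emp_law I X) k) \<partial>?P) = (\<Sum>k\<in>{1..K}. \<integral>X. V (emp_law I X) k \<partial>?P)"
      by (rule Bochner_Integration.integral_sum) (rule int[of "\<lambda>q. V q k" for k])
    finally show ?thesis by (simp add: PI.prob_space)
  qed
  moreover have "0 \<le> \<delta> q" for q unfolding \<delta>_def using c0 b0 V0 by (intro mult_nonneg_nonneg add_nonneg_nonneg sum_nonneg)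
  ultimately show ?thesis using 1 by (intro exI[of _ \<delta>]) auto
qed

end

section \<open>The estimator\<close>

definition candidate :: "nat \<Rightarrow> (nat \<Rightarrow> nat) \<Rightarrow> nat \<Rightarrow> ((nat \<Rightarrow> nat \<Rightarrow> nat) \<Rightarrow> real) \<Rightarrow> (nat \<times> nat) set \<Rightarrow>
    (nat \<Rightarrow> nat \<Rightarrow> nat) \<Rightarrow> real" where
  "candidate K d n q G = fit d n K (level K d n G) G q"

text \<open>Both the candidates and the functions that test them are made from \<open>q\<close>; the
  second law \<open>q'\<close> serves only to choose among them.\<close>

definition selected :: "nat \<Rightarrow> (nat \<Rightarrow> nat) \<Rightarrow> nat \<Rightarrow> ((nat \<Rightarrow> nat \<Rightarrow> nat) \<Rightarrow> real) \<Rightarrow>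
    ((nat \<Rightarrow> nat \<Rightarrow> nat) \<Rightarrow> real) \<Rightarrow> (nat \<Rightarrow> nat \<Rightarrow> nat) \<Rightarrow> real" where
  "selected K d n q q' = candidate K d n q (T.select d n K n (candidate K d n q) (graphs K) q')"

definition split_estimator :: "nat \<Rightarrow> (nat \<Rightarrow> nat) \<Rightarrow> nat \<Rightarrow> (nat \<Rightarrow> point) \<Rightarrow> point measure" where
  "split_estimator K d n X = grid_measure d n K
     (selected K d n (emp {1..n div 2} (\<lambda>i. quantize d n {1..K} (X i)))
       (emp {Suc (n div 2)..n} (\<lambda>i. quantize d n {1..K} (X i))))"

lemma empty_graph: "{} \<in> graphs K"
  by (simp add: graphs_def sorted_dag_def pa_def fully_connected_def acyclic_def)

lemma quantized_estimator:
  assumes nonneg: "\<And>\<omega> a. \<omega> \<in> PiE {1..n} (\<lambda>_. T.Om d M {1..K}) \<Longrightarrow> a \<in> T.Om d M {1..K} \<Longrightarrow> 0 \<le> W \<omega> a"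
    and total: "\<And>\<omega>. \<omega> \<in> PiE {1..n} (\<lambda>_. T.Om d M {1..K}) \<Longrightarrow> (\<Sum>a\<in>T.Om d M {1..K}. W \<omega> a) = 1"
  shows "(\<lambda>X. grid_measure d M K (W (restrict (\<lambda>i. quantize d M {1..K} (X i)) {1..n}))) \<in> estimators K d n"
proof -
  \<comment> \<open>A point mass at the origin gives access to the measurability lemmas of
    \<open>law\<close>, which are stated for a given law.\<close>
  have "(\<lambda>i\<in>{1..K}. \<lambda>j\<in>{..<d i}. 0) \<in> space (Xs d {1..K})"
    unfolding Xs_def cube_def by (auto simp: space_PiM space_restrict_space)
  then interpret law d M K "return (Xs d {1..K}) (\<lambda>i\<in>{1..K}. \<lambda>j\<in>{..<d i}. 0)"
    by unfold_locales (auto simp: space_prob_algebra intro: prob_space_return)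
  have "(\<lambda>\<omega>. grid_measure d M K (W \<omega>)) \<in> count_space (PiE {1..n} (\<lambda>_. Om {1..K})) \<rightarrow>\<^sub>M prob_algebra (Xs d {1..K})"
    unfolding measurable_count_space_eq1 space_prob_algebra
    using nonneg total by (intro Pi_I CollectI conjI sets_grid_measure prob_space_grid_measure) auto
  from measurable_compose[OF quantize_vector_measurable[of "{1..n}" "\<lambda>_. Xs d {1..K}"] this]
  show ?thesis unfolding estimators_def by simp
qed

lemma selected_pmf:
  assumes q: "\<And>a. a \<in> T.Om d n {1..K} \<Longrightarrow> 0 \<le> q a" "(\<Sum>a\<in>T.Om d n {1..K}. q a) = 1"
  shows "a \<in> T.Om d n {1..K} \<Longrightarrow> 0 \<le> selected K d n q q' a" "(\<Sum>a\<in>T.Om d n {1..K}. selected K d n q q' a) = 1"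
proof -
  have S: "T.select d n K n (candidate K d n q) (graphs K) q' \<in> graphs K"
    using empty_graph by (intro T.select_in) auto
  show "a \<in> T.Om d n {1..K} \<Longrightarrow> 0 \<le> selected K d n q q' a"
    unfolding selected_def candidate_def[of K d n q "T.select d n K n (candidate K d n q) (graphs K) q'"]
    by (rule fit_pmf(1)[OF S q])
  show "(\<Sum>a\<in>T.Om d n {1..K}. selected K d n q q' a) = 1"
    unfolding selected_def candidate_def[of K d n q "T.select d n K n (candidate K d n q) (graphs K) q'"]
    by (rule fit_pmf(2)[OF S q])
qed

lemma split_estimator_in:
  assumes n: "2 \<le> n"
  shows "split_estimator K d n \<in> estimators K d n"
proof -
  let ?W = "\<lambda>\<omega>. selected K d n (emp {1..n div 2} \<omega>) (emp {Suc (n div 2)..n} \<omega>)"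
  have ne: "{1..n div 2} \<noteq> {}" using n by simp
  have tot: "(\<Sum>a\<in>T.Om d n {1..K}. emp {1..n div 2} \<omega> a) = 1" if "\<omega> \<in> PiE {1..n} (\<lambda>_. T.Om d n {1..K})" for \<omega>
    using that ne by (intro emp_total) (auto simp: PiE_def Pi_def)
  have "(\<lambda>X. grid_measure d n K (?W (restrict (\<lambda>i. quantize d n {1..K} (X i)) {1..n}))) \<in> estimators K d n"
    by (rule quantized_estimator) (rule selected_pmf[OF emp_nonneg tot]; assumption)+
  moreover have "?W (restrict (\<lambda>i. quantize d n {1..K} (X i)) {1..n}) = ?W (\<lambda>i. quantize d n {1..K} (X i))" for X
    by (intro arg_cong2[where f = "selected K d n"] emp_cong) auto
  ultimately show ?thesis unfolding split_estimator_def[abs_def] by simp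
qed

section \<open>Validation and the error of the split estimator\<close>

context law
begin

lemma wasserstein_grid_gap:
  assumes "\<And>a. a \<in> Om {1..K} \<Longrightarrow> 0 \<le> w a" "(\<Sum>a\<in>Om {1..K}. w a) = 1"
  shows "wasserstein (sup_dist d {1..K}) \<mu> (grid_measure d M K w) \<le> ennreal (1 / 2 ^ M + T.gap d M K M p w)"
  unfolding T.gap_def by (rule wasserstein_grid_le[OF assms])

text \<open>The witness is bounded by two and each law has mass one. This crude bound handles the
  sample size one.\<close>

lemma gap_le_4:
  assumes "\<And>a. a \<in> Om {1..K} \<Longrightarrow> 0 \<le> w a" "(\<Sum>a\<in>Om {1..K}. w a) = 1"
  shows "T.gap d M K M p w \<le> 4"
proof -
  have "T.gap d M K M p w \<le> (\<Sum>x\<in>Om {1..K}. \<bar>(p x - w x) * T.witness d M K M p w x\<bar>)"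
    unfolding T.sum_witness[symmetric] by (rule order.trans[OF abs_ge_self sum_abs])
  also have "\<dots> \<le> (\<Sum>x\<in>Om {1..K}. (p x + w x) * 2)"
    unfolding abs_mult
  proof (intro sum_mono mult_mono T.abs_witness_le)
    fix x assume "x \<in> Om {1..K}"
    then have "0 \<le> p x" "0 \<le> w x" using assms p_nonneg by auto
    then show "\<bar>p x - w x\<bar> \<le> p x + w x" "0 \<le> p x + w x" by linarith+
  qed auto
  also have "\<dots> = 4" unfolding sum_distrib_right[symmetric] sum.distrib p_total assms(2) by simp
  finally show ?thesis .
qed

text \<open>For fixed test functions the deviation is a centred mean with variance at most
  \<open>4\<close>, the square of their bound; no Lipschitz property and no dimension enters, so the
  error has the parametric order.\<close>

lemma validation_deviation:
  fixes W :: "'z \<Rightarrow> (nat \<Rightarrow> nat \<Rightarrow> nat) \<Rightarrow> real" and I :: "nat set"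
  assumes I: "finite I" "I \<noteq> {}" and C: "finite C" "C \<noteq> {}" and W: "\<And>z x. \<bar>W z x\<bar> \<le> 2"
  shows "(\<integral>\<^sup>+X. ennreal (\<Sum>z\<in>C. \<bar>\<Sum>x\<in>Om {1..K}. (p x - emp_law I X x) * W z x\<bar>) \<partial>PiM I (\<lambda>_. \<mu>)) \<le>
    ennreal (2 * real (card C) / sqrt (real (card I)))"
proof -
  define c where "c z = (\<Sum>x\<in>Om {1..K}. p x * W z x)" for z
  define N where "N = real (card C)"
  have N: "0 < N" unfolding N_def using C by (simp add: card_gt_0_iff)
  have m: "0 < real (card I)" using I by (simp add: card_gt_0_iff)
  have eq: "(\<Sum>x\<in>Om {1..K}. (p x - emp_law I X x) * W z x) = (\<Sum>i\<in>I. c z - W z (qz {1..K} (X i))) / real (card I)" for X z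
  proof -
    have "(\<Sum>x\<in>Om {1..K}. (p x - emp_law I X x) * W z x) = c z - (\<Sum>x\<in>Om {1..K}. emp_law I X x * W z x)"
      unfolding c_def by (simp add: left_diff_distrib sum_subtractf)
    also have "(\<Sum>x\<in>Om {1..K}. emp_law I X x * W z x) = (\<Sum>i\<in>I. W z (qz {1..K} (X i))) / real (card I)"
      by (rule sum_emp) auto
    finally show ?thesis using m by (simp add: sum_subtractf field_simps)
  qed
  have "(\<Sum>a\<in>Om {1..K}. p a * (c z - W z a)\<^sup>2) \<le> 4" for z
  proof -
    have "(\<Sum>a\<in>Om {1..K}. p a * (c z - W z a)\<^sup>2) =
      (\<Sum>a\<in>Om {1..K}. (c z)\<^sup>2 * p a - 2 * c z * (p a * W z a) + p a * (W z a)\<^sup>2)"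
      by (intro sum.cong refl) (simp add: power2_eq_square algebra_simps)
    also have "\<dots> = (c z)\<^sup>2 * 1 - 2 * c z * c z + (\<Sum>a\<in>Om {1..K}. p a * (W z a)\<^sup>2)"
      unfolding sum.distrib sum_subtractf sum_distrib_left[symmetric] p_total c_def[symmetric] ..
    also have "\<dots> \<le> (\<Sum>a\<in>Om {1..K}. p a * (W z a)\<^sup>2)"
      by (simp add: power2_eq_square)
    also have "\<dots> \<le> (\<Sum>a\<in>Om {1..K}. p a * 2\<^sup>2)"
      using p_nonneg W power_mono[OF W abs_ge_zero, where n = 2] by (intro sum_mono mult_left_mono) auto
    also have "\<dots> = 4" unfolding sum_distrib_right[symmetric] p_total by simp
    finally show ?thesis .
  qed
  then have var: "(\<Sum>z\<in>C. \<Sum>a\<in>Om {1..K}. p a * (c z - W z a)\<^sup>2) \<le> 4 * N"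
    using sum_bounded_above[of C "\<lambda>z. \<Sum>a\<in>Om {1..K}. p a * (c z - W z a)\<^sup>2" 4] unfolding N_def by (simp add: mult.commute)
  have mean: "(\<Sum>a\<in>Om {1..K}. p a * (c z - W z a)) = 0" for z
    unfolding right_diff_distrib sum_subtractf sum_distrib_right[symmetric] p_total c_def by simp
  have "(\<integral>\<^sup>+X. ennreal (\<Sum>z\<in>C. \<bar>\<Sum>x\<in>Om {1..K}. (p x - emp_law I X x) * W z x\<bar>) \<partial>PiM I (\<lambda>_. \<mu>)) \<le>
    ennreal (sqrt (4 * N * N / real (card I)))"
    unfolding eq
    by (rule expected_empirical_deviation[OF I C(1) _ N _ mean var]) (use N in \<open>auto simp: N_def\<close>)
  also have "sqrt (4 * N * N / real (card I)) = 2 * N / sqrt (real (card I))"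
    using N by (simp add: real_sqrt_divide real_sqrt_mult)
  finally show ?thesis unfolding N_def .
qed

end

context graph_law
begin

text \<open>\<open>selection\<close> bounds the error pathwise by the fit error of the true graph
  and the deviations of the validation sample; the latter are averaged conditionally on the first
  half.\<close>

lemma expected_split_error:
  assumes K: "1 \<le> K" and M: "2 \<le> M"
  shows "expected_error K d M \<mu> (split_estimator K d M) \<le>
    ennreal ((1 + 12 * fit_const K d (2 * \<bar>L\<bar>) + 6 * (real (card (graphs K)))\<^sup>2) * rate K d M G)"
proof -
  define I1 where "I1 = {1..M div 2}"
  define I2 where "I2 = {Suc (M div 2)..M}"
  have I: "finite I1" "finite I2" "I1 \<noteq> {}" "I2 \<noteq> {}" "I1 \<inter> I2 = {}" "I1 \<union> I2 = {1..M}"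
    unfolding I1_def I2_def using M by auto
  have "M \<le> 3 * card I1" unfolding I1_def using M by simp
  then have card1: "real M \<le> 3 * real (card I1)" by linarith
  have card2: "real M \<le> 2 * real (card I2)" unfolding I2_def by simp
  let ?P1 = "PiM I1 (\<lambda>_. \<mu>)" and ?P2 = "PiM I2 (\<lambda>_. \<mu>)" and ?P = "PiM (I1 \<union> I2) (\<lambda>_. \<mu>)"
  interpret P1: prob_space ?P1 by (rule prob_PiM)
  interpret P2: prob_space ?P2 by (rule prob_PiM)
  interpret pr: product_sigma_finite "\<lambda>_ :: nat. \<mu>"
    by (intro product_sigma_finite.intro prob_space_imp_sigma_finite prob_\<mu>)
  define S where "S = graphs K"
  have S: "finite S" "S \<noteq> {}" "G \<in> S"
    unfolding S_def using finite_graphs empty_graph dag conn by (blast, blast, auto simp: graphs_def)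
  define N where "N = (real (card S))\<^sup>2"
  define wit where "wit q z = T.witness d M K M (candidate K d M q (fst z)) (candidate K d M q (snd z))"
    for q and z :: "(nat \<times> nat) set \<times> (nat \<times> nat) set"
  define dev where "dev q q' = (\<Sum>z\<in>S \<times> S. \<bar>\<Sum>x\<in>Om {1..K}. (p x - q' x) * wit q z x\<bar>)" for q q'
  obtain \<delta> where \<delta>: "\<And>X f \<theta>. T.lip d M K \<theta> f \<Longrightarrow>
      \<bar>\<Sum>x\<in>Om {1..K}. (p x - fit d M K (level K d M G) G (emp_law I1 X) x) * f x\<bar> \<le> \<theta> * \<delta> (emp_law I1 X)"
    "\<And>X. 0 \<le> \<delta> (emp_law I1 X)"
    "(\<integral>X. \<delta> (emp_law I1 X) \<partial>?P1) \<le> fit_const K d (2 * \<bar>L\<bar>) * rate K d M G"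
    using expected_fit_error[OF K I(1,3) M card1 refl] by blast
  define B where "B q q' = (1 / 2 ^ M + 12 * \<delta> q) + 2 * dev q q'" for q q'
  have dev0: "0 \<le> dev q q'" for q q' unfolding dev_def by (simp add: sum_nonneg)
  have W: "wasserstein (sup_dist d {1..K}) \<mu> (split_estimator K d M X) \<le> ennreal (B (emp_law I1 X) (emp_law I2 X))" for X
  proof -
    let ?q = "emp_law I1 X" and ?q' = "emp_law I2 X"
    have tot: "(\<Sum>a\<in>Om {1..K}. ?q a) = 1" using I by (intro emp_total) auto
    have "wasserstein (sup_dist d {1..K}) \<mu> (split_estimator K d M X) \<le>
      ennreal (1 / 2 ^ M + T.gap d M K M p (selected K d M ?q ?q'))"
      unfolding split_estimator_def I1_def[symmetric] I2_def[symmetric]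
      by (intro wasserstein_grid_gap selected_pmf emp_nonneg tot)
    also have "\<dots> \<le> ennreal (B ?q ?q')"
    proof (rule ennreal_leI)
      have "T.gap d M K M p (candidate K d M ?q (T.select d M K M (candidate K d M ?q) S ?q')) \<le> 12 * \<delta> ?q +
        2 * (\<Sum>(G1, G2)\<in>S \<times> S. \<bar>\<Sum>x\<in>Om {1..K}. (p x - ?q' x) *
          T.witness d M K M (candidate K d M ?q G1) (candidate K d M ?q G2) x\<bar>)"
      proof (rule T.selection[OF S(1,3)])
        show "\<bar>\<Sum>x\<in>Om {1..K}. (p x - candidate K d M ?q G x) * f x\<bar> \<le> \<theta> * \<delta> ?q" if "T.lip d M K \<theta> f" for f \<theta>
          unfolding candidate_def using that by (rule \<delta>(1))
      qed
      then show "1 / 2 ^ M + T.gap d M K M p (selected K d M ?q ?q') \<le> B ?q ?q'"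
        unfolding B_def selected_def S_def[symmetric] dev_def wit_def split_def by simp
    qed
    finally show ?thesis .
  qed
  have eB: "ennreal (B (emp_law I1 X) (emp_law I2 Y)) =
    ennreal (1 / 2 ^ M + 12 * \<delta> (emp_law I1 X)) + 2 * ennreal (dev (emp_law I1 X) (emp_law I2 Y))" for X Y
    unfolding B_def using \<delta>(2)[of X] dev0 by (subst ennreal_plus) (auto simp: ennreal_mult)
  have rg: "1 / real M \<le> rate K d M G" "real M powr - (1 / 2) \<le> rate K d M G" "0 \<le> rate K d M G"
    using rate_ge[OF K, of M d G] M by auto
  have dev_le: "(\<integral>\<^sup>+Y. ennreal (dev (emp_law I1 X) (emp_law I2 Y)) \<partial>?P2) \<le> ennreal (3 * N * rate K d M G)" for X
  proof -
    have "(\<integral>\<^sup>+Y. ennreal (dev (emp_law I1 X) (emp_law I2 Y)) \<partial>?P2) \<le>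
      ennreal (2 * real (card (S \<times> S)) / sqrt (real (card I2)))"
      unfolding dev_def using S I unfolding wit_def by (intro validation_deviation T.abs_witness_le) auto
    also have "2 * real (card (S \<times> S)) / sqrt (real (card I2)) \<le> 3 * N * rate K d M G"
    proof -
      have "0 < real (card I2)" using I by (simp add: card_gt_0_iff)
      \<comment> \<open>The second half has at least \<open>M / 2\<close> points, and
        \<open>2 \<le> (3 / 2)^2\<close>.\<close>
      moreover have "sqrt (real M) \<le> 3 / 2 * sqrt (real (card I2))"
      proof (rule real_le_lsqrt[THEN order.trans])
        show "real M \<le> (3 / 2 * sqrt (real (card I2)))\<^sup>2"
          using card2 unfolding power_mult_distrib by (simp add: power2_eq_square)
      qed auto
      ultimately have "1 / sqrt (real (card I2)) \<le> 3 / 2 * (1 / sqrt (real M))"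
        using M by (simp add: field_simps)
      also have "1 / sqrt (real M) = real M powr - (1 / 2)"
        using M by (simp add: powr_minus_divide powr_half_sqrt)
      finally have "1 / sqrt (real (card I2)) \<le> 3 / 2 * rate K d M G" using rg by linarith
      then have "2 * N * (1 / sqrt (real (card I2))) \<le> 2 * N * (3 / 2 * rate K d M G)"
        by (intro mult_left_mono) (auto simp: N_def)
      then show ?thesis by (simp add: N_def power2_eq_square card_cartesian_product)
    qed
    finally show ?thesis by (simp add: ennreal_leI)
  qed
  have N0: "0 \<le> 3 * N * rate K d M G" using rg unfolding N_def by simp
  have int: "integrable ?P1 (\<lambda>X. 1 / 2 ^ M + 12 * \<delta> (emp_law I1 X) + 2 * (3 * N * rate K d M G))"
    by (rule emp_law_integrable[OF I(1), of "\<lambda>q. 1 / 2 ^ M + 12 * \<delta> q + 2 * (3 * N * rate K d M G)"])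
  have "expected_error K d M \<mu> (split_estimator K d M) \<le> (\<integral>\<^sup>+X. ennreal (B (emp_law I1 X) (emp_law I2 X)) \<partial>?P)"
    unfolding expected_error_def I(6)[symmetric] by (rule nn_integral_mono) (rule W)
  \<comment> \<open>Fubini over the two halves: once the first is fixed, so are the candidates and
    their witnesses, and the second is an independent sample.\<close>
  also have "\<dots> = (\<integral>\<^sup>+X. (\<integral>\<^sup>+Y. ennreal (B (emp_law I1 (merge I1 I2 (X, Y))) (emp_law I2 (merge I1 I2 (X, Y)))) \<partial>?P2) \<partial>?P1)"
    using I by (intro pr.product_nn_integral_fold emp_law_measurable[of _ _ _ "\<lambda>q q'. ennreal (B q q')"]) auto
  also have "\<dots> = (\<integral>\<^sup>+X. (\<integral>\<^sup>+Y. ennreal (B (emp_law I1 X) (emp_law I2 Y)) \<partial>?P2) \<partial>?P1)"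
  proof -
    have 1: "emp_law I1 (merge I1 I2 (X, Y)) = emp_law I1 X" for X Y by (rule emp_cong) (simp add: merge_def)
    have 2: "emp_law I2 (merge I1 I2 (X, Y)) = emp_law I2 Y" for X Y
      by (rule emp_cong) (use I(5) in \<open>auto simp: merge_def\<close>)
    show ?thesis unfolding 1 2 ..
  qed
  also have "\<dots> \<le> (\<integral>\<^sup>+X. ennreal (1 / 2 ^ M + 12 * \<delta> (emp_law I1 X) + 2 * (3 * N * rate K d M G)) \<partial>?P1)"
  proof (rule nn_integral_mono)
    fix X
    have meas: "(\<lambda>Y. ennreal (dev (emp_law I1 X) (emp_law I2 Y))) \<in> borel_measurable ?P2"
      by (rule emp_law_measurable[OF I(2) order.refl order.refl, of "\<lambda>q _. ennreal (dev (emp_law I1 X) q)"])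
    have "(\<integral>\<^sup>+Y. ennreal (B (emp_law I1 X) (emp_law I2 Y)) \<partial>?P2) =
      ennreal (1 / 2 ^ M + 12 * \<delta> (emp_law I1 X)) + 2 * (\<integral>\<^sup>+Y. ennreal (dev (emp_law I1 X) (emp_law I2 Y)) \<partial>?P2)"
      unfolding eB using meas by (simp add: nn_integral_add nn_integral_cmult P2.emeasure_space_1)
    also have "\<dots> \<le> ennreal (1 / 2 ^ M + 12 * \<delta> (emp_law I1 X)) + 2 * ennreal (3 * N * rate K d M G)"
      by (intro add_left_mono mult_left_mono dev_le) simp
    also have "\<dots> = ennreal (1 / 2 ^ M + 12 * \<delta> (emp_law I1 X) + 2 * (3 * N * rate K d M G))"
    proof -
      have "ennreal a + 2 * ennreal b = ennreal (a + 2 * b)" if "0 \<le> a" "0 \<le> b" for a b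
        using that by (simp add: ennreal_plus ennreal_mult)
      then show ?thesis using \<delta>(2)[of X] N0 by simp
    qed
    finally show "(\<integral>\<^sup>+Y. ennreal (B (emp_law I1 X) (emp_law I2 Y)) \<partial>?P2) \<le>
      ennreal (1 / 2 ^ M + 12 * \<delta> (emp_law I1 X) + 2 * (3 * N * rate K d M G))" .
  qed
  also have "\<dots> = ennreal (\<integral>X. 1 / 2 ^ M + 12 * \<delta> (emp_law I1 X) + 2 * (3 * N * rate K d M G) \<partial>?P1)"
    using \<delta>(2) N0 by (intro nn_integral_eq_integral[OF int]) simp
  also have "(\<integral>X. 1 / 2 ^ M + 12 * \<delta> (emp_law I1 X) + 2 * (3 * N * rate K d M G) \<partial>?P1) =
      1 / 2 ^ M + 12 * (\<integral>X. \<delta> (emp_law I1 X) \<partial>?P1) + 2 * (3 * N * rate K d M G)"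
    using emp_law_integrable[OF I(1), of \<delta>] by (simp add: P1.prob_space)
  also have "\<dots> \<le> (1 + 12 * fit_const K d (2 * \<bar>L\<bar>) + 6 * N) * rate K d M G"
  proof -
    have "1 / 2 ^ M \<le> 1 / real M"
      using of_nat_less_two_power[of M] M by (intro divide_left_mono) auto
    then show ?thesis using rg(1) \<delta>(3) by (simp add: algebra_simps)
  qed
  finally show ?thesis unfolding N_def S_def by (simp add: ennreal_leI)
qed

end

lemma fit_const_nonneg: "0 \<le> \<Lambda> \<Longrightarrow> 0 \<le> fit_const K d \<Lambda>"
  unfolding fit_const_def by simp

theorem theorem3p3:
  fixes K :: nat and d :: "nat \<Rightarrow> nat"
  assumes "K \<ge> 1" and "\<And>k. k \<in> {1..K} \<Longrightarrow> d k \<ge> 1"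
  shows "\<exists>C :: real \<Rightarrow> real. \<forall>n\<ge>1. \<exists>est \<in> estimators K d n.
           \<forall>G L \<mu>. sorted_dag K G \<and> (\<forall>k\<in>{1..K}. fully_connected G (pa G k)) \<and>
             \<mu> \<in> graph_measures K d G \<and> TV_lipschitz K d G L \<mu> \<longrightarrow>
             expected_error K d n \<mu> est \<le>
               ennreal (C L * max 1 (ln (real n)) *
                 (real n powr (- 2 / (2 + real (d_loc K d G))) + real n powr (- 1 / real (d_max K d))))"
proof -
  \<comment> \<open>The summand \<open>5\<close> instead of \<open>1\<close> covers
    \<open>n = 1\<close>, where the error is at most \<open>1 / 2 + 4\<close>.\<close>
  define C where "C L = 5 + 12 * fit_const K d (2 * \<bar>L\<bar>) + 6 * (real (card (graphs K)))\<^sup>2" for L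
  have "\<exists>est\<in>estimators K d n. \<forall>G L \<mu>. sorted_dag K G \<and> (\<forall>k\<in>{1..K}. fully_connected G (pa G k)) \<and>
      \<mu> \<in> graph_measures K d G \<and> TV_lipschitz K d G L \<mu> \<longrightarrow>
      expected_error K d n \<mu> est \<le> ennreal (C L * rate K d n G)" if n: "1 \<le> n" for n
  proof (cases "2 \<le> n")
    case True
    show ?thesis
    proof (intro bexI[OF _ split_estimator_in[OF True]] allI impI, elim conjE)
      fix G L \<mu> assume *: "sorted_dag K G" "\<forall>k\<in>{1..K}. fully_connected G (pa G k)"
        "\<mu> \<in> graph_measures K d G" "TV_lipschitz K d G L \<mu>"
      interpret graph_law d n K \<mu> G L
        using * by unfold_locales (auto simp: graph_measures_def)
      have "(1 + 12 * fit_const K d (2 * \<bar>L\<bar>) + 6 * (real (card (graphs K)))\<^sup>2) * rate K d n G \<le> C L * rate K d n G"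
        unfolding C_def using rate_ge(4)[OF assms(1) n] by (intro mult_right_mono) auto
      with expected_split_error[OF assms(1) True]
      show "expected_error K d n \<mu> (split_estimator K d n) \<le> ennreal (C L * rate K d n G)"
        by (meson ennreal_leI order.trans)
    qed
  next
    case False
    then have [simp]: "n = 1" using n by simp
    \<comment> \<open>A single observation cannot be split; the empirical law of the quantised
      sample is used instead.\<close>
    let ?est = "\<lambda>X. grid_measure d n K (emp {1..n} (restrict (\<lambda>i. quantize d n {1..K} (X i)) {1..n}))"
    have tot: "(\<Sum>a\<in>T.Om d n {1..K}. emp {1..n} \<omega> a) = 1" if "\<omega> \<in> PiE {1..n} (\<lambda>_. T.Om d n {1..K})" for \<omega>
      using that by (intro emp_total) (auto simp: PiE_def Pi_def)
    have est: "?est \<in> estimators K d n"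
      by (rule quantized_estimator) (rule emp_nonneg, rule tot)
    show ?thesis
    proof (intro bexI[OF _ est] allI impI, elim conjE)
      fix G L \<mu> assume *: "sorted_dag K G" "\<forall>k\<in>{1..K}. fully_connected G (pa G k)"
        "\<mu> \<in> graph_measures K d G" "TV_lipschitz K d G L \<mu>"
      interpret graph_law d n K \<mu> G L
        using * by unfold_locales (auto simp: graph_measures_def)
      interpret PI: prob_space "PiM {1..n} (\<lambda>_. \<mu>)" by (rule prob_PiM)
      have "wasserstein (sup_dist d {1..K}) \<mu> (?est X) \<le> ennreal 5" for X
      proof -
        let ?w = "emp {1..n} (restrict (\<lambda>i. qz {1..K} (X i)) {1..n})"
        have w: "(\<Sum>a\<in>Om {1..K}. ?w a) = 1" by (intro tot) auto
        have "wasserstein (sup_dist d {1..K}) \<mu> (?est X) \<le> ennreal (1 / 2 ^ n + T.gap d n K n p ?w)"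
          by (rule wasserstein_grid_gap[OF emp_nonneg w])
        also have "\<dots> \<le> ennreal 5"
          using gap_le_4[OF emp_nonneg w] by (intro ennreal_leI) simp
        finally show ?thesis .
      qed
      then have "expected_error K d n \<mu> ?est \<le> (\<integral>\<^sup>+X. ennreal 5 \<partial>PiM {1..n} (\<lambda>_. \<mu>))"
        unfolding expected_error_def by (intro nn_integral_mono)
      also have "\<dots> = ennreal 5" unfolding nn_integral_const PI.emeasure_space_1 by simp
      also have "\<dots> \<le> ennreal (C L * rate K d n G)"
      proof (rule ennreal_leI)
        \<comment> \<open>At \<open>n = 1\<close> the maximum and both powers are one, so
          \<open>rate\<close> equals \<open>2\<close>.\<close>
        have "5 * 2 \<le> C L * rate K d n G"
          unfolding C_def rate_def using fit_const_nonneg[of "2 * \<bar>L\<bar>" K d] by (intro mult_mono) auto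
        then show "5 \<le> C L * rate K d n G" by simp
      qed
      finally show "expected_error K d n \<mu> ?est \<le> ennreal (C L * rate K d n G)" .
    qed
  qed
  then show ?thesis unfolding rate_def mult.assoc by (intro exI[of _ C]) blast
qed

end
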